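(* Let $f(t,\tau)$, $t\ge0$, $\tau\in\mathbb C_+$, be a function with values in $\mathbb C\mathbb P^1$, continuous in $(t,\tau)$, with $f(0,\tau)=\tau$. For each $t>0$ put $q=e^{-t}$ and $[\tau]_q:=f(t,\tau)$, and assume that $\tau\mapsto[\tau]_q$ is meromorphic in the upper half-plane $\mathbb C_+$, satisfies $$[\tau+1]_q=q[\tau]_q+1,\qquad\left[-\tfrac1\tau\right]_q=-\frac{1}{q[\tau]_q},$$ and satisfies the following two assumptions: Assumption 1: $\lim_{\mathrm{Re}\,\tau,\,\mathrm{Im}\,\tau\to+\infty}f(t,\tau)=(1-e^{-t})^{-1}$. Assumption 2: the map $\tau\mapsto f(t,\tau)$ from $\mathbb C_+$ to $\mathbb C\mathbb P^1$ is a local diffeomorphism (its differential in $\tau$ vanishes nowhere). Then $[\tau]_q$ is uniquely determined and, with $s=\frac{t}{2\pi i}=-\frac{\log q}{2\pi i}$, is given by either of the formulas $$[\tau]_q=ie^{\pi is}\left(\frac{1-\lambda(\tau)}{\lambda(\tau)}\right)^{2s}\frac{F(\frac12-s,\frac12+s,1+2s;1-\lambda(\tau))}{F(\frac12-s,\frac12+s,1+2s;\lambda(\tau))},$$ $$[\tau]_q=iq^{-1/2}\frac{\Gamma(1+2s)\Gamma(2s)}{\Gamma(\frac12+s)\Gamma(\frac12+3s)}\left(\frac{1-\lambda(\tau)}{\lambda(\tau)}\right)^{2s}\frac{F(\frac12-s,\frac12+s,1-2s;\lambda(\tau))}{F(\frac12-s,\frac12+s,1+2s;\lambda(\tau))}+\frac1{1-q}.$$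 More precisely, these are the formulas for purely imaginary $\tau$, where one uses the principal branch of $F(a,b,c;z)$ on $(0,1)$ defined by the power series; the general case is obtained by analytic continuation in $\tau\in\mathbb C_+$.
   Context: $\mathbb C_+=\{\tau\in\mathbb C:\mathrm{Im}\,\tau>0\}$. $F(a,b,c;z)={}_2F_1$ is the Gauss hypergeometric function, $F(a,b,c;z)=\sum_{n\ge0}\frac{(a)_n(b)_n}{(c)_n\,n!}z^n$ on $(0,1)$. $\lambda$ is the modular lambda function, $\lambda(\tau)=\theta_{10}(\tau)^4/\theta_{00}(\tau)^4$, with $\theta_{00}(\tau)=\sum_{n\in\mathbb Z}e^{\pi i\tau n^2}$, $\theta_{10}(\tau)=\sum_{n\in\mathbb Z}e^{\pi i\tau(n+1/2)^2}$; it is a universal covering map $\mathbb C_+\to\mathbb C\setminus\{0,1\}$, and $\lambda(\tau)\in(0,1)$ for purely imaginary $\tau$, in which case the power $\left(\frac{1-\lambda}{\lambda}\right)^{2s}$ of a positive number is the standard one. In the functional equations, values are in $\mathbb C\mathbb P^1$ with the usual conventions for $0,\infty$. *)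

theory Defs
  imports "HOL-Complex_Analysis.Complex_Analysis"
begin

definition upper_half_plane :: "complex set" where
  "upper_half_plane = {\<tau>. 0 < Im \<tau>}"

text \<open>The complex projective line, as the one-point compactification of the complex plane:
  \<open>Some w\<close> is the point $w$ (that is, $[w:1]$) and \<open>None\<close> is $\infty$ (that is, $[1:0]$).\<close>

type_synonym cp1 = "complex option"

definition cp1_topology :: "cp1 topology" where
  "cp1_topology = Alexandroff_compactification euclidean"

text \<open>The point $[u:v]$. The pair $(0,0)$ is outside the domain of this notation.\<close>

definition cp1_quot :: "complex \<Rightarrow> complex \<Rightarrow> cp1" where
  "cp1_quot u v = (if v = 0 then None else Some (u / v))"

definition cp1_inverse :: "cp1 \<Rightarrow> cp1" where
  "cp1_inverse x = (case x of None \<Rightarrow> Some 0 | Some w \<Rightarrow> cp1_quot 1 w)"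

text \<open>The map $x \mapsto a x + b$, fixing $\infty$; to be used for $a \neq 0$ only.\<close>

definition cp1_affine :: "complex \<Rightarrow> complex \<Rightarrow> cp1 \<Rightarrow> cp1" where
  "cp1_affine a b = map_option (\<lambda>w. a * w + b)"

text \<open>The affine coordinate, with the dummy value 0 at $\infty$; this is the value that
  \<^const>\<open>nicely_meromorphic_on\<close> prescribes at a pole.\<close>

definition cp1_coord :: "cp1 \<Rightarrow> complex" where
  "cp1_coord x = (case x of None \<Rightarrow> 0 | Some w \<Rightarrow> w)"

definition cp1_meromorphic_on :: "(complex \<Rightarrow> cp1) \<Rightarrow> complex set \<Rightarrow> bool" where
  "cp1_meromorphic_on h A \<longleftrightarrow>
     (\<lambda>z. cp1_coord (h z)) nicely_meromorphic_on A \<and>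
     (\<forall>z\<in>A. h z = None \<longleftrightarrow> is_pole (\<lambda>z. cp1_coord (h z)) z)"

text \<open>The complex differential exists and is nonzero at every point of \<open>A\<close>, computed in the
  affine chart $w$ at a finite value and in the chart $1/w$ at the value $\infty$.\<close>

definition cp1_nonvanishing_differential_on :: "(complex \<Rightarrow> cp1) \<Rightarrow> complex set \<Rightarrow> bool" where
  "cp1_nonvanishing_differential_on h A \<longleftrightarrow>
     (\<forall>z\<in>A. \<exists>D. D \<noteq> 0 \<and>
        (if h z \<noteq> None
         then ((\<lambda>w. cp1_coord (h w)) has_field_derivative D) (at z)
         else ((\<lambda>w. cp1_coord (cp1_inverse (h w))) has_field_derivative D) (at z)))"

text \<open>The functions \<open>f\<close> considered here, with $[\tau]_q = $ \<open>f t \<tau>\<close> for $q = e^{-t}$.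
  Only the values for $t \geq 0$ and $\tau$ in the upper half-plane matter.\<close>

definition q_complex_family :: "(real \<Rightarrow> complex \<Rightarrow> cp1) \<Rightarrow> bool" where
  "q_complex_family f \<longleftrightarrow>
     continuous_map (top_of_set ({0..} \<times> upper_half_plane)) cp1_topology (\<lambda>(t, \<tau>). f t \<tau>) \<and>
     (\<forall>\<tau>\<in>upper_half_plane. f 0 \<tau> = Some \<tau>) \<and>
     (\<forall>t>0. let q = complex_of_real (exp (- t)) in
        cp1_meromorphic_on (f t) upper_half_plane \<and>
        (\<forall>\<tau>\<in>upper_half_plane. f t (\<tau> + 1) = cp1_affine q 1 (f t \<tau>)) \<and>
        (\<forall>\<tau>\<in>upper_half_plane. f t (- 1 / \<tau>) = cp1_inverse (cp1_affine (- q) 0 (f t \<tau>))) \<and>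
        limitin cp1_topology (f t) (Some (1 / (1 - q)))
          (inf (filtercomap Re at_top) (filtercomap Im at_top)) \<and>
        cp1_nonvanishing_differential_on (f t) upper_half_plane)"

definition hyp2F1 :: "complex \<Rightarrow> complex \<Rightarrow> complex \<Rightarrow> complex \<Rightarrow> complex" where
  "hyp2F1 a b c z = (\<Sum>n. pochhammer a n * pochhammer b n / (pochhammer c n * fact n) * z ^ n)"

definition theta00 :: "complex \<Rightarrow> complex" where
  "theta00 \<tau> = (\<Sum>\<^sub>\<infinity>n::int. exp (of_real pi * \<i> * \<tau> * of_int n ^ 2))"

definition theta10 :: "complex \<Rightarrow> complex" where
  "theta10 \<tau> = (\<Sum>\<^sub>\<infinity>n::int. exp (of_real pi * \<i> * \<tau> * (of_int n + 1 / 2) ^ 2))"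

definition modular_lambda :: "complex \<Rightarrow> complex" where
  "modular_lambda \<tau> = theta10 \<tau> ^ 4 / theta00 \<tau> ^ 4"

text \<open>The right-hand sides of the two formulas, used for purely imaginary \<open>\<tau>\<close> only. There
  \<open>modular_lambda \<tau>\<close> is in $(0,1)$, so that \<open>powr\<close> is the standard power of a positive number.\<close>

definition q_formula1 :: "real \<Rightarrow> complex \<Rightarrow> cp1" where
  "q_formula1 t \<tau> =
     (let s = of_real t / (2 * of_real pi * \<i>); l = modular_lambda \<tau> in
      cp1_quot
        (\<i> * exp (of_real pi * \<i> * s) * ((1 - l) / l) powr (2 * s)
           * hyp2F1 (1/2 - s) (1/2 + s) (1 + 2 * s) (1 - l))
        (hyp2F1 (1/2 - s) (1/2 + s) (1 + 2 * s) l))"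

definition q_formula2 :: "real \<Rightarrow> complex \<Rightarrow> cp1" where
  "q_formula2 t \<tau> =
     (let q = complex_of_real (exp (- t)); s = of_real t / (2 * of_real pi * \<i>);
          l = modular_lambda \<tau> in
      cp1_affine 1 (1 / (1 - q))
       (cp1_quot
         (\<i> * q powr (- 1/2)
            * (Gamma (1 + 2 * s) * Gamma (2 * s) / (Gamma (1/2 + s) * Gamma (1/2 + 3 * s)))
            * ((1 - l) / l) powr (2 * s)
            * hyp2F1 (1/2 - s) (1/2 + s) (1 - 2 * s) l)
         (hyp2F1 (1/2 - s) (1/2 + s) (1 + 2 * s) l)))"

text \<open>\<open>h\<close> is an analytic continuation to the upper half-plane, as a function with values in the
  projective line, of the restriction of \<open>\<phi>\<close> to the positive imaginary axis.\<close>

definition continues_from_imaginary_axis :: "(complex \<Rightarrow> cp1) \<Rightarrow> (complex \<Rightarrow> cp1) \<Rightarrow> bool" where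
  "continues_from_imaginary_axis h \<phi> \<longleftrightarrow>
     cp1_meromorphic_on h upper_half_plane \<and>
     (\<forall>\<tau>\<in>upper_half_plane. Re \<tau> = 0 \<longrightarrow> h \<tau> = \<phi> \<tau>)"

end

theory Submission
  imports Defs "HOL-Probability.Probability"
begin

text \<open>The functional equations say that $[\<tau>]_q$ transforms under the modular group by projective
  maps, so its Schwarzian derivative is a modular form of weight 4 for the full modular group; it is
  holomorphic because the differential vanishes nowhere. Assumption 1 gives its growth at the cusp:
  $[\<tau>]_q - (1-q)^{-1}$ behaves like $e^{(2 \pi i m - t) \<tau>}$ for some $m \geq 0$, so the Schwarzian is
  $-(2 \pi i m - t)^2 / 2$ times the normalized form of weight 4, here
  $(\theta_2^8 + \theta_3^8 + \theta_4^8)/2$. The Schwarzian at $\<tau> = i$ depends continuously on $t$,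
  and at $t = 0$ the function is the identity, which forces $m = 0$. In the same way
  $[i]_q^2 = -1/q$ gives $[i]_q = i q^{-1/2}$.

  Hence $[\<tau>]_q$ is locally a quotient of two solutions of a second order equation whose pullback
  along $\lambda$ is hypergeometric. On the imaginary axis the two hypergeometric solutions oscillate as
  $e^{\pm i t y / 2}$ when $\<tau> = i y$ tends to $i \infty$. Comparing oscillating terms in the
  expansion at the cusp, and in the equation for $\<tau> \mapsto -1/\<tau>$ rewritten by the connection
  formula for $z \mapsto 1 - z$, fixes the quotient up to a constant, which is read off at
  $\<tau> = i$.\<close>

text \<open>The parameter s is imaginary, and this shapes the proof. Both hypergeometric solutions
  have the same size at the cusp, so coefficients cannot be separated by growth. Each comparison is
  instead a quadratic polynomial in z = exp(-i t y) with convergent coefficients; y can run to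
  infinity with z fixed at any point of the unit circle, so all three limits vanish. For the same
  reason the series sits on the border Re (c - a - b) = 0 of convergence at 1, and the Gamma factor
  of the second formula comes from Gauss's theorem for c + 1.

  From the theory of modular forms only one vanishing criterion is used: enough decay at the cusp,
  compared with the weight, forces 0. It yields Jacobi's identity, the differential relations
  between theta constants that produce the hypergeometric equation, and the identification of the
  Schwarzian. The inversion formula of the theta function is proved beforehand from a Fourier
  expansion.

  Continuity in t is used only near \<tau> = i, for the value and the derivatives there, and only to
  fix discrete data: an integer and a sign.\<close>

abbreviation at_i_infinity :: "complex filter" where
  "at_i_infinity \<equiv> filtercomap Im at_top"

lemma eventually_at_i_infinity:
  "eventually P at_i_infinity \<longleftrightarrow> (\<exists>R>0. \<forall>\<tau>. Im \<tau> > R \<longrightarrow> P \<tau>)" (is "?l \<longleftrightarrow> ?r")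
proof
  assume ?l
  then obtain R where "\<And>\<tau>. Im \<tau> \<ge> R \<Longrightarrow> P \<tau>"
    unfolding eventually_filtercomap eventually_at_top_linorder by blast
  then show ?r by (intro exI[of _ "max R 1"]) auto
next
  assume ?r
  then obtain R where "\<And>\<tau>. Im \<tau> > R \<Longrightarrow> P \<tau>" by blast
  then show ?l
    unfolding eventually_filtercomap eventually_at_top_dense by blast
qed

lemma open_upper_half_plane: "open upper_half_plane"
  unfolding upper_half_plane_def by (rule open_halfspace_Im_gt)

lemma connected_upper_half_plane: "connected upper_half_plane"
proof -
  have "convex {\<tau>. 0 < Im \<tau>}"
    using convex_halfspace_gt[of 0 "\<i>::complex"] by simp
  then show ?thesis unfolding upper_half_plane_def by (rule convex_connected)
qed

lemma mem_upper_half_plane [simp]: "\<tau> \<in> upper_half_plane \<longleftrightarrow> 0 < Im \<tau>"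
  by (simp add: upper_half_plane_def)

lemma Im_neg_inverse: "Im (- 1 / \<tau>) = Im \<tau> / (cmod \<tau>)\<^sup>2"
  by (cases "\<tau> = 0") (simp_all add: Im_divide cmod_power2)

lemma Im_neg_inverse_pos: "Im \<tau> > 0 \<Longrightarrow> Im (- 1 / \<tau>) > 0"
  by (subst Im_neg_inverse) (auto intro!: divide_pos_pos)

text \<open>Cauchy's inequality on unit discs suffices: \<open>at_i_infinity\<close> constrains
  \<open>Im\<close> only, so the limit is uniform in the real part and controls the whole disc
  around a high point.\<close>

lemma deriv_tendsto_0_at_i_infinity:
  assumes "f holomorphic_on {\<tau>. Im \<tau> > R}" and "(f \<longlongrightarrow> L) at_i_infinity"
  shows "(deriv f \<longlongrightarrow> 0) at_i_infinity"
proof (rule tendstoI)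
  fix e :: real assume e: "e > 0"
  have "eventually (\<lambda>\<tau>. dist (f \<tau>) L < e / 2) at_i_infinity"
    using assms(2) e by (intro tendstoD) auto
  then obtain R1 where R1: "\<And>\<tau>. Im \<tau> > R1 \<Longrightarrow> dist (f \<tau>) L < e / 2"
    unfolding eventually_at_i_infinity by blast
  have "dist (deriv f \<tau>) 0 < e" if "Im \<tau> > max (max R R1 + 1) 1" for \<tau>
  proof -
    have sub: "w \<in> {\<tau>. Im \<tau> > R} \<and> Im w > R1" if "w \<in> cball \<tau> 1" for w
    proof -
      have "\<bar>Im (\<tau> - w)\<bar> \<le> 1"
        using that abs_Im_le_cmod[of "\<tau> - w"] by (simp add: dist_norm)
      then show ?thesis using \<open>Im \<tau> > _\<close> by auto
    qed
    have hol: "f holomorphic_on ball \<tau> 1" and cont: "continuous_on (cball \<tau> 1) f"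
      using sub by (auto intro!: holomorphic_on_subset[OF assms(1)]
          continuous_on_subset[OF holomorphic_on_imp_continuous_on[OF assms(1)]])
    have "cmod ((deriv ^^ 1) (\<lambda>w. f w - L) \<tau>) \<le> fact 1 * (e / 2) / 1 ^ 1"
    proof (rule Cauchy_inequality)
      show "cmod (f x - L) \<le> e / 2" if "cmod (\<tau> - x) = 1" for x
        using R1[of x] sub[of x] that by (auto simp: dist_norm less_imp_le)
    qed (use hol cont in \<open>auto intro!: holomorphic_intros continuous_intros\<close>)
    moreover have "deriv (\<lambda>w. f w - L) \<tau> = deriv f \<tau>"
      using hol by (subst deriv_diff) (auto intro: holomorphic_on_imp_differentiable_at)
    ultimately show ?thesis using e by simp
  qed
  then show "eventually (\<lambda>\<tau>. dist (deriv f \<tau>) 0 < e) at_i_infinity"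
    unfolding eventually_at_i_infinity
    by (intro exI[of _ "max (max R R1 + 1) 1"]) auto
qed

section \<open>Holomorphic functions of period 1 near the cusp\<close>

text \<open>The value type is arbitrary because this is applied to complex functions, to real
  invariants and, for poles, to the predicate \<open>h \<tau> = None\<close>.\<close>

lemma periodic_int:
  fixes f :: "complex \<Rightarrow> 'a"
  assumes per: "\<And>\<tau>. Im \<tau> > R \<Longrightarrow> f (\<tau> + 1) = f \<tau>" and "Im \<tau> > R"
  shows "f (\<tau> + of_int n) = f \<tau>"
proof -
  have nat: "f (\<tau> + of_nat k) = f \<tau>" if "Im \<tau> > R" for k :: nat and \<tau>
  proof (induction k)
    case (Suc k)
    have "f (\<tau> + of_nat k + 1) = f (\<tau> + of_nat k)" by (rule per) (use that in simp)
    then show ?case using Suc by (simp add: add_ac)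
  qed simp
  show ?thesis
  proof (cases "n \<ge> 0")
    case True
    then show ?thesis using nat[of \<tau> "nat n"] assms(2) by simp
  next
    case False
    have "f (\<tau> + of_int n + of_nat (nat (-n))) = f (\<tau> + of_int n)"
      by (rule nat) (use assms(2) in simp)
    then show ?thesis using False by simp
  qed
qed

text \<open>Composition with \<open>Ln\<close> descends: the jump of \<open>Ln\<close> across its
  cut is a multiple of 2 pi i and is absorbed by the period. Boundedness makes the puncture 0, the
  image of the cusp, a removable singularity.\<close>

lemma periodic_descends_to_disc:
  assumes hol: "f holomorphic_on {\<tau>. Im \<tau> > R}"
    and per: "\<And>\<tau>. Im \<tau> > R \<Longrightarrow> f (\<tau> + 1) = f \<tau>"
    and bdd: "\<And>\<tau>. Im \<tau> > R \<Longrightarrow> cmod (f \<tau>) \<le> B"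
  obtains g where "g holomorphic_on ball 0 (exp (- 2 * pi * R))"
    "\<And>\<tau>. Im \<tau> > R \<Longrightarrow> f \<tau> = g (exp (2 * of_real pi * \<i> * \<tau>))"
proof -
  define r where "r = exp (- 2 * pi * R)"
  define g0 where "g0 = (\<lambda>w. f (Ln w / (2 * of_real pi * \<i>)))"
  have Im_log: "Im (z / (2 * of_real pi * \<i>)) > R" if "cmod (exp z) < r" for z
  proof -
    have "Re z < - 2 * pi * R" using that by (simp add: r_def)
    then show ?thesis by (simp add: Im_divide power2_eq_square field_simps)
  qed
  have eq: "f (z / (2 * of_real pi * \<i>)) = g0 (exp z)" if "cmod (exp z) < r" for z
  proof -
    have "exp (Ln (exp z)) = exp z" by simp
    then obtain n :: int where n: "Ln (exp z) = z + of_real (of_int (2 * n) * pi) * \<i>"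
      unfolding exp_eq by blast
    have "Ln (exp z) / (2 * of_real pi * \<i>) = z / (2 * of_real pi * \<i>) + of_int n"
      unfolding n by (simp add: field_simps)
    then have "g0 (exp z) = f (z / (2 * of_real pi * \<i>) + of_int n)"
      unfolding g0_def by (rule arg_cong)
    also have "\<dots> = f (z / (2 * of_real pi * \<i>))"
      by (rule periodic_int[of R]) (use per Im_log[OF that] in auto)
    finally show ?thesis by simp
  qed
  have hol0: "g0 holomorphic_on ball 0 r - {0}"
    unfolding holomorphic_on_open[OF open_delete[OF open_ball]]
  proof
    fix w0 :: complex assume w0: "w0 \<in> ball 0 r - {0}"
    \<comment> \<open>A branch of the logarithm that is holomorphic at \<open>w0\<close> wherever
      \<open>w0\<close> lies, since \<open>w / w0\<close> is near 1 and away from the cut. By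
      \<open>eq\<close> every branch gives the same \<open>g0\<close>.\<close>
    define l where "l = (\<lambda>w. Ln w0 + Ln (w / w0))"
    have l_exp: "exp (l w) = w" if "w \<noteq> 0" for w
      using that w0 by (simp add: l_def exp_add)
    have l_an: "l field_differentiable at w0"
      unfolding l_def using w0
      by (intro derivative_intros field_differentiable_add field_differentiable_compose[unfolded o_def, of "\<lambda>w. w / w0" _ Ln]
           field_differentiable_within_Ln field_differentiable_const field_differentiable_divide field_differentiable_ident) auto
    have l_Im: "Im (l w0 / (2 * of_real pi * \<i>)) > R"
      by (rule Im_log) (use w0 l_exp[of w0] in \<open>auto simp: dist_norm\<close>)
    have f_d: "f field_differentiable at (l w0 / (2 * of_real pi * \<i>))"
      by (rule holomorphic_on_imp_differentiable_at[OF hol]) (use l_Im in \<open>auto simp: open_halfspace_Im_gt\<close>)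
    have "(f \<circ> (\<lambda>w. l w / (2 * of_real pi * \<i>))) field_differentiable at w0"
      by (rule field_differentiable_compose[of "\<lambda>w. l w / (2 * of_real pi * \<i>)" w0 f])
         (use l_an f_d in \<open>auto intro!: field_differentiable_divide field_differentiable_const\<close>)
    then obtain D where D: "((f \<circ> (\<lambda>w. l w / (2 * of_real pi * \<i>))) has_field_derivative D) (at w0)"
      unfolding field_differentiable_def by blast
    have "(g0 has_field_derivative D) (at w0)"
    proof (rule has_field_derivative_transform_within_open[OF D])
      fix w :: complex assume w: "w \<in> ball 0 r - {0}"
      show "(f \<circ> (\<lambda>w. l w / (2 * of_real pi * \<i>))) w = g0 w"
      proof -
        have "exp (l w) = w" "cmod w < r" using l_exp[of w] w by auto
        then show ?thesis using eq[of "l w"] by (metis comp_apply)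
      qed
    qed (use w0 in auto)
    then show "\<exists>f'. (g0 has_field_derivative f') (at w0)" by blast
  qed
  have "\<exists>g. g holomorphic_on ball 0 r \<and> (\<forall>z\<in>ball 0 r - {0}. g z = g0 z)"
  proof (rule holomorphic_on_extend[OF hol0])
    show "(0::complex) \<in> interior (ball 0 r)" by (simp add: r_def)
    have "eventually (\<lambda>w::complex. w \<in> ball 0 r - {0}) (at 0)"
      by (intro eventually_at_in_open) (auto simp: r_def)
    then show "g0 \<in> O[at 0](\<lambda>_. 1)"
    proof (intro bigoI[of _ B], elim eventually_mono)
      fix w :: complex assume w: "w \<in> ball 0 r - {0}"
      then have "cmod (exp (Ln w)) < r" by simp
      then show "norm (g0 w) \<le> B * norm (1::complex)"
        unfolding g0_def using bdd[OF Im_log] by simp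
    qed
  qed
  then obtain g where g: "g holomorphic_on ball 0 r" "\<And>z. z \<in> ball 0 r - {0} \<Longrightarrow> g z = g0 z"
    by blast
  show ?thesis
  proof (rule that[of g])
    show "g holomorphic_on ball 0 (exp (- 2 * pi * R))" using g(1) by (simp add: r_def)
    fix \<tau> assume \<tau>: "Im \<tau> > R"
    have "cmod (exp (2 * of_real pi * \<i> * \<tau>)) < r" using \<tau> by (simp add: r_def)
    then show "f \<tau> = g (exp (2 * of_real pi * \<i> * \<tau>))"
      using eq[of "2 * of_real pi * \<i> * \<tau>"] g(2)[of "exp (2 * of_real pi * \<i> * \<tau>)"] by simp
  qed
qed

text \<open>The constant Fourier coefficient is the limit at the cusp; once it is 0, a factor exp(2
  pi i \<tau>) splits off. Below a fixed height the bound comes from compactness of one period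
  rectangle.\<close>

lemma periodic_vanishing_decay:
  assumes hol: "f holomorphic_on upper_half_plane"
    and per: "\<And>\<tau>. Im \<tau> > 0 \<Longrightarrow> f (\<tau> + 1) = f \<tau>"
    and lim: "(f \<longlongrightarrow> 0) at_i_infinity"
  obtains C where "\<And>\<tau>. Im \<tau> \<ge> 1/2 \<Longrightarrow> cmod (f \<tau>) \<le> C * exp (- (2 * pi) * Im \<tau>)"
proof -
  have "eventually (\<lambda>\<tau>. dist (f \<tau>) 0 < 1) at_i_infinity"
    using lim by (intro tendstoD) auto
  then obtain R where R: "R > 0" "\<And>\<tau>. Im \<tau> > R \<Longrightarrow> cmod (f \<tau>) < 1"
    unfolding eventually_at_i_infinity dist_0_norm dist_norm diff_0_right by blast
  obtain g where g: "g holomorphic_on ball 0 (exp (- 2 * pi * R))"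
    "\<And>\<tau>. Im \<tau> > R \<Longrightarrow> f \<tau> = g (exp (2 * of_real pi * \<i> * \<tau>))"
    by (rule periodic_descends_to_disc[of f R 1])
       (use R holomorphic_on_subset[OF hol, of "{\<tau>. Im \<tau> > R}"] per in
          \<open>auto simp: subset_iff less_imp_le\<close>)
  define r where "r = exp (- 2 * pi * R)"
  have r: "r > 0" by (simp add: r_def)
  have "g 0 = 0"
  proof -
    have "filterlim (\<lambda>y. of_real y * \<i>) at_i_infinity at_top"
      unfolding filterlim_filtercomap_iff by (simp add: o_def filterlim_ident)
    then have "((\<lambda>y. f (of_real y * \<i>)) \<longlongrightarrow> 0) at_top"
      by (rule filterlim_compose[OF lim])
    moreover have "eventually (\<lambda>y. f (of_real y * \<i>) = g (of_real (exp (- 2 * pi * y)))) at_top"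
      using eventually_gt_at_top[of R]
    proof eventually_elim
      case (elim y)
      have "2 * of_real pi * \<i> * (of_real y * \<i>) = complex_of_real (- 2 * pi * y)"
        by (simp add: algebra_simps)
      then have "exp (2 * of_real pi * \<i> * (of_real y * \<i>)) = complex_of_real (exp (- 2 * pi * y))"
        by (simp only: exp_of_real)
      then show ?case using g(2)[of "of_real y * \<i>"] elim by simp
    qed
    ultimately have "((\<lambda>y. g (of_real (exp (- 2 * pi * y)))) \<longlongrightarrow> 0) at_top"
      by (rule Lim_transform_eventually)
    moreover have "((\<lambda>y. g (of_real (exp (- 2 * pi * y)))) \<longlongrightarrow> g 0) at_top"
    proof (rule isCont_tendsto_compose[of 0 g])
      show "isCont g 0"
        using holomorphic_on_imp_continuous_on[OF g(1)] by (simp add: continuous_on_eq_continuous_at)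
      have "((\<lambda>y::real. exp (- 2 * pi * y)) \<longlongrightarrow> 0) at_top"
        by real_asymp
      then show "((\<lambda>y::real. complex_of_real (exp (- 2 * pi * y))) \<longlongrightarrow> 0) at_top"
        using tendsto_of_real_iff[of _ 0] by fastforce
    qed
    ultimately show ?thesis using tendsto_unique trivial_limit_at_top_linorder by blast
  qed
  then obtain k where k: "k holomorphic_on ball 0 r" "\<And>z. norm z < r \<Longrightarrow> g z = z * k z"
    using Schwarz3[of g r] g(1) by (auto simp: r_def)
  \<comment> \<open>The cofactor \<open>k\<close> is bounded only on a smaller closed disc. One more
    unit of height, \<open>Y = R + 1\<close>, lands in it because exp(-2 pi) is at most 1/2.\<close>
  have "compact (k ` cball 0 (r/2))"
    using r by (intro compact_continuous_image continuous_on_subset[OF holomorphic_on_imp_continuous_on[OF k(1)]]) auto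
  then have "bounded (k ` cball 0 (r/2))" by (rule compact_imp_bounded)
  then obtain C1 where "\<forall>x\<in>k ` cball 0 (r/2). cmod x \<le> C1" unfolding bounded_iff by blast
  then have C1: "cmod (k z) \<le> C1" if "norm z \<le> r/2" for z using that by simp
  define Y where "Y = R + 1"
  have big: "cmod (f \<tau>) \<le> C1 * exp (- (2 * pi) * Im \<tau>)" if "Im \<tau> > Y" for \<tau>
  proof -
    let ?z = "exp (2 * of_real pi * \<i> * \<tau>)"
    have n: "norm ?z = exp (- (2 * pi) * Im \<tau>)" by simp
    have "2 * pi * (R + 1) \<le> 2 * pi * Im \<tau>"
      using that by (intro mult_left_mono) (auto simp: Y_def)
    then have "- (2 * pi) * Im \<tau> \<le> - 2 * pi * R + - 2 * pi" unfolding distrib_left by linarith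
    then have "exp (- (2 * pi) * Im \<tau>) \<le> exp (- 2 * pi * R + - 2 * pi)" by (simp only: exp_le_cancel_iff)
    also have "\<dots> = r * exp (- 2 * pi)" unfolding r_def by (rule exp_add)
    also have "\<dots> \<le> r * (1/2)"
    proof (rule mult_left_mono)
      have "2 \<le> 1 + 2 * pi" using pi_gt3 by simp
      also have "\<dots> \<le> exp (2 * pi)" by (rule exp_ge_add_one_self)
      finally show "exp (- 2 * pi) \<le> 1/2" by (simp add: exp_minus field_simps)
    qed (use r in simp)
    finally have "norm ?z \<le> r / 2" unfolding n by simp
    then show ?thesis
      using g(2)[of \<tau>] k(2)[of ?z] C1[of ?z] that r mult_left_mono[of "cmod (k ?z)" C1 "exp (- (2 * pi) * Im \<tau>)"]
      by (simp add: Y_def norm_mult mult.commute)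
  qed
  define K where "K = cbox (Complex 0 (1/2)) (Complex 1 Y)"
  have "compact (f ` K)"
    by (intro compact_continuous_image continuous_on_subset[OF holomorphic_on_imp_continuous_on[OF hol]])
       (auto simp: K_def in_cbox_complex_iff)
  then have "bounded (f ` K)" by (rule compact_imp_bounded)
  then obtain C2 where C2: "\<And>z. z \<in> K \<Longrightarrow> cmod (f z) \<le> C2" unfolding bounded_iff by blast
  define C where "C = max C1 (\<bar>C2\<bar> * exp (2 * pi * Y))"
  show ?thesis
  proof (rule that[of C])
    fix \<tau> :: complex assume \<tau>: "Im \<tau> \<ge> 1/2"
    show "cmod (f \<tau>) \<le> C * exp (- (2 * pi) * Im \<tau>)"
    proof (cases "Im \<tau> > Y")
      case True
      have "C1 * exp (- (2 * pi) * Im \<tau>) \<le> C * exp (- (2 * pi) * Im \<tau>)"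
        by (rule mult_right_mono) (auto simp: C_def)
      then show ?thesis using big[OF True] by linarith
    next
      case False
      define n where "n = - \<lfloor>Re \<tau>\<rfloor>"
      have "f \<tau> = f (\<tau> + of_int n)" by (rule periodic_int[of 0, symmetric]) (use per \<tau> in auto)
      moreover have "\<tau> + of_int n \<in> K"
        using \<tau> False by (auto simp: K_def n_def in_cbox_complex_iff) linarith+
      ultimately have "cmod (f \<tau>) \<le> \<bar>C2\<bar>" using C2[of "\<tau> + of_int n"] by simp
      also have "\<dots> \<le> \<bar>C2\<bar> * (exp (2 * pi * Y) * exp (- (2 * pi) * Im \<tau>))"
      proof -
        have "exp (2 * pi * Y) * exp (- (2 * pi) * Im \<tau>) = exp (2 * pi * (Y - Im \<tau>))"
          by (simp add: algebra_simps flip: exp_add)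
        also have "\<dots> \<ge> 1" using False by simp
        finally show ?thesis using mult_left_mono[of 1 _ "\<bar>C2\<bar>"] by simp
      qed
      also have "\<dots> \<le> C * exp (- (2 * pi) * Im \<tau>)"
        unfolding mult.assoc[symmetric] by (rule mult_right_mono) (auto simp: C_def)
      finally show ?thesis .
    qed
  qed
qed

section \<open>A vanishing criterion for modular forms\<close>

text \<open>The height 4/5 lies below sqrt 3 / 2, the best possible one, so each inversion gains a
  definite factor: with \<open>\<bar>Re z\<bar> \<le> 1/2\<close> and \<open>Im z < 4/5\<close> the
  square of \<open>cmod z\<close> is at most 1/4 + 16/25 < 9/10.\<close>

lemma modular_reduction:
  fixes f :: "complex \<Rightarrow> 'a"
  assumes T: "\<And>\<tau>. Im \<tau> > 0 \<Longrightarrow> f (\<tau> + 1) = f \<tau>"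
    and S: "\<And>\<tau>. Im \<tau> > 0 \<Longrightarrow> f (- 1 / \<tau>) = f \<tau>"
    and \<tau>: "Im \<tau> > 0"
  obtains \<tau>' where "Im \<tau>' \<ge> 4/5" "f \<tau>' = f \<tau>"
proof -
  \<comment> \<open>\<open>n\<close> bounds the number of inversions that are still required; each
    of them replaces the lower bound for n + 1 by the one for n.\<close>
  have "\<exists>\<tau>'. Im \<tau>' \<ge> 4/5 \<and> f \<tau>' = f \<tau>" if "Im \<tau> > 0" "Im \<tau> \<ge> 4/5 * (9/10) ^ n" for n
    using that
  proof (induction n arbitrary: \<tau>)
    case (Suc n)
    define k where "k = - round (Re \<tau>)"
    define z where "z = \<tau> + of_int k"
    have fz: "f z = f \<tau>" unfolding z_def by (rule periodic_int[of 0]) (use T Suc.prems in auto)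
    have Imz: "Im z = Im \<tau>" by (simp add: z_def)
    show ?case
    proof (cases "Im \<tau> \<ge> 4/5")
      case False
      have Rez: "\<bar>Re z\<bar> \<le> 1/2"
        using of_int_round_abs_le[of "Re \<tau>"] by (simp add: z_def k_def abs_minus_commute)
      have "(cmod z)\<^sup>2 = (Re z)\<^sup>2 + (Im z)\<^sup>2" by (rule cmod_power2)
      also have "\<dots> \<le> (1/2)\<^sup>2 + (4/5)\<^sup>2"
      proof (rule add_mono)
        show "(Re z)\<^sup>2 \<le> (1/2)\<^sup>2"
          using Rez abs_le_square_iff[of "Re z" "1/2"] by simp
        show "(Im z)\<^sup>2 \<le> (4/5)\<^sup>2"
          using False Suc.prems Imz by (intro power_mono) auto
      qed
      also have "\<dots> \<le> 9/10" by (simp add: power2_eq_square)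
      finally have m: "(cmod z)\<^sup>2 \<le> 9/10" .
      have z0: "(cmod z)\<^sup>2 > 0" using Imz Suc.prems by auto
      have "4/5 * (9/10) ^ n * (cmod z)\<^sup>2 \<le> 4/5 * (9/10) ^ n * (9/10)"
        using m by (intro mult_left_mono) auto
      also have "\<dots> \<le> Im z" using Suc.prems Imz by simp
      finally have "Im (- 1 / z) \<ge> 4/5 * (9/10) ^ n"
        unfolding Im_neg_inverse using z0 by (simp add: pos_le_divide_eq)
      then obtain \<tau>' where "Im \<tau>' \<ge> 4/5" "f \<tau>' = f (- 1 / z)"
        using Suc.IH[of "- 1 / z"] Im_neg_inverse_pos[of z] Suc.prems Imz by auto
      then show ?thesis using S[of z] Imz fz Suc.prems by auto
    qed auto
  qed auto
  moreover have "\<exists>n. 4/5 * (9/10 :: real) ^ n \<le> Im \<tau>"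
  proof -
    obtain n where "(9/10 :: real) ^ n < Im \<tau>" using real_arch_pow_inv[of "Im \<tau>" "9/10"] \<tau> by auto
    moreover have "(9/10::real) ^ n \<ge> 0" by simp
    ultimately have "4/5 * (9/10 :: real) ^ n \<le> Im \<tau>" by linarith
    then show ?thesis by blast
  qed
  ultimately show ?thesis using \<tau> that by blast
qed

text \<open>A Phragmen-Lindelof argument: the n-th power of \<open>f\<close> is damped by a linear
  denominator, compared with the boundary of a large half-disc, and n is sent to infinity.\<close>

lemma half_plane_maximum_modulus:
  assumes hol: "f holomorphic_on {z. Im z > b}" and "b < c"
    and bdd: "\<And>z. Im z \<ge> c \<Longrightarrow> cmod (f z) \<le> B"
    and line: "\<And>z. Im z = c \<Longrightarrow> cmod (f z) \<le> M"
    and z: "Im z \<ge> c"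
  shows "cmod (f z) \<le> M"
proof (rule ccontr)
  assume "\<not> ?thesis"
  then have gt: "cmod (f z) > M" by simp
  have "cmod (f (of_real c * \<i>)) \<le> M" by (rule line) simp
  then have M0: "M \<ge> 0" using norm_ge_zero order_trans by blast
  \<comment> \<open>Positive and strictly between \<open>M\<close> and the alleged larger value,
    also when \<open>M\<close> is 0. The powers of \<open>cmod (f z) / m\<close> then outgrow the
    fixed factor in \<open>key\<close>.\<close>
  define m where "m = (M + cmod (f z)) / 2"
  have m: "m > 0" "M < m" "m < cmod (f z)" using gt M0 by (auto simp: m_def)
  have zc: "Im z > c"
  proof (rule ccontr)
    assume "\<not> Im z > c"
    then have "Im z = c" using z by simp
    from line[OF this] gt show False by simp
  qed
  define w0 where "w0 = of_real c * \<i>"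
  have w1: "cmod (w - w0 + \<i>) \<ge> 1" if "Im w \<ge> c" for w
    using abs_Im_le_cmod[of "w - w0 + \<i>"] that by (simp add: w0_def)
  have key: "cmod (f z) ^ n \<le> m ^ n * cmod (z - w0 + \<i>)" for n
  proof -
    \<comment> \<open>The zero of the denominator lies at height \<open>c - 1\<close>, so on the
      half-plane its modulus is at least 1, while it makes \<open>F\<close> small far out.\<close>
    define F where "F = (\<lambda>w. f w ^ n / (w - w0 + \<i>))"
    \<comment> \<open>On the arc the denominator is at least \<open>r - 1\<close>, which must
      dominate \<open>\<bar>B\<bar> ^ n / m ^ n\<close>. The first entry of the maximum puts
      \<open>z\<close> inside the half-disc.\<close>
    define r where "r = max (cmod (z - w0) + 1) (\<bar>B\<bar> ^ n / m ^ n + 1)"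
    define S where "S = {w. Im w > c} \<inter> ball w0 r"
    have opS: "open S" unfolding S_def by (intro open_Int open_halfspace_Im_gt open_ball)
    have clS: "closure S \<subseteq> {w. Im w \<ge> c} \<inter> cball w0 r"
      unfolding S_def by (intro closure_minimal closed_Int closed_halfspace_Im_ge closed_cball) auto
    have nz: "w - w0 + \<i> \<noteq> 0" if "Im w \<ge> c" for w using w1[OF that] by force
    have holF: "F holomorphic_on {w. Im w > b} \<inter> {w. w - w0 + \<i> \<noteq> 0}"
      unfolding F_def by (auto intro!: holomorphic_intros holomorphic_on_subset[OF hol])
    have "cmod (F z) \<le> m ^ n"
    proof (rule maximum_modulus_frontier[of F S])
      have sub: "closure S \<subseteq> {w. Im w > b} \<inter> {w. w - w0 + \<i> \<noteq> 0}"
      proof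
        fix w assume "w \<in> closure S"
        then have "Im w \<ge> c" using clS by blast
        then show "w \<in> {w. Im w > b} \<inter> {w. w - w0 + \<i> \<noteq> 0}" using nz[of w] \<open>b < c\<close> by simp
      qed
      show "continuous_on (closure S) F"
        by (rule continuous_on_subset[OF holomorphic_on_imp_continuous_on[OF holF] sub])
      have "interior S \<subseteq> closure S" using interior_subset closure_subset by blast
      then show "F holomorphic_on interior S"
        using sub by (intro holomorphic_on_subset[OF holF]) blast
      show "bounded S" unfolding S_def by (intro bounded_Int) auto
      show "z \<in> S" using zc by (auto simp: S_def r_def dist_norm norm_minus_commute)
      fix w assume w: "w \<in> frontier S"
      then have w': "Im w \<ge> c" "dist w0 w \<le> r" "w \<notin> S"
        using clS opS by (auto simp: frontier_def interior_open)
      have "cmod (F w) = cmod (f w) ^ n / cmod (w - w0 + \<i>)"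
        by (simp add: F_def norm_divide norm_power)
      show "cmod (F w) \<le> m ^ n"
      proof (cases "Im w = c")
        case True
        have "cmod (f w) ^ n \<le> m ^ n" using line[OF True] m by (intro power_mono) auto
        moreover have "cmod (f w) ^ n / cmod (w - w0 + \<i>) \<le> cmod (f w) ^ n / 1"
          using w1[of w] w' by (intro divide_left_mono) auto
        ultimately show ?thesis unfolding \<open>cmod (F w) = _\<close> by linarith
      next
        case False
        then have "cmod (w - w0) = r" using w' by (auto simp: S_def dist_norm norm_minus_commute)
        then have d: "cmod (w - w0 + \<i>) \<ge> r - 1"
          using norm_triangle_ineq4[of "w - w0 + \<i>" \<i>] by simp
        have pos: "\<bar>B\<bar> ^ n / m ^ n \<le> r - 1" by (simp add: r_def)
        have "cmod (f w) ^ n \<le> \<bar>B\<bar> ^ n" using bdd[OF w'(1)] by (intro power_mono) auto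
        also have "\<dots> \<le> m ^ n * (r - 1)" using pos m by (simp add: field_simps)
        also have "\<dots> \<le> m ^ n * cmod (w - w0 + \<i>)" using d m by (intro mult_left_mono) auto
        finally show ?thesis unfolding \<open>cmod (F w) = _\<close> using w1[OF w'(1)]
          by (subst pos_divide_le_eq) auto
      qed
    qed
    moreover have "cmod (z - w0 + \<i>) > 0" using w1[OF z] by linarith
    ultimately show ?thesis unfolding F_def
      by (simp only: norm_divide norm_power pos_divide_le_eq)
  qed
  have "1 < cmod (f z) / m" using m by simp
  then obtain n where "(cmod (f z) / m) ^ n > cmod (z - w0 + \<i>)"
    using real_arch_pow by blast
  then show False using key[of n] m by (simp add: power_divide field_simps)
qed

text \<open>This replaces the valence formula. The invariant function |f| (Im \<tau>)^w is bounded,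
  and by reduction its supremum is already reached over the heights at least 4/5. There the maximum
  principle for f(z) exp(-i A z) improves the supremum by a factor below 1, so it is 0. The
  transformation laws concern moduli only, which admits sign characters. For a modular form of
  weight 2 w the valence formula permits w < 3 A / pi; the factor 4/5 used here is the height of the
  reduction.\<close>

lemma siegel_vanishing:
  fixes f :: "complex \<Rightarrow> complex" and w A :: real
  assumes hol: "f holomorphic_on upper_half_plane"
    and T: "\<And>\<tau>. Im \<tau> > 0 \<Longrightarrow> cmod (f (\<tau> + 1)) = cmod (f \<tau>)"
    and S: "\<And>\<tau>. Im \<tau> > 0 \<Longrightarrow> cmod (f (- 1 / \<tau>)) = cmod \<tau> powr (2 * w) * cmod (f \<tau>)"
    and decay: "\<And>\<tau>. Im \<tau> \<ge> 1/2 \<Longrightarrow> cmod (f \<tau>) \<le> C * exp (- A * Im \<tau>)"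
    and wA: "0 < w" "w < 4/5 * A"
    and \<tau>: "Im \<tau> > 0"
  shows "f \<tau> = 0"
proof -
  have A: "A > 0" using wA by simp
  define \<psi> where "\<psi> = (\<lambda>\<tau>. cmod (f \<tau>) * Im \<tau> powr w)"
  have \<psi>T: "\<psi> (\<tau> + 1) = \<psi> \<tau>" if "Im \<tau> > 0" for \<tau> using T[OF that] by (simp add: \<psi>_def)
  have \<psi>S: "\<psi> (- 1 / \<tau>) = \<psi> \<tau>" if "Im \<tau> > 0" for \<tau>
  proof -
    have pos: "cmod \<tau> > 0" using that by auto
    have "Im (- 1 / \<tau>) powr w = Im \<tau> powr w / (cmod \<tau>)\<^sup>2 powr w"
      unfolding Im_neg_inverse by (simp add: powr_divide)
    also have "(cmod \<tau>)\<^sup>2 powr w = cmod \<tau> powr (2 * w)"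
      using pos by (simp add: powr_powr flip: powr_numeral)
    finally have "Im (- 1 / \<tau>) powr w = Im \<tau> powr w / cmod \<tau> powr (2 * w)" .
    then show ?thesis unfolding \<psi>_def S[OF that] using pos by simp
  qed
  have red: "\<exists>\<tau>'. Im \<tau>' \<ge> 4/5 \<and> \<psi> \<tau>' = \<psi> \<tau>" if "Im \<tau> > 0" for \<tau>
    by (rule modular_reduction[of \<psi> \<tau>]) (use \<psi>T \<psi>S that in blast)+
  have \<psi>0: "\<psi> \<tau> \<ge> 0" for \<tau> by (simp add: \<psi>_def)
  have "\<exists>B. \<forall>y\<ge>1/2. y powr w * exp (- A * y) \<le> B"
  proof -
    have "((\<lambda>y. y powr w * exp (- A * y)) \<longlongrightarrow> 0) at_top" using A by real_asymp
    then have "eventually (\<lambda>y. y powr w * exp (- A * y) < 1) at_top"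
      by (rule order_tendstoD) auto
    then obtain Y where Y: "\<And>y. y \<ge> Y \<Longrightarrow> y powr w * exp (- A * y) < 1"
      unfolding eventually_at_top_linorder by blast
    have "compact ((\<lambda>y. y powr w * exp (- A * y)) ` {1/2..Y})"
      by (intro compact_continuous_image continuous_intros) auto
    then have "bounded ((\<lambda>y. y powr w * exp (- A * y)) ` {1/2..Y})" by (rule compact_imp_bounded)
    then obtain B where B: "\<And>y. y \<in> {1/2..Y} \<Longrightarrow> norm (y powr w * exp (- A * y)) \<le> B"
      unfolding bounded_iff by blast
    have "y powr w * exp (- A * y) \<le> max B 1" if "y \<ge> 1/2" for y
      using B[of y] Y[of y] that by (cases "y \<le> Y") (simp_all add: max_def)
    then show ?thesis by blast
  qed
  then obtain B where B: "\<And>y. y \<ge> 1/2 \<Longrightarrow> y powr w * exp (- A * y) \<le> B" by blast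
  have C: "C \<ge> 0"
  proof -
    have "cmod (f \<i>) \<le> C * exp (- A * Im \<i>)" by (rule decay) simp
    then have "0 \<le> C * exp (- A * Im \<i>)" using norm_ge_zero order_trans by blast
    then show ?thesis by (simp add: zero_le_mult_iff)
  qed
  have bd: "\<psi> \<tau> \<le> C * B" if pos: "Im \<tau> > 0" for \<tau>
  proof -
    obtain \<tau>' where \<tau>': "Im \<tau>' \<ge> 4/5" "\<psi> \<tau>' = \<psi> \<tau>" using red[OF pos] by blast
    have "\<psi> \<tau>' \<le> C * exp (- A * Im \<tau>') * Im \<tau>' powr w"
      unfolding \<psi>_def using \<tau>' by (intro mult_right_mono decay) auto
    also have "\<dots> = C * (Im \<tau>' powr w * exp (- A * Im \<tau>'))" by simp
    also have "\<dots> \<le> C * B" using B[of "Im \<tau>'"] \<tau>' C by (intro mult_left_mono) auto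
    finally show ?thesis using \<tau>' by simp
  qed
  define \<Psi> where "\<Psi> = (SUP \<tau>\<in>upper_half_plane. \<psi> \<tau>)"
  have bdd: "bdd_above (\<psi> ` upper_half_plane)"
    by (rule bdd_aboveI[of _ "C * B"]) (use bd in auto)
  have up: "\<psi> \<tau> \<le> \<Psi>" if "Im \<tau> > 0" for \<tau>
    unfolding \<Psi>_def by (rule cSUP_upper[OF _ bdd]) (use that in simp)
  have \<Psi>0: "\<Psi> \<ge> 0" using up[of \<i>] \<psi>0[of \<i>] by simp
  \<comment> \<open>\<open>r > 5/8\<close> keeps the comparison line at height
    \<open>r * Im \<tau>\<close> above 1/2, where \<open>decay\<close> is available;
    \<open>w / r < 4/5 * A\<close> is what makes \<kappa> < 1, through ln (1/r) \<le> 1/r -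
    1.\<close>
  obtain r where r: "max (w / (4/5 * A)) (5/8) < r" "r < 1"
    using dense[of "max (w / (4/5 * A)) (5/8)" 1] wA A by (auto simp: field_simps)
  then have r': "r > 5/8" "w / r < 4/5 * A" using A by (auto simp: field_simps)
  define \<kappa> where "\<kappa> = r powr (- w) * exp (- A * (4/5) * (1 - r))"
  have \<kappa>: "\<kappa> < 1"
  proof -
    have "ln (1/r) \<le> 1/r - 1" using r r' by (intro ln_le_minus_one) auto
    then have "- ln r \<le> (1 - r) / r" using r' by (simp add: ln_div field_simps)
    then have "- w * ln r \<le> w * ((1 - r) / r)" using wA mult_left_mono[of "- ln r" "(1-r)/r" w] by simp
    also have "\<dots> = w / r * (1 - r)" by simp
    also have "\<dots> < 4/5 * A * (1 - r)" using r r' by (intro mult_strict_right_mono) auto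
    finally have "- w * ln r + (- A * (4/5) * (1 - r)) < 0" by (simp add: algebra_simps)
    moreover have "\<kappa> = exp (- w * ln r + (- A * (4/5) * (1 - r)))"
      unfolding \<kappa>_def exp_add using r' by (simp add: powr_def)
    ultimately show ?thesis by simp
  qed
  have imp: "\<psi> \<tau> \<le> \<kappa> * \<Psi>" if "Im \<tau> \<ge> 4/5" for \<tau>
  proof -
    define c where "c = r * Im \<tau>"
    have c: "c > 1/2" "c \<le> Im \<tau>"
    proof -
      have "5/8 * (4/5) < r * Im \<tau>" using r' that by (intro mult_less_le_imp_less) auto
      then show "c > 1/2" by (simp add: c_def)
      show "c \<le> Im \<tau>" using r that mult_right_mono[of r 1 "Im \<tau>"] by (simp add: c_def)
    qed
    \<comment> \<open>The exponential exactly offsets the assumed decay, so \<open>G\<close> is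
      bounded above height \<open>c\<close> and its values on that line control it at
      \<tau>.\<close>
    define G where "G = (\<lambda>z. f z * exp (- \<i> * of_real A * z))"
    have nG: "cmod (G z) = cmod (f z) * exp (A * Im z)" for z
      by (simp add: G_def norm_mult)
    have "cmod (G \<tau>) \<le> \<Psi> * c powr (- w) * exp (A * c)"
    proof (rule half_plane_maximum_modulus[of G 0 c C])
      show "G holomorphic_on {z. 0 < Im z}"
        unfolding G_def using hol by (auto intro!: holomorphic_intros simp: upper_half_plane_def)
      show "cmod (G z) \<le> C" if "c \<le> Im z" for z
      proof -
        have "cmod (f z) * exp (A * Im z) \<le> C * exp (- A * Im z) * exp (A * Im z)"
          using that c by (intro mult_right_mono decay) auto
        then show ?thesis unfolding nG by (simp add: mult.assoc flip: exp_add)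
      qed
      show "cmod (G z) \<le> \<Psi> * c powr (- w) * exp (A * c)" if "Im z = c" for z
      proof -
        have "cmod (f z) * c powr w \<le> \<Psi>" using up[of z] that c by (simp add: \<psi>_def)
        then have "cmod (f z) \<le> \<Psi> * c powr (- w)" using c by (simp add: powr_minus field_simps)
        then show ?thesis unfolding nG that by (intro mult_right_mono) auto
      qed
    qed (use c in auto)
    then have "cmod (f \<tau>) * exp (A * Im \<tau>) * Im \<tau> powr w \<le> \<Psi> * c powr (- w) * exp (A * c) * Im \<tau> powr w"
      unfolding nG by (intro mult_right_mono) auto
    then have "\<psi> \<tau> * exp (A * Im \<tau>) \<le> \<Psi> * (c powr (- w) * Im \<tau> powr w) * exp (A * c)"
      by (simp add: \<psi>_def mult_ac)
    also have "c powr (- w) * Im \<tau> powr w = r powr (- w)"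
    proof -
      have "c powr (- w) = r powr (- w) * Im \<tau> powr (- w)"
        unfolding c_def by (simp add: powr_mult)
      then show ?thesis using that by (simp add: powr_minus)
    qed
    finally have "\<psi> \<tau> \<le> \<Psi> * r powr (- w) * (exp (A * c) * exp (- (A * Im \<tau>)))"
      by (simp add: exp_minus field_simps)
    also have "exp (A * c) * exp (- (A * Im \<tau>)) = exp (- A * Im \<tau> * (1 - r))"
      by (simp add: c_def algebra_simps flip: exp_add)
    also have "\<Psi> * r powr (- w) * exp (- A * Im \<tau> * (1 - r)) \<le> \<Psi> * r powr (- w) * exp (- A * (4/5) * (1 - r))"
    proof -
      have "A * (1 - r) * (4/5) \<le> A * (1 - r) * Im \<tau>" using that r A by (intro mult_left_mono) auto
      then have "- A * Im \<tau> * (1 - r) \<le> - A * (4/5) * (1 - r)" by (simp add: mult_ac)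
      then show ?thesis using \<Psi>0 by (intro mult_left_mono) auto
    qed
    finally show ?thesis by (simp add: \<kappa>_def mult_ac)
  qed
  have "\<Psi> \<le> \<kappa> * \<Psi>"
    unfolding \<Psi>_def
  proof (rule cSUP_least)
    show "upper_half_plane \<noteq> {}" by (auto simp: upper_half_plane_def intro!: exI[of _ \<i>])
    fix \<tau> assume "\<tau> \<in> upper_half_plane"
    then have "\<exists>\<tau>'. Im \<tau>' \<ge> 4/5 \<and> \<psi> \<tau>' = \<psi> \<tau>" by (intro red) simp
    then obtain \<tau>' where "Im \<tau>' \<ge> 4/5" "\<psi> \<tau>' = \<psi> \<tau>" by blast
    then show "\<psi> \<tau> \<le> \<kappa> * (SUP \<tau>\<in>upper_half_plane. \<psi> \<tau>)" using imp[of \<tau>'] by (simp add: \<Psi>_def)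
  qed
  then have "\<Psi> * (1 - \<kappa>) \<le> 0" by (simp add: algebra_simps)
  then have "\<Psi> = 0" using \<kappa> \<Psi>0 by (simp add: mult_le_0_iff)
  then have "\<psi> \<tau> = 0" using up[OF \<tau>] \<psi>0[of \<tau>] by simp
  then show ?thesis using \<tau> by (simp add: \<psi>_def)
qed

section \<open>Jacobi theta functions\<close>

text \<open>The variable \<open>z\<close> is kept because the inversion formula is proved by Fourier
  expansion in it. The theta constants are the values at 0, at 1/2 and, up to an exponential factor,
  at \<tau>/2.\<close>

definition jacobi_theta :: "complex \<Rightarrow> complex \<Rightarrow> complex" where
  "jacobi_theta z \<tau> =
     (\<Sum>\<^sub>\<infinity>n::int. exp (of_real pi * \<i> * \<tau> * of_int n ^ 2 + 2 * of_real pi * \<i> * of_int n * z))"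

lemma summable_on_exp_abs_int: "(\<lambda>n::int. exp (- \<bar>real_of_int n\<bar>)) summable_on UNIV"
proof -
  have nat: "(\<lambda>n::nat. exp (- real n)) summable_on UNIV"
  proof -
    have "(\<lambda>n::nat. exp (- 1 :: real) ^ n) summable_on UNIV"
      by (subst summable_on_UNIV_nonneg_real_iff) (auto intro!: summable_geometric)
    then show ?thesis by (simp add: mult.commute flip: exp_of_nat_mult)
  qed
  have 1: "(\<lambda>n::int. exp (- \<bar>real_of_int n\<bar>)) summable_on {0..}"
  proof (rule summable_on_reindex_bij_betw[THEN iffD1])
    show "bij_betw int UNIV {0..}" by (rule bij_betwI[of _ _ _ nat]) auto
  qed (use nat in simp)
  have 2: "(\<lambda>n::int. exp (- \<bar>real_of_int n\<bar>)) summable_on {..0}"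
  proof (rule summable_on_reindex_bij_betw[THEN iffD1])
    show "bij_betw (\<lambda>n. - int n) UNIV {..0}" by (rule bij_betwI[of _ _ _ "\<lambda>n. nat (- n)"]) auto
  qed (use nat in simp)
  have "(\<lambda>n::int. exp (- \<bar>real_of_int n\<bar>)) summable_on {0..} \<union> ({..0} - {0..})"
    by (rule summable_on_Un_disjoint[OF 1 summable_on_subset_banach[OF 2]]) auto
  also have "{0..} \<union> ({..0} - {0..}) = (UNIV :: int set)" by auto
  finally show ?thesis .
qed

text \<open>Completing the square in |n| with linear coefficient 2 pi M + 1: the extra 1 is what
  remains as the summable factor exp(-|n|). The bound depends on \<open>\<delta>\<close> and
  \<open>M\<close> only, as uniform convergence on compact sets demands.\<close>

lemma norm_theta_term_le:
  assumes "\<delta> > 0" "Im \<tau> \<ge> \<delta>" "\<bar>Im z\<bar> \<le> M"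
  shows "cmod (exp (of_real pi * \<i> * \<tau> * of_int n ^ 2 + 2 * of_real pi * \<i> * of_int n * z))
     \<le> exp ((2 * pi * M + 1)\<^sup>2 / (4 * pi * \<delta>)) * exp (- \<bar>real_of_int n\<bar>)"
proof -
  define x where "x = \<bar>real_of_int n\<bar>"
  define k where "k = 2 * pi * M + 1"
  have x2: "(real_of_int n)\<^sup>2 = x\<^sup>2" by (simp add: x_def)
  have cn: "(complex_of_int n)\<^sup>2 = of_real (x\<^sup>2)" using x2 by (metis of_real_of_int_eq of_real_power)
  have "cmod (exp (of_real pi * \<i> * \<tau> * of_int n ^ 2 + 2 * of_real pi * \<i> * of_int n * z))
      = exp (- (pi * Im \<tau> * x\<^sup>2) - 2 * pi * real_of_int n * Im z)"
    unfolding norm_exp_eq_Re cn by simp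
  also have "\<dots> \<le> exp (- (pi * \<delta> * x\<^sup>2) + 2 * pi * M * x)"
  proof -
    have "pi * \<delta> * x\<^sup>2 \<le> pi * Im \<tau> * x\<^sup>2"
      using assms by (intro mult_right_mono) auto
    moreover have "- (2 * pi * real_of_int n * Im z) \<le> 2 * pi * M * x"
    proof -
      have "- (real_of_int n * Im z) \<le> \<bar>real_of_int n * Im z\<bar>" by simp
      also have "\<dots> \<le> x * M" unfolding abs_mult x_def using assms by (intro mult_left_mono) auto
      finally have "2 * pi * (- (real_of_int n * Im z)) \<le> 2 * pi * (x * M)" by (intro mult_left_mono) auto
      then show ?thesis by (simp add: mult_ac)
    qed
    ultimately have "- (pi * Im \<tau> * x\<^sup>2) - 2 * pi * real_of_int n * Im z \<le> - (pi * \<delta> * x\<^sup>2) + 2 * pi * M * x"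
      by linarith
    then show ?thesis by (simp only: exp_le_cancel_iff)
  qed
  also have "\<dots> \<le> exp (k\<^sup>2 / (4 * pi * \<delta>) + - x)"
  proof -
    have "0 \<le> (2 * pi * \<delta> * x - k)\<^sup>2 / (4 * pi * \<delta>)"
      using assms by (intro divide_nonneg_nonneg) auto
    also have "\<dots> = pi * \<delta> * x\<^sup>2 - k * x + k\<^sup>2 / (4 * pi * \<delta>)"
      using assms by (simp add: field_simps power2_eq_square)
    finally have "- (pi * \<delta> * x\<^sup>2) + 2 * pi * M * x \<le> k\<^sup>2 / (4 * pi * \<delta>) + - x"
      by (simp add: k_def algebra_simps)
    then show ?thesis by (simp only: exp_le_cancel_iff)
  qed
  finally show ?thesis unfolding exp_add k_def x_def .
qed

lemma theta_summable:
  assumes "Im \<tau> > 0"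
  shows "(\<lambda>n::int. exp (of_real pi * \<i> * \<tau> * of_int n ^ 2 + 2 * of_real pi * \<i> * of_int n * z)) summable_on UNIV"
proof (rule abs_summable_summable, rule Infinite_Sum.abs_summable_on_comparison_test')
  show "(\<lambda>n::int. exp ((2 * pi * \<bar>Im z\<bar> + 1)\<^sup>2 / (4 * pi * Im \<tau>)) * exp (- \<bar>real_of_int n\<bar>)) summable_on UNIV"
    by (intro summable_on_cmult_right summable_on_exp_abs_int)
qed (rule norm_theta_term_le, use assms in auto)

text \<open>Both arguments may vary, which covers \<open>z\<close> moving at fixed \<tau>, \<tau>
  moving at fixed \<open>z\<close>, and the coupled pair (\<tau>/2, \<tau>).\<close>

lemma holomorphic_jacobi_theta:
  assumes X: "open X" and u: "u holomorphic_on X" and v: "v holomorphic_on X"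
    and pos: "\<And>x. x \<in> X \<Longrightarrow> Im (v x) > 0"
  shows "(\<lambda>x. jacobi_theta (u x) (v x)) holomorphic_on X"
  unfolding holomorphic_on_def
proof
  fix x0 assume x0: "x0 \<in> X"
  obtain r where r: "r > 0" "cball x0 r \<subseteq> X" using X x0 open_contains_cball by blast
  have cu: "continuous_on (cball x0 r) (\<lambda>x. Im (u x))" and cv: "continuous_on (cball x0 r) (\<lambda>x. Im (v x))"
    using r u v by (auto intro!: continuous_intros holomorphic_on_imp_continuous_on elim: holomorphic_on_subset)
  have "\<exists>x\<in>cball x0 r. \<forall>y\<in>cball x0 r. Im (v x) \<le> Im (v y)"
    by (rule continuous_attains_inf) (use r cv in auto)
  then obtain x1 where x1: "x1 \<in> cball x0 r" "\<And>y. y \<in> cball x0 r \<Longrightarrow> Im (v x1) \<le> Im (v y)" by blast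
  have \<delta>: "Im (v x1) > 0" using pos x1(1) r by blast
  have "bounded ((\<lambda>x. Im (u x)) ` cball x0 r)"
    by (intro compact_imp_bounded compact_continuous_image cu compact_cball)
  then obtain M where M: "\<And>y. y \<in> cball x0 r \<Longrightarrow> \<bar>Im (u y)\<bar> \<le> M"
    unfolding bounded_iff real_norm_def by blast
  define t where "t = (\<lambda>(n::int) x. exp (of_real pi * \<i> * v x * of_int n ^ 2 + 2 * of_real pi * \<i> * of_int n * u x))"
  have "uniform_limit (cball x0 r) (\<lambda>N x. \<Sum>n\<in>N. t n x) (\<lambda>x. \<Sum>\<^sub>\<infinity>n. t n x) (finite_subsets_at_top UNIV)"
  proof (rule Weierstrass_m_test_general)
    show "norm (t n x) \<le> exp ((2 * pi * M + 1)\<^sup>2 / (4 * pi * Im (v x1))) * exp (- \<bar>real_of_int n\<bar>)"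
      if "x \<in> cball x0 r" for n x
      unfolding t_def by (rule norm_theta_term_le[OF \<delta> x1(2)[OF that] M[OF that]])
  qed (intro summable_on_cmult_right summable_on_exp_abs_int)
  moreover have "t n holomorphic_on X" for n
    unfolding t_def by (intro holomorphic_intros u v)
  ultimately obtain "(\<lambda>x. \<Sum>\<^sub>\<infinity>n. t n x) holomorphic_on ball x0 r"
  proof (rule_tac holomorphic_uniform_limit[of x0 r "\<lambda>N x. \<Sum>n\<in>N. t n x" "finite_subsets_at_top UNIV"])
    assume h: "\<And>n. t n holomorphic_on X"
    show "\<forall>\<^sub>F N in finite_subsets_at_top UNIV. continuous_on (cball x0 r) (\<lambda>x. \<Sum>n\<in>N. t n x) \<and> (\<lambda>x. \<Sum>n\<in>N. t n x) holomorphic_on ball x0 r"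
    proof (rule always_eventually, intro allI conjI)
      fix N :: "int set"
      have "(\<lambda>x. \<Sum>n\<in>N. t n x) holomorphic_on X" using h by (intro holomorphic_on_sum)
      then show "continuous_on (cball x0 r) (\<lambda>x. \<Sum>n\<in>N. t n x)" "(\<lambda>x. \<Sum>n\<in>N. t n x) holomorphic_on ball x0 r"
        using r ball_subset_cball[of x0 r]
        by (blast intro: continuous_on_subset[OF holomorphic_on_imp_continuous_on] holomorphic_on_subset)+
    qed
  qed auto
  then have "(\<lambda>x. \<Sum>\<^sub>\<infinity>n. t n x) field_differentiable at x0"
    using r by (auto intro: holomorphic_on_imp_differentiable_at)
  then show "(\<lambda>x. jacobi_theta (u x) (v x)) field_differentiable at x0 within X"
    unfolding t_def jacobi_theta_def by (rule field_differentiable_at_within)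
qed

lemma jacobi_theta_add_1: "jacobi_theta (z + 1) \<tau> = jacobi_theta z \<tau>"
  unfolding jacobi_theta_def
proof (rule infsum_cong)
  fix n :: int
  have "exp (2 * of_real pi * \<i> * of_int n) = (1::complex)"
    using exp_integer_2pi[of "of_int n"] by (simp add: mult_ac)
  then show "exp (of_real pi * \<i> * \<tau> * of_int n ^ 2 + 2 * of_real pi * \<i> * of_int n * (z + 1))
      = exp (of_real pi * \<i> * \<tau> * of_int n ^ 2 + 2 * of_real pi * \<i> * of_int n * z)"
    by (simp add: distrib_left exp_add)
qed

lemma jacobi_theta_add_int: "jacobi_theta (z + of_int n) \<tau> = jacobi_theta z \<tau>"
  by (rule periodic_int[of "Im z - 1" "\<lambda>z. jacobi_theta z \<tau>"]) (rule jacobi_theta_add_1, simp)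

lemma exp_pi_int_square: "exp (of_real pi * \<i> * of_int n ^ 2) = exp (of_real pi * \<i> * of_int n)"
proof -
  have "even (n\<^sup>2 - n)" by (simp add: power2_eq_square)
  then obtain k where "n\<^sup>2 - n = 2 * k" by blast
  then have "(of_int n :: complex) ^ 2 = of_int n + 2 * of_int k"
    by (metis add.commute diff_add_cancel of_int_add of_int_mult of_int_numeral of_int_power)
  then have "exp (of_real pi * \<i> * of_int n ^ 2) = exp (of_real pi * \<i> * of_int n) * exp (2 * of_real pi * \<i> * of_int k)"
    by (simp add: distrib_left exp_add mult_ac)
  also have "exp (2 * of_real pi * \<i> * of_int k) = (1::complex)"
    using exp_integer_2pi[of "of_int k"] by (simp add: mult_ac)
  finally show ?thesis by simp
qed

lemma jacobi_theta_tau_add_1: "jacobi_theta z (\<tau> + 1) = jacobi_theta (z + 1/2) \<tau>"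
  unfolding jacobi_theta_def
proof (rule infsum_cong)
  fix n :: int
  have "exp (of_real pi * \<i> * (\<tau> + 1) * of_int n ^ 2 + 2 * of_real pi * \<i> * of_int n * z)
      = exp (of_real pi * \<i> * \<tau> * of_int n ^ 2 + 2 * of_real pi * \<i> * of_int n * z) * exp (of_real pi * \<i> * of_int n ^ 2)"
    by (simp add: algebra_simps flip: exp_add)
  also have "\<dots> = exp (of_real pi * \<i> * \<tau> * of_int n ^ 2 + 2 * of_real pi * \<i> * of_int n * (z + 1/2))"
    unfolding exp_pi_int_square by (simp add: algebra_simps flip: exp_add)
  finally show "exp (of_real pi * \<i> * (\<tau> + 1) * of_int n ^ 2 + 2 * of_real pi * \<i> * of_int n * z) = \<dots>" .
qed

text \<open>Replacing n by n + 1 in the series completes the square in the exponent.\<close>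

lemma jacobi_theta_add_tau:
  "jacobi_theta (z + \<tau>) \<tau> = exp (- of_real pi * \<i> * \<tau> - 2 * of_real pi * \<i> * z) * jacobi_theta z \<tau>"
proof -
  have "jacobi_theta z \<tau> = (\<Sum>\<^sub>\<infinity>n::int. exp (of_real pi * \<i> * \<tau> * of_int (n + 1) ^ 2 + 2 * of_real pi * \<i> * of_int (n + 1) * z))"
    unfolding jacobi_theta_def
    by (rule infsum_reindex_bij_witness[of _ "\<lambda>n. n + 1" "\<lambda>n. n - 1"]) auto
  then have "exp (- of_real pi * \<i> * \<tau> - 2 * of_real pi * \<i> * z) * jacobi_theta z \<tau> =
      (\<Sum>\<^sub>\<infinity>n::int. exp (- of_real pi * \<i> * \<tau> - 2 * of_real pi * \<i> * z) * exp (of_real pi * \<i> * \<tau> * of_int (n + 1) ^ 2 + 2 * of_real pi * \<i> * of_int (n + 1) * z))"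
    by (simp only: infsum_cmult_right')
  also have "\<dots> = jacobi_theta (z + \<tau>) \<tau>"
    unfolding jacobi_theta_def exp_add[symmetric]
    by (intro infsum_cong arg_cong[where f = exp]) (simp add: algebra_simps power2_eq_square)
  finally show ?thesis by simp
qed

section \<open>Fourier expansion of entire periodic functions and the inversion of theta\<close>

text \<open>For a primitive P the difference P(z + 1) - P(z) has derivative 0. Fourier coefficients
  may therefore be computed on any horizontal segment of length 1.\<close>

lemma entire_periodic_mean_shift:
  assumes hol: "G holomorphic_on UNIV" and per: "\<And>z. G (z + 1) = G z"
  shows "(G has_contour_integral contour_integral (linepath 0 1) G) (linepath w (w + 1))"
proof -
  obtain P where P: "\<And>z. (P has_field_derivative G z) (at z)"
    using holomorphic_convex_primitive'[OF convex_UNIV open_UNIV hol] by auto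
  have int: "(G has_contour_integral P b - P a) (linepath a b)" for a b
    using contour_integral_primitive[of UNIV P G "linepath a b"] P
    by (auto simp: has_field_derivative_at_within)
  have "((\<lambda>z. P (z + 1) - P z) has_field_derivative 0) (at z)" for z
  proof -
    have "((\<lambda>z. P (z + 1)) has_field_derivative G (z + 1)) (at z)"
      by (rule DERIV_shift[THEN iffD1, OF P])
    from DERIV_diff[OF this P[of z]] show ?thesis by (simp add: per)
  qed
  then have "\<exists>c. \<forall>z\<in>UNIV. P (z + 1) - P z = c"
    by (intro has_field_derivative_zero_constant[OF convex_UNIV]) (auto simp: has_field_derivative_at_within)
  then have "P (w + 1) - P w = P (0 + 1) - P 0" by (metis UNIV_I)
  moreover have "contour_integral (linepath 0 1) G = P 1 - P 0" by (rule contour_integral_unique[OF int])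
  ultimately show ?thesis using int[of "w + 1" w] by (metis add_0 int)
qed

text \<open>Chernoff's argument. G - G(0) is divided by exp(2 pi i z) - 1; the quotient K is again
  entire and periodic, so the coefficients of G are differences of neighbouring coefficients of K
  and the partial sums telescope.\<close>

lemma entire_periodic_fourier_0:
  assumes hol: "G holomorphic_on UNIV" and per: "\<And>z. G (z + 1) = G z"
  shows "(\<lambda>N::nat. \<Sum>n=-int N..int N. contour_integral (linepath 0 1) (\<lambda>z. G z * exp (- 2 * of_real pi * \<i> * of_int n * z)))
           \<longlonglongrightarrow> G 0"
proof -
  define e where "e = (\<lambda>(n::int) z::complex. exp (- 2 * of_real pi * \<i> * of_int n * z))"
  have e_hol: "e n holomorphic_on A" for n A unfolding e_def by (intro holomorphic_intros)
  have e_per: "e n (z + 1) = e n z" for n z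
  proof -
    have "exp (- 2 * of_real pi * \<i> * of_int n) = (1::complex)"
      using exp_integer_2pi[of "of_int (- n)"] by (simp add: mult_ac)
    then show ?thesis by (simp add: e_def exp_add algebra_simps flip: exp_add) (simp add: exp_diff exp_add exp_minus field_simps)
  qed
  have e_int: "e n (of_int k) = 1" for n k
    using exp_integer_2pi[of "of_int (- n * k)"] by (simp add: e_def mult_ac)
  have e_ne: "e (-1) z \<noteq> 1" if "z \<notin> \<int>" for z
  proof
    assume "e (-1) z = 1"
    then obtain n :: int where "2 * of_real pi * \<i> * z = of_real (of_int (2 * n) * pi) * \<i>"
      unfolding e_def exp_eq_1 by (auto simp: complex_eq_iff)
    then have "z = of_int n" by simp
    then show False using that by simp
  qed
  \<comment> \<open>The denominator vanishes exactly at the integers, to first order, and so does G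
    - G(0) at least; the first case is the limiting value of the quotient.\<close>
  define K where "K = (\<lambda>z. if z \<in> \<int> then deriv G z / (2 * of_real pi * \<i>) else (G z - G 0) / (e (-1) z - 1))"
  have G_int: "G (of_int k) = G 0" for k
    using periodic_int[of "-1" G 0 k] per by simp
  have derG: "deriv G (z + 1) = deriv G z" for z
    using deriv_shift_0[of G "z + 1"] deriv_shift_0[of G z] per
    by (metis (no_types, lifting) DERIV_imp_deriv DERIV_shift DERIV_deriv_iff_field_differentiable ext UNIV_I hol holomorphic_on_imp_differentiable_at open_UNIV)
  have K_per: "K (z + 1) = K z" for z
  proof -
    have "z + 1 \<in> \<int> \<longleftrightarrow> z \<in> \<int>" by (metis Ints_1 Ints_add Ints_diff add_diff_cancel)
    then show ?thesis by (simp add: K_def per e_per derG)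
  qed
  have K_hol: "K holomorphic_on UNIV"
    unfolding holomorphic_on_def
  proof
    fix z0 :: complex
    have "K field_differentiable at z0"
    proof (cases "z0 \<in> \<int>")
      case True
      then obtain k where k: "z0 = of_int k" by (auto elim: Ints_cases)
      let ?q = "\<lambda>f z. if z = z0 then deriv f z0 else (f z - f z0) / (z - z0)"
      have d: "deriv (e (-1)) z0 = 2 * of_real pi * \<i>"
      proof -
        have "(e (-1) has_field_derivative 2 * of_real pi * \<i> * e (-1) z0) (at z0)"
          unfolding e_def by (auto intro!: derivative_eq_intros)
        then show ?thesis using e_int[of "-1" k] k by (simp add: DERIV_imp_deriv)
      qed
      have notint: "z \<notin> \<int>" if "z \<in> ball z0 1" "z \<noteq> z0" for z
      proof
        assume "z \<in> \<int>"
        then obtain j where "z = of_int j" by (auto elim: Ints_cases)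
        then show False using that k by (auto simp: dist_norm simp flip: of_int_diff)
      qed
      have nz: "?q (e (-1)) z \<noteq> 0" if "z \<in> ball z0 1" for z
        using e_ne[OF notint[OF that]] e_int[of "-1" k] d k by auto
      have "(\<lambda>z. ?q G z / ?q (e (-1)) z) holomorphic_on ball z0 1"
        by (intro holomorphic_on_divide pole_lemma_open open_ball e_hol holomorphic_on_subset[OF hol] nz) auto
      moreover have "?q G z / ?q (e (-1)) z = K z" if "z \<in> ball z0 1" for z
        using notint[OF that] e_int[of "-1" k] d k G_int[of k] True by (auto simp: K_def)
      ultimately have "K holomorphic_on ball z0 1" by (rule holomorphic_transform)
      then show ?thesis by (rule holomorphic_on_imp_differentiable_at) auto
    next
      case False
      have op: "open (- \<int> :: complex set)" by (simp add: open_Compl closed_Ints)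
      have "(\<lambda>z. (G z - G 0) / (e (-1) z - 1)) holomorphic_on - \<int>"
        by (intro holomorphic_intros e_hol holomorphic_on_subset[OF hol]) (auto dest: e_ne)
      then have "K holomorphic_on - \<int>" by (rule holomorphic_transform) (auto simp: K_def)
      then show ?thesis by (rule holomorphic_on_imp_differentiable_at[OF _ op]) (use False in auto)
    qed
    then show "K field_differentiable at z0 within UNIV" by simp
  qed
  have K_eq: "G z = G 0 + (e (-1) z - 1) * K z" for z
    using e_ne[of z] e_int[of "-1"] G_int by (auto simp: K_def elim!: Ints_cases)
  define c where "c = (\<lambda>F n. contour_integral (linepath 0 1) (\<lambda>z. F z * e n z))"
  have ci: "(F has_contour_integral contour_integral (linepath 0 1) F) (linepath 0 1)" if "F holomorphic_on UNIV" for F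
    by (rule has_contour_integral_integral)
       (auto intro!: contour_integrable_continuous_linepath holomorphic_on_imp_continuous_on holomorphic_on_subset[OF that])
  have cK_shift: "((\<lambda>z. K z * e n z) has_contour_integral c K n) (linepath w (w + 1))" for n w
    unfolding c_def by (rule entire_periodic_mean_shift) (auto intro!: holomorphic_intros K_hol e_hol simp: K_per e_per)
  have cK_bound: "\<exists>M. \<forall>n. cmod (c K n) \<le> M * exp (2 * pi * of_int n * Im w)" if "Re w = 0" for w
  proof -
    have "bounded (K ` closed_segment w (w + 1))"
      by (intro compact_imp_bounded compact_continuous_image compact_segment holomorphic_on_imp_continuous_on holomorphic_on_subset[OF K_hol]) auto
    then obtain M where M: "\<And>z. z \<in> closed_segment w (w + 1) \<Longrightarrow> cmod (K z) \<le> M" unfolding bounded_iff by blast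
    have "cmod (c K n) \<le> \<bar>M\<bar> * exp (2 * pi * of_int n * Im w) * cmod (w + 1 - w)" for n
    proof (rule has_contour_integral_bound_linepath[OF cK_shift])
      fix z assume z: "z \<in> closed_segment w (w + 1)"
      then have "Im z = Im w" by (auto simp: closed_segment_def algebra_simps)
      then have "cmod (e n z) = exp (2 * pi * of_int n * Im w)" by (simp add: e_def)
      then show "cmod (K z * e n z) \<le> \<bar>M\<bar> * exp (2 * pi * of_int n * Im w)"
        unfolding norm_mult using M[OF z] by (intro mult_mono) auto
    qed auto
    then show ?thesis by auto
  qed
  \<comment> \<open>The segment is moved down to height -1 for indices tending to +infinity, and up
    to height 1 for those tending to -infinity in \<open>lim2\<close>.\<close>
  have lim1: "(\<lambda>N::nat. c K (int N)) \<longlonglongrightarrow> 0"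
  proof -
    obtain M where M: "\<And>n. cmod (c K n) \<le> M * exp (2 * pi * of_int n * Im (- \<i>))" using cK_bound[of "- \<i>"] by auto
    have "(\<lambda>N::nat. M * exp (2 * pi * real N * - 1)) \<longlonglongrightarrow> 0" by real_asymp
    then show ?thesis by (rule Lim_null_comparison[rotated]) (use M[of "int _"] in auto)
  qed
  have lim2: "(\<lambda>N::nat. c K (- int N - 1)) \<longlonglongrightarrow> 0"
  proof -
    obtain M where M: "\<And>n. cmod (c K n) \<le> M * exp (2 * pi * of_int n * Im \<i>)" using cK_bound[of "\<i>"] by auto
    have "(\<lambda>N::nat. M * exp (2 * pi * (- real N - 1))) \<longlonglongrightarrow> 0" by real_asymp
    then show ?thesis by (rule Lim_null_comparison[rotated]) (use M[of "- int _ - 1"] in auto)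
  qed
  have c_const: "c (\<lambda>_. G 0) n = (if n = 0 then G 0 else 0)" for n
  proof (cases "n = 0")
    case True
    then show ?thesis by (simp add: c_def e_def)
  next
    case False
    define k where "k = - 2 * of_real pi * \<i> * of_int n"
    have k: "k \<noteq> 0" using False by (simp add: k_def)
    have e_k: "e n z = exp (k * z)" for z by (simp add: e_def k_def)
    have "((\<lambda>z. G 0 * exp (k * z) / k) has_field_derivative G 0 * exp (k * z)) (at z)" for z
      using k by (auto intro!: derivative_eq_intros)
    then have "((\<lambda>z. G 0 * e n z) has_contour_integral (G 0 * e n 1 / k - G 0 * e n 0 / k)) (linepath 0 1)"
      using contour_integral_primitive[of UNIV "\<lambda>z. G 0 * e n z / k" "\<lambda>z. G 0 * e n z" "linepath 0 1"] k
      by (simp add: e_k)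
    moreover have "e n 1 = 1" "e n 0 = 1" using e_int[of n 1] e_int[of n 0] by auto
    ultimately show ?thesis using False unfolding c_def by (simp add: contour_integral_unique)
  qed
  \<comment> \<open>Multiplication by exp(2 pi i z) lowers the index of the coefficient by one,
    which turns the relation \<open>K_eq\<close> into a difference.\<close>
  have cG: "c G n = (if n = 0 then G 0 else 0) + (c K (n - 1) - c K n)" for n
  proof -
    have "(\<lambda>z. G z * e n z) = (\<lambda>z. G 0 * e n z + (K z * e (n - 1) z - K z * e n z))"
    proof
      fix z
      have "e (-1) z * e n z = e (n - 1) z" by (simp add: e_def algebra_simps flip: exp_add)
      then show "G z * e n z = G 0 * e n z + (K z * e (n - 1) z - K z * e n z)"
        unfolding K_eq[of z] by (simp add: algebra_simps)
    qed
    moreover have "((\<lambda>z. G 0 * e n z + (K z * e (n - 1) z - K z * e n z)) has_contour_integral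
        (c (\<lambda>_. G 0) n + (c K (n - 1) - c K n))) (linepath 0 1)"
      unfolding c_def
      by (intro has_contour_integral_add has_contour_integral_diff ci holomorphic_intros e_hol K_hol)
    ultimately show ?thesis unfolding c_const[symmetric] by (simp add: c_def contour_integral_unique)
  qed
  have "(\<Sum>n=-int N..int N. c G n) = G 0 + (c K (- int N - 1) - c K (int N))" for N :: nat
  proof (induction N)
    case 0
    then show ?case by (simp add: cG)
  next
    case (Suc N)
    have "{- int (Suc N)..int (Suc N)} = insert (- int (Suc N)) (insert (int (Suc N)) {-int N..int N})" by auto
    then have "(\<Sum>n=-int (Suc N)..int (Suc N). c G n)
        = c G (- int (Suc N)) + (c G (int (Suc N)) + (G 0 + (c K (- int N - 1) - c K (int N))))"
      using Suc by simp
    also have "\<dots> = G 0 + (c K (- int (Suc N) - 1) - c K (int (Suc N)))"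
    proof -
      have e: "- int (Suc N) = - int N - 1" "int (Suc N) - 1 = int N" by simp_all
      have nz: "- int N - 1 \<noteq> 0" "int (Suc N) \<noteq> 0" by simp_all
      show ?thesis unfolding cG e if_not_P[OF nz(1)] if_not_P[OF nz(2)] by (simp only: algebra_simps) simp
    qed
    finally show ?case .
  qed
  then have eq: "(\<lambda>N::nat. \<Sum>n=-int N..int N. c G n) = (\<lambda>N. G 0 + (c K (- int N - 1) - c K (int N)))" by blast
  have "(\<lambda>N::nat. \<Sum>n=-int N..int N. c G n) \<longlonglongrightarrow> G 0 + (0 - 0)"
    unfolding eq by (intro tendsto_intros lim1 lim2)
  then show ?thesis by (simp add: c_def e_def)
qed

lemma has_sum_int_symmetric_limit:
  assumes "(f has_sum S) (UNIV :: int set)"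
  shows "(\<lambda>N::nat. \<Sum>n=-int N..int N. f n) \<longlonglongrightarrow> S"
proof -
  have "filterlim (\<lambda>N::nat. {-int N..int N}) (finite_subsets_at_top UNIV) sequentially"
    unfolding filterlim_finite_subsets_at_top
  proof (intro allI impI)
    fix X :: "int set" assume "finite X \<and> X \<subseteq> UNIV"
    then have "finite X" by simp
    define N where "N = nat (Max (insert 0 (abs ` X)))"
    have "\<bar>x\<bar> \<le> int N" if "x \<in> X" for x
      unfolding N_def using \<open>finite X\<close> that by (auto intro!: Max_ge)
    then have "X \<subseteq> {-int n..int n}" if "n \<ge> N" for n using that by force
    then show "\<forall>\<^sub>F n in sequentially. finite {-int n..int n} \<and> X \<subseteq> {-int n..int n} \<and> {-int n..int n} \<subseteq> UNIV"
      unfolding eventually_sequentially by auto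
  qed
  then show ?thesis using assms unfolding has_sum_def by (rule filterlim_compose[rotated])
qed

text \<open>The integrand is sqrt y times the normal density of variance y / (2 pi), whose total
  mass is 1.\<close>

lemma gaussian_integral_limit:
  assumes y: "y > 0"
  shows "(\<lambda>N::nat. integral {- real N..real N} (\<lambda>x. exp (- (pi * x\<^sup>2 / y)))) \<longlonglongrightarrow> sqrt y"
proof -
  define \<sigma> where "\<sigma> = sqrt (y / (2 * pi))"
  have \<sigma>: "\<sigma> > 0" "2 * \<sigma>\<^sup>2 = y / pi" using y by (auto simp: \<sigma>_def)
  define g where "g = (\<lambda>x. exp (- (pi * x\<^sup>2 / y)))"
  have g: "g x = sqrt y * normal_density 0 \<sigma> x" for x
  proof -
    have "2 * pi * \<sigma>\<^sup>2 = y" using \<sigma> by (simp add: field_simps)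
    then show ?thesis unfolding normal_density_def g_def \<sigma>(2) using y by (simp add: field_simps)
  qed
  have int: "integrable lborel g" unfolding g using \<sigma> by simp
  have val: "(\<integral>x. g x \<partial>lborel) = sqrt y" unfolding g using \<sigma> by simp
  have "(\<lambda>N::nat. \<integral>x. indicator {- real N..real N} x *\<^sub>R g x \<partial>lborel) \<longlonglongrightarrow> (\<integral>x. g x \<partial>lborel)"
  proof (rule integral_dominated_convergence[where w = g])
    show "AE x in lborel. (\<lambda>N::nat. indicator {- real N..real N} x *\<^sub>R g x) \<longlonglongrightarrow> g x"
    proof (rule AE_I2)
      fix x :: real
      obtain n :: nat where n: "\<bar>x\<bar> \<le> real n" using real_arch_simple by blast
      have "eventually (\<lambda>N::nat. indicator {- real N..real N} x *\<^sub>R g x = g x) sequentially"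
        using eventually_ge_at_top[of n] by eventually_elim (use n in \<open>auto simp: indicator_def\<close>)
      then show "(\<lambda>N::nat. indicator {- real N..real N} x *\<^sub>R g x) \<longlonglongrightarrow> g x"
        by (rule tendsto_eventually)
    qed
    show "AE x in lborel. norm (indicator {- real N..real N} x *\<^sub>R g x) \<le> g x" for N :: nat
      by (rule AE_I2) (auto simp: indicator_def g_def)
  qed (use int in auto)
  moreover have "(\<integral>x. indicator {- real N..real N} x *\<^sub>R g x \<partial>lborel) = integral {- real N..real N} g" for N :: nat
  proof -
    have "set_integrable lborel {- real N..real N} g"
      using int unfolding set_integrable_def by (intro integrable_mult_indicator) auto
    then show ?thesis using set_borel_integral_eq_integral(2)[of "{- real N..real N}" g]
      by (simp add: set_lebesgue_integral_def)
  qed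
  ultimately have "(\<lambda>N::nat. integral {- real N..real N} g) \<longlonglongrightarrow> sqrt y" using val by simp
  then show ?thesis by (simp add: g_def)
qed

text \<open>The left-hand side B is entire and, by the quasi-period of theta, 1-periodic in z. Its
  behaviour under shifts by i n y determines all Fourier coefficients up to the mean m, so B is m
  times theta; m is found by unfolding to a Gaussian integral. Only the imaginary axis is treated;
  the identity theorem extends the consequences to all \<tau>.\<close>

lemma jacobi_theta_inversion:
  assumes y: "y > 0"
  shows "exp (- (of_real pi * z\<^sup>2 / of_real y)) * jacobi_theta (\<i> * z / of_real y) (\<i> / of_real y)
     = of_real (sqrt y) * jacobi_theta z (\<i> * of_real y)"
proof -
  define \<tau>' where "\<tau>' = \<i> / complex_of_real y"
  have \<tau>': "Im \<tau>' > 0" using y by (simp add: \<tau>'_def)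
  define B where "B = (\<lambda>z. exp (- (of_real pi * z\<^sup>2 / of_real y)) * jacobi_theta (\<i> * z / of_real y) \<tau>')"
  have cy: "complex_of_real y \<noteq> 0" using y by simp
  have B_hol: "B holomorphic_on UNIV"
    unfolding B_def using cy \<tau>' by (intro holomorphic_intros holomorphic_jacobi_theta) auto
  have B_per: "B (z + 1) = B z" for z
  proof -
    have "B (z + 1) = exp (- (of_real pi * (z + 1)\<^sup>2 / of_real y)) * jacobi_theta (\<i> * z / of_real y + \<tau>') \<tau>'"
      using cy by (simp add: B_def \<tau>'_def field_simps)
    also have "\<dots> = exp (- (of_real pi * (z + 1)\<^sup>2 / of_real y) + (- of_real pi * \<i> * \<tau>' - 2 * of_real pi * \<i> * (\<i> * z / of_real y)))
        * jacobi_theta (\<i> * z / of_real y) \<tau>'"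
      unfolding jacobi_theta_add_tau exp_add by simp
    also have "- (of_real pi * (z + 1)\<^sup>2 / of_real y) + (- of_real pi * \<i> * \<tau>' - 2 * of_real pi * \<i> * (\<i> * z / of_real y))
        = - (of_real pi * z\<^sup>2 / of_real y)"
      using cy by (simp add: \<tau>'_def field_simps power2_eq_square)
    finally show ?thesis by (simp add: B_def)
  qed
  \<comment> \<open>In the theta factor this is a shift of the first argument by the integer -n;
    only the Gaussian factor changes. Moving the segment up by n y therefore gives the n-th Fourier
    coefficient.\<close>
  have B_shift: "B (z + \<i> * of_int n * of_real y) = exp (of_real pi * of_real y * of_int n ^ 2 - 2 * of_real pi * \<i> * of_int n * z) * B z" for n z
  proof -
    have "B (z + \<i> * of_int n * of_real y) = exp (- (of_real pi * (z + \<i> * of_int n * of_real y)\<^sup>2 / of_real y))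
        * jacobi_theta (\<i> * z / of_real y + of_int (- n)) \<tau>'"
      using cy by (simp add: B_def field_simps)
    also have "jacobi_theta (\<i> * z / of_real y + of_int (- n)) \<tau>' = jacobi_theta (\<i> * z / of_real y) \<tau>'"
      by (rule jacobi_theta_add_int)
    also have "- (of_real pi * (z + \<i> * of_int n * of_real y)\<^sup>2 / of_real y)
        = (of_real pi * of_real y * of_int n ^ 2 - 2 * of_real pi * \<i> * of_int n * z) + - (of_real pi * z\<^sup>2 / of_real y)"
      using cy by (simp add: field_simps power2_eq_square)
    finally show ?thesis unfolding exp_add B_def by simp
  qed
  define m where "m = contour_integral (linepath 0 1) B"
  have fourier: "contour_integral (linepath 0 1) (\<lambda>x. B (x + z) * exp (- 2 * of_real pi * \<i> * of_int n * x))
      = m * exp (of_real pi * \<i> * (\<i> * of_real y) * of_int n ^ 2 + 2 * of_real pi * \<i> * of_int n * z)" for n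
  proof -
    define w where "w = z + \<i> * of_int n * of_real y"
    define k where "k = exp (of_real pi * \<i> * (\<i> * of_real y) * of_int n ^ 2 + 2 * of_real pi * \<i> * of_int n * z)"
    have eq: "B (x + z) * exp (- 2 * of_real pi * \<i> * of_int n * x) = B (x + w) * k" for x
    proof -
      have "B (x + w) * k = B (x + z) * (exp (of_real pi * of_real y * of_int n ^ 2 - 2 * of_real pi * \<i> * of_int n * (x + z)) * k)"
        using B_shift[of "x + z" n] by (simp add: w_def add_ac mult_ac)
      also have "exp (of_real pi * of_real y * of_int n ^ 2 - 2 * of_real pi * \<i> * of_int n * (x + z)) * k = exp (- 2 * of_real pi * \<i> * of_int n * x)"
        unfolding k_def exp_add[symmetric] by (intro arg_cong[where f = exp]) (simp add: algebra_simps)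
      finally show ?thesis by simp
    qed
    have "((\<lambda>x. B (x + w) * k) has_contour_integral m * k) (linepath 0 1)"
    proof (rule has_contour_integral_rmul)
      have "(B has_contour_integral m) (linepath w (w + 1))"
        unfolding m_def by (rule entire_periodic_mean_shift[OF B_hol B_per])
      then show "((\<lambda>x. B (x + w)) has_contour_integral m) (linepath 0 1)"
        unfolding has_contour_integral_linepath by (simp add: linepath_def algebra_simps)
    qed
    then show ?thesis unfolding eq k_def[symmetric] by (rule contour_integral_unique)
  qed
  \<comment> \<open>The expansion theorem concerns the point 0, so it is applied to the translate of
    \<open>B\<close> by \<open>z\<close>.\<close>
  have "(\<lambda>N::nat. \<Sum>n=-int N..int N. contour_integral (linepath 0 1) (\<lambda>x. B (x + z) * exp (- 2 * of_real pi * \<i> * of_int n * x)))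
      \<longlonglongrightarrow> B (0 + z)"
  proof (rule entire_periodic_fourier_0[where G = "\<lambda>x. B (x + z)"])
    show "(\<lambda>x. B (x + z)) holomorphic_on UNIV"
      by (rule holomorphic_on_compose_gen[of "\<lambda>x. x + z" UNIV B UNIV, unfolded o_def]) (auto intro!: holomorphic_intros B_hol)
    show "B (x + 1 + z) = B (x + z)" for x using B_per[of "x + z"] by (simp add: add_ac)
  qed
  then have L1: "(\<lambda>N::nat. m * (\<Sum>n=-int N..int N. exp (of_real pi * \<i> * (\<i> * of_real y) * of_int n ^ 2 + 2 * of_real pi * \<i> * of_int n * z)))
      \<longlonglongrightarrow> B z"
    unfolding fourier by (simp add: sum_distrib_left)
  have "Im (\<i> * complex_of_real y) > 0" using y by simp
  from has_sum_infsum[OF theta_summable[OF this]]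
  have "(\<lambda>N::nat. m * (\<Sum>n=-int N..int N. exp (of_real pi * \<i> * (\<i> * of_real y) * of_int n ^ 2 + 2 * of_real pi * \<i> * of_int n * z)))
      \<longlonglongrightarrow> m * jacobi_theta z (\<i> * of_real y)"
    unfolding jacobi_theta_def by (intro tendsto_mult_left has_sum_int_symmetric_limit)
  with L1 have main: "B z = m * jacobi_theta z (\<i> * of_real y)" by (rule LIMSEQ_unique)
  \<comment> \<open>Unfolding: \<open>B\<close> is the sum of the translates by n of the Gaussian,
    and integrating them over [0,1] assembles the integral over the real line.\<close>
  have "m = of_real (sqrt y)"
  proof -
    define g where "g = (\<lambda>x::real. exp (- (pi * x\<^sup>2 / y)))"
    define F where "F = (\<lambda>(n::int) x. exp (- (of_real pi * (x + of_int n)\<^sup>2 / of_real y)) :: complex)"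
    have Fg: "F n (of_real x) = of_real (g (x + of_int n))" for n x
    proof -
      have "- (of_real pi * (of_real x + of_int n)\<^sup>2 / of_real y) = complex_of_real (- (pi * (x + of_int n)\<^sup>2 / y))"
        by simp
      then show ?thesis unfolding F_def g_def by (simp only: exp_of_real)
    qed
    have F_term: "F n x = exp (- (of_real pi * x\<^sup>2 / of_real y)) * exp (of_real pi * \<i> * \<tau>' * of_int n ^ 2 + 2 * of_real pi * \<i> * of_int n * (\<i> * x / of_real y))" for n x
      unfolding F_def exp_add[symmetric] using cy
      by (intro arg_cong[where f = exp]) (simp add: \<tau>'_def divide_inverse algebra_simps power2_eq_square)
    have "uniform_limit (cball 0 1) (\<lambda>N x. \<Sum>n\<in>N. F n x) (\<lambda>x. \<Sum>\<^sub>\<infinity>n. F n x) (finite_subsets_at_top UNIV)"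
    proof (rule Weierstrass_m_test_general)
      fix n :: int and x :: complex assume x: "x \<in> cball 0 1"
      have "cmod (exp (- (of_real pi * x\<^sup>2 / of_real y))) \<le> exp (cmod (- (of_real pi * x\<^sup>2 / of_real y)))"
        by (rule norm_exp)
      also have "\<dots> \<le> exp (pi / y)"
        using x y power_mono[of "cmod x" 1 2] by (simp add: norm_mult norm_divide norm_power divide_simps)
      finally have 1: "cmod (exp (- (of_real pi * x\<^sup>2 / of_real y))) \<le> exp (pi / y)" .
      have 2: "cmod (exp (of_real pi * \<i> * \<tau>' * of_int n ^ 2 + 2 * of_real pi * \<i> * of_int n * (\<i> * x / of_real y)))
          \<le> exp ((2 * pi * (1 / y) + 1)\<^sup>2 / (4 * pi * Im \<tau>')) * exp (- \<bar>real_of_int n\<bar>)"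
      proof (rule norm_theta_term_le[OF \<tau>' order_refl])
        have "\<bar>Im (\<i> * x / of_real y)\<bar> \<le> cmod (\<i> * x / of_real y)" by (rule abs_Im_le_cmod)
        also have "\<dots> \<le> 1 / y" using x y by (simp add: norm_mult norm_divide divide_simps)
        finally show "\<bar>Im (\<i> * x / of_real y)\<bar> \<le> 1 / y" .
      qed
      show "cmod (F n x) \<le> exp (pi / y) * (exp ((2 * pi * (1 / y) + 1)\<^sup>2 / (4 * pi * Im \<tau>')) * exp (- \<bar>real_of_int n\<bar>))"
        unfolding F_term norm_mult using 1 2 by (intro mult_mono) auto
    qed (intro summable_on_cmult_right summable_on_exp_abs_int)
    moreover have "(\<lambda>x. \<Sum>\<^sub>\<infinity>n. F n x) = B"
      unfolding F_term B_def jacobi_theta_def by (simp add: infsum_cmult_right')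
    ultimately have ul: "uniform_limit (path_image (linepath 0 1)) (\<lambda>N x. \<Sum>n\<in>N. F n x) B (finite_subsets_at_top UNIV)"
      by (auto elim!: uniform_limit_on_subset dest: segment_bound1)
    have Fint: "(F n has_contour_integral of_real (integral {of_int n..of_int n + 1} g)) (linepath 0 1)" for n
    proof -
      have "((\<lambda>x. g (x + of_int n)) has_integral integral {of_int n..of_int n + 1} g) {0..1}"
      proof -
        have "(g has_integral integral {of_int n..of_int n + 1} g) {of_int n..of_int n + 1}"
          unfolding g_def by (intro integrable_integral integrable_continuous_interval continuous_intros) (use y in auto)
        then show ?thesis
          using has_integral_affinity[of g _ "of_int n" "of_int n + 1" 1 "of_int n"]
          by (simp add: image_add_atLeastAtMost' cbox_interval)
      qed
      then have "((\<lambda>x. F n (of_real x)) has_integral of_real (integral {of_int n..of_int n + 1} g)) {0..1}"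
        unfolding Fg by (rule has_integral_of_real)
      then show ?thesis by (subst has_contour_integral_linepath_Reals_iff) auto
    qed
    have "((\<lambda>N. contour_integral (linepath 0 1) (\<lambda>x. \<Sum>n\<in>N. F n x)) \<longlongrightarrow> m) (finite_subsets_at_top UNIV)"
      unfolding m_def
    proof (rule contour_integral_uniform_limit(2)[OF _ ul])
      show "\<forall>\<^sub>F N in finite_subsets_at_top UNIV. (\<lambda>x. \<Sum>n\<in>N. F n x) contour_integrable_on linepath 0 1"
        unfolding F_def using cy
        by (intro always_eventually allI contour_integrable_continuous_linepath continuous_intros) auto
      show "cmod (vector_derivative (linepath 0 1) (at t)) \<le> 1" for t :: real by simp
    qed auto
    moreover have "eventually (\<lambda>N. contour_integral (linepath 0 1) (\<lambda>x. \<Sum>n\<in>N. F n x) = (\<Sum>n\<in>N. complex_of_real (integral {of_int n..of_int n + 1} g))) (finite_subsets_at_top UNIV)"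
      using eventually_finite_subsets_at_top_weakI[of UNIV finite]
      by (auto elim!: eventually_mono intro!: contour_integral_unique has_contour_integral_sum Fint)
    ultimately have "((\<lambda>N. \<Sum>n\<in>N. complex_of_real (integral {of_int n..of_int n + 1} g)) \<longlongrightarrow> m) (finite_subsets_at_top UNIV)"
      by (rule Lim_transform_eventually)
    then have "(\<lambda>N::nat. \<Sum>n=-int N..int N. complex_of_real (integral {of_int n..of_int n + 1} g)) \<longlonglongrightarrow> m"
      by (intro has_sum_int_symmetric_limit) (simp add: has_sum_def)
    \<comment> \<open>The symmetric sum covers [-N, N + 1], one unit more than the symmetric
      interval of the Gaussian limit; the surplus integral tends to 0.\<close>
    moreover have "(\<Sum>n=-int N..int N. integral {of_int n..of_int n + 1} g)
        = integral {- real N..real N} g + integral {real N..real N + 1} g" for N :: nat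
    proof -
      have gi: "g integrable_on {a..b}" for a b
        unfolding g_def by (intro integrable_continuous_interval continuous_intros) (use y in auto)
      have "(\<Sum>n=-int N..int N. integral {of_int n..of_int n + 1} g) = integral {- real N..real N + 1} g"
      proof (induction N)
        case (Suc N)
        have "{- int (Suc N)..int (Suc N)} = insert (- int (Suc N)) (insert (int (Suc N)) {-int N..int N})" by auto
        then have "(\<Sum>n=-int (Suc N)..int (Suc N). integral {of_int n..of_int n + 1} g)
            = integral {- real (Suc N)..- real (Suc N) + 1} g + (integral {real (Suc N)..real (Suc N) + 1} g + integral {- real N..real N + 1} g)"
          using Suc by simp
        also have "\<dots> = integral {- real (Suc N)..real (Suc N) + 1} g"
          using Henstock_Kurzweil_Integration.integral_combine[of "- real (Suc N)" "- real N" "real (Suc N) + 1" g]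
            Henstock_Kurzweil_Integration.integral_combine[of "- real N" "real N + 1" "real (Suc N) + 1" g] gi
          by (simp add: add_ac)
        finally show ?case .
      qed simp
      then show ?thesis
        using Henstock_Kurzweil_Integration.integral_combine[of "- real N" "real N" "real N + 1" g] gi by simp
    qed
    moreover have "(\<lambda>N::nat. integral {real N..real N + 1} g) \<longlonglongrightarrow> 0"
    proof (rule Lim_null_comparison)
      show "(\<lambda>N::nat. exp (- (pi * (real N)\<^sup>2 / y))) \<longlonglongrightarrow> 0" using y by real_asymp
      have "norm (integral {real N..real N + 1} g) \<le> exp (- (pi * (real N)\<^sup>2 / y)) * (real N + 1 - real N)" for N
      proof (rule integral_bound)
        show "continuous_on {real N..real N + 1} g" unfolding g_def by (intro continuous_intros) (use y in auto)
        fix x assume "x \<in> {real N..real N + 1}"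
        then have "(real N)\<^sup>2 \<le> x\<^sup>2" by (intro power_mono) auto
        then show "norm (g x) \<le> exp (- (pi * (real N)\<^sup>2 / y))"
          using y by (simp add: g_def divide_right_mono)
      qed auto
      then show "\<forall>\<^sub>F N in sequentially. norm (integral {real N..real N + 1} g) \<le> exp (- (pi * (real N)\<^sup>2 / y))"
        by simp
    qed
    ultimately have lim: "(\<lambda>N::nat. complex_of_real (integral {- real N..real N} g + integral {real N..real N + 1} g)) \<longlonglongrightarrow> m"
      and z: "(\<lambda>N::nat. integral {real N..real N + 1} g) \<longlonglongrightarrow> 0"
      by (simp_all flip: of_real_sum)
    have "(\<lambda>N::nat. complex_of_real (integral {- real N..real N} g + integral {real N..real N + 1} g)) \<longlonglongrightarrow> of_real (sqrt y + 0)"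
      using gaussian_integral_limit[OF y] by (intro tendsto_of_real tendsto_add z) (simp add: g_def)
    with lim show ?thesis using LIMSEQ_unique by fastforce
  qed
  then show ?thesis using main by (simp add: B_def \<tau>'_def)
qed

text \<open>The terms with exponent 0 give the limit. The remaining exponents are at least 1, so the
  rest is at most exp(-pi (Im \<tau> - 1)) times the sum of absolute values at \<tau> = i.\<close>

lemma qseries_limit:
  fixes e :: "int \<Rightarrow> real" and \<epsilon> :: "int \<Rightarrow> complex"
  assumes fin: "finite S" and e0: "\<And>n. n \<in> S \<Longrightarrow> e n = 0" and e1: "\<And>n. n \<notin> S \<Longrightarrow> e n \<ge> 1"
    and \<epsilon>: "\<And>n. cmod (\<epsilon> n) \<le> 1" and summ: "(\<lambda>n. exp (- pi * e n)) summable_on UNIV"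
  shows "((\<lambda>\<tau>. \<Sum>\<^sub>\<infinity>n. \<epsilon> n * exp (of_real pi * \<i> * \<tau> * of_real (e n))) \<longlongrightarrow> (\<Sum>n\<in>S. \<epsilon> n)) at_i_infinity"
proof -
  define K where "K = (\<Sum>\<^sub>\<infinity>n. exp (- pi * e n))"
  have bound: "cmod ((\<Sum>\<^sub>\<infinity>n. \<epsilon> n * exp (of_real pi * \<i> * \<tau> * of_real (e n))) - (\<Sum>n\<in>S. \<epsilon> n)) \<le> exp (- pi * (Im \<tau> - 1)) * K"
    if \<tau>: "Im \<tau> \<ge> 1" for \<tau>
  proof -
    define f where "f = (\<lambda>n. \<epsilon> n * exp (of_real pi * \<i> * \<tau> * of_real (e n)))"
    have nf: "cmod (f n) \<le> exp (- pi * Im \<tau> * e n)" for n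
      unfolding f_def norm_mult using \<epsilon>[of n] mult_right_mono[of "cmod (\<epsilon> n)" 1 "exp (- pi * Im \<tau> * e n)"]
      by (simp add: mult_ac)
    have e_ge: "e n \<ge> 0" for n using e0[of n] e1[of n] by (cases "n \<in> S") auto
    have b: "cmod (f n) \<le> exp (- pi * e n)" for n
    proof -
      have "pi * e n * 1 \<le> pi * e n * Im \<tau>" using \<tau> e_ge[of n] by (intro mult_left_mono) auto
      then have "exp (- pi * Im \<tau> * e n) \<le> exp (- pi * e n)" by (simp add: mult_ac)
      then show ?thesis using nf[of n] by linarith
    qed
    \<comment> \<open>From (Im \<tau> - 1) (e n - 1) \<ge> 0, which detaches a factor independent of
      n.\<close>
    have b2: "cmod (f n) \<le> exp (- pi * (Im \<tau> - 1)) * exp (- pi * e n)" if "n \<notin> S" for n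
    proof -
      have "(Im \<tau> - 1) * 1 \<le> (Im \<tau> - 1) * e n" using \<tau> e1[OF that] by (intro mult_left_mono) auto
      then have "pi * (Im \<tau> - 1) + pi * e n \<le> pi * (Im \<tau> * e n)"
        unfolding distrib_left[symmetric] by (intro mult_left_mono) (auto simp: algebra_simps)
      then have "exp (- pi * Im \<tau> * e n) \<le> exp (- pi * (Im \<tau> - 1) + - pi * e n)" by (simp add: mult_ac)
      then show ?thesis using nf[of n] unfolding exp_add by linarith
    qed
    have sf: "f summable_on UNIV"
      by (rule abs_summable_summable, rule Infinite_Sum.abs_summable_on_comparison_test'[OF summ]) (rule b)
    have s2: "f summable_on - S" by (rule summable_on_subset_banach[OF sf]) auto
    have "infsum f UNIV = infsum f S + infsum f (- S)"
      using infsum_Un_disjoint[of f S "- S"] s2 fin by (simp add: Compl_partition)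
    moreover have "infsum f S = (\<Sum>n\<in>S. \<epsilon> n)" using fin e0 by (simp add: f_def)
    moreover have "cmod (infsum f (- S)) \<le> exp (- pi * (Im \<tau> - 1)) * K"
    proof -
      have sm: "(\<lambda>n. exp (- pi * (Im \<tau> - 1)) * exp (- pi * e n)) summable_on - S"
        by (intro summable_on_cmult_right summable_on_subset_banach[OF summ]) auto
      have "cmod (infsum f (- S)) \<le> (\<Sum>\<^sub>\<infinity>n\<in>- S. exp (- pi * (Im \<tau> - 1)) * exp (- pi * e n))"
        by (rule norm_infsum_le[OF has_sum_infsum[OF s2] has_sum_infsum[OF sm]]) (use b2 in auto)
      also have "\<dots> = exp (- pi * (Im \<tau> - 1)) * (\<Sum>\<^sub>\<infinity>n\<in>- S. exp (- pi * e n))"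
        by (rule infsum_cmult_right')
      also have "\<dots> \<le> exp (- pi * (Im \<tau> - 1)) * K"
        unfolding K_def by (intro mult_left_mono infsum_mono_neutral summable_on_subset_banach[OF summ] summ) auto
      finally show ?thesis .
    qed
    ultimately show ?thesis by (simp add: f_def)
  qed
  have "((\<lambda>\<tau>. exp (- pi * (Im \<tau> - 1)) * K) \<longlongrightarrow> 0) at_i_infinity"
  proof -
    have "((\<lambda>y. exp (- pi * (y - 1)) * K) \<longlongrightarrow> 0) at_top" by real_asymp
    then show ?thesis by (rule filterlim_compose[OF _ filterlim_filtercomap])
  qed
  then have "((\<lambda>\<tau>. (\<Sum>\<^sub>\<infinity>n. \<epsilon> n * exp (of_real pi * \<i> * \<tau> * of_real (e n))) - (\<Sum>n\<in>S. \<epsilon> n)) \<longlongrightarrow> 0) at_i_infinity"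
  proof (rule Lim_null_comparison[rotated])
    show "\<forall>\<^sub>F \<tau> in at_i_infinity. norm ((\<Sum>\<^sub>\<infinity>n. \<epsilon> n * exp (of_real pi * \<i> * \<tau> * of_real (e n))) - (\<Sum>n\<in>S. \<epsilon> n))
        \<le> exp (- pi * (Im \<tau> - 1)) * K"
      unfolding eventually_at_i_infinity
    proof (intro exI conjI allI impI)
      fix \<tau> :: complex assume "1 < Im \<tau>"
      then show "norm ((\<Sum>\<^sub>\<infinity>n. \<epsilon> n * exp (of_real pi * \<i> * \<tau> * of_real (e n))) - (\<Sum>n\<in>S. \<epsilon> n))
        \<le> exp (- pi * (Im \<tau> - 1)) * K" by (intro bound) simp
    qed simp
  qed
  then show ?thesis by (rule LIM_zero_cancel)
qed

section \<open>Theta constants\<close>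

text \<open>Fourth powers turn the eighth roots of unity in the transformation laws into signs and
  the weight 1/2 into 2, so the modular group permutes the three functions up to sign and the weight
  factor.\<close>

definition th2 :: "complex \<Rightarrow> complex" where "th2 \<tau> = theta10 \<tau> ^ 4"
definition th3 :: "complex \<Rightarrow> complex" where "th3 \<tau> = theta00 \<tau> ^ 4"
definition th4 :: "complex \<Rightarrow> complex" where "th4 \<tau> = jacobi_theta (1/2) \<tau> ^ 4"

lemma theta00_eq: "theta00 \<tau> = jacobi_theta 0 \<tau>"
  by (simp add: theta00_def jacobi_theta_def)

lemma theta10_eq: "theta10 \<tau> = exp (of_real pi * \<i> * \<tau> / 4) * jacobi_theta (\<tau> / 2) \<tau>"
  unfolding theta10_def jacobi_theta_def infsum_cmult_right'[symmetric] exp_add[symmetric]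
  by (intro infsum_cong arg_cong[where f = exp]) (simp add: field_simps power2_eq_square)

lemma th2_eq: "th2 \<tau> = exp (of_real pi * \<i> * \<tau>) * jacobi_theta (\<tau> / 2) \<tau> ^ 4"
  unfolding th2_def theta10_eq power_mult_distrib exp_of_nat_mult[symmetric] by simp

lemma modular_lambda_eq: "modular_lambda \<tau> = th2 \<tau> / th3 \<tau>"
  by (simp add: modular_lambda_def th2_def th3_def)

lemma th3_holomorphic: "th3 holomorphic_on upper_half_plane"
  unfolding th3_def theta00_eq
  by (intro holomorphic_intros holomorphic_jacobi_theta open_upper_half_plane) auto

lemma th4_holomorphic: "th4 holomorphic_on upper_half_plane"
  unfolding th4_def
  by (intro holomorphic_intros holomorphic_jacobi_theta open_upper_half_plane) auto

lemma jacobi_half_holomorphic: "(\<lambda>\<tau>. jacobi_theta (\<tau> / 2) \<tau> ^ 4) holomorphic_on upper_half_plane"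
  by (intro holomorphic_intros holomorphic_jacobi_theta open_upper_half_plane) auto

lemma th2_holomorphic: "th2 holomorphic_on upper_half_plane"
  unfolding th2_eq by (intro holomorphic_intros jacobi_half_holomorphic)

lemma th3_add_1: "th3 (\<tau> + 1) = th4 \<tau>"
  by (simp add: th3_def th4_def theta00_eq jacobi_theta_tau_add_1)

lemma th4_add_1: "th4 (\<tau> + 1) = th3 \<tau>"
  using jacobi_theta_add_1[of 0 \<tau>] by (simp add: th3_def th4_def theta00_eq jacobi_theta_tau_add_1)

lemma exp_pi_add_1: "exp (of_real pi * \<i> * (\<tau> + 1)) = - exp (of_real pi * \<i> * \<tau>)"
  by (simp add: distrib_left exp_add)

lemma th2_add_1: "th2 (\<tau> + 1) = - th2 \<tau>"
proof -
  have "jacobi_theta ((\<tau> + 1) / 2) (\<tau> + 1) = jacobi_theta (\<tau> / 2) \<tau>"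
  proof -
    have "(\<tau> + 1) / 2 + 1/2 = \<tau> / 2 + 1" by (simp add: field_simps)
    then show ?thesis unfolding jacobi_theta_tau_add_1 using jacobi_theta_add_1[of "\<tau> / 2" \<tau>] by simp
  qed
  then show ?thesis unfolding th2_eq exp_pi_add_1 by simp
qed

text \<open>Carries the inversion laws, known for \<tau> = i y only, to the whole half-plane; the
  points \<open>\<i> * of_real (1 + e/2)\<close> accumulate at \<open>\<i>\<close>.\<close>

lemma upper_half_plane_eqI:
  assumes f: "f holomorphic_on upper_half_plane" and g: "g holomorphic_on upper_half_plane"
    and eq: "\<And>y. y > 0 \<Longrightarrow> f (\<i> * of_real y) = g (\<i> * of_real y)" and \<tau>: "Im \<tau> > 0"
  shows "f \<tau> = g \<tau>"
proof -
  define U where "U = {\<i> * of_real y | y::real. y > 0}"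
  have "(\<lambda>\<tau>. f \<tau> - g \<tau>) \<tau> = 0"
  proof (rule analytic_continuation[of "\<lambda>\<tau>. f \<tau> - g \<tau>" upper_half_plane U \<i>])
    show "\<i> islimpt U"
      unfolding islimpt_approachable
    proof (intro allI impI)
      fix e :: real assume "e > 0"
      have "dist (\<i> * of_real (1 + e/2)) \<i> < e"
        using \<open>e > 0\<close> by (simp add: dist_norm algebra_simps norm_mult)
      then show "\<exists>x'\<in>U. x' \<noteq> \<i> \<and> dist x' \<i> < e"
        using \<open>e > 0\<close> by (intro bexI[of _ "\<i> * of_real (1 + e/2)"]) (auto simp: U_def complex_eq_iff intro!: exI[of _ "1 + e/2"])
    qed
    show "(\<lambda>\<tau>. f \<tau> - g \<tau>) holomorphic_on upper_half_plane" by (intro holomorphic_intros f g)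
    show "U \<subseteq> upper_half_plane" by (auto simp: U_def)
    show "f z - g z = 0" if "z \<in> U" for z using that eq by (auto simp: U_def)
  qed (use \<tau> open_upper_half_plane connected_upper_half_plane in simp_all)
  then show ?thesis by simp
qed

lemma holomorphic_compose_neg_inverse:
  assumes "f holomorphic_on upper_half_plane"
  shows "(\<lambda>\<tau>. f (- 1 / \<tau>)) holomorphic_on upper_half_plane"
  by (rule holomorphic_on_compose_gen[of "\<lambda>\<tau>. - 1 / \<tau>" _ f upper_half_plane, unfolded o_def])
     (use assms Im_neg_inverse_pos in \<open>auto intro!: holomorphic_intros\<close>)

lemma sqrt_power4: "y > 0 \<Longrightarrow> complex_of_real (sqrt y) ^ 4 = of_real y ^ 2"
proof -
  assume "y > 0"
  then have "sqrt y ^ 4 = y ^ 2" by (simp add: power4_eq_xxxx power2_eq_square mult.assoc)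
  then show ?thesis by (metis of_real_power)
qed

lemma th_neg_inverse_axis:
  assumes y: "y > 0"
  shows "theta00 (- 1 / (\<i> * of_real y)) = of_real (sqrt y) * theta00 (\<i> * of_real y)"
    and "theta10 (- 1 / (\<i> * of_real y)) = of_real (sqrt y) * jacobi_theta (1/2) (\<i> * of_real y)"
proof -
  have inv: "- 1 / (\<i> * of_real y) = \<i> / of_real y" using y by (simp add: field_simps)
  show "theta00 (- 1 / (\<i> * of_real y)) = of_real (sqrt y) * theta00 (\<i> * of_real y)"
    unfolding theta00_eq inv using jacobi_theta_inversion[OF y, of 0] by simp
  show "theta10 (- 1 / (\<i> * of_real y)) = of_real (sqrt y) * jacobi_theta (1/2) (\<i> * of_real y)"
  proof -
    have "exp (of_real pi * \<i> * (\<i> / of_real y) / 4) = exp (- (of_real pi * (1/2)\<^sup>2 / complex_of_real y))"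
      by (intro arg_cong[where f = exp]) (simp add: field_simps power2_eq_square)
    then show ?thesis unfolding theta10_eq inv using jacobi_theta_inversion[OF y, of "1/2"] by (simp add: mult.commute)
  qed
qed

text \<open>On the axis the fourth power of the factor sqrt y is y^2 = -(i y)^2, and in this form it
  continues holomorphically.\<close>

lemma th3_neg_inverse: "Im \<tau> > 0 \<Longrightarrow> th3 (- 1 / \<tau>) = - \<tau>\<^sup>2 * th3 \<tau>"
proof (rule upper_half_plane_eqI[where f = "\<lambda>\<tau>. th3 (- 1 / \<tau>)" and g = "\<lambda>\<tau>. - \<tau>\<^sup>2 * th3 \<tau>"])
  show "(\<lambda>\<tau>. th3 (- 1 / \<tau>)) holomorphic_on upper_half_plane"
    by (rule holomorphic_compose_neg_inverse[OF th3_holomorphic])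
  show "(\<lambda>\<tau>. - \<tau>\<^sup>2 * th3 \<tau>) holomorphic_on upper_half_plane"
    by (intro holomorphic_intros th3_holomorphic)
  show "th3 (- 1 / (\<i> * of_real y)) = - (\<i> * of_real y)\<^sup>2 * th3 (\<i> * of_real y)" if "y > 0" for y
    unfolding th3_def th_neg_inverse_axis[OF that] power_mult_distrib sqrt_power4[OF that] by simp
qed

lemma th2_neg_inverse: "Im \<tau> > 0 \<Longrightarrow> th2 (- 1 / \<tau>) = - \<tau>\<^sup>2 * th4 \<tau>"
proof (rule upper_half_plane_eqI[where f = "\<lambda>\<tau>. th2 (- 1 / \<tau>)" and g = "\<lambda>\<tau>. - \<tau>\<^sup>2 * th4 \<tau>"])
  show "(\<lambda>\<tau>. th2 (- 1 / \<tau>)) holomorphic_on upper_half_plane"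
    by (rule holomorphic_compose_neg_inverse[OF th2_holomorphic])
  show "(\<lambda>\<tau>. - \<tau>\<^sup>2 * th4 \<tau>) holomorphic_on upper_half_plane"
    by (intro holomorphic_intros th4_holomorphic)
  show "th2 (- 1 / (\<i> * of_real y)) = - (\<i> * of_real y)\<^sup>2 * th4 (\<i> * of_real y)" if "y > 0" for y
    unfolding th2_def th4_def th_neg_inverse_axis[OF that] power_mult_distrib sqrt_power4[OF that] by simp
qed

lemma th4_neg_inverse: "Im \<tau> > 0 \<Longrightarrow> th4 (- 1 / \<tau>) = - \<tau>\<^sup>2 * th2 \<tau>"
  using th2_neg_inverse[of "- 1 / \<tau>"] Im_neg_inverse_pos[of \<tau>] by (auto simp: field_simps)

lemma int_mult_Suc_ge: "n \<notin> {-1, 0} \<Longrightarrow> (n::int) * (n + 1) \<ge> \<bar>n\<bar>"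
proof (cases "n \<ge> 0")
  case False
  assume "n \<notin> {-1, 0}"
  then have "(- n) * (- n - 1) \<ge> (- n) * 1" using False by (intro mult_left_mono) auto
  then show ?thesis using False by (simp add: algebra_simps)
qed (auto simp: algebra_simps)

lemma int_square_ge_abs: "(n::int)\<^sup>2 \<ge> \<bar>n\<bar>"
  using mult_left_mono[of 1 "\<bar>n\<bar>" "\<bar>n\<bar>"] by (cases "n = 0") (auto simp: power2_eq_square simp flip: abs_mult)

lemma jacobi_theta_const_limit:
  assumes "Im z = 0"
  shows "((\<lambda>\<tau>. jacobi_theta z \<tau>) \<longlongrightarrow> 1) at_i_infinity"
proof -
  have "((\<lambda>\<tau>. \<Sum>\<^sub>\<infinity>n::int. exp (2 * of_real pi * \<i> * of_int n * z) * exp (of_real pi * \<i> * \<tau> * of_real ((of_int n)\<^sup>2)))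
      \<longlongrightarrow> (\<Sum>n\<in>{0::int}. exp (2 * of_real pi * \<i> * of_int n * z))) at_i_infinity"
  proof (rule qseries_limit)
    show "(real_of_int n)\<^sup>2 \<ge> 1" if "n \<notin> {0}" for n
      using int_square_ge_abs[of n] that by (simp flip: of_int_power)
    show "(\<lambda>n::int. exp (- pi * (real_of_int n)\<^sup>2)) summable_on UNIV"
    proof (rule summable_on_comparison_test[OF summable_on_exp_abs_int])
      fix n :: int
      have "\<bar>real_of_int n\<bar> \<le> (real_of_int n)\<^sup>2" using int_square_ge_abs[of n] by (metis of_int_abs of_int_le_iff of_int_power)
      also have "\<dots> \<le> pi * (real_of_int n)\<^sup>2" using pi_gt3 mult_right_mono[of 1 pi "(real_of_int n)\<^sup>2"] by simp
      finally show "exp (- pi * (real_of_int n)\<^sup>2) \<le> exp (- \<bar>real_of_int n\<bar>)" by simp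
    qed simp
  qed (use assms in auto)
  then show ?thesis by (simp add: jacobi_theta_def exp_add mult_ac)
qed

lemma th3_limit: "(th3 \<longlongrightarrow> 1) at_i_infinity"
  unfolding th3_def theta00_eq using tendsto_power[OF jacobi_theta_const_limit[of 0], of 4] by simp

lemma th4_limit: "(th4 \<longlongrightarrow> 1) at_i_infinity"
  unfolding th4_def using tendsto_power[OF jacobi_theta_const_limit[of "1/2"], of 4] by simp

text \<open>At z = \<tau>/2 the exponents become n (n + 1), which vanish for n = -1 and n = 0. The
  theta value tends to 2, its fourth power to 16.\<close>

lemma jacobi_half_limit: "((\<lambda>\<tau>. jacobi_theta (\<tau> / 2) \<tau> ^ 4) \<longlongrightarrow> 16) at_i_infinity"
proof -
  have "((\<lambda>\<tau>. \<Sum>\<^sub>\<infinity>n::int. 1 * exp (of_real pi * \<i> * \<tau> * of_real (of_int (n * (n + 1)))))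
      \<longlongrightarrow> (\<Sum>n\<in>{-1, 0::int}. 1)) at_i_infinity"
  proof (rule qseries_limit)
    show "real_of_int (n * (n + 1)) \<ge> 1" if "n \<notin> {-1, 0}" for n
      using int_mult_Suc_ge[OF that] that by (metis abs_ge_zero abs_of_nonneg add_0 insert_iff int_one_le_iff_zero_less of_int_1 of_int_le_iff order_less_le order_trans zero_less_abs_iff)
    show "(\<lambda>n::int. exp (- pi * of_int (n * (n + 1)))) summable_on UNIV"
    proof (rule summable_on_comparison_test[OF summable_on_cmult_right[OF summable_on_exp_abs_int, of "exp 1"]])
      fix n :: int
      have 1: "\<bar>n\<bar> - 1 \<le> n * (n + 1)" using int_mult_Suc_ge[of n] by (cases "n \<in> {-1, 0}") auto
      have 0: "n * (n + 1) \<ge> 0" using int_mult_Suc_ge[of n] by (cases "n \<in> {-1, 0}") auto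
      have "\<bar>real_of_int n\<bar> - 1 \<le> of_int (n * (n + 1))" using 1 by (metis of_int_1 of_int_abs of_int_diff of_int_le_iff)
      also have "\<dots> \<le> pi * of_int (n * (n + 1))"
      proof -
        have "0 \<le> real_of_int (n * (n + 1))" using 0 by (simp only: of_int_0_le_iff)
        then have "1 * real_of_int (n * (n + 1)) \<le> pi * of_int (n * (n + 1))"
          using pi_gt3 by (intro mult_right_mono) auto
        then show ?thesis by simp
      qed
      finally have "- pi * of_int (n * (n + 1)) \<le> 1 + - \<bar>real_of_int n\<bar>" by linarith
      then show "exp (- pi * of_int (n * (n + 1))) \<le> exp 1 * exp (- \<bar>real_of_int n\<bar>)"
        by (simp only: exp_le_cancel_iff flip: exp_add)
    qed simp
  qed auto
  moreover have "jacobi_theta (\<tau> / 2) \<tau> = (\<Sum>\<^sub>\<infinity>n::int. 1 * exp (of_real pi * \<i> * \<tau> * of_real (of_int (n * (n + 1)))))" for \<tau>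
    unfolding jacobi_theta_def by (intro infsum_cong) (simp add: algebra_simps power2_eq_square flip: exp_add)
  ultimately have "((\<lambda>\<tau>. jacobi_theta (\<tau> / 2) \<tau>) \<longlongrightarrow> 2) at_i_infinity" by simp
  from tendsto_power[OF this, of 4] show ?thesis by simp
qed

lemma exp_pi_limit: "((\<lambda>\<tau>. exp (of_real pi * \<i> * \<tau>)) \<longlongrightarrow> 0) at_i_infinity"
proof (rule tendsto_norm_zero_cancel)
  have "((\<lambda>y. exp (- pi * y)) \<longlongrightarrow> 0) at_top" by real_asymp
  then have "((\<lambda>\<tau>. exp (- pi * Im \<tau>)) \<longlongrightarrow> 0) at_i_infinity" by (rule filterlim_compose[OF _ filterlim_filtercomap])
  then show "((\<lambda>\<tau>. cmod (exp (of_real pi * \<i> * \<tau>))) \<longlongrightarrow> 0) at_i_infinity" by simp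
qed

lemma th2_limit: "(th2 \<longlongrightarrow> 0) at_i_infinity"
  unfolding th2_eq using tendsto_mult[OF exp_pi_limit jacobi_half_limit] by simp

section \<open>Differential relations between the theta constants\<close>

lemma deriv_add_1_eq:
  assumes "\<And>\<tau>. Im \<tau> > 0 \<Longrightarrow> f (\<tau> + 1) = k * g \<tau>" and g: "g holomorphic_on upper_half_plane"
    and \<tau>: "Im \<tau> > 0" and f: "f holomorphic_on upper_half_plane"
  shows "deriv f (\<tau> + 1) = k * deriv g \<tau>"
proof -
  have "(f has_field_derivative deriv f (\<tau> + 1)) (at (\<tau> + 1))"
    by (rule holomorphic_derivI[OF f open_upper_half_plane]) (use \<tau> in simp)
  then have 1: "((\<lambda>z. f (z + 1)) has_field_derivative deriv f (\<tau> + 1)) (at \<tau>)"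
    by (rule DERIV_shift[THEN iffD1])
  have "(g has_field_derivative deriv g \<tau>) (at \<tau>)"
    by (rule holomorphic_derivI[OF g open_upper_half_plane]) (use \<tau> in simp)
  then have "((\<lambda>z. k * g z) has_field_derivative k * deriv g \<tau>) (at \<tau>)"
    by (rule DERIV_cmult)
  then have "((\<lambda>z. f (z + 1)) has_field_derivative k * deriv g \<tau>) (at \<tau>)"
    by (rule has_field_derivative_transform_within_open[OF _ open_upper_half_plane]) (use assms in auto)
  with 1 show ?thesis by (rule DERIV_unique)
qed

text \<open>Derivatives of modular forms are not modular. The terms of lower order in these formulas
  are those that must cancel in the Wronskian and in the quadratic second-order expression
  below.\<close>

lemma deriv_neg_inverse_weight_2:
  assumes fg: "\<And>\<tau>. Im \<tau> > 0 \<Longrightarrow> f (- 1 / \<tau>) = - \<tau>\<^sup>2 * g \<tau>" and g: "g holomorphic_on upper_half_plane"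
    and f: "f holomorphic_on upper_half_plane" and \<tau>: "Im \<tau> > 0"
  shows "deriv f (- 1 / \<tau>) = - 2 * \<tau> ^ 3 * g \<tau> - \<tau> ^ 4 * deriv g \<tau>"
    and "deriv (deriv f) (- 1 / \<tau>) = - 6 * \<tau> ^ 4 * g \<tau> - 6 * \<tau> ^ 5 * deriv g \<tau> - \<tau> ^ 6 * deriv (deriv g) \<tau>"
proof -
  have inv: "((\<lambda>z. h (- 1 / z)) has_field_derivative deriv h (- 1 / z) / z\<^sup>2) (at z)"
    if "Im z > 0" "h holomorphic_on upper_half_plane" for h z
  proof -
    have "z \<noteq> 0" using that by auto
    have "((\<lambda>z. - 1 / z) has_field_derivative 1 / z\<^sup>2) (at z)"
      using \<open>z \<noteq> 0\<close> by (auto intro!: derivative_eq_intros simp: power2_eq_square)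
    moreover have "(h has_field_derivative deriv h (- 1 / z)) (at (- 1 / z))"
      by (rule holomorphic_derivI[OF that(2) open_upper_half_plane]) (use Im_neg_inverse_pos[OF that(1)] in simp)
    ultimately show ?thesis using DERIV_chain2 by fastforce
  qed
  have dg: "(h has_field_derivative deriv h z) (at z)" if "Im z > 0" "h holomorphic_on upper_half_plane" for h z
    by (rule holomorphic_derivI[OF that(2) open_upper_half_plane]) (use that in simp)
  have g': "deriv g holomorphic_on upper_half_plane" and f': "deriv f holomorphic_on upper_half_plane"
    by (intro holomorphic_deriv f g open_upper_half_plane)+
  have first: "deriv f (- 1 / z) = - 2 * z ^ 3 * g z - z ^ 4 * deriv g z" if z: "Im z > 0" for z
  proof -
    have "z \<noteq> 0" using z by auto
    have "((\<lambda>z. - z\<^sup>2 * g z) has_field_derivative - 2 * z * g z - z\<^sup>2 * deriv g z) (at z)"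
      by (auto intro!: derivative_eq_intros dg[OF z g])
    then have "((\<lambda>z. f (- 1 / z)) has_field_derivative - 2 * z * g z - z\<^sup>2 * deriv g z) (at z)"
      by (rule has_field_derivative_transform_within_open[OF _ open_upper_half_plane]) (use fg z in auto)
    then have "deriv f (- 1 / z) / z\<^sup>2 = - 2 * z * g z - z\<^sup>2 * deriv g z"
      using inv[OF z f] DERIV_unique by blast
    then show ?thesis using \<open>z \<noteq> 0\<close> by (simp add: field_simps power2_eq_square power3_eq_cube power4_eq_xxxx)
  qed
  show "deriv f (- 1 / \<tau>) = - 2 * \<tau> ^ 3 * g \<tau> - \<tau> ^ 4 * deriv g \<tau>" by (rule first[OF \<tau>])
  have "\<tau> \<noteq> 0" using \<tau> by auto
  have "((\<lambda>z. - 2 * z ^ 3 * g z - z ^ 4 * deriv g z) has_field_derivative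
      - 6 * \<tau>\<^sup>2 * g \<tau> - 6 * \<tau> ^ 3 * deriv g \<tau> - \<tau> ^ 4 * deriv (deriv g) \<tau>) (at \<tau>)"
    by (auto intro!: derivative_eq_intros dg[OF \<tau> g] dg[OF \<tau> g'] simp: algebra_simps)
  then have "((\<lambda>z. deriv f (- 1 / z)) has_field_derivative
      - 6 * \<tau>\<^sup>2 * g \<tau> - 6 * \<tau> ^ 3 * deriv g \<tau> - \<tau> ^ 4 * deriv (deriv g) \<tau>) (at \<tau>)"
    by (rule has_field_derivative_transform_within_open[OF _ open_upper_half_plane]) (use first \<tau> in auto)
  then have "deriv (deriv f) (- 1 / \<tau>) / \<tau>\<^sup>2 = - 6 * \<tau>\<^sup>2 * g \<tau> - 6 * \<tau> ^ 3 * deriv g \<tau> - \<tau> ^ 4 * deriv (deriv g) \<tau>"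
    using inv[OF \<tau> f'] DERIV_unique by blast
  then have "deriv (deriv f) (- 1 / \<tau>) = \<tau>\<^sup>2 * (- 6 * \<tau>\<^sup>2 * g \<tau> - 6 * \<tau> ^ 3 * deriv g \<tau> - \<tau> ^ 4 * deriv (deriv g) \<tau>)"
    using \<open>\<tau> \<noteq> 0\<close> by (simp add: field_simps)
  also have "\<dots> = - 6 * \<tau> ^ 4 * g \<tau> - 6 * \<tau> ^ 5 * deriv g \<tau> - \<tau> ^ 6 * deriv (deriv g) \<tau>"
    by (simp add: algebra_simps flip: power_add)
  finally show "deriv (deriv f) (- 1 / \<tau>) = \<dots>" .
qed

lemmas th_holomorphic = th2_holomorphic th3_holomorphic th4_holomorphic
lemmas th_holomorphic' = th_holomorphic[THEN holomorphic_deriv[OF _ open_upper_half_plane]]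
lemmas th_holomorphic'' = th_holomorphic'[THEN holomorphic_deriv[OF _ open_upper_half_plane]]
lemmas th_add_1 = th2_add_1 th3_add_1 th4_add_1
lemmas th_neg_inverse = th2_neg_inverse th3_neg_inverse th4_neg_inverse

lemma th_deriv_add_1:
  assumes "Im \<tau> > 0"
  shows "deriv th2 (\<tau> + 1) = - deriv th2 \<tau>" "deriv th3 (\<tau> + 1) = deriv th4 \<tau>" "deriv th4 (\<tau> + 1) = deriv th3 \<tau>"
    "deriv (deriv th2) (\<tau> + 1) = - deriv (deriv th2) \<tau>"
    "deriv (deriv th3) (\<tau> + 1) = deriv (deriv th4) \<tau>" "deriv (deriv th4) (\<tau> + 1) = deriv (deriv th3) \<tau>"
proof -
  have 1: "deriv th2 (\<tau> + 1) = - 1 * deriv th2 \<tau>" "deriv th3 (\<tau> + 1) = 1 * deriv th4 \<tau>" "deriv th4 (\<tau> + 1) = 1 * deriv th3 \<tau>"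
    if "Im \<tau> > 0" for \<tau>
    by (rule deriv_add_1_eq[OF _ _ that]; simp add: th_holomorphic th_add_1)+
  then show "deriv th2 (\<tau> + 1) = - deriv th2 \<tau>" "deriv th3 (\<tau> + 1) = deriv th4 \<tau>" "deriv th4 (\<tau> + 1) = deriv th3 \<tau>"
    using assms by simp_all
  have "deriv (deriv th2) (\<tau> + 1) = - 1 * deriv (deriv th2) \<tau>"
    "deriv (deriv th3) (\<tau> + 1) = 1 * deriv (deriv th4) \<tau>" "deriv (deriv th4) (\<tau> + 1) = 1 * deriv (deriv th3) \<tau>"
    by (rule deriv_add_1_eq[OF _ _ assms]; simp add: th_holomorphic' 1)+
  then show "deriv (deriv th2) (\<tau> + 1) = - deriv (deriv th2) \<tau>"
    "deriv (deriv th3) (\<tau> + 1) = deriv (deriv th4) \<tau>" "deriv (deriv th4) (\<tau> + 1) = deriv (deriv th3) \<tau>" by simp_all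
qed

lemma th_deriv_neg_inverse:
  assumes "Im \<tau> > 0"
  shows "deriv th2 (- 1 / \<tau>) = - 2 * \<tau> ^ 3 * th4 \<tau> - \<tau> ^ 4 * deriv th4 \<tau>"
    and "deriv th3 (- 1 / \<tau>) = - 2 * \<tau> ^ 3 * th3 \<tau> - \<tau> ^ 4 * deriv th3 \<tau>"
    and "deriv th4 (- 1 / \<tau>) = - 2 * \<tau> ^ 3 * th2 \<tau> - \<tau> ^ 4 * deriv th2 \<tau>"
    and "deriv (deriv th2) (- 1 / \<tau>) = - 6 * \<tau> ^ 4 * th4 \<tau> - 6 * \<tau> ^ 5 * deriv th4 \<tau> - \<tau> ^ 6 * deriv (deriv th4) \<tau>"
    and "deriv (deriv th3) (- 1 / \<tau>) = - 6 * \<tau> ^ 4 * th3 \<tau> - 6 * \<tau> ^ 5 * deriv th3 \<tau> - \<tau> ^ 6 * deriv (deriv th3) \<tau>"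
    and "deriv (deriv th4) (- 1 / \<tau>) = - 6 * \<tau> ^ 4 * th2 \<tau> - 6 * \<tau> ^ 5 * deriv th2 \<tau> - \<tau> ^ 6 * deriv (deriv th2) \<tau>"
  by (rule deriv_neg_inverse_weight_2[OF _ _ _ assms]; simp only: th_holomorphic th_neg_inverse)+

lemma deriv_limit_upper_half_plane:
  assumes "f holomorphic_on upper_half_plane" "(f \<longlongrightarrow> L) at_i_infinity"
  shows "(deriv f \<longlongrightarrow> 0) at_i_infinity"
  by (rule deriv_tendsto_0_at_i_infinity[of _ 0]) (use assms in \<open>simp_all add: upper_half_plane_def\<close>)

lemmas th_deriv_limit =
  deriv_limit_upper_half_plane[OF th2_holomorphic th2_limit]
  deriv_limit_upper_half_plane[OF th3_holomorphic th3_limit]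
  deriv_limit_upper_half_plane[OF th4_holomorphic th4_limit]
lemmas th_deriv2_limit =
  deriv_limit_upper_half_plane[OF th_holomorphic'(1) th_deriv_limit(1)]
  deriv_limit_upper_half_plane[OF th_holomorphic'(2) th_deriv_limit(2)]
  deriv_limit_upper_half_plane[OF th_holomorphic'(3) th_deriv_limit(3)]

text \<open>The difference has weight 2 and changes sign under \<tau> + 1. Times exp(pi i \<tau>),
  which does the same, it becomes periodic with limit 0, so it decays at rate 2 pi; the difference
  itself decays at rate pi, enough for w = 1.\<close>

theorem jacobi_identity:
  assumes "Im \<tau> > 0"
  shows "th3 \<tau> = th2 \<tau> + th4 \<tau>"
proof -
  define D where "D = (\<lambda>\<tau>. th3 \<tau> - th2 \<tau> - th4 \<tau>)"
  have hol: "D holomorphic_on upper_half_plane" unfolding D_def by (intro holomorphic_intros th_holomorphic)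
  have lim: "(D \<longlongrightarrow> 0) at_i_infinity"
    unfolding D_def using tendsto_diff[OF tendsto_diff[OF th3_limit th2_limit] th4_limit] by simp
  have T: "D (\<tau> + 1) = - D \<tau>" for \<tau> by (simp add: D_def th_add_1)
  have hol': "(\<lambda>\<tau>. D \<tau> * exp (of_real pi * \<i> * \<tau>)) holomorphic_on upper_half_plane"
    by (intro holomorphic_intros hol)
  have per: "D (\<tau> + 1) * exp (of_real pi * \<i> * (\<tau> + 1)) = D \<tau> * exp (of_real pi * \<i> * \<tau>)" for \<tau>
    unfolding T exp_pi_add_1 by simp
  have lim': "((\<lambda>\<tau>. D \<tau> * exp (of_real pi * \<i> * \<tau>)) \<longlongrightarrow> 0) at_i_infinity"
    using tendsto_mult[OF lim exp_pi_limit] by simp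
  obtain C where C: "\<And>\<tau>. Im \<tau> \<ge> 1/2 \<Longrightarrow> cmod (D \<tau> * exp (of_real pi * \<i> * \<tau>)) \<le> C * exp (- (2 * pi) * Im \<tau>)"
    using periodic_vanishing_decay[OF hol' per lim'] by blast
  have "D \<tau> = 0"
  proof (rule siegel_vanishing[where f = D and \<tau> = \<tau> and w = 1 and A = pi and C = C])
    fix \<tau> :: complex assume \<tau>: "Im \<tau> \<ge> 1/2"
    have "cmod (D \<tau>) = cmod (D \<tau> * exp (of_real pi * \<i> * \<tau>)) * exp (pi * Im \<tau>)"
      by (simp add: norm_mult flip: exp_add)
    also have "\<dots> \<le> C * exp (- (2 * pi) * Im \<tau>) * exp (pi * Im \<tau>)"
      by (intro mult_right_mono C \<tau>) auto
    also have "\<dots> = C * exp (- pi * Im \<tau>)" by (simp add: mult.assoc algebra_simps flip: exp_add)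
    finally show "cmod (D \<tau>) \<le> C * exp (- pi * Im \<tau>)" .
  next
    fix \<tau> :: complex assume \<tau>: "Im \<tau> > 0"
    have "D (- 1 / \<tau>) = - \<tau>\<^sup>2 * D \<tau>"
      unfolding D_def th_neg_inverse[OF \<tau>] by (simp add: algebra_simps)
    moreover have "\<tau> \<noteq> 0" using \<tau> by auto
    ultimately show "cmod (D (- 1 / \<tau>)) = cmod \<tau> powr (2 * 1) * cmod (D \<tau>)"
      by (simp add: norm_mult norm_power powr_realpow[of _ 2, simplified])
  qed (use hol T assms pi_gt3 in auto)
  then show ?thesis by (simp add: D_def algebra_simps)
qed

lemma jacobi_identity_deriv:
  assumes "Im \<tau> > 0"
  shows "deriv th3 \<tau> = deriv th2 \<tau> + deriv th4 \<tau>"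
    and "deriv (deriv th3) \<tau> = deriv (deriv th2) \<tau> + deriv (deriv th4) \<tau>"
proof -
  have d: "(h has_field_derivative deriv h z) (at z)" if "Im z > 0" "h holomorphic_on upper_half_plane" for h z
    by (rule holomorphic_derivI[OF that(2) open_upper_half_plane]) (use that in simp)
  have 1: "deriv th3 \<tau> = deriv th2 \<tau> + deriv th4 \<tau>" if \<tau>: "Im \<tau> > 0" for \<tau>
  proof (rule DERIV_imp_deriv)
    show "(th3 has_field_derivative deriv th2 \<tau> + deriv th4 \<tau>) (at \<tau>)"
      by (rule has_field_derivative_transform_within_open[OF DERIV_add[OF d[OF \<tau> th2_holomorphic] d[OF \<tau> th4_holomorphic]] open_upper_half_plane])
         (use \<tau> jacobi_identity in auto)
  qed
  then show "deriv th3 \<tau> = deriv th2 \<tau> + deriv th4 \<tau>" using assms by blast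
  show "deriv (deriv th3) \<tau> = deriv (deriv th2) \<tau> + deriv (deriv th4) \<tau>"
  proof (rule DERIV_imp_deriv)
    show "(deriv th3 has_field_derivative deriv (deriv th2) \<tau> + deriv (deriv th4) \<tau>) (at \<tau>)"
      by (rule has_field_derivative_transform_within_open[OF DERIV_add[OF d[OF assms th_holomorphic'(1)] d[OF assms th_holomorphic'(3)]] open_upper_half_plane])
         (use assms 1 in auto)
  qed
qed

text \<open>Both sides have weight 6, and the sign change under \<tau> + 1 rests on Jacobi's
  identity. Decay at rate pi would not reach w = 3, so the difference is divided by exp(pi i
  \<tau>): the quotient is periodic, its limit 16 pi i - 16 pi i is 0, and the total rate is 3
  pi.\<close>

theorem th_wronskian:
  assumes "Im \<tau> > 0"
  shows "deriv th2 \<tau> * th4 \<tau> - th2 \<tau> * deriv th4 \<tau> = of_real pi * \<i> * th2 \<tau> * th3 \<tau> * th4 \<tau>"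
proof -
  define D where "D = (\<lambda>\<tau>. deriv th2 \<tau> * th4 \<tau> - th2 \<tau> * deriv th4 \<tau> - of_real pi * \<i> * th2 \<tau> * th3 \<tau> * th4 \<tau>)"
  define Q where "Q = (\<lambda>\<tau>. exp (of_real pi * \<i> * \<tau>))"
  define g where "g = (\<lambda>\<tau>. jacobi_theta (\<tau> / 2) \<tau> ^ 4)"
  have g: "g holomorphic_on upper_half_plane" unfolding g_def by (rule jacobi_half_holomorphic)
  have hol: "D holomorphic_on upper_half_plane"
    unfolding D_def by (intro holomorphic_intros th_holomorphic th_holomorphic')
  have T: "D (\<tau> + 1) = - D \<tau>" if \<tau>: "Im \<tau> > 0" for \<tau>
    unfolding D_def th_add_1 th_deriv_add_1[OF \<tau>]
    using jacobi_identity[OF \<tau>] jacobi_identity_deriv[OF \<tau>] by (simp add: algebra_simps)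
  \<comment> \<open>\<open>th2\<close> is exp(pi i \<tau>) times \<open>g\<close>, and
    \<open>g\<close> tends to 16. Written through \<open>g\<close>, the quotient shows its
    limit.\<close>
  have eq: "D \<tau> * exp (- of_real pi * \<i> * \<tau>)
      = (of_real pi * \<i> * g \<tau> + deriv g \<tau>) * th4 \<tau> - g \<tau> * deriv th4 \<tau> - of_real pi * \<i> * g \<tau> * th3 \<tau> * th4 \<tau>"
    if \<tau>: "Im \<tau> > 0" for \<tau>
  proof -
    have "(g has_field_derivative deriv g \<tau>) (at \<tau>)"
      by (rule holomorphic_derivI[OF g open_upper_half_plane]) (use \<tau> in simp)
    then have "((\<lambda>\<tau>. Q \<tau> * g \<tau>) has_field_derivative Q \<tau> * (of_real pi * \<i> * g \<tau> + deriv g \<tau>)) (at \<tau>)"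
      unfolding Q_def by (auto intro!: derivative_eq_intros simp: algebra_simps)
    then have "deriv th2 \<tau> = Q \<tau> * (of_real pi * \<i> * g \<tau> + deriv g \<tau>)"
      unfolding Q_def g_def th2_eq[symmetric] by (rule DERIV_imp_deriv)
    moreover have "th2 \<tau> = Q \<tau> * g \<tau>" by (simp add: th2_eq Q_def g_def)
    moreover have "exp (- of_real pi * \<i> * \<tau>) * Q \<tau> = 1" by (simp add: Q_def flip: exp_add)
    ultimately show ?thesis unfolding D_def by algebra
  qed
  have per: "D (\<tau> + 1) * exp (- of_real pi * \<i> * (\<tau> + 1)) = D \<tau> * exp (- of_real pi * \<i> * \<tau>)" if "Im \<tau> > 0" for \<tau>
  proof -
    have "exp (- of_real pi * \<i> * (\<tau> + 1)) = - exp (- of_real pi * \<i> * \<tau>)"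
      using exp_pi_add_1[of \<tau>] by (simp add: exp_minus)
    then show ?thesis using T[OF that] by simp
  qed
  have lim: "((\<lambda>\<tau>. D \<tau> * exp (- of_real pi * \<i> * \<tau>)) \<longlongrightarrow> 0) at_i_infinity"
  proof (rule Lim_transform_eventually)
    have g16: "(g \<longlongrightarrow> 16) at_i_infinity" unfolding g_def by (rule jacobi_half_limit)
    note g0 = deriv_limit_upper_half_plane[OF g g16]
    have "((\<lambda>\<tau>. (of_real pi * \<i> * g \<tau> + deriv g \<tau>) * th4 \<tau> - g \<tau> * deriv th4 \<tau> - of_real pi * \<i> * g \<tau> * th3 \<tau> * th4 \<tau>)
      \<longlongrightarrow> (of_real pi * \<i> * 16 + 0) * 1 - 16 * 0 - of_real pi * \<i> * 16 * 1 * 1) at_i_infinity"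
      by (intro tendsto_intros g16 g0 th3_limit th4_limit th_deriv_limit)
    then show "((\<lambda>\<tau>. (of_real pi * \<i> * g \<tau> + deriv g \<tau>) * th4 \<tau> - g \<tau> * deriv th4 \<tau> - of_real pi * \<i> * g \<tau> * th3 \<tau> * th4 \<tau>)
      \<longlongrightarrow> 0) at_i_infinity" by simp
    show "\<forall>\<^sub>F \<tau> in at_i_infinity. (of_real pi * \<i> * g \<tau> + deriv g \<tau>) * th4 \<tau> - g \<tau> * deriv th4 \<tau> - of_real pi * \<i> * g \<tau> * th3 \<tau> * th4 \<tau>
       = D \<tau> * exp (- of_real pi * \<i> * \<tau>)"
      unfolding eventually_at_i_infinity using eq by (intro exI[of _ 1]) auto
  qed
  have hol': "(\<lambda>\<tau>. D \<tau> * exp (- of_real pi * \<i> * \<tau>)) holomorphic_on upper_half_plane"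
    by (intro holomorphic_intros hol)
  obtain C where C: "\<And>\<tau>. Im \<tau> \<ge> 1/2 \<Longrightarrow> cmod (D \<tau> * exp (- of_real pi * \<i> * \<tau>)) \<le> C * exp (- (2 * pi) * Im \<tau>)"
    using periodic_vanishing_decay[OF hol' per lim] by blast
  have "D \<tau> = 0"
  proof (rule siegel_vanishing[where f = D and \<tau> = \<tau> and w = 3 and A = "3 * pi" and C = C])
    fix \<tau> :: complex assume \<tau>: "Im \<tau> \<ge> 1/2"
    \<comment> \<open>Of the rate 3 pi, the periodic quotient contributes 2 pi and the factor that
      was divided out contributes pi.\<close>
    have "cmod (D \<tau>) = cmod (D \<tau> * exp (- of_real pi * \<i> * \<tau>)) * exp (- pi * Im \<tau>)"
      by (simp add: norm_mult flip: exp_add)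
    also have "\<dots> \<le> C * exp (- (2 * pi) * Im \<tau>) * exp (- pi * Im \<tau>)"
      by (intro mult_right_mono C \<tau>) auto
    also have "\<dots> = C * exp (- (3 * pi) * Im \<tau>)" by (simp add: mult.assoc algebra_simps flip: exp_add)
    finally show "cmod (D \<tau>) \<le> C * exp (- (3 * pi) * Im \<tau>)" .
  next
    fix \<tau> :: complex assume \<tau>: "Im \<tau> > 0"
    have "D (- 1 / \<tau>) = - (\<tau> ^ 6) * D \<tau>"
      unfolding D_def th_neg_inverse[OF \<tau>] th_deriv_neg_inverse[OF \<tau>] by algebra
    moreover have "\<tau> \<noteq> 0" using \<tau> by auto
    ultimately show "cmod (D (- 1 / \<tau>)) = cmod \<tau> powr (2 * 3) * cmod (D \<tau>)"
      by (simp add: norm_mult norm_power powr_realpow[of _ 6, simplified])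
  qed (use hol T assms pi_gt3 in auto)
  then show ?thesis by (simp add: D_def)
qed

text \<open>For f of weight 2 the combination 3 f'^2 - 2 f f'' is, up to a constant, the second
  Rankin-Cohen bracket of f with itself and transforms with weight 8. The sum over the three
  permuted functions belongs to the full group and vanishes at the cusp.\<close>

lemma th_second_order_sum:
  assumes "Im \<tau> > 0"
  shows "3 * ((deriv th2 \<tau>)\<^sup>2 + (deriv th3 \<tau>)\<^sup>2 + (deriv th4 \<tau>)\<^sup>2) =
    2 * (th2 \<tau> * deriv (deriv th2) \<tau> + th3 \<tau> * deriv (deriv th3) \<tau> + th4 \<tau> * deriv (deriv th4) \<tau>)"
proof -
  define D where "D = (\<lambda>\<tau>. 3 * ((deriv th2 \<tau>)\<^sup>2 + (deriv th3 \<tau>)\<^sup>2 + (deriv th4 \<tau>)\<^sup>2) -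
    2 * (th2 \<tau> * deriv (deriv th2) \<tau> + th3 \<tau> * deriv (deriv th3) \<tau> + th4 \<tau> * deriv (deriv th4) \<tau>))"
  have hol: "D holomorphic_on upper_half_plane"
    unfolding D_def by (intro holomorphic_intros th_holomorphic th_holomorphic' th_holomorphic'')
  have T: "D (\<tau> + 1) = D \<tau>" if \<tau>: "Im \<tau> > 0" for \<tau>
    unfolding D_def th_add_1 th_deriv_add_1[OF \<tau>] by (simp add: algebra_simps)
  have "(D \<longlongrightarrow> 3 * (0\<^sup>2 + 0\<^sup>2 + 0\<^sup>2) - 2 * (0 * 0 + 1 * 0 + 1 * 0)) at_i_infinity"
    unfolding D_def by (intro tendsto_intros th2_limit th3_limit th4_limit th_deriv_limit th_deriv2_limit)
  then have lim: "(D \<longlongrightarrow> 0) at_i_infinity" by simp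
  obtain C where C: "\<And>\<tau>. Im \<tau> \<ge> 1/2 \<Longrightarrow> cmod (D \<tau>) \<le> C * exp (- (2 * pi) * Im \<tau>)"
    using periodic_vanishing_decay[OF hol T lim] by blast
  have "D \<tau> = 0"
  proof (rule siegel_vanishing[where f = D and \<tau> = \<tau> and w = 4 and A = "2 * pi" and C = C])
    fix \<tau> :: complex assume \<tau>: "Im \<tau> > 0"
    have "D (- 1 / \<tau>) = \<tau> ^ 8 * D \<tau>"
      unfolding D_def th_neg_inverse[OF \<tau>] th_deriv_neg_inverse[OF \<tau>] by algebra
    moreover have "\<tau> \<noteq> 0" using \<tau> by auto
    ultimately show "cmod (D (- 1 / \<tau>)) = cmod \<tau> powr (2 * 4) * cmod (D \<tau>)"
      by (simp add: norm_mult norm_power powr_realpow[of _ 8, simplified])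
  qed (use hol T C assms pi_gt3 in auto)
  then show ?thesis by (simp add: D_def)
qed

text \<open>The Eisenstein series E_4, in its expression by theta constants.\<close>

definition weight4 :: "complex \<Rightarrow> complex" where
  "weight4 \<tau> = ((th2 \<tau>)\<^sup>2 + (th3 \<tau>)\<^sup>2 + (th4 \<tau>)\<^sup>2) / 2"

lemma weight4_holomorphic: "weight4 holomorphic_on upper_half_plane"
  unfolding weight4_def by (intro holomorphic_intros th_holomorphic) auto

lemma weight4_add_1: "weight4 (\<tau> + 1) = weight4 \<tau>"
  unfolding weight4_def th_add_1 by (simp add: add_ac)

lemma weight4_neg_inverse: "Im \<tau> > 0 \<Longrightarrow> weight4 (- 1 / \<tau>) = \<tau> ^ 4 * weight4 \<tau>"
  unfolding weight4_def th_neg_inverse by (simp add: power_mult_distrib field_simps flip: power_mult)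

lemma weight4_limit: "(weight4 \<longlongrightarrow> 1) at_i_infinity"
proof -
  have "((\<lambda>\<tau>. ((th2 \<tau>)\<^sup>2 + (th3 \<tau>)\<^sup>2 + (th4 \<tau>)\<^sup>2) / 2) \<longlongrightarrow> (0\<^sup>2 + 1\<^sup>2 + 1\<^sup>2) / 2) at_i_infinity"
    by (intro tendsto_intros th2_limit th3_limit th4_limit) auto
  then show ?thesis by (simp add: weight4_def[abs_def])
qed

text \<open>With the Wronskian and its derivative, the defects of the second-order equations for a =
  \<open>th2\<close>, b = \<open>th4\<close> and a + b = \<open>th3\<close> are proportional to a^2,
  b^2 and (a + b)^2. Their sum is 0, and the sum of these squares is 2 \<open>weight4\<close>, hence
  the exclusion of its zeros.\<close>

theorem th3_second_order:
  assumes \<tau>: "Im \<tau> > 0" and nz: "weight4 \<tau> \<noteq> 0"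
  shows "3 * (deriv th3 \<tau>)\<^sup>2 - 2 * th3 \<tau> * deriv (deriv th3) \<tau> = of_real pi ^ 2 * (th3 \<tau>)\<^sup>2 * th2 \<tau> * th4 \<tau>"
proof -
  define k where "k = complex_of_real pi * \<i>"
  define a b a1 b1 a2 b2 where ab: "a = th2 \<tau>" "b = th4 \<tau>" "a1 = deriv th2 \<tau>" "b1 = deriv th4 \<tau>"
    "a2 = deriv (deriv th2) \<tau>" "b2 = deriv (deriv th4) \<tau>"
  have k2: "k\<^sup>2 = - (of_real pi)\<^sup>2" by (simp add: k_def power_mult_distrib)
  have c: "th3 \<tau> = a + b" "deriv th3 \<tau> = a1 + b1" "deriv (deriv th3) \<tau> = a2 + b2"
    using jacobi_identity[OF \<tau>] jacobi_identity_deriv[OF \<tau>] by (simp_all add: ab)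
  have w1: "a1 * b - a * b1 = k * a * (a + b) * b"
    using th_wronskian[OF \<tau>] unfolding c(1) by (simp only: ab k_def)
  have w2: "a2 * b - a * b2 = k * (a1 * (a + b) * b + a * (a1 + b1) * b + a * (a + b) * b1)"
  proof -
    have d: "(h has_field_derivative deriv h \<tau>) (at \<tau>)" if "h holomorphic_on upper_half_plane" for h
      by (rule holomorphic_derivI[OF that open_upper_half_plane]) (use \<tau> in simp)
    have "((\<lambda>\<tau>. deriv th2 \<tau> * th4 \<tau> - th2 \<tau> * deriv th4 \<tau>) has_field_derivative a2 * b - a * b2) (at \<tau>)"
      unfolding ab by (auto intro!: derivative_eq_intros d th_holomorphic th_holomorphic')
    moreover have "((\<lambda>\<tau>. deriv th2 \<tau> * th4 \<tau> - th2 \<tau> * deriv th4 \<tau>) has_field_derivative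
        k * (a1 * (a + b) * b + a * (a1 + b1) * b + a * (a + b) * b1)) (at \<tau>)"
    proof (rule has_field_derivative_transform_within_open[OF _ open_upper_half_plane])
      show "((\<lambda>\<tau>. of_real pi * \<i> * th2 \<tau> * th3 \<tau> * th4 \<tau>) has_field_derivative
        k * (a1 * (a + b) * b + a * (a1 + b1) * b + a * (a + b) * b1)) (at \<tau>)"
        unfolding c[symmetric] unfolding ab k_def
        by (auto intro!: derivative_eq_intros d th_holomorphic simp: algebra_simps)
    qed (use \<tau> th_wronskian in auto)
    ultimately show ?thesis by (rule DERIV_unique)
  qed
  \<comment> \<open>The three defects; in their sum the terms with k^2 cancel, leaving the relation
    of \<open>th_second_order_sum\<close>.\<close>
  define Da where "Da = 3 * a1\<^sup>2 - 2 * a * a2 - k\<^sup>2 * a\<^sup>2 * b * (a + b)"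
  define Db where "Db = 3 * b1\<^sup>2 - 2 * b * b2 - k\<^sup>2 * b\<^sup>2 * a * (a + b)"
  define Dc where "Dc = 3 * (a1 + b1)\<^sup>2 - 2 * (a + b) * (a2 + b2) + k\<^sup>2 * (a + b)\<^sup>2 * a * b"
  have 1: "a\<^sup>2 * Dc = (a + b)\<^sup>2 * Da" unfolding Da_def Dc_def using w1 w2 by algebra
  have 2: "b\<^sup>2 * Dc = (a + b)\<^sup>2 * Db" unfolding Db_def Dc_def using w1 w2 by algebra
  have "3 * (a1\<^sup>2 + (a1 + b1)\<^sup>2 + b1\<^sup>2) = 2 * (a * a2 + (a + b) * (a2 + b2) + b * b2)"
    using th_second_order_sum[OF \<tau>] unfolding c by (simp add: ab)
  then have 3: "Da + Db + Dc = 0" unfolding Da_def Db_def Dc_def by algebra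
  have "(a\<^sup>2 + b\<^sup>2 + (a + b)\<^sup>2) * Dc = (a + b)\<^sup>2 * (Da + Db + Dc)"
    using 1 2 by (simp add: algebra_simps)
  moreover have "2 * weight4 \<tau> = a\<^sup>2 + b\<^sup>2 + (a + b)\<^sup>2" unfolding weight4_def c by (simp add: ab)
  ultimately have "2 * weight4 \<tau> * Dc = 0" using 3 by simp
  then have "Dc = 0" using nz by simp
  then show ?thesis unfolding c Dc_def k2 by (simp add: ab algebra_simps)
qed

text \<open>The series for \<open>th2\<close> has positive terms on the axis, that for
  \<open>th4\<close> alternates. Positivity of \<open>th4\<close> is therefore taken from
  \<open>th2\<close> at i / y by inversion.\<close>

lemma th_axis_positive:
  assumes y: "y > 0"
  obtains ra rb where "ra > 0" "rb > 0" "th2 (\<i> * of_real y) = of_real ra" "th4 (\<i> * of_real y) = of_real rb"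
proof -
  have pos: "\<exists>r>0. th2 (\<i> * of_real y) = of_real r" if y: "y > 0" for y
  proof -
    define r where "r = (\<Sum>\<^sub>\<infinity>n::int. exp (- pi * y * (of_int n + 1/2)\<^sup>2))"
    have eq: "exp (of_real pi * \<i> * (\<i> * of_real y) * (of_int n + 1 / 2) ^ 2) = complex_of_real (exp (- pi * y * (of_int n + 1/2)\<^sup>2))"
      for n :: int
      unfolding exp_of_real[symmetric] by (intro arg_cong[where f = exp]) (simp add: mult_ac)
    have "(\<lambda>n::int. exp (of_real pi * \<i> * (\<i> * of_real y) / 4) *
        exp (of_real pi * \<i> * (\<i> * of_real y) * of_int n ^ 2 + 2 * of_real pi * \<i> * of_int n * (\<i> * of_real y / 2))) summable_on UNIV"
      by (intro summable_on_cmult_right theta_summable) (use y in simp)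
    also have "(\<lambda>n::int. exp (of_real pi * \<i> * (\<i> * of_real y) / 4) *
        exp (of_real pi * \<i> * (\<i> * of_real y) * of_int n ^ 2 + 2 * of_real pi * \<i> * of_int n * (\<i> * of_real y / 2)))
        = (\<lambda>n. complex_of_real (exp (- pi * y * (of_int n + 1/2)\<^sup>2)))"
      unfolding eq[symmetric] exp_add[symmetric]
      by (intro ext arg_cong[where f = exp]) (simp add: field_simps power2_eq_square)
    finally have "(\<lambda>n::int. complex_of_real (exp (- pi * y * (of_int n + 1/2)\<^sup>2))) summable_on UNIV" .
    then have s: "(\<lambda>n::int. exp (- pi * y * (of_int n + 1/2)\<^sup>2)) summable_on UNIV"
      using summable_on_Re by fastforce
    have "theta10 (\<i> * of_real y) = of_real r"
      unfolding theta10_def eq r_def by (rule infsumI[OF has_sum_of_real[OF has_sum_infsum[OF s]]])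
    moreover have "(\<Sum>n\<in>{0::int}. exp (- pi * y * (of_int n + 1/2)\<^sup>2)) \<le> r"
      unfolding r_def by (rule finite_sum_le_infsum[OF s]) auto
    then have "r > 0" by (smt (verit) exp_gt_zero finite.emptyI finite.insertI insert_not_empty sum_pos)
    ultimately show ?thesis unfolding th2_def by (intro exI[of _ "r ^ 4"]) simp
  qed
  obtain ra where ra: "ra > 0" "th2 (\<i> * of_real y) = of_real ra" using pos[OF y] by blast
  obtain rb where rb: "rb > 0" "th2 (\<i> * of_real (1 / y)) = of_real rb" using pos[of "1 / y"] y by auto
  have "th4 (- 1 / (\<i> * of_real (1 / y))) = - (\<i> * of_real (1 / y))\<^sup>2 * th2 (\<i> * of_real (1 / y))"
    by (rule th4_neg_inverse) (use y in simp)
  also have "- 1 / (\<i> * of_real (1 / y)) = \<i> * of_real y" using y by (simp add: field_simps)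
  also have "- (\<i> * of_real (1 / y))\<^sup>2 * th2 (\<i> * of_real (1 / y)) = of_real ((1 / y)\<^sup>2 * rb)"
    unfolding rb(2) by (simp add: power_mult_distrib power_divide)
  finally show ?thesis using that[of ra "(1 / y)\<^sup>2 * rb"] ra rb y by simp
qed

section \<open>The hypergeometric function\<close>

definition hyp_coeff :: "complex \<Rightarrow> complex \<Rightarrow> complex \<Rightarrow> nat \<Rightarrow> complex" where
  "hyp_coeff a b c n = pochhammer a n * pochhammer b n / (pochhammer c n * fact n)"

lemma hyp2F1_eq: "hyp2F1 a b c z = (\<Sum>n. hyp_coeff a b c n * z ^ n)"
  by (simp add: hyp2F1_def hyp_coeff_def)

lemma hyp_coeff_0 [simp]: "hyp_coeff a b c 0 = 1"
  by (simp add: hyp_coeff_def)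

lemma not_nonpos_Int_add_nat: "c \<notin> \<int>\<^sub>\<le>\<^sub>0 \<Longrightarrow> c + of_nat n \<noteq> 0"
  by (metis add_eq_0_iff2 minus_of_nat_in_nonpos_Ints add.commute eq_neg_iff_add_eq_0)

lemma pochhammer_nonzero: "c \<notin> \<int>\<^sub>\<le>\<^sub>0 \<Longrightarrow> pochhammer (c :: complex) n \<noteq> 0"
  using not_nonpos_Int_add_nat by (auto simp: pochhammer_eq_0_iff)

lemma hyp_coeff_Suc:
  assumes "c \<notin> \<int>\<^sub>\<le>\<^sub>0"
  shows "(c + of_nat n) * of_nat (Suc n) * hyp_coeff a b c (Suc n) = (a + of_nat n) * (b + of_nat n) * hyp_coeff a b c n"
proof -
  have "c + of_nat n \<noteq> 0" "pochhammer c n \<noteq> 0"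
    using assms not_nonpos_Int_add_nat pochhammer_nonzero by auto
  then show ?thesis
    unfolding hyp_coeff_def pochhammer_Suc fact_Suc by (simp add: divide_simps del: of_nat_Suc)
qed

lemma hyp_coeff_ratio_limit:
  "(\<lambda>n. (a + of_nat n) * (b + of_nat n) / ((c + of_nat n) * of_nat (Suc n)) :: complex) \<longlonglongrightarrow> 1"
proof -
  have l: "(\<lambda>n. 1 + k / of_nat n :: complex) \<longlonglongrightarrow> 1" for k
    using tendsto_add[OF tendsto_const tendsto_mult[OF tendsto_const lim_1_over_n], of 1 k] by simp
  have "(\<lambda>n. (1 + a / of_nat n) * (1 + b / of_nat n) / ((1 + c / of_nat n) * (1 + 1 / of_nat n)) :: complex) \<longlonglongrightarrow> 1 * 1 / (1 * 1)"
    by (intro tendsto_intros l) auto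
  then have "(\<lambda>n. (1 + a / of_nat n) * (1 + b / of_nat n) / ((1 + c / of_nat n) * (1 + 1 / of_nat n)) :: complex) \<longlonglongrightarrow> 1"
    by simp
  moreover have "\<forall>\<^sub>F n in sequentially. (1 + a / of_nat n) * (1 + b / of_nat n) / ((1 + c / of_nat n) * (1 + 1 / of_nat n))
      = (a + of_nat n) * (b + of_nat n) / ((c + of_nat n) * of_nat (Suc n) :: complex)"
    using eventually_gt_at_top[of 0]
  proof eventually_elim
    case (elim n)
    define N where "N = (of_nat n :: complex)"
    have N: "N \<noteq> 0" using elim by (simp add: N_def)
    have e: "1 + k / N = (k + N) / N" for k using N by (simp add: field_simps)
    have S: "of_nat (Suc n) = 1 + N" by (simp add: N_def)
    show ?case unfolding S N_def[symmetric] e using N by simp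
  qed
  ultimately show ?thesis by (rule Lim_transform_eventually)
qed

lemma hyp2F1_summable:
  assumes c: "c \<notin> \<int>\<^sub>\<le>\<^sub>0" and z: "norm z < 1"
  shows "summable (\<lambda>n. hyp_coeff a b c n * z ^ n)"
proof -
  define r where "r = (norm z + 1) / 2"
  have r: "norm z < r" "r < 1" "r > 0" using z by (auto simp: r_def intro: add_nonneg_pos)
  define R where "R = (\<lambda>n. (a + of_nat n) * (b + of_nat n) / ((c + of_nat n) * of_nat (Suc n)))"
  have "(\<lambda>n. norm (R n * z)) \<longlonglongrightarrow> norm (1 * z)"
    unfolding R_def by (intro tendsto_intros hyp_coeff_ratio_limit)
  then have "eventually (\<lambda>n. norm (R n * z) < r) sequentially"
    using r by (intro order_tendstoD) auto
  then obtain N where N: "\<And>n. n \<ge> N \<Longrightarrow> norm (R n * z) < r" by (auto simp: eventually_sequentially)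
  show ?thesis
  proof (rule summable_ratio_test[of r N])
    fix n assume n: "n \<ge> N"
    have nz: "(c + of_nat n) * of_nat (Suc n) \<noteq> 0"
      using not_nonpos_Int_add_nat[OF c] by (simp del: of_nat_Suc)
    have "hyp_coeff a b c (Suc n) = R n * hyp_coeff a b c n"
      using hyp_coeff_Suc[OF c, of n a b] nz unfolding R_def by (simp add: field_simps del: of_nat_Suc)
    then have "norm (hyp_coeff a b c (Suc n) * z ^ Suc n) = norm (R n * z) * norm (hyp_coeff a b c n * z ^ n)"
      by (simp add: norm_mult mult_ac)
    also have "\<dots> \<le> r * norm (hyp_coeff a b c n * z ^ n)"
      using N[OF n] by (intro mult_right_mono) auto
    finally show "norm (hyp_coeff a b c (Suc n) * z ^ Suc n) \<le> r * norm (hyp_coeff a b c n * z ^ n)" .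
  qed (use r in auto)
qed

lemma hyp2F1_0 [simp]: "hyp2F1 a b c 0 = 1"
  using powser_zero[of "hyp_coeff a b c"] by (simp add: hyp2F1_eq)

lemma sums_mult_shift:
  fixes g :: "nat \<Rightarrow> complex"
  assumes "(\<lambda>n. g n * z ^ n) sums S"
  shows "(\<lambda>n. (if n = 0 then 0 else g (n - 1)) * z ^ n) sums (z * S)"
proof -
  have "(\<lambda>n. (if Suc n = 0 then 0 else g (Suc n - 1)) * z ^ Suc n) sums (z * S)"
    using sums_mult[OF assms, of z] by (simp add: mult_ac)
  then show ?thesis by (subst (asm) sums_Suc_iff) simp
qed

lemma hyp2F1_derivs:
  assumes c: "c \<notin> \<int>\<^sub>\<le>\<^sub>0" and z: "norm z < 1"
  shows hyp2F1_has_deriv: "(hyp2F1 a b c has_field_derivative deriv (hyp2F1 a b c) z) (at z)"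
    and hyp2F1_has_deriv2: "(deriv (hyp2F1 a b c) has_field_derivative deriv (deriv (hyp2F1 a b c)) z) (at z)"
    and hyp2F1_deriv_sums: "(\<lambda>n. diffs (hyp_coeff a b c) n * z ^ n) sums deriv (hyp2F1 a b c) z"
    and hyp2F1_deriv2_sums: "(\<lambda>n. diffs (diffs (hyp_coeff a b c)) n * z ^ n) sums deriv (deriv (hyp2F1 a b c)) z"
proof -
  let ?h = "hyp_coeff a b c"
  have s0: "summable (\<lambda>n. ?h n * z ^ n)" if "norm z < 1" for z by (rule hyp2F1_summable[OF c that])
  have s1: "summable (\<lambda>n. diffs ?h n * z ^ n)" if "norm z < 1" for z
    by (rule termdiff_converges[of z 1]) (use that s0 in auto)
  have s2: "summable (\<lambda>n. diffs (diffs ?h) n * z ^ n)" if "norm z < 1" for z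
    by (rule termdiff_converges[of z 1]) (use that s1 in auto)
  have d1: "(hyp2F1 a b c has_field_derivative (\<Sum>n. diffs ?h n * z ^ n)) (at z)" if "norm z < 1" for z
    using termdiffs_strong'[of 1 ?h z] s0 that unfolding hyp2F1_eq[abs_def] by auto
  have e1: "deriv (hyp2F1 a b c) z = (\<Sum>n. diffs ?h n * z ^ n)" if "norm z < 1" for z
    by (rule DERIV_imp_deriv[OF d1[OF that]])
  have d2: "(deriv (hyp2F1 a b c) has_field_derivative (\<Sum>n. diffs (diffs ?h) n * z ^ n)) (at z)" if "norm z < 1" for z
  proof (rule has_field_derivative_transform_within_open)
    show "((\<lambda>z. \<Sum>n. diffs ?h n * z ^ n) has_field_derivative (\<Sum>n. diffs (diffs ?h) n * z ^ n)) (at z)"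
      using termdiffs_strong'[of 1 "diffs ?h" z] s1 that by auto
  qed (use that e1 in \<open>auto intro: open_ball[of 0 1]\<close>)
  show "(hyp2F1 a b c has_field_derivative deriv (hyp2F1 a b c) z) (at z)" using d1[OF z] e1[OF z] by simp
  show "(deriv (hyp2F1 a b c) has_field_derivative deriv (deriv (hyp2F1 a b c)) z) (at z)"
    using d2[OF z] DERIV_imp_deriv[OF d2[OF z]] by simp
  show "(\<lambda>n. diffs ?h n * z ^ n) sums deriv (hyp2F1 a b c) z"
    using summable_sums[OF s1[OF z]] e1[OF z] by simp
  show "(\<lambda>n. diffs (diffs ?h) n * z ^ n) sums deriv (deriv (hyp2F1 a b c)) z"
    using summable_sums[OF s2[OF z]] DERIV_imp_deriv[OF d2[OF z]] by simp
qed

lemma hyp2F1_holomorphic: "c \<notin> \<int>\<^sub>\<le>\<^sub>0 \<Longrightarrow> hyp2F1 a b c holomorphic_on ball 0 1"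
  by (subst holomorphic_on_open) (auto intro!: exI hyp2F1_has_deriv)

lemma hyp2F1_ode:
  assumes c: "c \<notin> \<int>\<^sub>\<le>\<^sub>0" and z: "norm z < 1"
  shows "z * (1 - z) * deriv (deriv (hyp2F1 a b c)) z + (c - (a + b + 1) * z) * deriv (hyp2F1 a b c) z
     = a * b * hyp2F1 a b c z"
proof -
  let ?h = "hyp_coeff a b c" and ?F = "hyp2F1 a b c z" and ?F1 = "deriv (hyp2F1 a b c) z" and ?F2 = "deriv (deriv (hyp2F1 a b c)) z"
  have F: "(\<lambda>n. ?h n * z ^ n) sums ?F"
    unfolding hyp2F1_eq by (rule summable_sums[OF hyp2F1_summable[OF c z]])
  note F1 = hyp2F1_deriv_sums[OF c z, of a b] and F2 = hyp2F1_deriv2_sums[OF c z, of a b]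
  note zF1 = sums_mult_shift[OF F1] and zF2 = sums_mult_shift[OF F2]
  note zzF2 = sums_mult_shift[OF zF2]
  \<comment> \<open>The coefficient of z^n in the difference of both sides; the conditionals are the
    index shifts caused by multiplication with z and z^2.\<close>
  define T where "T = (\<lambda>n. (if n = 0 then 0 else diffs (diffs ?h) (n - 1)) * z ^ n
      - (if n = 0 then 0 else (if n - 1 = 0 then 0 else diffs (diffs ?h) (n - 1 - 1))) * z ^ n
      + c * (diffs ?h n * z ^ n) - (a + b + 1) * ((if n = 0 then 0 else diffs ?h (n - 1)) * z ^ n)
      - a * b * (?h n * z ^ n))"
  have "T sums (z * ?F2 - z * (z * ?F2) + c * ?F1 - (a + b + 1) * (z * ?F1) - a * b * ?F)"
    unfolding T_def by (intro sums_add sums_diff sums_mult zF2 zzF2 F1 zF1 F)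
  moreover have "T n = 0" for n
  proof -
    have "(if n = 0 then 0 else diffs (diffs ?h) (n - 1)) = of_nat n * of_nat (Suc n) * ?h (Suc n)"
      by (cases n) (auto simp: diffs_def)
    moreover have "(if n = 0 then 0 else (if n - 1 = 0 then 0 else diffs (diffs ?h) (n - 1 - 1))) = of_nat n * (of_nat n - 1) * ?h n"
      by (cases n; cases "n - 1") (auto simp: diffs_def algebra_simps)
    moreover have "(if n = 0 then 0 else diffs ?h (n - 1)) = of_nat n * ?h n"
      by (cases n) (auto simp: diffs_def)
    moreover have "diffs ?h n = of_nat (Suc n) * ?h (Suc n)" by (simp add: diffs_def)
    ultimately have "T n = ((c + of_nat n) * of_nat (Suc n) * ?h (Suc n) - (a + of_nat n) * (b + of_nat n) * ?h n) * z ^ n"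
      unfolding T_def by (simp only:) (simp add: algebra_simps del: of_nat_Suc)
    then show ?thesis using hyp_coeff_Suc[OF c, of n a b] by simp
  qed
  then have "T sums 0" by (simp add: sums_0)
  ultimately have "z * ?F2 - z * (z * ?F2) + c * ?F1 - (a + b + 1) * (z * ?F1) - a * b * ?F = 0"
    by (metis sums_unique2)
  then show ?thesis by (simp add: algebra_simps)
qed

section \<open>Contiguity relations and Gauss's value at 1\<close>

lemma hyp_coeff_add_1:
  assumes c: "c \<notin> \<int>\<^sub>\<le>\<^sub>0"
  shows "(c + of_nat n) * hyp_coeff a b (c + 1) n = c * hyp_coeff a b c n"
proof -
  have "pochhammer c n * (c + of_nat n) = c * pochhammer (c + 1) n"
    by (metis pochhammer_Suc pochhammer_rec)
  moreover have "pochhammer c n \<noteq> 0" using c by (rule pochhammer_nonzero)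
  moreover have "c + of_nat n \<noteq> 0" "c \<noteq> 0" using not_nonpos_Int_add_nat[OF c] c by auto
  moreover have "pochhammer (c + 1) n \<noteq> 0" using calculation by auto
  ultimately show ?thesis unfolding hyp_coeff_def by (simp add: divide_simps) (metis mult.commute mult.left_commute)
qed

lemma not_nonpos_Int_Suc: "c \<notin> \<int>\<^sub>\<le>\<^sub>0 \<Longrightarrow> c + 1 \<notin> (\<int>\<^sub>\<le>\<^sub>0 :: complex set)"
  using nonpos_Ints_diff_Nats[of "c + 1" 1] by auto

text \<open>The left-hand side is arranged as a difference of consecutive values of n times the
  coefficient, so that it telescopes when summed. After multiplication by c + n the claim follows
  polynomially from the two recursions.\<close>

lemma hyp_coeff_contiguous:
  assumes c: "c \<notin> \<int>\<^sub>\<le>\<^sub>0"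
  shows "c * (of_nat (Suc n) * hyp_coeff a b c (Suc n) - of_nat n * hyp_coeff a b c n)
     = (c - a) * (c - b) * hyp_coeff a b (c + 1) n + c * (a + b - c) * hyp_coeff a b c n"
proof -
  have nz: "c + of_nat n \<noteq> 0" by (rule not_nonpos_Int_add_nat[OF c])
  have "(c + of_nat n) * (c * (of_nat (Suc n) * hyp_coeff a b c (Suc n) - of_nat n * hyp_coeff a b c n))
      = (c + of_nat n) * ((c - a) * (c - b) * hyp_coeff a b (c + 1) n + c * (a + b - c) * hyp_coeff a b c n)"
    using hyp_coeff_Suc[OF c, of n a b] hyp_coeff_add_1[OF c, of n a b] by algebra
  then show ?thesis using nz by (metis mult_cancel_left)
qed

text \<open>Expresses (1 - z) F' through F and the function with c + 1. The latter still converges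
  at z = 1 when Re (c - a - b) = 0, the case met in the connection formula.\<close>

lemma hyp2F1_contiguous:
  assumes c: "c \<notin> \<int>\<^sub>\<le>\<^sub>0" and z: "norm z < 1"
  shows "c * (1 - z) * deriv (hyp2F1 a b c) z
    = (c - a) * (c - b) * hyp2F1 a b (c + 1) z + c * (a + b - c) * hyp2F1 a b c z"
proof -
  let ?h = "hyp_coeff a b c" and ?F1 = "deriv (hyp2F1 a b c) z"
  have F: "(\<lambda>n. hyp_coeff a b c n * z ^ n) sums hyp2F1 a b c z" if "c \<notin> \<int>\<^sub>\<le>\<^sub>0" for c
    unfolding hyp2F1_eq by (rule summable_sums[OF hyp2F1_summable[OF that z]])
  note F1 = hyp2F1_deriv_sums[OF c z, of a b]
  have "(\<lambda>n. c * (diffs ?h n * z ^ n - (if n = 0 then 0 else diffs ?h (n - 1)) * z ^ n)) sums (c * (?F1 - z * ?F1))"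
    by (intro sums_mult sums_diff F1 sums_mult_shift)
  also have "(\<lambda>n. c * (diffs ?h n * z ^ n - (if n = 0 then 0 else diffs ?h (n - 1)) * z ^ n))
     = (\<lambda>n. (c - a) * (c - b) * (hyp_coeff a b (c + 1) n * z ^ n) + c * (a + b - c) * (?h n * z ^ n))"
  proof
    fix n
    have "(if n = 0 then 0 else diffs ?h (n - 1)) = of_nat n * ?h n" by (cases n) (auto simp: diffs_def)
    then have "c * (diffs ?h n * z ^ n - (if n = 0 then 0 else diffs ?h (n - 1)) * z ^ n)
      = (c * (of_nat (Suc n) * ?h (Suc n) - of_nat n * ?h n)) * z ^ n" by (simp only: diffs_def) (simp add: algebra_simps)
    also have "\<dots> = (c - a) * (c - b) * (hyp_coeff a b (c + 1) n * z ^ n) + c * (a + b - c) * (?h n * z ^ n)"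
      unfolding hyp_coeff_contiguous[OF c] by (simp add: algebra_simps)
    finally show "c * (diffs ?h n * z ^ n - (if n = 0 then 0 else diffs ?h (n - 1)) * z ^ n) = \<dots>" .
  qed
  finally have "(\<lambda>n. (c - a) * (c - b) * (hyp_coeff a b (c + 1) n * z ^ n) + c * (a + b - c) * (?h n * z ^ n)) sums (c * (?F1 - z * ?F1))" .
  moreover have "(\<lambda>n. (c - a) * (c - b) * (hyp_coeff a b (c + 1) n * z ^ n) + c * (a + b - c) * (?h n * z ^ n)) sums
     ((c - a) * (c - b) * hyp2F1 a b (c + 1) z + c * (a + b - c) * hyp2F1 a b c z)"
    by (intro sums_add sums_mult F c not_nonpos_Int_Suc)
  ultimately have "c * (?F1 - z * ?F1) = (c - a) * (c - b) * hyp2F1 a b (c + 1) z + c * (a + b - c) * hyp2F1 a b c z"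
    by (rule sums_unique2)
  then show ?thesis by (simp add: algebra_simps)
qed

text \<open>Up to n^(a + b - c) / (n + 1) the coefficient of index n + 1 is a quotient of the Euler
  approximations \<open>rGamma_series\<close>, which converge and are therefore bounded.\<close>

lemma hyp_coeff_bound:
  assumes c: "c \<notin> \<int>\<^sub>\<le>\<^sub>0"
  obtains K where "\<And>n. n > 0 \<Longrightarrow> cmod (hyp_coeff a b c (Suc n)) \<le> K * real n powr (Re (a + b - c) - 1)"
proof -
  define X where "X = (\<lambda>n. rGamma_series a n * rGamma_series b n / rGamma_series c n)"
  have "rGamma c \<noteq> 0" using c by (simp add: rGamma_eq_zero_iff)
  then have "X \<longlonglongrightarrow> rGamma a * rGamma b / rGamma c"
    unfolding X_def by (intro tendsto_intros rGamma_series_LIMSEQ)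
  then have "Bseq X" by (rule convergent_imp_Bseq[OF convergentI])
  then obtain K where K: "K > 0" "\<And>n. cmod (X n) \<le> K" by (auto elim: BseqE)
  show ?thesis
  proof (rule that[of K])
    fix n :: nat assume n: "n > 0"
    have pc: "pochhammer c (Suc n) \<noteq> 0" using c by (rule pochhammer_nonzero)
    have "hyp_coeff a b c (Suc n) = X n * exp ((a + b - c) * of_real (ln (real n))) / of_nat (Suc n)"
      unfolding X_def rGamma_series_def hyp_coeff_def fact_Suc using pc n
      by (simp add: field_simps exp_add exp_diff del: of_nat_Suc pochhammer_Suc)
    then have "cmod (hyp_coeff a b c (Suc n)) = cmod (X n) * exp (Re (a + b - c) * ln (real n)) / real (Suc n)"
      by (simp add: norm_mult norm_divide del: of_nat_Suc)
    also have "\<dots> \<le> K * exp (Re (a + b - c) * ln (real n)) / real n"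
      using K n by (intro frac_le mult_right_mono) auto
    also have "\<dots> = K * real n powr (Re (a + b - c) - 1)"
    proof -
      have "real n powr (Re (a + b - c) - 1) = real n powr Re (a + b - c) / real n powr 1" by (rule powr_diff)
      moreover have "real n powr Re (a + b - c) = exp (Re (a + b - c) * ln (real n))" using n by (simp add: powr_def)
      ultimately show ?thesis by simp
    qed
    finally show "cmod (hyp_coeff a b c (Suc n)) \<le> K * real n powr (Re (a + b - c) - 1)" .
  qed
qed

lemma hyp_coeff_abs_summable:
  assumes c: "c \<notin> \<int>\<^sub>\<le>\<^sub>0" and re: "Re (c - a - b) > 0"
  shows "summable (\<lambda>n. cmod (hyp_coeff a b c n))"
    and "(\<lambda>n. of_nat n * hyp_coeff a b c n) \<longlonglongrightarrow> 0"
proof -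
  obtain K where K: "\<And>n. n > 0 \<Longrightarrow> cmod (hyp_coeff a b c (Suc n)) \<le> K * real n powr (Re (a + b - c) - 1)"
    using hyp_coeff_bound[OF c] by blast
  have s: "summable (\<lambda>n. K * real n powr (Re (a + b - c) - 1))"
    using re by (intro summable_mult) (simp add: summable_real_powr_iff)
  have "summable (\<lambda>n. cmod (hyp_coeff a b c (Suc n)))"
    by (rule summable_comparison_test'[OF s, of 1]) (use K in simp)
  then show "summable (\<lambda>n. cmod (hyp_coeff a b c n))" by (subst (asm) summable_Suc_iff)
  define d where "d = Re (a + b - c)"
  have d: "d < 0" using re by (simp add: d_def)
  have "(\<lambda>n. of_nat (Suc n) * hyp_coeff a b c (Suc n)) \<longlonglongrightarrow> 0"
  proof (rule Lim_null_comparison)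
    show "(\<lambda>n. real (Suc n) * (K * real n powr (d - 1))) \<longlonglongrightarrow> 0" using d by real_asymp
    show "\<forall>\<^sub>F n in sequentially. norm (of_nat (Suc n) * hyp_coeff a b c (Suc n)) \<le> real (Suc n) * (K * real n powr (d - 1))"
      using eventually_gt_at_top[of 0]
    proof eventually_elim
      case (elim n)
      then show ?case using K[of n] unfolding norm_mult d_def norm_of_nat by (intro mult_left_mono) auto
    qed
  qed
  then show "(\<lambda>n. of_nat n * hyp_coeff a b c n) \<longlonglongrightarrow> 0" by (subst (asm) filterlim_sequentially_Suc)
qed

text \<open>The sum of the contiguity relation at z = 1: the telescoping side is 0 because n times
  the coefficient tends to 0.\<close>

lemma hyp2F1_gauss_step:
  assumes c: "c \<notin> \<int>\<^sub>\<le>\<^sub>0" and re: "Re (c - a - b) > 0"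
  shows "c * (c - a - b) * hyp2F1 a b c 1 = (c - a) * (c - b) * hyp2F1 a b (c + 1) 1"
proof -
  have F: "(\<lambda>n. hyp_coeff a b c n) sums hyp2F1 a b c 1" if "c \<notin> \<int>\<^sub>\<le>\<^sub>0" "Re (c - a - b) > 0" for c
    unfolding hyp2F1_eq using summable_sums[OF summable_norm_cancel[OF hyp_coeff_abs_summable(1)[OF that]]] by simp
  have A: "(\<lambda>n. of_nat (Suc n) * hyp_coeff a b c (Suc n) - of_nat n * hyp_coeff a b c n) sums (0 - of_nat 0 * hyp_coeff a b c 0)"
    by (rule telescope_sums[OF hyp_coeff_abs_summable(2)[OF c re]])
  then have "(\<lambda>n. c * (of_nat (Suc n) * hyp_coeff a b c (Suc n) - of_nat n * hyp_coeff a b c n)) sums (c * 0)"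
    by (intro sums_mult) simp
  then have A: "(\<lambda>n. (c - a) * (c - b) * hyp_coeff a b (c + 1) n + c * (a + b - c) * hyp_coeff a b c n) sums 0"
    unfolding hyp_coeff_contiguous[OF c] by simp
  have B: "(\<lambda>n. (c - a) * (c - b) * hyp_coeff a b (c + 1) n + c * (a + b - c) * hyp_coeff a b c n) sums
     ((c - a) * (c - b) * hyp2F1 a b (c + 1) 1 + c * (a + b - c) * hyp2F1 a b c 1)"
    using c re by (intro sums_add sums_mult F not_nonpos_Int_Suc) auto
  have "(c - a) * (c - b) * hyp2F1 a b (c + 1) 1 + c * (a + b - c) * hyp2F1 a b c 1 = 0"
    by (rule sums_unique2[OF B A])
  then show ?thesis by algebra
qed

text \<open>The step is iterated to c + n. There the series at 1 tends to 1, and the accumulated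
  Pochhammer quotient tends to the Gamma quotient by Euler's limit.\<close>

theorem hyp2F1_gauss:
  assumes c: "Re c > 0" and re: "Re (c - a - b) > 0"
  shows "hyp2F1 a b c 1 = Gamma c * Gamma (c - a - b) / (Gamma (c - a) * Gamma (c - b))"
proof -
  have nn: "z \<notin> \<int>\<^sub>\<le>\<^sub>0" if "Re z > 0" for z
    using that by (auto elim!: nonpos_Ints_cases)
  define d where "d = c - a - b"
  have d: "d \<notin> \<int>\<^sub>\<le>\<^sub>0" using nn[of d] re by (simp add: d_def)
  have cn: "c \<notin> \<int>\<^sub>\<le>\<^sub>0" by (rule nn[OF c])
  have step: "pochhammer c n * pochhammer d n * hyp2F1 a b c 1
      = pochhammer (c - a) n * pochhammer (c - b) n * hyp2F1 a b (c + of_nat n) 1" for n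
  proof (induction n)
    case (Suc n)
    have "(c + of_nat n) * (c + of_nat n - a - b) * hyp2F1 a b (c + of_nat n) 1
        = (c + of_nat n - a) * (c + of_nat n - b) * hyp2F1 a b (c + of_nat n + 1) 1"
      using c re by (intro hyp2F1_gauss_step nn) auto
    then have "(c + of_nat n) * (d + of_nat n) * hyp2F1 a b (c + of_nat n) 1
        = (c - a + of_nat n) * (c - b + of_nat n) * hyp2F1 a b (c + of_nat (Suc n)) 1"
      by (simp add: d_def algebra_simps)
    then show ?case using Suc.IH unfolding pochhammer_Suc by algebra
  qed simp
  have lim1: "(\<lambda>n. hyp2F1 a b (c + of_nat n) 1) \<longlonglongrightarrow> 1"
  proof -
    define M where "M = (\<Sum>k. cmod (hyp_coeff a b c (Suc k)))"
    have sM: "summable (\<lambda>k. cmod (hyp_coeff a b c (Suc k)))"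
      using hyp_coeff_abs_summable(1)[OF cn re] by (subst summable_Suc_iff)
    \<comment> \<open>One factor c / (c + n) is split off the Pochhammer quotient and tends to 0;
      the other factors only grow in modulus when c is moved to the right, so the original series is
      a majorant.\<close>
    have bound: "cmod (hyp_coeff a b (c + of_nat n) (Suc k)) \<le> cmod c / cmod (c + of_nat n) * cmod (hyp_coeff a b c (Suc k))" for n k
    proof -
      have mono: "cmod (pochhammer x k) \<le> cmod (pochhammer (x + of_nat n) k)" if "Re x > 0" for x k
      proof (induction k)
        case (Suc k)
        have "cmod (x + of_nat k) \<le> cmod (x + of_nat n + of_nat k)"
        proof -
          have "(Re x + real k)\<^sup>2 \<le> (Re x + real n + real k)\<^sup>2" using that by (intro power_mono) auto
          then show ?thesis by (simp add: cmod_def)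
        qed
        then show ?case unfolding pochhammer_Suc norm_mult using Suc by (intro mult_mono) auto
      qed simp
      have "cmod (pochhammer c (Suc k)) * cmod (c + of_nat n) \<le> cmod c * cmod (pochhammer (c + of_nat n) (Suc k))"
        unfolding pochhammer_rec norm_mult using mono[of "c + 1" k] c
        by (simp add: add_ac mult_left_mono mult_ac)
      moreover have "cmod (pochhammer c (Suc k)) > 0" "cmod (pochhammer (c + of_nat n) (Suc k)) > 0" "cmod (c + of_nat n) > 0"
        using pochhammer_nonzero[OF cn] pochhammer_nonzero[OF nn[of "c + of_nat n"]] not_nonpos_Int_add_nat[OF cn] c
        by (simp_all del: pochhammer_Suc)
      ultimately have "1 / cmod (pochhammer (c + of_nat n) (Suc k)) \<le> cmod c / cmod (c + of_nat n) * (1 / cmod (pochhammer c (Suc k)))"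
        by (simp add: divide_simps mult_ac del: pochhammer_Suc)
      from mult_left_mono[OF this, of "cmod (pochhammer a (Suc k) * pochhammer b (Suc k) / fact (Suc k))"]
      show ?thesis unfolding hyp_coeff_def norm_divide norm_mult
        by (simp add: mult_ac del: pochhammer_Suc fact_Suc)
    qed
    have B1: "cmod (hyp2F1 a b (c + of_nat n) 1 - 1) \<le> cmod c / cmod (c + of_nat n) * M" for n
    proof -
      have re': "Re (c + of_nat n - a - b) > 0" and c': "c + of_nat n \<notin> \<int>\<^sub>\<le>\<^sub>0" using re c nn[of "c + of_nat n"] by auto
      note s = hyp_coeff_abs_summable(1)[OF c' re']
      have "hyp2F1 a b (c + of_nat n) 1 = 1 + (\<Sum>k. hyp_coeff a b (c + of_nat n) (Suc k))"
        unfolding hyp2F1_eq using suminf_split_head[OF summable_norm_cancel[OF s]] by simp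
      then have "cmod (hyp2F1 a b (c + of_nat n) 1 - 1) = cmod (\<Sum>k. hyp_coeff a b (c + of_nat n) (Suc k))" by simp
      also have "\<dots> \<le> (\<Sum>k. cmod (hyp_coeff a b (c + of_nat n) (Suc k)))"
        using s by (intro summable_norm) (subst summable_Suc_iff)
      also have "\<dots> \<le> (\<Sum>k. cmod c / cmod (c + of_nat n) * cmod (hyp_coeff a b c (Suc k)))"
        using s by (intro suminf_le bound summable_mult sM) (subst summable_Suc_iff)
      also have "\<dots> = cmod c / cmod (c + of_nat n) * M"
        unfolding M_def by (rule suminf_mult[OF sM])
      finally show ?thesis .
    qed
    have B2: "(\<lambda>n. cmod c / cmod (c + of_nat n) * M) \<longlonglongrightarrow> 0"
    proof -
      have "filterlim (\<lambda>n. cmod (c + of_nat n)) at_top sequentially"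
      proof (rule filterlim_at_top_mono)
        show "filterlim (\<lambda>n. real n) at_top sequentially" by (rule filterlim_real_sequentially)
        have "real n \<le> cmod (c + of_nat n)" for n
        proof -
          have "real n \<le> Re (c + of_nat n)" using c by simp
          also have "\<dots> \<le> cmod (c + of_nat n)" by (rule complex_Re_le_cmod)
          finally show ?thesis .
        qed
        then show "\<forall>\<^sub>F n in sequentially. real n \<le> cmod (c + of_nat n)" by (rule always_eventually[OF allI])
      qed
      then have "(\<lambda>n. cmod c / cmod (c + of_nat n)) \<longlonglongrightarrow> 0"
        by (intro tendsto_divide_0[OF tendsto_const] filterlim_at_top_imp_at_infinity)
      from tendsto_mult_left_zero[OF this] show ?thesis .
    qed
    have "(\<lambda>n. hyp2F1 a b (c + of_nat n) 1 - 1) \<longlonglongrightarrow> 0"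
      by (rule Lim_null_comparison[OF always_eventually[OF allI[OF B1]] B2])
    then show ?thesis by (rule LIM_zero_cancel)
  qed
  have rG: "rGamma c \<noteq> 0" "rGamma d \<noteq> 0" using cn d by (auto simp: rGamma_eq_zero_iff)
  have "(\<lambda>n. rGamma_series (c - a) n * rGamma_series (c - b) n / (rGamma_series c n * rGamma_series d n) * hyp2F1 a b (c + of_nat (Suc n)) 1)
      \<longlonglongrightarrow> rGamma (c - a) * rGamma (c - b) / (rGamma c * rGamma d) * 1"
    using rG by (intro tendsto_intros rGamma_series_LIMSEQ LIMSEQ_Suc[OF lim1]) auto
  moreover have "\<forall>\<^sub>F n in sequentially. rGamma_series (c - a) n * rGamma_series (c - b) n / (rGamma_series c n * rGamma_series d n) * hyp2F1 a b (c + of_nat (Suc n)) 1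
      = hyp2F1 a b c 1"
    using eventually_gt_at_top[of 0]
  proof eventually_elim
    case (elim n)
    have p: "pochhammer c (Suc n) \<noteq> 0" "pochhammer d (Suc n) \<noteq> 0" using cn d by (simp_all only: pochhammer_nonzero not_False_eq_True)
    define L where "L = complex_of_real (ln (real n))"
    \<comment> \<open>The powers of n in the four approximations cancel, since (c - a) + (c - b) = c
      + d.\<close>
    have "exp ((c - a) * L) * exp ((c - b) * L) = exp (c * L) * exp (d * L)"
      by (simp add: d_def algebra_simps flip: exp_add)
    then have eq: "rGamma_series (c - a) n * rGamma_series (c - b) n / (rGamma_series c n * rGamma_series d n)
        = pochhammer (c - a) (Suc n) * pochhammer (c - b) (Suc n) / (pochhammer c (Suc n) * pochhammer d (Suc n))"
      unfolding rGamma_series_def L_def[symmetric] Suc_eq_plus1[symmetric] using p by (simp add: divide_simps del: pochhammer_Suc) 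
    show ?case unfolding eq using step[of "Suc n"] p by (simp add: field_simps del: of_nat_Suc pochhammer_Suc)
  qed
  ultimately have "(\<lambda>n. hyp2F1 a b c 1) \<longlonglongrightarrow> rGamma (c - a) * rGamma (c - b) / (rGamma c * rGamma d)"
    using Lim_transform_eventually by fastforce
  then have "hyp2F1 a b c 1 = rGamma (c - a) * rGamma (c - b) / (rGamma c * rGamma d)"
    by (simp add: LIMSEQ_const_iff)
  then show ?thesis by (simp add: rGamma_inverse_Gamma d_def field_simps)
qed

lemma hyp2F1_continuous_cball:
  assumes c: "c \<notin> \<int>\<^sub>\<le>\<^sub>0" and re: "Re (c - a - b) > 0"
  shows "continuous_on (cball 0 1) (hyp2F1 a b c)"
proof -
  have "uniform_limit (cball 0 1) (\<lambda>n z. \<Sum>i<n. hyp_coeff a b c i * z ^ i) (\<lambda>z. \<Sum>i. hyp_coeff a b c i * z ^ i) sequentially"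
  proof (rule Weierstrass_m_test)
    fix n and z :: complex assume "z \<in> cball 0 1"
    then have "cmod z ^ n \<le> 1" by (simp add: power_le_one)
    then show "norm (hyp_coeff a b c n * z ^ n) \<le> cmod (hyp_coeff a b c n)"
      unfolding norm_mult norm_power by (rule mult_left_le) simp
  qed (rule hyp_coeff_abs_summable(1)[OF c re])
  then have "continuous_on (cball 0 1) (\<lambda>z. \<Sum>i. hyp_coeff a b c i * z ^ i)"
    by (rule uniform_limit_theorem[rotated]) (auto intro!: always_eventually continuous_intros)
  then show ?thesis by (simp add: hyp2F1_eq[abs_def])
qed

section \<open>The hypergeometric system on the lens around (0,1)\<close>

text \<open>Both power series, in z and in 1 - z, converge here. The set is convex, symmetric under
  z -> 1 - z and meets the real line in (0,1).\<close>

definition lens :: "complex set" where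
  "lens = ball 0 1 \<inter> ball 1 1"

lemma mem_lens: "z \<in> lens \<longleftrightarrow> cmod z < 1 \<and> cmod (1 - z) < 1"
  by (auto simp: lens_def dist_norm)

lemma open_lens: "open lens" and convex_lens: "convex lens"
  by (auto simp: lens_def intro: convex_Int)

lemma lens_minus: "z \<in> lens \<Longrightarrow> 1 - z \<in> lens"
  by (simp add: mem_lens norm_minus_commute)

lemma lens_of_real: "0 < x \<Longrightarrow> x < 1 \<Longrightarrow> complex_of_real x \<in> lens"
proof -
  assume "0 < x" "x < 1"
  moreover have "1 - complex_of_real x = of_real (1 - x)" by simp
  ultimately show ?thesis unfolding mem_lens by (simp only: norm_of_real) auto
qed

lemma lens_nonzero: "z \<in> lens \<Longrightarrow> z \<noteq> 0 \<and> 1 - z \<noteq> 0"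
  by (auto simp: mem_lens)

text \<open>A real value r \<le> 0 of the quotient would give z = 1 / (1 + r), a real number outside
  (0,1). Hence \<open>Ln\<close> of the quotient is holomorphic on \<open>lens\<close>.\<close>

lemma lens_slit:
  assumes z: "z \<in> lens"
  shows "(1 - z) / z \<notin> \<real>\<^sub>\<le>\<^sub>0"
proof
  assume "(1 - z) / z \<in> \<real>\<^sub>\<le>\<^sub>0"
  then obtain r where r: "(1 - z) / z = of_real r" "r \<le> 0" by (auto elim!: nonpos_Reals_cases)
  then have eq: "(1 + of_real r) * z = 1" using lens_nonzero[OF z] by (simp add: field_simps)
  then have n: "1 + complex_of_real r \<noteq> 0" by auto
  then have "1 + r \<noteq> 0" by (metis of_real_0 of_real_1 of_real_add)
  have "z = 1 / (1 + of_real r)" using n eq by (simp add: eq_divide_eq mult.commute)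
  then have zr: "z = of_real (1 / (1 + r))" by simp
  have 1: "\<bar>1 / (1 + r)\<bar> < 1" "\<bar>1 - 1 / (1 + r)\<bar> < 1"
  proof -
    show "\<bar>1 / (1 + r)\<bar> < 1" using z unfolding mem_lens zr norm_of_real by blast
    have "1 - complex_of_real (1 / (1 + r)) = of_real (1 - 1 / (1 + r))" by simp
    then show "\<bar>1 - 1 / (1 + r)\<bar> < 1" using z unfolding mem_lens zr by (metis norm_of_real)
  qed
  show False
  proof (cases "1 + r > 0")
    case True
    then have "1 / (1 + r) \<ge> 1" using r(2) by (simp add: field_simps)
    then show False using 1(1) by linarith
  next
    case False
    then have "1 / (1 + r) < 0" using \<open>1 + r \<noteq> 0\<close> by simp
    then show False using 1(2) by linarith
  qed
qed

text \<open>After removal of the factor \<open>((1 - z) / z) powr \<sigma>\<close> the hypergeometric equation becomes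
  even in \<open>\<sigma>\<close> and symmetric under \<open>z \<mapsto> 1 - z\<close>. It is written as a first order
  system for \<open>hypv\<close> and \<open>hypw = z (1 - z) hypv'\<close>.\<close>

definition hypF :: "complex \<Rightarrow> complex \<Rightarrow> complex" where
  "hypF \<sigma> = hyp2F1 (1/2 - \<sigma>) (1/2 + \<sigma>) (1 + 2 * \<sigma>)"

definition hypv :: "complex \<Rightarrow> complex \<Rightarrow> complex" where
  "hypv \<sigma> z = exp (- \<sigma> * Ln ((1 - z) / z)) * hypF \<sigma> z"

definition hypw :: "complex \<Rightarrow> complex \<Rightarrow> complex" where
  "hypw \<sigma> z = exp (- \<sigma> * Ln ((1 - z) / z)) * (z * (1 - z) * deriv (hypF \<sigma>) z + \<sigma> * hypF \<sigma> z)"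

lemma imaginary_parameter: "Re \<sigma> = 0 \<Longrightarrow> 1 + 2 * \<sigma> \<notin> \<int>\<^sub>\<le>\<^sub>0"
  by (auto elim!: nonpos_Ints_cases simp: complex_eq_iff)

lemma hypF_0 [simp]: "hypF \<sigma> 0 = 1"
  by (simp add: hypF_def)

lemma hyp_system:
  assumes \<sigma>: "Re \<sigma> = 0" and z: "z \<in> lens"
  shows hypv_deriv: "(hypv \<sigma> has_field_derivative hypw \<sigma> z / (z * (1 - z))) (at z)"
    and hypw_deriv: "(hypw \<sigma> has_field_derivative (1/4 + \<sigma>\<^sup>2 * (1 - z + z\<^sup>2) / (z * (1 - z))) * hypv \<sigma> z) (at z)"
proof -
  have c: "1 + 2 * \<sigma> \<notin> \<int>\<^sub>\<le>\<^sub>0" by (rule imaginary_parameter[OF \<sigma>])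
  have z1: "norm z < 1" using z by (simp add: mem_lens)
  have nz: "z \<noteq> 0" "1 - z \<noteq> 0" using lens_nonzero[OF z] by auto
  define E where "E = (\<lambda>z. exp (- \<sigma> * Ln ((1 - z) / z)))"
  have hv: "hypv \<sigma> = (\<lambda>z. E z * hypF \<sigma> z)"
    and hw: "hypw \<sigma> = (\<lambda>z. E z * (z * (1 - z) * deriv (hypF \<sigma>) z + \<sigma> * hypF \<sigma> z))"
    by (simp_all add: fun_eq_iff hypv_def hypw_def E_def)
  have dL: "((\<lambda>z. Ln ((1 - z) / z)) has_field_derivative - 1 / (z * (1 - z))) (at z)"
  proof -
    have d: "((\<lambda>z. (1 - z) / z) has_field_derivative - 1 / z\<^sup>2) (at z)"
      by (rule DERIV_cong[OF DERIV_divide[OF DERIV_diff[OF DERIV_const DERIV_ident] DERIV_ident nz(1)]])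
         (simp add: power2_eq_square)
    have "((\<lambda>z. Ln ((1 - z) / z)) has_field_derivative inverse ((1 - z) / z) * (- 1 / z\<^sup>2)) (at z)"
      by (rule DERIV_chain2[where g = "\<lambda>z. (1 - z) / z" and f = Ln, OF has_field_derivative_Ln[OF lens_slit[OF z]] d])
    moreover have "inverse ((1 - z) / z) * (- 1 / z\<^sup>2) = - 1 / (z * (1 - z))"
      using nz by (simp add: divide_simps power2_eq_square)
    ultimately show ?thesis by simp
  qed
  \<comment> \<open>The logarithmic derivative of the removed factor is \<sigma> / (z (1 - z)); this
    is the source of the term \<open>\<sigma> * hypF \<sigma> z\<close> in
    \<open>hypw\<close>.\<close>
  have dE: "(E has_field_derivative \<sigma> / (z * (1 - z)) * E z) (at z)"
    unfolding E_def by (rule DERIV_cong[OF DERIV_fun_exp[OF DERIV_cmult[OF dL, of "- \<sigma>"]]]) simp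
  have d0: "(hypF \<sigma> has_field_derivative deriv (hypF \<sigma>) z) (at z)"
    unfolding hypF_def by (rule hyp2F1_has_deriv[OF c z1])
  have d1: "(deriv (hypF \<sigma>) has_field_derivative deriv (deriv (hypF \<sigma>)) z) (at z)"
    unfolding hypF_def by (rule hyp2F1_has_deriv2[OF c z1])
  have ode: "z * (1 - z) * deriv (deriv (hypF \<sigma>)) z + (1 + 2 * \<sigma> - 2 * z) * deriv (hypF \<sigma>) z
     = (1/4 - \<sigma>\<^sup>2) * hypF \<sigma> z"
    using hyp2F1_ode[OF c z1, of "1/2 - \<sigma>" "1/2 + \<sigma>"] unfolding hypF_def[symmetric]
    by (simp add: algebra_simps power2_eq_square)
  show "(hypv \<sigma> has_field_derivative hypw \<sigma> z / (z * (1 - z))) (at z)"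
    unfolding hv hw
  proof -
    have "((\<lambda>z. E z * hypF \<sigma> z) has_field_derivative \<sigma> / (z * (1 - z)) * E z * hypF \<sigma> z + E z * deriv (hypF \<sigma>) z) (at z)"
      by (rule DERIV_cong[OF DERIV_mult[OF dE d0]]) (simp add: mult.commute)
    moreover have "\<sigma> / (z * (1 - z)) * E z * hypF \<sigma> z + E z * deriv (hypF \<sigma>) z
        = E z * (z * (1 - z) * deriv (hypF \<sigma>) z + \<sigma> * hypF \<sigma> z) / (z * (1 - z))"
      using nz by (simp add: add_divide_distrib distrib_left mult_ac)
    ultimately show "((\<lambda>z. E z * hypF \<sigma> z) has_field_derivative
        E z * (z * (1 - z) * deriv (hypF \<sigma>) z + \<sigma> * hypF \<sigma> z) / (z * (1 - z))) (at z)" by simp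
  qed
  define F0 F1 F2 where F: "F0 = hypF \<sigma> z" "F1 = deriv (hypF \<sigma>) z" "F2 = deriv (deriv (hypF \<sigma>)) z"
  show "(hypw \<sigma> has_field_derivative (1/4 + \<sigma>\<^sup>2 * (1 - z + z\<^sup>2) / (z * (1 - z))) * hypv \<sigma> z) (at z)"
    unfolding hv hw
  proof -
    have "((\<lambda>z. E z * (z * (1 - z) * deriv (hypF \<sigma>) z + \<sigma> * hypF \<sigma> z)) has_field_derivative
        \<sigma> / (z * (1 - z)) * E z * (z * (1 - z) * F1 + \<sigma> * F0) + E z * ((1 - 2 * z) * F1 + z * (1 - z) * F2 + \<sigma> * F1)) (at z)"
    proof -
      define k where "k = \<sigma> / (z * (1 - z)) * E z"
      have dz: "((\<lambda>z. z * (1 - z)) has_field_derivative 1 - 2 * z) (at z)"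
        by (auto intro!: derivative_eq_intros)
      show ?thesis
        using DERIV_mult[OF dE DERIV_add[OF DERIV_mult[OF dz d1] DERIV_cmult[OF d0]]]
        unfolding F[symmetric] k_def[symmetric] by (rule DERIV_cong) algebra
    qed
    moreover have "\<sigma> / (z * (1 - z)) * E z * (z * (1 - z) * F1 + \<sigma> * F0) + E z * ((1 - 2 * z) * F1 + z * (1 - z) * F2 + \<sigma> * F1)
       = (1/4 + \<sigma>\<^sup>2 * (1 - z + z\<^sup>2) / (z * (1 - z))) * (E z * F0)"
    proof -
      \<comment> \<open>With the name r for the reciprocal of z (1 - z) the claim is a polynomial
        identity modulo r z (1 - z) = 1 and the hypergeometric equation.\<close>
      define r where "r = 1 / (z * (1 - z))"
      have r: "r * (z * (1 - z)) = 1" using nz by (simp add: r_def)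
      have "\<sigma> * r * E z * (z * (1 - z) * F1 + \<sigma> * F0) + E z * ((1 - 2 * z) * F1 + z * (1 - z) * F2 + \<sigma> * F1)
       = (1/4 + \<sigma>\<^sup>2 * (1 - z + z\<^sup>2) * r) * (E z * F0)"
      proof -
        have o: "z * (1 - z) * F2 = (1/4 - \<sigma>\<^sup>2) * F0 - (1 + 2 * \<sigma> - 2 * z) * F1"
          unfolding eq_diff_eq using ode unfolding F[symmetric] .
        have s: "1 - z + z\<^sup>2 = 1 - z * (1 - z)" by (simp add: algebra_simps power2_eq_square)
        have "\<sigma> * r * E z * (z * (1 - z) * F1 + \<sigma> * F0) + E z * ((1 - 2 * z) * F1 + z * (1 - z) * F2 + \<sigma> * F1)
            = E z * (\<sigma> * (r * (z * (1 - z))) * F1 + \<sigma>\<^sup>2 * r * F0 + ((1 - 2 * z) * F1 + z * (1 - z) * F2 + \<sigma> * F1))"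
          by algebra
        also have "\<dots> = E z * ((1/4 - \<sigma>\<^sup>2 + \<sigma>\<^sup>2 * r) * F0)" unfolding o r by algebra
        also have "1/4 - \<sigma>\<^sup>2 + \<sigma>\<^sup>2 * r = 1/4 + (\<sigma>\<^sup>2 * r - \<sigma>\<^sup>2 * (r * (z * (1 - z))))" unfolding r by simp
        also have "\<sigma>\<^sup>2 * r - \<sigma>\<^sup>2 * (r * (z * (1 - z))) = \<sigma>\<^sup>2 * (1 - z + z\<^sup>2) * r"
          by algebra
        finally show ?thesis by algebra
      qed
      then show ?thesis by (simp add: r_def)
    qed
    ultimately show "((\<lambda>z. E z * (z * (1 - z) * deriv (hypF \<sigma>) z + \<sigma> * hypF \<sigma> z)) has_field_derivative
        (1/4 + \<sigma>\<^sup>2 * (1 - z + z\<^sup>2) / (z * (1 - z))) * (E z * hypF \<sigma> z)) (at z)" by (simp add: F)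
  qed
qed

text \<open>For x in (0,1) the logarithm is real, so an imaginary \<sigma> gives an exponential of
  modulus 1: it oscillates as x tends to 0 but does no harm to a null function.\<close>

lemma exp_Ln_imaginary_tendsto:
  assumes "Re \<sigma> = 0" and "(g \<longlongrightarrow> 0) (at_right 0)"
  shows "((\<lambda>x::real. exp (\<sigma> * Ln ((1 - of_real x) / of_real x)) * g x) \<longlongrightarrow> 0) (at_right 0)"
proof (rule Lim_null_comparison[OF _ tendsto_norm_zero[OF assms(2)]])
  have "eventually (\<lambda>x::real. x \<in> {0<..<1}) (at_right 0)" by (rule eventually_at_right_real) simp
  then show "\<forall>\<^sub>F x in at_right 0. cmod (exp (\<sigma> * Ln ((1 - of_real x) / of_real x)) * g x) \<le> cmod (g x)"
  proof eventually_elim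
    case (elim x)
    have "Ln ((1 - of_real x) / of_real x) = complex_of_real (ln ((1 - x) / x))"
      using elim by (simp flip: Ln_of_real)
    then show ?case using assms(1) by (simp add: norm_mult)
  qed
qed

lemma hypF_tendsto:
  assumes "Re \<sigma> = 0"
  shows "((\<lambda>x::real. hypF \<sigma> (of_real x)) \<longlongrightarrow> 1) (at_right 0)"
    and "((\<lambda>x::real. of_real x * (1 - of_real x) * deriv (hypF \<sigma>) (of_real x)) \<longlongrightarrow> 0) (at_right 0)"
proof -
  have x: "((\<lambda>x::real. complex_of_real x) \<longlongrightarrow> 0) (at_right 0)"
    by (rule tendsto_eq_intros | simp)+
  have hol: "hypF \<sigma> holomorphic_on ball 0 1"
    unfolding hypF_def by (rule hyp2F1_holomorphic[OF imaginary_parameter[OF assms]])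
  have c: "isCont (hypF \<sigma>) 0" "isCont (deriv (hypF \<sigma>)) 0"
    using holomorphic_on_imp_continuous_on[OF hol] holomorphic_on_imp_continuous_on[OF holomorphic_deriv[OF hol open_ball]]
    by (auto simp: continuous_on_eq_continuous_at)
  show "((\<lambda>x::real. hypF \<sigma> (of_real x)) \<longlongrightarrow> 1) (at_right 0)"
    using isCont_tendsto_compose[OF c(1) x] by simp
  have "((\<lambda>x::real. of_real x * (1 - of_real x) * deriv (hypF \<sigma>) (of_real x)) \<longlongrightarrow> 0 * (1 - 0) * deriv (hypF \<sigma>) 0) (at_right 0)"
    by (intro tendsto_intros x isCont_tendsto_compose[OF c(2)])
  then show "((\<lambda>x::real. of_real x * (1 - of_real x) * deriv (hypF \<sigma>) (of_real x)) \<longlongrightarrow> 0) (at_right 0)" by simp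
qed

text \<open>The coefficient matrix of the system is off-diagonal, hence of trace 0.\<close>

lemma system_wronskian_constant:
  assumes V1: "\<And>z. z \<in> lens \<Longrightarrow> (V1 has_field_derivative W1 z / (z * (1 - z))) (at z)"
    and W1: "\<And>z. z \<in> lens \<Longrightarrow> (W1 has_field_derivative (1/4 + \<sigma>\<^sup>2 * (1 - z + z\<^sup>2) / (z * (1 - z))) * V1 z) (at z)"
    and V2: "\<And>z. z \<in> lens \<Longrightarrow> (V2 has_field_derivative W2 z / (z * (1 - z))) (at z)"
    and W2: "\<And>z. z \<in> lens \<Longrightarrow> (W2 has_field_derivative (1/4 + \<sigma>\<^sup>2 * (1 - z + z\<^sup>2) / (z * (1 - z))) * V2 z) (at z)"
  obtains k where "\<And>z. z \<in> lens \<Longrightarrow> V1 z * W2 z - W1 z * V2 z = k"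
proof -
  have "((\<lambda>z. V1 z * W2 z - W1 z * V2 z) has_field_derivative 0) (at z within lens)" if z: "z \<in> lens" for z
    by (rule has_field_derivative_at_within,
        rule DERIV_cong[OF DERIV_diff[OF DERIV_mult[OF V1[OF z] W2[OF z]] DERIV_mult[OF W1[OF z] V2[OF z]]]])
       (simp add: algebra_simps)
  then have "\<exists>k. \<forall>z\<in>lens. V1 z * W2 z - W1 z * V2 z = k"
    by (rule has_field_derivative_zero_constant[OF convex_lens])
  then show ?thesis using that by blast
qed

text \<open>The exponential factors for \<sigma> and -\<sigma> cancel in the Wronskian, so its
  constant value is the limit at 0, where both series are 1 and the terms with z (1 - z)
  vanish.\<close>

lemma hyp_wronskian:
  assumes \<sigma>: "Re \<sigma> = 0" and z: "z \<in> lens"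
  shows "hypv \<sigma> z * hypw (- \<sigma>) z - hypw \<sigma> z * hypv (- \<sigma>) z = - 2 * \<sigma>"
proof -
  have m\<sigma>: "Re (- \<sigma>) = 0" using \<sigma> by simp
  obtain k where k: "\<And>z. z \<in> lens \<Longrightarrow> hypv \<sigma> z * hypw (- \<sigma>) z - hypw \<sigma> z * hypv (- \<sigma>) z = k"
    using system_wronskian_constant[of "hypv \<sigma>" "hypw \<sigma>" \<sigma> "hypv (- \<sigma>)" "hypw (- \<sigma>)"]
      hyp_system[OF \<sigma>] hyp_system[OF m\<sigma>] by (metis power2_minus)
  have eq: "hypv \<sigma> z * hypw (- \<sigma>) z - hypw \<sigma> z * hypv (- \<sigma>) z
      = hypF \<sigma> z * (z * (1 - z) * deriv (hypF (- \<sigma>)) z - \<sigma> * hypF (- \<sigma>) z)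
        - (z * (1 - z) * deriv (hypF \<sigma>) z + \<sigma> * hypF \<sigma> z) * hypF (- \<sigma>) z" for z
  proof -
    have "exp (- \<sigma> * Ln ((1 - z) / z)) * exp (- (- \<sigma>) * Ln ((1 - z) / z)) = 1" by (simp flip: exp_add)
    then show ?thesis unfolding hypv_def hypw_def by algebra
  qed
  have "((\<lambda>x::real. hypF \<sigma> (of_real x) * (of_real x * (1 - of_real x) * deriv (hypF (- \<sigma>)) (of_real x) - \<sigma> * hypF (- \<sigma>) (of_real x))
        - (of_real x * (1 - of_real x) * deriv (hypF \<sigma>) (of_real x) + \<sigma> * hypF \<sigma> (of_real x)) * hypF (- \<sigma>) (of_real x))
      \<longlongrightarrow> 1 * (0 - \<sigma> * 1) - (0 + \<sigma> * 1) * 1) (at_right 0)"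
    by (intro tendsto_intros hypF_tendsto \<sigma> m\<sigma>)
  moreover have "eventually (\<lambda>x::real. x \<in> {0<..<1}) (at_right 0)" by (rule eventually_at_right_real) simp
  then have "\<forall>\<^sub>F x::real in at_right 0. hypF \<sigma> (of_real x) * (of_real x * (1 - of_real x) * deriv (hypF (- \<sigma>)) (of_real x) - \<sigma> * hypF (- \<sigma>) (of_real x))
        - (of_real x * (1 - of_real x) * deriv (hypF \<sigma>) (of_real x) + \<sigma> * hypF \<sigma> (of_real x)) * hypF (- \<sigma>) (of_real x) = k"
    by eventually_elim (use k lens_of_real eq in auto)
  ultimately have "((\<lambda>x::real. k) \<longlongrightarrow> 1 * (0 - \<sigma> * 1) - (0 + \<sigma> * 1) * 1) (at_right 0)"
    by (rule Lim_transform_eventually)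
  then have "k = - 2 * \<sigma>" by (simp add: tendsto_const_iff)
  then show ?thesis using k[OF z] by simp
qed

text \<open>Cramer's rule: the Wronskians of V with the two basic solutions are constants, and the
  basic Wronskian -2 \<sigma> is not 0.\<close>

lemma hyp_solution_combination:
  assumes \<sigma>: "Re \<sigma> = 0" "\<sigma> \<noteq> 0"
    and V: "\<And>z. z \<in> lens \<Longrightarrow> (V has_field_derivative W z / (z * (1 - z))) (at z)"
    and W: "\<And>z. z \<in> lens \<Longrightarrow> (W has_field_derivative (1/4 + \<sigma>\<^sup>2 * (1 - z + z\<^sup>2) / (z * (1 - z))) * V z) (at z)"
  obtains \<alpha> \<beta> where "\<And>z. z \<in> lens \<Longrightarrow> V z = \<alpha> * hypv \<sigma> z + \<beta> * hypv (- \<sigma>) z"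
    and "\<And>z. z \<in> lens \<Longrightarrow> W z = \<alpha> * hypw \<sigma> z + \<beta> * hypw (- \<sigma>) z"
proof -
  have m\<sigma>: "Re (- \<sigma>) = 0" using \<sigma> by simp
  obtain k1 where k1: "\<And>z. z \<in> lens \<Longrightarrow> V z * hypw \<sigma> z - W z * hypv \<sigma> z = k1"
    using system_wronskian_constant[of V W \<sigma> "hypv \<sigma>" "hypw \<sigma>"] V W hyp_system[OF \<sigma>(1)] by metis
  obtain k2 where k2: "\<And>z. z \<in> lens \<Longrightarrow> V z * hypw (- \<sigma>) z - W z * hypv (- \<sigma>) z = k2"
    using system_wronskian_constant[of V W \<sigma> "hypv (- \<sigma>)" "hypw (- \<sigma>)"] V W hyp_system[OF m\<sigma>] by (metis power2_minus)
  show ?thesis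
  proof (rule that[of "- k2 / (2 * \<sigma>)" "k1 / (2 * \<sigma>)"])
    fix z assume z: "z \<in> lens"
    note w = hyp_wronskian[OF \<sigma>(1) z]
    have "- 2 * \<sigma> * V z = k2 * hypv \<sigma> z - k1 * hypv (- \<sigma>) z"
      unfolding k1[OF z, symmetric] k2[OF z, symmetric] w[symmetric] by (simp add: algebra_simps)
    then show "V z = - k2 / (2 * \<sigma>) * hypv \<sigma> z + k1 / (2 * \<sigma>) * hypv (- \<sigma>) z"
      using \<sigma> by (simp add: field_simps)
    have "- 2 * \<sigma> * W z = k2 * hypw \<sigma> z - k1 * hypw (- \<sigma>) z"
      unfolding k1[OF z, symmetric] k2[OF z, symmetric] w[symmetric] by (simp add: algebra_simps)
    then show "W z = - k2 / (2 * \<sigma>) * hypw \<sigma> z + k1 / (2 * \<sigma>) * hypw (- \<sigma>) z"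
      using \<sigma> by (simp add: field_simps)
  qed
qed

text \<open>Only the coefficient \<beta> of \<open>hypv (- \<sigma>)\<close> is evaluated, from the
  behaviour as z tends to 0. There 1 - z reaches the boundary point 1 with Re (c - a - b) = 0, so
  the value of the series cannot be used. A combination of the solution and its derivative leads to
  the series with c + 1, to which Gauss's theorem applies.\<close>

theorem hyp_connection:
  assumes \<sigma>: "Re \<sigma> = 0" "\<sigma> \<noteq> 0"
  obtains \<alpha> where "\<And>z. z \<in> lens \<Longrightarrow> hypv \<sigma> (1 - z) = \<alpha> * hypv \<sigma> z +
    Gamma (1 + 2 * \<sigma>) * Gamma (2 * \<sigma>) / (Gamma (1/2 + \<sigma>) * Gamma (1/2 + 3 * \<sigma>)) * hypv (- \<sigma>) z"
proof -
  have m\<sigma>: "Re (- \<sigma>) = 0" using \<sigma> by simp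
  have cn: "1 + 2 * \<sigma> \<notin> \<int>\<^sub>\<le>\<^sub>0" by (rule imaginary_parameter[OF \<sigma>(1)])
  \<comment> \<open>The system is invariant under z -> 1 - z; the sign in \<open>W\<close> comes
    from the inner derivative.\<close>
  define V W where VW: "V = (\<lambda>z. hypv \<sigma> (1 - z))" "W = (\<lambda>z. - hypw \<sigma> (1 - z))"
  have V: "(V has_field_derivative W z / (z * (1 - z))) (at z)" if z: "z \<in> lens" for z
  proof -
    have d: "((\<lambda>z. 1 - z) has_field_derivative - 1) (at z)" for z :: complex by (auto intro!: derivative_eq_intros)
    show ?thesis
      using DERIV_chain2[OF hypv_deriv[OF \<sigma>(1) lens_minus[OF z]] d] unfolding VW by (simp add: mult.commute)
  qed
  have W: "(W has_field_derivative (1/4 + \<sigma>\<^sup>2 * (1 - z + z\<^sup>2) / (z * (1 - z))) * V z) (at z)" if z: "z \<in> lens" for z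
  proof -
    have d: "((\<lambda>z. 1 - z) has_field_derivative - 1) (at z)" for z :: complex by (auto intro!: derivative_eq_intros)
    note D = DERIV_minus[OF DERIV_chain2[OF hypw_deriv[OF \<sigma>(1) lens_minus[OF z]] d]]
    have "1 - (1 - z) + (1 - z)\<^sup>2 = 1 - z + z\<^sup>2" "(1 - z) * (1 - (1 - z)) = z * (1 - z)"
      by (simp_all add: power2_eq_square algebra_simps)
    then show ?thesis unfolding VW by (intro DERIV_cong[OF D]) (simp only: mult_minus_right mult_1_right minus_minus)
  qed
  obtain \<alpha> \<beta> where v: "\<And>z. z \<in> lens \<Longrightarrow> V z = \<alpha> * hypv \<sigma> z + \<beta> * hypv (- \<sigma>) z"
    and w: "\<And>z. z \<in> lens \<Longrightarrow> W z = \<alpha> * hypw \<sigma> z + \<beta> * hypw (- \<sigma>) z"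
    using hyp_solution_combination[OF \<sigma> V W] by blast
  define G where "G = hyp2F1 (1/2 - \<sigma>) (1/2 + \<sigma>) (1 + 2 * \<sigma> + 1)"
  define K where "K = (1/2 + 3 * \<sigma>) * (1/2 + \<sigma>) / (1 + 2 * \<sigma>)"
  have c0: "1 + 2 * \<sigma> \<noteq> 0" using \<sigma>(1) by (auto simp: complex_eq_iff)
  have c0': "4 + \<sigma> * 8 \<noteq> 0" using \<sigma>(1) by (auto simp: complex_eq_iff)
  define E where "E = (\<lambda>l. exp (- \<sigma> * Ln ((1 - l) / l)))"
  have E2: "E l * E l = exp ((- 2 * \<sigma>) * Ln ((1 - l) / l))" for l by (simp add: E_def mult.assoc flip: exp_add)
  \<comment> \<open>The equation for the second component, with F'(1 - l) eliminated by contiguity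
    and F(1 - l) by the equation for the first. The term
    \<open>\<sigma> * hypF \<sigma> (1 - l)\<close> cancels the one oscillating contribution of
    \<alpha> that does not decay.\<close>
  have key: "(1 - l) * (K * G (1 - l)) + 2 * \<sigma> * l * (\<alpha> * (E l * E l) * hypF \<sigma> l + \<beta> * hypF (- \<sigma>) l)
     = - (E l * E l) * \<alpha> * (l * (1 - l) * deriv (hypF \<sigma>) l) + \<beta> * (2 * \<sigma> * hypF (- \<sigma>) l - l * (1 - l) * deriv (hypF (- \<sigma>)) l)"
    if l: "l \<in> lens" for l
  proof -
    define e1 where "e1 = exp (\<sigma> * Ln ((1 - l) / l))"
    have e1: "E l * e1 = 1" by (simp add: E_def e1_def flip: exp_add)
    have Ln1: "Ln ((1 - (1 - l)) / (1 - l)) = - Ln ((1 - l) / l)"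
      using Ln_inverse[OF lens_slit[OF l]] by simp
    have nl: "norm (1 - l) < 1" using l by (simp add: mem_lens)
    have cont: "(1 + 2 * \<sigma>) * l * deriv (hypF \<sigma>) (1 - l) = (1/2 + 3 * \<sigma>) * (1/2 + \<sigma>) * G (1 - l) - (1 + 2 * \<sigma>) * (2 * \<sigma>) * hypF \<sigma> (1 - l)"
      using hyp2F1_contiguous[OF cn nl, of "1/2 - \<sigma>" "1/2 + \<sigma>"] unfolding hypF_def G_def by (simp add: algebra_simps)
    have KG: "l * deriv (hypF \<sigma>) (1 - l) = K * G (1 - l) - 2 * \<sigma> * hypF \<sigma> (1 - l)"
    proof -
      have "(1 + 2 * \<sigma>) * (l * deriv (hypF \<sigma>) (1 - l)) = (1 + 2 * \<sigma>) * (K * G (1 - l) - 2 * \<sigma> * hypF \<sigma> (1 - l))"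
      proof -
        have "(1 + 2 * \<sigma>) * K = (1/2 + 3 * \<sigma>) * (1/2 + \<sigma>)" using c0 by (simp add: K_def)
        then show ?thesis using cont by algebra
      qed
      then show ?thesis using c0 by (metis mult_cancel_left)
    qed
    have 1: "e1 * hypF \<sigma> (1 - l) = \<alpha> * (E l * hypF \<sigma> l) + \<beta> * (e1 * hypF (- \<sigma>) l)"
      using v[OF l] unfolding VW hypv_def Ln1 by (simp add: E_def e1_def)
    have 2: "- (e1 * ((1 - l) * l * deriv (hypF \<sigma>) (1 - l) + \<sigma> * hypF \<sigma> (1 - l)))
      = \<alpha> * (E l * (l * (1 - l) * deriv (hypF \<sigma>) l + \<sigma> * hypF \<sigma> l)) + \<beta> * (e1 * (l * (1 - l) * deriv (hypF (- \<sigma>)) l - \<sigma> * hypF (- \<sigma>) l))"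
      using w[OF l] unfolding VW hypw_def Ln1 by (simp add: E_def e1_def)
    have x: "hypF \<sigma> (1 - l) = \<alpha> * (E l * E l) * hypF \<sigma> l + \<beta> * hypF (- \<sigma>) l" using 1 e1 by algebra
    have "- ((1 - l) * (l * deriv (hypF \<sigma>) (1 - l)) + \<sigma> * hypF \<sigma> (1 - l))
      = \<alpha> * (E l * E l) * (l * (1 - l) * deriv (hypF \<sigma>) l + \<sigma> * hypF \<sigma> l) + \<beta> * (l * (1 - l) * deriv (hypF (- \<sigma>)) l - \<sigma> * hypF (- \<sigma>) l)"
      using 2 e1 by algebra
    then show ?thesis unfolding KG x by (simp add: algebra_simps)
  qed
  have "((\<lambda>x::real. (1 - of_real x) * (K * G (1 - of_real x))) \<longlongrightarrow> (1 - 0) * (K * G 1)) (at_right 0)"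
  proof -
    have x: "((\<lambda>x::real. complex_of_real x) \<longlongrightarrow> 0) (at_right 0)" by (rule tendsto_eq_intros | simp)+
    have "continuous_on (cball 0 1) G"
      unfolding G_def by (rule hyp2F1_continuous_cball[OF not_nonpos_Int_Suc[OF cn]]) (use \<sigma> in simp)
    then have "(G \<longlongrightarrow> G 1) (at 1 within cball 0 1)" by (simp add: continuous_on_def)
    moreover have "filterlim (\<lambda>x::real. 1 - complex_of_real x) (at 1 within cball 0 1) (at_right 0)"
      unfolding filterlim_at
    proof
      show "((\<lambda>x::real. 1 - complex_of_real x) \<longlongrightarrow> 1) (at_right 0)" using tendsto_diff[OF tendsto_const x, of 1] by simp
      have "eventually (\<lambda>x::real. x \<in> {0<..<1}) (at_right 0)" by (rule eventually_at_right_real) simp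
      then show "\<forall>\<^sub>F x::real in at_right 0. 1 - complex_of_real x \<in> cball 0 1 \<and> 1 - complex_of_real x \<noteq> 1"
      proof eventually_elim
        case (elim x)
        have "1 - complex_of_real x = of_real (1 - x)" by simp
        then have "cmod (1 - complex_of_real x) = \<bar>1 - x\<bar>" by (simp only: norm_of_real)
        then show ?case using elim by simp
      qed
    qed
    ultimately have "((\<lambda>x::real. G (1 - of_real x)) \<longlongrightarrow> G 1) (at_right 0)" by (rule filterlim_compose)
    then show ?thesis by (intro tendsto_intros x)
  qed
  \<comment> \<open>Each term with \<alpha> now carries a factor tending to 0 beside the oscillation
    of modulus 1, so only 2 \<sigma> \<beta> survives.\<close>
  moreover have "((\<lambda>x::real. (1 - of_real x) * (K * G (1 - of_real x))) \<longlongrightarrow> \<beta> * (2 * \<sigma>)) (at_right 0)"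
  proof (rule Lim_transform_eventually)
    let ?l = "\<lambda>x::real. complex_of_real x"
    have x: "((\<lambda>x::real. complex_of_real x) \<longlongrightarrow> 0) (at_right 0)" by (rule tendsto_eq_intros | simp)+
    have m2: "Re (- 2 * \<sigma>) = 0" using \<sigma> by simp
    note F = hypF_tendsto[OF \<sigma>(1)] and F' = hypF_tendsto[OF m\<sigma>]
    have A: "((\<lambda>x. E (?l x) * E (?l x) * (\<alpha> * (?l x * (1 - ?l x) * deriv (hypF \<sigma>) (?l x)))) \<longlongrightarrow> 0) (at_right 0)"
      unfolding E2 by (rule exp_Ln_imaginary_tendsto[OF m2]) (use tendsto_mult_right_zero[OF F(2)] in simp)
    have B: "((\<lambda>x. E (?l x) * E (?l x) * (2 * \<sigma> * ?l x * \<alpha> * hypF \<sigma> (?l x))) \<longlongrightarrow> 0) (at_right 0)"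
      unfolding E2
    proof (rule exp_Ln_imaginary_tendsto[OF m2])
      have "((\<lambda>x. 2 * \<sigma> * ?l x * \<alpha> * hypF \<sigma> (?l x)) \<longlongrightarrow> 2 * \<sigma> * 0 * \<alpha> * 1) (at_right 0)" by (intro tendsto_intros x F)
      then show "((\<lambda>x. 2 * \<sigma> * ?l x * \<alpha> * hypF \<sigma> (?l x)) \<longlongrightarrow> 0) (at_right 0)" by simp
    qed
    have "((\<lambda>x. - (E (?l x) * E (?l x) * (\<alpha> * (?l x * (1 - ?l x) * deriv (hypF \<sigma>) (?l x))))
        + \<beta> * (2 * \<sigma> * hypF (- \<sigma>) (?l x) - ?l x * (1 - ?l x) * deriv (hypF (- \<sigma>)) (?l x))
        - E (?l x) * E (?l x) * (2 * \<sigma> * ?l x * \<alpha> * hypF \<sigma> (?l x)) - 2 * \<sigma> * ?l x * \<beta> * hypF (- \<sigma>) (?l x))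
      \<longlongrightarrow> - 0 + \<beta> * (2 * \<sigma> * 1 - 0) - 0 - 2 * \<sigma> * 0 * \<beta> * 1) (at_right 0)"
      by (intro tendsto_intros A B F' x)
    then show "((\<lambda>x. - (E (?l x) * E (?l x) * (\<alpha> * (?l x * (1 - ?l x) * deriv (hypF \<sigma>) (?l x))))
        + \<beta> * (2 * \<sigma> * hypF (- \<sigma>) (?l x) - ?l x * (1 - ?l x) * deriv (hypF (- \<sigma>)) (?l x))
        - E (?l x) * E (?l x) * (2 * \<sigma> * ?l x * \<alpha> * hypF \<sigma> (?l x)) - 2 * \<sigma> * ?l x * \<beta> * hypF (- \<sigma>) (?l x))
      \<longlongrightarrow> \<beta> * (2 * \<sigma>)) (at_right 0)" by simp
    have "eventually (\<lambda>x::real. x \<in> {0<..<1}) (at_right 0)" by (rule eventually_at_right_real) simp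
    then show "\<forall>\<^sub>F x in at_right 0. - (E (?l x) * E (?l x) * (\<alpha> * (?l x * (1 - ?l x) * deriv (hypF \<sigma>) (?l x))))
        + \<beta> * (2 * \<sigma> * hypF (- \<sigma>) (?l x) - ?l x * (1 - ?l x) * deriv (hypF (- \<sigma>)) (?l x))
        - E (?l x) * E (?l x) * (2 * \<sigma> * ?l x * \<alpha> * hypF \<sigma> (?l x)) - 2 * \<sigma> * ?l x * \<beta> * hypF (- \<sigma>) (?l x)
        = (1 - ?l x) * (K * G (1 - ?l x))"
    proof eventually_elim
      case (elim x)
      then show ?case using key[OF lens_of_real[of x]] by (simp add: algebra_simps)
    qed
  qed
  ultimately have "(1 - 0) * (K * G 1) = \<beta> * (2 * \<sigma>)" by (rule tendsto_unique[rotated]) simp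
  then have \<beta>: "\<beta> = K * G 1 / (2 * \<sigma>)" using \<sigma> by (simp add: field_simps)
  \<comment> \<open>With c = 2 + 2 \<sigma> one has c - a - b = 1 + 2 \<sigma>, of real part 1. The
    functional equation of Gamma then lowers the arguments, and the factors are absorbed by K / (2
    \<sigma>).\<close>
  have "G 1 = Gamma (1 + 2 * \<sigma> + 1) * Gamma (2 * \<sigma> + 1) / (Gamma (1/2 + 3 * \<sigma> + 1) * Gamma (1/2 + \<sigma> + 1))"
    unfolding G_def using hyp2F1_gauss[of "1 + 2 * \<sigma> + 1" "1/2 - \<sigma>" "1/2 + \<sigma>"] \<sigma> by (simp add: algebra_simps)
  also have "\<dots> = (1 + 2 * \<sigma>) * Gamma (1 + 2 * \<sigma>) * (2 * \<sigma> * Gamma (2 * \<sigma>)) /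
      ((1/2 + 3 * \<sigma>) * Gamma (1/2 + 3 * \<sigma>) * ((1/2 + \<sigma>) * Gamma (1/2 + \<sigma>)))"
    using \<sigma> by (subst (1 2 3 4) Gamma_plus1) (auto elim!: nonpos_Ints_cases simp: complex_eq_iff)
  finally have G1: "G 1 = \<dots>" .
  have n: "1/2 + 3 * \<sigma> \<noteq> 0" "1/2 + \<sigma> \<noteq> 0" using \<sigma> by (auto simp: complex_eq_iff)
  have "\<beta> = Gamma (1 + 2 * \<sigma>) * Gamma (2 * \<sigma>) / (Gamma (1/2 + \<sigma>) * Gamma (1/2 + 3 * \<sigma>))"
    unfolding \<beta> G1 K_def using n c0 c0' \<sigma>(2) by (simp add: divide_simps) (simp add: algebra_simps)?
  then show ?thesis using that v unfolding VW by blast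
qed

section \<open>The Schwarzian derivative\<close>

definition schwarzian :: "(complex \<Rightarrow> complex) \<Rightarrow> complex \<Rightarrow> complex" where
  "schwarzian f z = deriv (\<lambda>w. deriv (deriv f) w / deriv f w) z - (deriv (deriv f) z / deriv f z)\<^sup>2 / 2"

lemma deriv_eq_on_open:
  assumes "open A" "\<And>w. w \<in> A \<Longrightarrow> f w = g w" "z \<in> A"
  shows "deriv f z = deriv g z"
  using assms by (intro deriv_cong_ev) (auto simp: eventually_nhds)

lemma schwarzian_cong:
  assumes A: "open A" and eq: "\<And>w. w \<in> A \<Longrightarrow> f w = g w" and z: "z \<in> A"
  shows "schwarzian f z = schwarzian g z"
proof -
  have 1: "deriv f w = deriv g w" if "w \<in> A" for w by (rule deriv_eq_on_open[OF A eq that])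
  have 2: "deriv (deriv f) w = deriv (deriv g) w" if "w \<in> A" for w by (rule deriv_eq_on_open[OF A 1 that])
  have "deriv (\<lambda>w. deriv (deriv f) w / deriv f w) z = deriv (\<lambda>w. deriv (deriv g) w / deriv g w) z"
    by (rule deriv_eq_on_open[OF A _ z]) (simp add: 1 2)
  then show ?thesis by (simp add: schwarzian_def 1[OF z] 2[OF z])
qed

lemma schwarzian_holomorphic:
  assumes "f holomorphic_on A" "open A" "\<And>z. z \<in> A \<Longrightarrow> deriv f z \<noteq> 0"
  shows "schwarzian f holomorphic_on A"
  unfolding schwarzian_def using assms by (intro holomorphic_intros holomorphic_deriv) auto

text \<open>For N_f = f''/f' the chain rule gives N_(f o g) = (N_f o g) g' + N_g. In N' - N^2/2 the
  mixed terms cancel because g'' = N_g g'.\<close>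

lemma schwarzian_compose:
  assumes A: "open A" "g holomorphic_on A" "\<And>w. w \<in> A \<Longrightarrow> deriv g w \<noteq> 0" and z: "z \<in> A"
    and B: "open B" "f holomorphic_on B" "\<And>w. w \<in> B \<Longrightarrow> deriv f w \<noteq> 0" and AB: "\<And>w. w \<in> A \<Longrightarrow> g w \<in> B"
  shows "schwarzian (\<lambda>w. f (g w)) z = schwarzian f (g z) * (deriv g z)\<^sup>2 + schwarzian g z"
proof -
  have dg: "(g has_field_derivative deriv g w) (at w)" "(deriv g has_field_derivative deriv (deriv g) w) (at w)" if "w \<in> A" for w
    using that A by (auto intro!: holomorphic_derivI[OF _ A(1)] holomorphic_deriv)
  have df: "(f has_field_derivative deriv f w) (at w)" "(deriv f has_field_derivative deriv (deriv f) w) (at w)" if "w \<in> B" for w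
    using that B by (auto intro!: holomorphic_derivI[OF _ B(1)] holomorphic_deriv)
  have 1: "deriv (\<lambda>w. f (g w)) w = deriv f (g w) * deriv g w" if w: "w \<in> A" for w
    by (rule DERIV_imp_deriv, rule DERIV_chain2[OF df(1)[OF AB[OF w]] dg(1)[OF w]])
  have 2: "deriv (deriv (\<lambda>w. f (g w))) w = deriv (deriv f) (g w) * (deriv g w)\<^sup>2 + deriv f (g w) * deriv (deriv g) w"
    if w: "w \<in> A" for w
  proof -
    have "((\<lambda>w. deriv f (g w) * deriv g w) has_field_derivative
        deriv (deriv f) (g w) * deriv g w * deriv g w + deriv (deriv g) w * deriv f (g w)) (at w)"
      by (rule DERIV_mult[OF DERIV_chain2[OF df(2)[OF AB[OF w]] dg(1)[OF w]] dg(2)[OF w]])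
    then have "deriv (\<lambda>w. deriv f (g w) * deriv g w) w
      = deriv (deriv f) (g w) * (deriv g w)\<^sup>2 + deriv f (g w) * deriv (deriv g) w"
      by (intro DERIV_imp_deriv) (simp add: power2_eq_square mult_ac)
    then show ?thesis using deriv_eq_on_open[OF A(1) 1 w] by simp
  qed
  define Nf where "Nf = (\<lambda>w. deriv (deriv f) w / deriv f w)"
  define Ng where "Ng = (\<lambda>w. deriv (deriv g) w / deriv g w)"
  have N: "deriv (deriv (\<lambda>w. f (g w))) w / deriv (\<lambda>w. f (g w)) w = Nf (g w) * deriv g w + Ng w" if w: "w \<in> A" for w
    unfolding 1[OF w] 2[OF w] Nf_def Ng_def using A(3)[OF w] B(3)[OF AB[OF w]]
    by (simp add: field_simps power2_eq_square)
  have "Nf holomorphic_on B" unfolding Nf_def using B by (intro holomorphic_intros holomorphic_deriv) auto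
  then have dNf: "(Nf has_field_derivative deriv Nf (g z)) (at (g z))" by (rule holomorphic_derivI[OF _ B(1) AB[OF z]])
  have "Ng holomorphic_on A" unfolding Ng_def using A by (intro holomorphic_intros holomorphic_deriv) auto
  then have dNg: "(Ng has_field_derivative deriv Ng z) (at z)" by (rule holomorphic_derivI[OF _ A(1) z])
  have "((\<lambda>w. Nf (g w) * deriv g w + Ng w) has_field_derivative
      (deriv Nf (g z) * deriv g z * deriv g z + deriv (deriv g) z * Nf (g z)) + deriv Ng z) (at z)"
    by (rule DERIV_add[OF DERIV_mult[OF DERIV_chain2[OF dNf dg(1)[OF z]] dg(2)[OF z]] dNg])
  then have "deriv (\<lambda>w. Nf (g w) * deriv g w + Ng w) z
      = deriv Nf (g z) * (deriv g z)\<^sup>2 + deriv (deriv g) z * Nf (g z) + deriv Ng z"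
    by (intro DERIV_imp_deriv) (simp add: power2_eq_square mult_ac)
  then have d: "deriv (\<lambda>w. deriv (deriv (\<lambda>w. f (g w))) w / deriv (\<lambda>w. f (g w)) w) z
      = deriv Nf (g z) * (deriv g z)\<^sup>2 + deriv (deriv g) z * Nf (g z) + deriv Ng z"
    using deriv_eq_on_open[OF A(1) N z] by simp
  have g2: "deriv (deriv g) z = Ng z * deriv g z" using A(3)[OF z] by (simp add: Ng_def)
  have "schwarzian (\<lambda>w. f (g w)) z = deriv Nf (g z) * (deriv g z)\<^sup>2 + deriv (deriv g) z * Nf (g z) + deriv Ng z
      - (Nf (g z) * deriv g z + Ng z)\<^sup>2 / 2"
    unfolding schwarzian_def d N[OF z] by simp
  also have "\<dots> = (deriv Nf (g z) - (Nf (g z))\<^sup>2 / 2) * (deriv g z)\<^sup>2 + (deriv Ng z - (Ng z)\<^sup>2 / 2)"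
    unfolding g2 by (simp add: field_simps power2_eq_square)
  also have "\<dots> = schwarzian f (g z) * (deriv g z)\<^sup>2 + schwarzian g z"
    unfolding schwarzian_def Nf_def[symmetric] Ng_def[symmetric] unfolding Nf_def Ng_def by simp
  finally show ?thesis .
qed

lemma schwarzian_affine_0: "schwarzian (\<lambda>w. a * w + b) z = 0"
proof -
  have 1: "deriv (\<lambda>w. a * w + b) = (\<lambda>_. a)"
    by (intro ext DERIV_imp_deriv) (auto intro!: derivative_eq_intros)
  show ?thesis unfolding schwarzian_def 1 by simp
qed

lemma inverse_holomorphic: "inverse holomorphic_on - {0 :: complex}"
  using holomorphic_on_inverse[of "\<lambda>w. w" "- {0 :: complex}"] by auto

lemma deriv_inverse_fun: "w \<noteq> 0 \<Longrightarrow> deriv inverse w = - 1 / (w :: complex)\<^sup>2"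
  by (rule DERIV_imp_deriv) (auto intro!: derivative_eq_intros simp: field_simps power2_eq_square)

lemma schwarzian_inverse_0:
  assumes "z \<noteq> 0"
  shows "schwarzian inverse z = 0"
proof -
  have op: "open (- {0 :: complex})" by (simp add: open_Compl)
  have 2: "deriv (deriv inverse) w = 2 / w ^ 3" if "w \<noteq> 0" for w :: complex
  proof -
    have "deriv (deriv inverse) w = deriv (\<lambda>w. - 1 / w\<^sup>2) w"
      by (rule deriv_eq_on_open[OF op]) (use that in \<open>auto simp: deriv_inverse_fun\<close>)
    also have "\<dots> = 2 / w ^ 3"
      by (rule DERIV_imp_deriv) (use that in \<open>auto intro!: derivative_eq_intros simp: field_simps power2_eq_square power3_eq_cube\<close>)
    finally show ?thesis .
  qed
  have N: "deriv (deriv inverse) w / deriv inverse w = - 2 / w" if "w \<noteq> 0" for w :: complex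
    unfolding 2[OF that] deriv_inverse_fun[OF that] using that by (simp add: field_simps power2_eq_square power3_eq_cube)
  have "deriv (\<lambda>w. deriv (deriv inverse) w / deriv inverse w) z = deriv (\<lambda>w. - 2 / w) z"
    by (rule deriv_eq_on_open[OF op]) (use assms N in auto)
  also have "\<dots> = 2 / z\<^sup>2"
    by (rule DERIV_imp_deriv) (use assms in \<open>auto intro!: derivative_eq_intros simp: field_simps power2_eq_square\<close>)
  finally show ?thesis unfolding schwarzian_def N[OF assms] using assms by (simp add: power_divide)
qed

lemma schwarzian_affine:
  assumes A: "open A" "f holomorphic_on A" "\<And>w. w \<in> A \<Longrightarrow> deriv f w \<noteq> 0" and z: "z \<in> A" and a: "a \<noteq> 0"
  shows "schwarzian (\<lambda>w. a * f w + b) z = schwarzian f z"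
proof -
  have d: "deriv (\<lambda>w. a * w + b) w = a" for w :: complex
    by (rule DERIV_imp_deriv) (auto intro!: derivative_eq_intros)
  show ?thesis
    using schwarzian_compose[OF A z, of UNIV "\<lambda>w. a * w + b"] a
    by (simp add: schwarzian_affine_0 d holomorphic_intros)
qed

lemma schwarzian_inverse:
  assumes A: "open A" "f holomorphic_on A" "\<And>w. w \<in> A \<Longrightarrow> deriv f w \<noteq> 0" and z: "z \<in> A"
    and nz: "\<And>w. w \<in> A \<Longrightarrow> f w \<noteq> 0"
  shows "schwarzian (\<lambda>w. inverse (f w)) z = schwarzian f z"
  using schwarzian_compose[OF A z, of "- {0}" inverse] nz z
  by (simp add: schwarzian_inverse_0 open_Compl deriv_inverse_fun inverse_holomorphic)

lemma schwarzian_shift: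
  assumes B: "open B" "f holomorphic_on B" "\<And>w. w \<in> B \<Longrightarrow> deriv f w \<noteq> 0" and z: "z + 1 \<in> B"
  shows "schwarzian (\<lambda>w. f (w + 1)) z = schwarzian f (z + 1)"
proof -
  have d: "deriv (\<lambda>w. w + 1) w = 1" for w :: complex
    by (rule DERIV_imp_deriv) (auto intro!: derivative_eq_intros)
  have s: "schwarzian (\<lambda>w. w + 1) z = 0" using schwarzian_affine_0[of 1 1 z] by simp
  have "open ((\<lambda>w. w + 1) -` B)" by (intro open_vimage B continuous_intros)
  then show ?thesis
    using schwarzian_compose[of "(\<lambda>w. w + 1) -` B" "\<lambda>w. w + 1" z B f] B z
    by (simp add: d s holomorphic_intros)
qed

lemma deriv_neg_inverse_fun: "w \<noteq> 0 \<Longrightarrow> deriv (\<lambda>w. - 1 / w) w = 1 / (w :: complex)\<^sup>2"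
  by (rule DERIV_imp_deriv) (auto intro!: derivative_eq_intros simp: field_simps power2_eq_square)

text \<open>The map itself has Schwarzian 0, and the square of its derivative 1 / z^2 is the source
  of the weight 4.\<close>

lemma schwarzian_neg_inverse:
  assumes B: "open B" "f holomorphic_on B" "\<And>w. w \<in> B \<Longrightarrow> deriv f w \<noteq> 0" and z: "- 1 / z \<in> B" "z \<noteq> 0"
  shows "schwarzian (\<lambda>w. f (- 1 / w)) z = schwarzian f (- 1 / z) / z ^ 4"
proof -
  have "(\<lambda>w. - 1 / w) = (\<lambda>w::complex. (- 1) * inverse w + 0)" by (simp add: field_simps)
  then have s: "schwarzian (\<lambda>w. - 1 / w) z = 0"
    using schwarzian_affine[of "- {0}" inverse z "- 1" 0] z
    by (simp add: schwarzian_inverse_0 open_Compl deriv_inverse_fun inverse_holomorphic del: mult_minus1)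
  have op: "open {w. w \<noteq> 0 \<and> - 1 / w \<in> B}"
  proof -
    have "open (- {0} \<inter> (\<lambda>w. - 1 / w) -` B)"
      by (rule continuous_open_preimage[OF _ _ B(1)]) (auto intro!: continuous_intros simp: open_Compl)
    moreover have "{w. w \<noteq> 0 \<and> - 1 / w \<in> B} = - {0} \<inter> (\<lambda>w. - 1 / w) -` B" by blast
    ultimately show ?thesis by (simp only:)
  qed
  have "schwarzian (\<lambda>w. f (- 1 / w)) z = schwarzian f (- 1 / z) * (deriv (\<lambda>w. - 1 / w) z)\<^sup>2 + schwarzian (\<lambda>w. - 1 / w) z"
    by (rule schwarzian_compose[OF op _ _ _ B])
       (use z in \<open>auto intro!: holomorphic_intros simp: deriv_neg_inverse_fun simp del: divide_minus_left\<close>)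
  then show ?thesis unfolding s deriv_neg_inverse_fun[OF z(2)] by (simp add: power_divide flip: power_mult)
qed

text \<open>An expression by derivatives at the single point z; these converge when functions
  converge uniformly near z, which yields continuity in t.\<close>

lemma schwarzian_higher_deriv:
  assumes A: "open A" "f holomorphic_on A" "z \<in> A" "deriv f z \<noteq> 0"
  shows "schwarzian f z = (deriv ^^ 3) f z / deriv f z - 3 / 2 * ((deriv ^^ 2) f z / deriv f z)\<^sup>2"
proof -
  have d: "(deriv f has_field_derivative deriv (deriv f) z) (at z)"
    "(deriv (deriv f) has_field_derivative deriv (deriv (deriv f)) z) (at z)"
    using A by (auto intro!: holomorphic_derivI[OF _ A(1)] holomorphic_deriv)
  have "((\<lambda>w. deriv (deriv f) w / deriv f w) has_field_derivative
      (deriv (deriv (deriv f)) z * deriv f z - deriv (deriv f) z * deriv (deriv f) z) / (deriv f z * deriv f z)) (at z)"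
    by (rule DERIV_divide[OF d(2) d(1) A(4)])
  then show ?thesis unfolding schwarzian_def
    using A(4) by (simp add: DERIV_imp_deriv eval_nat_numeral field_simps)
qed

section \<open>Equivariant maps to the projective line\<close>

text \<open>True also at 0 and at infinity, since the dummy coordinate of \<open>None\<close> and
  \<open>inverse 0\<close> are both 0. Thus \<open>inverse\<close> of the coordinate is the chart at
  infinity with the right value at the pole itself.\<close>

lemma cp1_coord_inverse: "cp1_coord (cp1_inverse x) = inverse (cp1_coord x)"
  by (cases x) (auto simp: cp1_coord_def cp1_inverse_def cp1_quot_def divide_inverse)

lemma continuous_eqI_at:
  fixes f g :: "complex \<Rightarrow> complex"
  assumes "isCont f z" "isCont g z" "eventually (\<lambda>w. f w = g w) (at z)"
  shows "f z = g z"
proof -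
  have "(f \<longlongrightarrow> f z) (at z)" "(g \<longlongrightarrow> g z) (at z)" using assms(1,2) by (auto simp: isCont_def)
  moreover have "(g \<longlongrightarrow> f z) (at z)" by (rule Lim_transform_eventually[OF calculation(1) assms(3)])
  ultimately show ?thesis using tendsto_unique[OF trivial_limit_at] by blast
qed

text \<open>The conditions at one fixed t > 0. Continuity in t is kept apart and supplies later what
  cannot be seen at a single t.\<close>

locale equivariant_map =
  fixes h :: "complex \<Rightarrow> cp1" and t :: real
  assumes t_pos: "t > 0"
    and mero: "cp1_meromorphic_on h upper_half_plane"
    and h_add_1: "\<And>\<tau>. Im \<tau> > 0 \<Longrightarrow> h (\<tau> + 1) = cp1_affine (complex_of_real (exp (- t))) 1 (h \<tau>)"
    and h_neg_inverse: "\<And>\<tau>. Im \<tau> > 0 \<Longrightarrow> h (- 1 / \<tau>) = cp1_inverse (cp1_affine (- complex_of_real (exp (- t))) 0 (h \<tau>))"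
    and h_limit: "limitin cp1_topology h (Some (1 / (1 - complex_of_real (exp (- t)))))
          (inf (filtercomap Re at_top) (filtercomap Im at_top))"
    and nonvanishing: "cp1_nonvanishing_differential_on h upper_half_plane"
begin

definition hc :: "complex \<Rightarrow> complex" where "hc \<tau> = cp1_coord (h \<tau>)"

definition fin :: "complex set" where "fin = {\<tau>. Im \<tau> > 0 \<and> h \<tau> \<noteq> None}"

abbreviation q :: complex where "q \<equiv> complex_of_real (exp (- t))"

lemma q_nonzero: "q \<noteq> 0" by simp

lemma q_neq_1: "q \<noteq> 1"
  using t_pos by (metis exp_eq_one_iff neg_equal_0_iff_equal of_real_eq_1_iff order_less_irrefl)

lemma h_eq: "\<tau> \<in> fin \<Longrightarrow> h \<tau> = Some (hc \<tau>)"
  by (auto simp: fin_def hc_def cp1_coord_def)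

lemma hc_pole: "Im \<tau> > 0 \<Longrightarrow> h \<tau> = None \<longleftrightarrow> is_pole hc \<tau>"
  using mero unfolding cp1_meromorphic_on_def hc_def[abs_def] by simp

lemma hc_nicely: "hc nicely_meromorphic_on upper_half_plane"
  using mero unfolding cp1_meromorphic_on_def hc_def[abs_def] by simp

lemma hc_analytic_at:
  assumes "\<tau> \<in> fin"
  shows "hc analytic_on {\<tau>}"
proof -
  have pos: "Im \<tau> > 0" using assms by (simp add: fin_def)
  have "\<not> is_pole hc \<tau>" using assms hc_pole[OF pos] by (auto simp: fin_def)
  with pos show ?thesis by (intro nicely_meromorphic_on_imp_analytic_at[OF hc_nicely]) auto
qed

lemma analytic_imp_fin: "Im \<tau> > 0 \<Longrightarrow> hc analytic_on {\<tau>} \<Longrightarrow> \<tau> \<in> fin"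
  using hc_pole analytic_at_imp_no_pole by (auto simp: fin_def)

lemma open_fin: "open fin"
  unfolding open_contains_ball
proof
  fix \<tau> assume \<tau>: "\<tau> \<in> fin"
  from hc_analytic_at[OF this] obtain r where r: "r > 0" "hc holomorphic_on ball \<tau> r"
    by (auto simp: analytic_at_ball)
  obtain r' where r': "r' > 0" "ball \<tau> r' \<subseteq> upper_half_plane"
    using \<tau> open_upper_half_plane open_contains_ball unfolding fin_def by (metis (mono_tags, lifting) mem_Collect_eq mem_upper_half_plane)
  have "ball \<tau> (min r r') \<subseteq> fin"
  proof
    fix w assume w: "w \<in> ball \<tau> (min r r')"
    then have "hc analytic_on {w}" using r by (auto intro: holomorphic_on_imp_analytic_at)
    moreover have "Im w > 0" using w r' by (auto simp: subset_iff)
    ultimately show "w \<in> fin" by (rule analytic_imp_fin[rotated])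
  qed
  then show "\<exists>e>0. ball \<tau> e \<subseteq> fin" using r r' by (intro exI[of _ "min r r'"]) auto
qed

lemma hc_holomorphic: "hc holomorphic_on fin"
proof -
  have "hc analytic_on fin" unfolding analytic_on_analytic_at[of hc fin] using hc_analytic_at by blast
  then show ?thesis by (rule analytic_imp_holomorphic)
qed

lemma deriv_hc_nonzero:
  assumes "\<tau> \<in> fin"
  shows "deriv hc \<tau> \<noteq> 0"
proof -
  have "\<tau> \<in> upper_half_plane" "h \<tau> \<noteq> None" using assms by (auto simp: fin_def)
  then obtain D where "D \<noteq> 0" "(hc has_field_derivative D) (at \<tau>)"
    using nonvanishing unfolding cp1_nonvanishing_differential_on_def hc_def[abs_def] by fastforce
  then show ?thesis by (simp add: DERIV_imp_deriv)
qed

text \<open>At the pole the assumption on the differential speaks about the chart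
  \<open>inverse (hc w)\<close>. It makes this function holomorphic through \<tau>, and by
  continuity its derivative stays nonzero nearby.\<close>

lemma pole_chart:
  assumes \<tau>: "Im \<tau> > 0" "h \<tau> = None"
  obtains B where "open B" "\<tau> \<in> B" "B - {\<tau>} \<subseteq> fin" "\<And>w. w \<in> B - {\<tau>} \<Longrightarrow> hc w \<noteq> 0"
    "(\<lambda>w. inverse (hc w)) holomorphic_on B" "\<And>w. w \<in> B \<Longrightarrow> deriv (\<lambda>w. inverse (hc w)) w \<noteq> 0"
proof -
  define hi where "hi = (\<lambda>w. inverse (hc w))"
  have pole: "is_pole hc \<tau>" using hc_pole \<tau> by simp
  have "hc meromorphic_on upper_half_plane" using hc_nicely by (simp add: nicely_meromorphic_on_def)
  then have "isolated_singularity_at hc \<tau>" using \<tau> by (auto intro: meromorphic_on_isolated_singularity simp: meromorphic_on_altdef)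
  then obtain r1 where r1: "r1 > 0" "hc analytic_on ball \<tau> r1 - {\<tau>}" by (auto simp: isolated_singularity_at_def)
  obtain r2 where r2: "r2 > 0" "ball \<tau> r2 \<subseteq> upper_half_plane"
    using \<tau> open_upper_half_plane open_contains_ball by (metis mem_upper_half_plane)
  have "eventually (\<lambda>w. hc w \<noteq> 0) (at \<tau>)" using pole by (rule non_zero_neighbour_pole)
  then obtain r3 where r3: "r3 > 0" "\<And>w. w \<noteq> \<tau> \<Longrightarrow> dist w \<tau> < r3 \<Longrightarrow> hc w \<noteq> 0"
    unfolding eventually_at by auto
  define r where "r = min r1 (min r2 r3)"
  have r: "r > 0" using r1 r2 r3 by (simp add: r_def)
  have sub: "ball \<tau> r - {\<tau>} \<subseteq> fin"
  proof
    fix w assume w: "w \<in> ball \<tau> r - {\<tau>}"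
    then have "hc analytic_on {w}" using r1(2) by (auto simp: r_def intro: analytic_on_subset)
    moreover have "Im w > 0" using w r2 by (auto simp: r_def subset_iff)
    ultimately show "w \<in> fin" by (rule analytic_imp_fin[rotated])
  qed
  have nz: "hc w \<noteq> 0" if "w \<in> ball \<tau> r - {\<tau>}" for w using r3(2)[of w] that by (auto simp: r_def dist_commute)
  obtain D where D: "D \<noteq> 0" "(hi has_field_derivative D) (at \<tau>)"
  proof -
    have "\<tau> \<in> upper_half_plane" using \<tau> by simp
    then obtain D where "D \<noteq> 0" "((\<lambda>w. cp1_coord (cp1_inverse (h w))) has_field_derivative D) (at \<tau>)"
      using nonvanishing \<tau>(2) unfolding cp1_nonvanishing_differential_on_def by fastforce
    then show ?thesis using that unfolding cp1_coord_inverse hi_def hc_def by blast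
  qed
  have hol: "hi holomorphic_on ball \<tau> r"
    unfolding holomorphic_on_open[OF open_ball]
  proof
    fix w assume w: "w \<in> ball \<tau> r"
    show "\<exists>f'. (hi has_field_derivative f') (at w)"
    proof (cases "w = \<tau>")
      case True
      then show ?thesis using D(2) by blast
    next
      case False
      then have "w \<in> fin" "hc w \<noteq> 0" using w sub nz by auto
      then have "(hc has_field_derivative deriv hc w) (at w)" by (intro holomorphic_derivI[OF hc_holomorphic open_fin])
      from DERIV_inverse_fun[OF this \<open>hc w \<noteq> 0\<close>] show ?thesis unfolding hi_def by blast
    qed
  qed
  have "isCont (deriv hi) \<tau>"
    using holomorphic_on_imp_continuous_on[OF holomorphic_deriv[OF hol open_ball]] r
    by (simp add: continuous_on_eq_continuous_at)
  then have "(deriv hi \<longlongrightarrow> deriv hi \<tau>) (nhds \<tau>)" unfolding isCont_def tendsto_at_iff_tendsto_nhds .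
  moreover have "deriv hi \<tau> \<noteq> 0" using D by (simp add: DERIV_imp_deriv)
  ultimately have "eventually (\<lambda>w. deriv hi w \<noteq> 0) (nhds \<tau>)" by (rule tendsto_imp_eventually_ne)
  then obtain e where e: "e > 0" "\<And>w. dist w \<tau> < e \<Longrightarrow> deriv hi w \<noteq> 0" unfolding eventually_nhds_metric by blast
  show ?thesis
  proof (rule that[of "ball \<tau> (min r e)"])
    show "(\<lambda>w. inverse (hc w)) holomorphic_on ball \<tau> (min r e)"
      using hol unfolding hi_def by (rule holomorphic_on_subset) auto
    show "deriv (\<lambda>w. inverse (hc w)) w \<noteq> 0" if "w \<in> ball \<tau> (min r e)" for w
      using e(2)[of w] that unfolding hi_def by (simp add: dist_commute)
    show "ball \<tau> (min r e) - {\<tau>} \<subseteq> fin" using sub by auto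
    show "hc w \<noteq> 0" if "w \<in> ball \<tau> (min r e) - {\<tau>}" for w using nz[of w] that by auto
  qed (use r e in auto)
qed

lemma eventually_fin:
  assumes "Im \<tau> > 0"
  shows "eventually (\<lambda>w. w \<in> fin \<and> hc w \<noteq> 0) (at \<tau>)"
proof (cases "h \<tau> = None")
  case True
  then obtain B where "open B" "\<tau> \<in> B" "B - {\<tau>} \<subseteq> fin" "\<And>w. w \<in> B - {\<tau>} \<Longrightarrow> hc w \<noteq> 0"
    using pole_chart[OF assms] by metis
  then show ?thesis unfolding eventually_at_topological by (intro exI[of _ B]) auto
next
  case False
  then have fin: "\<tau> \<in> fin" using assms by (simp add: fin_def)
  have "eventually (\<lambda>w. w \<in> fin) (at \<tau>)"
    using fin open_fin by (intro eventually_at_in_open') auto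
  moreover have "eventually (\<lambda>w. hc w \<noteq> 0) (at \<tau>)"
  proof (cases "hc \<tau> = 0")
    case True
    have "(hc has_field_derivative deriv hc \<tau>) (at \<tau>)" by (rule holomorphic_derivI[OF hc_holomorphic open_fin fin])
    \<comment> \<open>At a zero of \<open>hc\<close> the difference quotient has the nonzero limit
      \<open>deriv hc \<tau>\<close>, so the zero is isolated.\<close>
    then have "((\<lambda>w. (hc w - hc \<tau>) / (w - \<tau>)) \<longlongrightarrow> deriv hc \<tau>) (at \<tau>)" by (simp add: has_field_derivative_iff)
    from tendsto_imp_eventually_ne[OF this deriv_hc_nonzero[OF fin]]
    show ?thesis by eventually_elim (use True in auto)
  next
    case False
    have "isCont hc \<tau>"
      using holomorphic_on_imp_continuous_on[OF hc_holomorphic] open_fin fin by (simp add: continuous_on_eq_continuous_at)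
    then show ?thesis using False by (simp add: isCont_def tendsto_imp_eventually_ne)
  qed
  ultimately show ?thesis by eventually_elim simp
qed

section \<open>The Schwarzian as a modular form of weight 4\<close>

text \<open>Inversion leaves the Schwarzian unchanged, so the two charts agree in a punctured
  neighbourhood of a pole and poles of h are no singularities of \<open>Sh\<close>.\<close>

definition Sh :: "complex \<Rightarrow> complex" where
  "Sh \<tau> = (if h \<tau> \<noteq> None then schwarzian hc \<tau> else schwarzian (\<lambda>w. inverse (hc w)) \<tau>)"

lemma Sh_fin: "\<tau> \<in> fin \<Longrightarrow> Sh \<tau> = schwarzian hc \<tau>"
  by (simp add: Sh_def fin_def)

lemma Sh_holomorphic: "Sh holomorphic_on upper_half_plane"
  unfolding holomorphic_on_open[OF open_upper_half_plane]
proof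
  fix \<tau> assume "\<tau> \<in> upper_half_plane"
  then have \<tau>: "Im \<tau> > 0" by simp
  show "\<exists>f'. (Sh has_field_derivative f') (at \<tau>)"
  proof (cases "h \<tau> = None")
    case False
    then have fin: "\<tau> \<in> fin" using \<tau> by (simp add: fin_def)
    have "schwarzian hc holomorphic_on fin"
      by (rule schwarzian_holomorphic[OF hc_holomorphic open_fin deriv_hc_nonzero])
    then have "Sh holomorphic_on fin" by (rule holomorphic_transform) (simp add: Sh_fin)
    then show ?thesis using fin open_fin by (auto simp: holomorphic_on_open)
  next
    case True
    obtain B where B: "open B" "\<tau> \<in> B" "B - {\<tau>} \<subseteq> fin" "\<And>w. w \<in> B - {\<tau>} \<Longrightarrow> hc w \<noteq> 0"
      "(\<lambda>w. inverse (hc w)) holomorphic_on B" "\<And>w. w \<in> B \<Longrightarrow> deriv (\<lambda>w. inverse (hc w)) w \<noteq> 0"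
      using pole_chart[OF \<tau> True] by blast
    have "schwarzian (\<lambda>w. inverse (hc w)) holomorphic_on B"
      by (rule schwarzian_holomorphic[OF B(5,1,6)])
    moreover have "schwarzian (\<lambda>w. inverse (hc w)) w = Sh w" if w: "w \<in> B" for w
    proof (cases "w = \<tau>")
      case True
      then show ?thesis using \<open>h \<tau> = None\<close> by (simp add: Sh_def)
    next
      case False
      have "schwarzian (\<lambda>w. inverse (hc w)) w = schwarzian hc w"
        by (rule schwarzian_inverse[of "B - {\<tau>}"])
           (use B w False deriv_hc_nonzero in \<open>auto intro!: open_delete holomorphic_on_subset[OF hc_holomorphic]\<close>)
      then show ?thesis using Sh_fin[of w] B(3) w False by auto
    qed
    ultimately have "Sh holomorphic_on B" by (rule holomorphic_transform)
    then show ?thesis using B(1,2) by (auto simp: holomorphic_on_open)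
  qed
qed

lemma isCont_upper_half_plane: "f holomorphic_on upper_half_plane \<Longrightarrow> Im \<tau> > 0 \<Longrightarrow> isCont f \<tau>"
  using holomorphic_on_imp_continuous_on[of f upper_half_plane] open_upper_half_plane
  by (simp add: continuous_on_eq_continuous_at)

lemma hc_add_1:
  assumes "\<tau> \<in> fin"
  shows "hc (\<tau> + 1) = q * hc \<tau> + 1" "\<tau> + 1 \<in> fin"
proof -
  have "Im \<tau> > 0" using assms by (simp add: fin_def)
  then have "h (\<tau> + 1) = Some (q * hc \<tau> + 1)"
    using h_add_1[of \<tau>] h_eq[OF assms] by (simp add: cp1_affine_def)
  then show "hc (\<tau> + 1) = q * hc \<tau> + 1" "\<tau> + 1 \<in> fin"
    using \<open>Im \<tau> > 0\<close> by (simp_all add: hc_def[of "\<tau> + 1"] cp1_coord_def fin_def)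
qed

lemma hc_neg_inverse:
  assumes "\<tau> \<in> fin" "hc \<tau> \<noteq> 0"
  shows "hc (- 1 / \<tau>) = inverse (- q * hc \<tau> + 0)" "- 1 / \<tau> \<in> fin"
proof -
  have "Im \<tau> > 0" using assms by (simp add: fin_def)
  then have "h (- 1 / \<tau>) = Some (inverse (- q * hc \<tau> + 0))"
    using h_neg_inverse[of \<tau>] h_eq[OF assms(1)] assms(2)
    by (simp add: cp1_affine_def cp1_inverse_def cp1_quot_def inverse_eq_divide)
  then show "hc (- 1 / \<tau>) = inverse (- q * hc \<tau> + 0)" "- 1 / \<tau> \<in> fin"
    using Im_neg_inverse_pos[OF \<open>Im \<tau> > 0\<close>]
    by (simp_all add: hc_def[of "- 1 / \<tau>"] cp1_coord_def fin_def del: divide_minus_left)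
qed

text \<open>Shown at finite nonzero values first, where affine maps leave the Schwarzian unchanged;
  the exceptional points are isolated and follow by continuity. The law for -1 / \<tau> is proved in
  the same way.\<close>

lemma Sh_add_1:
  assumes \<tau>: "Im \<tau> > 0"
  shows "Sh (\<tau> + 1) = Sh \<tau>"
proof (rule continuous_eqI_at[where f = "\<lambda>\<tau>. Sh (\<tau> + 1)" and z = \<tau> and g = Sh])
  have "(\<lambda>\<tau>. Sh (\<tau> + 1)) holomorphic_on upper_half_plane"
    by (rule holomorphic_on_compose_gen[of "\<lambda>\<tau>. \<tau> + 1" _ Sh upper_half_plane, unfolded o_def])
       (auto intro!: holomorphic_intros Sh_holomorphic)
  then show "isCont (\<lambda>\<tau>. Sh (\<tau> + 1)) \<tau>" using \<tau> by (rule isCont_upper_half_plane)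
  show "isCont Sh \<tau>" by (rule isCont_upper_half_plane[OF Sh_holomorphic \<tau>])
  from eventually_fin[OF \<tau>] show "\<forall>\<^sub>F w in at \<tau>. Sh (w + 1) = Sh w"
  proof eventually_elim
    case (elim w)
    then have w: "w \<in> fin" by simp
    have "schwarzian (\<lambda>w. hc (w + 1)) w = schwarzian hc (w + 1)"
      by (rule schwarzian_shift[OF open_fin hc_holomorphic deriv_hc_nonzero hc_add_1(2)[OF w]])
    moreover have "schwarzian (\<lambda>w. hc (w + 1)) w = schwarzian (\<lambda>w. q * hc w + 1) w"
      by (rule schwarzian_cong[OF open_fin hc_add_1(1) w])
    moreover have "\<dots> = schwarzian hc w"
      by (rule schwarzian_affine[OF open_fin hc_holomorphic deriv_hc_nonzero w q_nonzero])
    ultimately show ?case using Sh_fin[OF w] Sh_fin[OF hc_add_1(2)[OF w]] by simp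
  qed
qed

lemma Sh_neg_inverse:
  assumes \<tau>: "Im \<tau> > 0"
  shows "Sh (- 1 / \<tau>) = \<tau> ^ 4 * Sh \<tau>"
proof (rule continuous_eqI_at[where f = "\<lambda>\<tau>. Sh (- 1 / \<tau>)" and z = \<tau> and g = "\<lambda>\<tau>. \<tau> ^ 4 * Sh \<tau>"])
  show "isCont (\<lambda>\<tau>. Sh (- 1 / \<tau>)) \<tau>"
    by (rule isCont_upper_half_plane[OF holomorphic_compose_neg_inverse[OF Sh_holomorphic] \<tau>])
  show "isCont (\<lambda>\<tau>. \<tau> ^ 4 * Sh \<tau>) \<tau>"
    by (rule isCont_upper_half_plane[OF _ \<tau>]) (intro holomorphic_intros Sh_holomorphic)
  from eventually_fin[OF \<tau>] show "\<forall>\<^sub>F w in at \<tau>. Sh (- 1 / w) = w ^ 4 * Sh w"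
  proof eventually_elim
    case (elim w)
    define A where "A = {v \<in> fin. hc v \<noteq> 0}"
    have w: "w \<in> A" using elim by (simp add: A_def)
    have opA: "open A"
    proof -
      have "open (fin \<inter> hc -` (- {0}))"
        by (rule continuous_open_preimage[OF holomorphic_on_imp_continuous_on[OF hc_holomorphic] open_fin]) (simp add: open_Compl)
      moreover have "A = fin \<inter> hc -` (- {0})" unfolding A_def by blast
      ultimately show ?thesis by (simp only:)
    qed
    have A: "hc holomorphic_on A" "\<And>v. v \<in> A \<Longrightarrow> deriv hc v \<noteq> 0" "\<And>v. v \<in> A \<Longrightarrow> hc v \<noteq> 0"
      using holomorphic_on_subset[OF hc_holomorphic] deriv_hc_nonzero by (auto simp: A_def)
    have inv: "hc (- 1 / v) = inverse (- q * hc v + 0)" "- 1 / v \<in> fin" if "v \<in> A" for v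
      using hc_neg_inverse[of v] that unfolding A_def mem_Collect_eq by blast+
    have w0: "w \<noteq> 0" using w by (auto simp: A_def fin_def)
    have "schwarzian (\<lambda>w. hc (- 1 / w)) w = schwarzian hc (- 1 / w) / w ^ 4"
      by (rule schwarzian_neg_inverse[OF open_fin hc_holomorphic deriv_hc_nonzero inv(2)[OF w] w0])
    moreover have "schwarzian (\<lambda>w. hc (- 1 / w)) w = schwarzian (\<lambda>w. inverse (- q * hc w + 0)) w"
      by (rule schwarzian_cong[OF opA inv(1) w])
    moreover have "\<dots> = schwarzian (\<lambda>w. - q * hc w + 0) w"
    proof (rule schwarzian_inverse[OF opA _ _ w])
      show "(\<lambda>w. - q * hc w + 0) holomorphic_on A" by (intro holomorphic_intros A)
      show "deriv (\<lambda>w. - q * hc w + 0) v \<noteq> 0" if "v \<in> A" for v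
      proof -
        have "((\<lambda>w. - q * hc w + 0) has_field_derivative - q * deriv hc v + 0) (at v)"
          by (rule DERIV_add[OF DERIV_cmult[OF holomorphic_derivI[OF A(1) opA that]] DERIV_const])
        then show ?thesis using A(2)[OF that] by (simp add: DERIV_imp_deriv)
      qed
    qed (use A(3) in auto)
    moreover have "\<dots> = schwarzian hc w"
      by (rule schwarzian_affine[OF opA A(1,2) w]) auto
    ultimately have "schwarzian hc (- 1 / w) = w ^ 4 * schwarzian hc w" using w0 by (simp add: field_simps)
    then show ?case using Sh_fin[of w] Sh_fin[OF inv(2)[OF w]] w by (simp add: A_def)
  qed
qed

text \<open>The fixed point of w -> q w + 1, which is also the limit prescribed at the cusp.\<close>

definition p :: complex where "p = 1 / (1 - q)"

lemma p_fixed: "q * p + 1 = p"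
  using q_neq_1 by (simp add: p_def field_simps)

lemma exp_t_q: "q * exp (of_real t) = 1"
  by (simp flip: exp_of_real exp_add)

text \<open>The assumed limit concerns a quadrant only. Translations multiply
  \<open>hc \<tau> - p\<close> by q, which exp(t \<tau>) compensates, so poles and sizes may be
  examined after moving Re \<tau> into a unit interval at the edge of the quadrant.\<close>

lemma near_cusp:
  obtains R B where "R > 0" "\<And>\<tau>. Im \<tau> > R \<Longrightarrow> \<tau> \<in> fin"
    "\<And>\<tau>. Im \<tau> > R \<Longrightarrow> cmod ((hc \<tau> - p) * exp (of_real t * \<tau>)) \<le> B"
    "\<And>\<tau>. Im \<tau> > R \<Longrightarrow> (hc (\<tau> + 1) - p) * exp (of_real t * (\<tau> + 1)) = (hc \<tau> - p) * exp (of_real t * \<tau>)"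
proof -
  have "openin cp1_topology (Some ` ball p 1)" unfolding cp1_topology_def by simp
  then have "eventually (\<lambda>\<tau>. h \<tau> \<in> Some ` ball p 1) (inf (filtercomap Re at_top) (filtercomap Im at_top))"
    using h_limit unfolding limitin_def p_def by simp
  then obtain P Q where P: "eventually P (filtercomap Re at_top)" and Q: "eventually Q (filtercomap Im at_top)"
    and PQ: "\<And>\<tau>. P \<tau> \<Longrightarrow> Q \<tau> \<Longrightarrow> h \<tau> \<in> Some ` ball p 1"
    unfolding eventually_inf by blast
  obtain R1 where R1: "\<And>\<tau>. Re \<tau> \<ge> R1 \<Longrightarrow> P \<tau>"
    using P unfolding eventually_filtercomap eventually_at_top_linorder by blast
  obtain R where R: "R > 0" "\<And>\<tau>. Im \<tau> > R \<Longrightarrow> Q \<tau>"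
    using Q unfolding eventually_at_i_infinity by blast
  have near: "h \<tau> \<noteq> None \<and> cmod (hc \<tau> - p) < 1" if "Re \<tau> \<ge> R1" "Im \<tau> > R" for \<tau>
    using PQ[OF R1[OF that(1)] R(2)[OF that(2)]] by (auto simp: hc_def cp1_coord_def dist_norm norm_minus_commute)
  have fin: "\<tau> \<in> fin" if \<tau>: "Im \<tau> > R" for \<tau>
  proof -
    define n where "n = \<lceil>R1 - Re \<tau>\<rceil>"
    have "(h (\<tau> + of_int n) = None) = (h \<tau> = None)"
    proof (rule periodic_int[of R "\<lambda>\<tau>. h \<tau> = None"])
      fix z assume "R < Im z"
      then have "Im z > 0" using R by simp
      then show "(h (z + 1) = None) = (h z = None)" using h_add_1[of z] by (simp add: cp1_affine_def)
    qed (rule \<tau>)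
    moreover have "Re (\<tau> + of_int n) \<ge> R1" by (simp add: n_def) linarith
    then have "h (\<tau> + of_int n) \<noteq> None" using near[of "\<tau> + of_int n"] \<tau> by simp
    ultimately show ?thesis using \<tau> R by (simp add: fin_def)
  qed
  have per: "(hc (\<tau> + 1) - p) * exp (of_real t * (\<tau> + 1)) = (hc \<tau> - p) * exp (of_real t * \<tau>)" if "Im \<tau> > R" for \<tau>
  proof -
    have "hc (\<tau> + 1) - p = q * (hc \<tau> - p)" using hc_add_1(1)[OF fin[OF that]] p_fixed by (simp add: algebra_simps)
    moreover have "exp (of_real t * (\<tau> + 1)) = exp (of_real t) * exp (of_real t * \<tau>)" by (simp add: algebra_simps flip: exp_add)
    ultimately show ?thesis using exp_t_q by algebra
  qed
  show ?thesis
  proof (rule that[of R "exp (t * (R1 + 1))"])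
    fix \<tau> assume \<tau>: "Im \<tau> > R"
    define n where "n = \<lceil>R1 - Re \<tau>\<rceil>"
    have n: "Re (\<tau> + of_int n) \<ge> R1" "Re (\<tau> + of_int n) \<le> R1 + 1" by (simp_all add: n_def) linarith+
    have "(hc \<tau> - p) * exp (of_real t * \<tau>) = (hc (\<tau> + of_int n) - p) * exp (of_real t * (\<tau> + of_int n))"
      by (rule periodic_int[of R "\<lambda>\<tau>. (hc \<tau> - p) * exp (of_real t * \<tau>)", symmetric]) (use per \<tau> in auto)
    also have "cmod \<dots> \<le> 1 * exp (t * (R1 + 1))"
      unfolding norm_mult
    proof (rule mult_mono)
      show "cmod (hc (\<tau> + of_int n) - p) \<le> 1" using near[OF n(1)] \<tau> by (simp add: less_imp_le)
      have "t * Re (\<tau> + of_int n) \<le> t * (R1 + 1)" using n(2) t_pos by (intro mult_left_mono) auto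
      then show "cmod (exp (of_real t * (\<tau> + of_int n))) \<le> exp (t * (R1 + 1))" by simp
    qed auto
    finally show "cmod ((hc \<tau> - p) * exp (of_real t * \<tau>)) \<le> exp (t * (R1 + 1))" by simp
  qed (use R fin per in auto)
qed

text \<open>The periodic function (hc - p) exp(t \<tau>) descends to a holomorphic function g of
  exp(2 pi i \<tau>) at 0; m is its order of vanishing there and \<open>U0\<close> its leading
  coefficient.\<close>

lemma cusp_expansion:
  "\<exists>(m::nat) Y U0. Y > 0 \<and> U0 \<noteq> 0 \<and> (\<forall>\<tau>. Im \<tau> > Y \<longrightarrow> \<tau> \<in> fin) \<and>
    ((\<lambda>\<tau>. (hc \<tau> - p) * exp (- (2 * of_real pi * \<i> * of_nat m - of_real t) * \<tau>)) \<longlongrightarrow> U0) at_i_infinity"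
proof -
  obtain R B where R: "R > 0" "\<And>\<tau>. Im \<tau> > R \<Longrightarrow> \<tau> \<in> fin"
    and bd: "\<And>\<tau>. Im \<tau> > R \<Longrightarrow> cmod ((hc \<tau> - p) * exp (of_real t * \<tau>)) \<le> B"
    and per: "\<And>\<tau>. Im \<tau> > R \<Longrightarrow> (hc (\<tau> + 1) - p) * exp (of_real t * (\<tau> + 1)) = (hc \<tau> - p) * exp (of_real t * \<tau>)"
    using near_cusp by blast
  have hol: "(\<lambda>\<tau>. (hc \<tau> - p) * exp (of_real t * \<tau>)) holomorphic_on {\<tau>. Im \<tau> > R}"
    using R(2) by (intro holomorphic_intros holomorphic_on_subset[OF hc_holomorphic]) auto
  define r where "r = exp (- 2 * pi * R)"
  have r: "r > 0" by (simp add: r_def)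
  obtain g where g: "g holomorphic_on ball 0 r"
    "\<And>\<tau>. Im \<tau> > R \<Longrightarrow> (hc \<tau> - p) * exp (of_real t * \<tau>) = g (exp (2 * of_real pi * \<i> * \<tau>))"
    using periodic_descends_to_disc[OF hol per bd] unfolding r_def by blast
  have "\<exists>m U e. e > 0 \<and> e \<le> r \<and> isCont U 0 \<and> U 0 \<noteq> 0 \<and> (\<forall>w\<in>ball 0 e. g w = w ^ m * U w)"
  proof (cases "g 0 = 0")
    case False
    have "isCont g 0" using holomorphic_on_imp_continuous_on[OF g(1)] r by (simp add: continuous_on_eq_continuous_at)
    then show ?thesis using False r by (intro exI[of _ 0] exI[of _ g] exI[of _ r]) auto
  next
    case True
    \<comment> \<open>If g were identically 0, \<open>hc\<close> would be constant near the cusp,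
      against the nonvanishing differential.\<close>
    have nc: "\<not> g constant_on ball 0 r"
    proof
      assume "g constant_on ball 0 r"
      then have g0: "g w = 0" if "w \<in> ball 0 r" for w using True that r unfolding constant_on_def by (metis centre_in_ball)
      have zero: "hc \<tau> = p" if \<tau>: "Im \<tau> > R" for \<tau>
      proof -
        have "cmod (exp (2 * of_real pi * \<i> * \<tau>)) < r" using \<tau> by (simp add: r_def)
        then have "(hc \<tau> - p) * exp (of_real t * \<tau>) = 0" using g(2)[OF \<tau>] g0 by simp
        then show ?thesis by simp
      qed
      define z where "z = \<i> * of_real (R + 1)"
      have "Im z > R" by (simp add: z_def)
      have "deriv hc z = deriv (\<lambda>_. p) z"
        by (rule deriv_eq_on_open[OF open_halfspace_Im_gt[of R]]) (use zero \<open>Im z > R\<close> in auto)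
      then show False using deriv_hc_nonzero[OF R(2)[OF \<open>Im z > R\<close>]] by simp
    qed
    have r0: "(0::complex) \<in> ball 0 r" using r by simp
    show ?thesis
    proof (rule holomorphic_factor_zero_nonconstant[OF g(1) open_ball connected_ball r0 True nc])
      fix U :: "complex \<Rightarrow> complex" and e :: real and m :: nat
      assume U: "0 < m" "0 < e" "ball 0 e \<subseteq> ball (0::complex) r" "U holomorphic_on ball 0 e"
        "\<And>w. w \<in> ball 0 e \<Longrightarrow> g w = (w - 0) ^ m * U w" "\<And>w. w \<in> ball 0 e \<Longrightarrow> U w \<noteq> 0"
      have "isCont U 0"
        using holomorphic_on_imp_continuous_on[OF U(4)] U(2) by (simp add: continuous_on_eq_continuous_at)
      moreover have "e \<le> r" using U(2,3) by (simp add: ball_subset_ball_iff)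
      ultimately show ?thesis using U by (intro exI[of _ m] exI[of _ U] exI[of _ e]) simp
    qed
  qed
  then obtain m U e where e: "e > 0" "e \<le> r" "isCont U 0" "U 0 \<noteq> 0" "\<And>w. w \<in> ball 0 e \<Longrightarrow> g w = w ^ m * U w" by blast
  have Qlim: "((\<lambda>\<tau>. exp (2 * of_real pi * \<i> * \<tau>)) \<longlongrightarrow> 0) at_i_infinity"
  proof -
    have "((\<lambda>\<tau>. exp (of_real pi * \<i> * \<tau>) * exp (of_real pi * \<i> * \<tau>)) \<longlongrightarrow> 0 * 0) at_i_infinity"
      by (intro tendsto_mult exp_pi_limit)
    then show ?thesis by (simp add: mult_ac flip: exp_add)
  qed
  show ?thesis
  proof (intro exI[of _ m] exI[of _ R] exI[of _ "U 0"] conjI)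
    show "((\<lambda>\<tau>. (hc \<tau> - p) * exp (- (2 * of_real pi * \<i> * of_nat m - of_real t) * \<tau>)) \<longlongrightarrow> U 0) at_i_infinity"
    proof (rule Lim_transform_eventually)
      show "((\<lambda>\<tau>. U (exp (2 * of_real pi * \<i> * \<tau>))) \<longlongrightarrow> U 0) at_i_infinity"
        by (rule isCont_tendsto_compose[OF e(3) Qlim])
      have "eventually (\<lambda>\<tau>. dist (exp (2 * of_real pi * \<i> * \<tau>)) 0 < e) at_i_infinity"
        by (rule tendstoD[OF Qlim e(1)])
      moreover have "eventually (\<lambda>\<tau>. Im \<tau> > R) at_i_infinity"
        unfolding eventually_at_i_infinity using R by blast
      ultimately show "\<forall>\<^sub>F \<tau> in at_i_infinity. U (exp (2 * of_real pi * \<i> * \<tau>))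
          = (hc \<tau> - p) * exp (- (2 * of_real pi * \<i> * of_nat m - of_real t) * \<tau>)"
      proof eventually_elim
        case (elim \<tau>)
        define w where "w = exp (2 * of_real pi * \<i> * \<tau>)"
        have 1: "(hc \<tau> - p) * exp (of_real t * \<tau>) = w ^ m * U w"
          using g(2)[OF elim(2)] e(5)[of w] elim(1) by (simp add: w_def)
        have 2: "exp (- (2 * of_real pi * \<i> * of_nat m - of_real t) * \<tau>) = exp (of_real t * \<tau>) * inverse (w ^ m)"
          unfolding w_def exp_of_nat_mult[symmetric] exp_minus[symmetric] exp_add[symmetric] by (simp add: algebra_simps)
        have "w \<noteq> 0" by (simp add: w_def)
        then show ?case unfolding w_def[symmetric] 2 mult.assoc[symmetric] 1 by (simp add: field_simps)
      qed
    qed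
  qed (use R e in auto)
qed

text \<open>With \<beta> = 2 pi i m - t one has hc - p = exp(\<beta> \<tau>) V, and V tends to
  \<open>U0\<close>. Hence hc''/hc' tends to \<beta> and \<open>Sh\<close> to -\<beta>^2 / 2. The
  difference to the multiple of \<open>weight4\<close> with the same limit is a form of weight 4
  vanishing at the cusp, hence 0.\<close>

lemma schwarzian_eq_weight4:
  "\<exists>(m::nat) U0. U0 \<noteq> 0 \<and>
    ((\<lambda>\<tau>. (hc \<tau> - p) * exp (- (2 * of_real pi * \<i> * of_nat m - of_real t) * \<tau>)) \<longlongrightarrow> U0) at_i_infinity \<and>
    (\<forall>\<tau>. Im \<tau> > 0 \<longrightarrow> Sh \<tau> = - ((2 * of_real pi * \<i> * of_nat m - of_real t)\<^sup>2 / 2) * weight4 \<tau>)"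
proof -
  obtain m :: nat and Y U0 where Y: "Y > 0" "U0 \<noteq> 0" "\<And>\<tau>. Im \<tau> > Y \<Longrightarrow> \<tau> \<in> fin"
    and lim: "((\<lambda>\<tau>. (hc \<tau> - p) * exp (- (2 * of_real pi * \<i> * of_nat m - of_real t) * \<tau>)) \<longlongrightarrow> U0) at_i_infinity"
    using cusp_expansion by blast
  define \<beta> where "\<beta> = 2 * of_real pi * \<i> * of_nat m - complex_of_real t"
  \<comment> \<open>Its real part is -t. Thus W has the nonzero limit \<beta> U0, and W'/W tends to
    0.\<close>
  have \<beta>: "\<beta> \<noteq> 0" using t_pos by (auto simp: \<beta>_def complex_eq_iff)
  define H where "H = {\<tau>. Im \<tau> > Y}"
  have opH: "open H" unfolding H_def by (rule open_halfspace_Im_gt)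
  have hcH: "hc holomorphic_on H" by (rule holomorphic_on_subset[OF hc_holomorphic]) (use Y in \<open>auto simp: H_def\<close>)
  define V where "V = (\<lambda>\<tau>. (hc \<tau> - p) * exp (- \<beta> * \<tau>))"
  have Vlim: "(V \<longlongrightarrow> U0) at_i_infinity" using lim unfolding V_def \<beta>_def .
  have VH: "V holomorphic_on H" unfolding V_def by (intro holomorphic_intros hcH)
  have V'lim: "(deriv V \<longlongrightarrow> 0) at_i_infinity"
    by (rule deriv_tendsto_0_at_i_infinity[OF VH[unfolded H_def] Vlim])
  define W where "W = (\<lambda>\<tau>. \<beta> * V \<tau> + deriv V \<tau>)"
  have WH: "W holomorphic_on H" unfolding W_def by (intro holomorphic_intros VH holomorphic_deriv opH)
  have Wlim: "(W \<longlongrightarrow> \<beta> * U0) at_i_infinity"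
    unfolding W_def using tendsto_add[OF tendsto_mult[OF tendsto_const Vlim] V'lim] by simp
  have W'lim: "(deriv W \<longlongrightarrow> 0) at_i_infinity"
    by (rule deriv_tendsto_0_at_i_infinity[OF WH[unfolded H_def] Wlim])
  have d1: "deriv hc \<tau> = exp (\<beta> * \<tau>) * W \<tau>" if \<tau>: "\<tau> \<in> H" for \<tau>
  proof -
    have "(V has_field_derivative deriv V \<tau>) (at \<tau>)" by (rule holomorphic_derivI[OF VH opH \<tau>])
    then have "((\<lambda>\<tau>. exp (\<beta> * \<tau>) * V \<tau> + p) has_field_derivative exp (\<beta> * \<tau>) * W \<tau>) (at \<tau>)"
      unfolding W_def by (auto intro!: derivative_eq_intros simp: algebra_simps)
    moreover have "exp (\<beta> * z) * V z + p = hc z" for z by (simp add: V_def exp_minus field_simps)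
    ultimately show ?thesis by (simp add: DERIV_imp_deriv)
  qed
  have d2: "deriv (deriv hc) \<tau> = exp (\<beta> * \<tau>) * (\<beta> * W \<tau> + deriv W \<tau>)" if \<tau>: "\<tau> \<in> H" for \<tau>
  proof -
    have "(W has_field_derivative deriv W \<tau>) (at \<tau>)" by (rule holomorphic_derivI[OF WH opH \<tau>])
    then have "((\<lambda>\<tau>. exp (\<beta> * \<tau>) * W \<tau>) has_field_derivative exp (\<beta> * \<tau>) * (\<beta> * W \<tau> + deriv W \<tau>)) (at \<tau>)"
      by (auto intro!: derivative_eq_intros simp: algebra_simps)
    then show ?thesis using deriv_eq_on_open[OF opH d1 \<tau>] by (simp add: DERIV_imp_deriv)
  qed
  define N where "N = (\<lambda>\<tau>. deriv (deriv hc) \<tau> / deriv hc \<tau>)"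
  have W0: "W \<tau> \<noteq> 0" if "\<tau> \<in> H" for \<tau>
    using d1[OF that] deriv_hc_nonzero[of \<tau>] Y(3)[of \<tau>] that by (auto simp: H_def)
  have inH: "eventually (\<lambda>\<tau>. \<tau> \<in> H) at_i_infinity"
    unfolding eventually_at_i_infinity H_def using Y(1) by blast
  have Nlim: "(N \<longlongrightarrow> \<beta>) at_i_infinity"
  proof (rule Lim_transform_eventually)
    have "((\<lambda>\<tau>. \<beta> + deriv W \<tau> / W \<tau>) \<longlongrightarrow> \<beta> + 0 / (\<beta> * U0)) at_i_infinity"
      using \<beta> Y(2) by (intro tendsto_intros W'lim Wlim) auto
    then show "((\<lambda>\<tau>. \<beta> + deriv W \<tau> / W \<tau>) \<longlongrightarrow> \<beta>) at_i_infinity" by simp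
    from inH show "\<forall>\<^sub>F \<tau> in at_i_infinity. \<beta> + deriv W \<tau> / W \<tau> = N \<tau>"
    proof eventually_elim
      case (elim \<tau>)
      then show ?case unfolding N_def d1[OF elim] d2[OF elim] using W0[OF elim] by (simp add: field_simps)
    qed
  qed
  have NH: "N holomorphic_on H"
    unfolding N_def using Y(3) deriv_hc_nonzero
    by (intro holomorphic_intros holomorphic_deriv hcH opH) (auto simp: H_def)
  have N'lim: "(deriv N \<longlongrightarrow> 0) at_i_infinity"
    by (rule deriv_tendsto_0_at_i_infinity[OF NH[unfolded H_def] Nlim])
  have Slim: "(Sh \<longlongrightarrow> - (\<beta>\<^sup>2 / 2)) at_i_infinity"
  proof (rule Lim_transform_eventually)
    have "((\<lambda>\<tau>. deriv N \<tau> - (N \<tau>)\<^sup>2 / 2) \<longlongrightarrow> 0 - \<beta>\<^sup>2 / 2) at_i_infinity"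
      by (intro tendsto_intros N'lim Nlim) auto
    then show "((\<lambda>\<tau>. deriv N \<tau> - (N \<tau>)\<^sup>2 / 2) \<longlongrightarrow> - (\<beta>\<^sup>2 / 2)) at_i_infinity" by simp
    from inH show "\<forall>\<^sub>F \<tau> in at_i_infinity. deriv N \<tau> - (N \<tau>)\<^sup>2 / 2 = Sh \<tau>"
    proof eventually_elim
      case (elim \<tau>)
      then have "\<tau> \<in> fin" using Y(3) by (simp add: H_def)
      then show ?case by (simp add: Sh_fin schwarzian_def N_def)
    qed
  qed
  define D where "D = (\<lambda>\<tau>. Sh \<tau> + \<beta>\<^sup>2 / 2 * weight4 \<tau>)"
  have holD: "D holomorphic_on upper_half_plane"
    unfolding D_def by (intro holomorphic_intros Sh_holomorphic weight4_holomorphic)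
  have TD: "D (\<tau> + 1) = D \<tau>" if "Im \<tau> > 0" for \<tau> using Sh_add_1[OF that] by (simp add: D_def weight4_add_1)
  have SD: "D (- 1 / \<tau>) = \<tau> ^ 4 * D \<tau>" if "Im \<tau> > 0" for \<tau>
    unfolding D_def Sh_neg_inverse[OF that] weight4_neg_inverse[OF that] by (simp add: algebra_simps)
  have "(D \<longlongrightarrow> - (\<beta>\<^sup>2 / 2) + \<beta>\<^sup>2 / 2 * 1) at_i_infinity"
    unfolding D_def by (intro tendsto_intros Slim weight4_limit)
  then have limD: "(D \<longlongrightarrow> 0) at_i_infinity" by simp
  obtain C where C: "\<And>\<tau>. Im \<tau> \<ge> 1/2 \<Longrightarrow> cmod (D \<tau>) \<le> C * exp (- (2 * pi) * Im \<tau>)"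
    using periodic_vanishing_decay[OF holD TD limD] by blast
  have D0: "D \<tau> = 0" if "Im \<tau> > 0" for \<tau>
  proof (rule siegel_vanishing[where f = D and \<tau> = \<tau> and w = 2 and A = "2 * pi" and C = C])
    fix \<tau> :: complex assume \<tau>: "Im \<tau> > 0"
    then have "\<tau> \<noteq> 0" by auto
    then show "cmod (D (- 1 / \<tau>)) = cmod \<tau> powr (2 * 2) * cmod (D \<tau>)"
      unfolding SD[OF \<tau>] by (simp add: norm_mult norm_power powr_realpow[of _ 4, simplified])
  qed (use holD TD C that pi_gt3 in auto)
  have "Sh \<tau> = - ((2 * of_real pi * \<i> * of_nat m - of_real t)\<^sup>2 / 2) * weight4 \<tau>" if "Im \<tau> > 0" for \<tau>
    using D0[OF that] unfolding D_def \<beta>_def[symmetric] by (simp add: eq_neg_iff_add_eq_0)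
  then show ?thesis using Y(2) lim by blast
qed

text \<open>The point i is fixed by -1 / \<tau>, so its image is fixed by w -> -1 / (q w). This map
  exchanges 0 and infinity, which excludes both values.\<close>

lemma h_at_i: "h \<i> = Some (hc \<i>)" "(hc \<i>)\<^sup>2 = - (of_real (exp t))"
proof -
  have "- 1 / \<i> = \<i>" by simp
  then have eq: "h \<i> = cp1_inverse (cp1_affine (- q) 0 (h \<i>))" using h_neg_inverse[of \<i>] by simp
  obtain w where w: "h \<i> = Some w" "w \<noteq> 0"
  proof (cases "h \<i>")
    case None
    then show thesis using eq by (simp add: cp1_inverse_def cp1_affine_def)
  next
    case (Some w)
    then have "w \<noteq> 0" using eq by (auto simp: cp1_inverse_def cp1_affine_def cp1_quot_def)
    then show thesis using that Some by blast
  qed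
  have hw: "hc \<i> = w" using w by (simp add: hc_def cp1_coord_def)
  have "w = 1 / (- q * w)" using eq w by (simp add: cp1_inverse_def cp1_affine_def cp1_quot_def)
  then have "- q * (w * w) = 1" using w by (simp add: field_simps)
  then have "w\<^sup>2 = - (of_real (exp t))" using exp_t_q by (simp add: power2_eq_square exp_of_real) (algebra)
  then show "h \<i> = Some (hc \<i>)" "(hc \<i>)\<^sup>2 = - (of_real (exp t))" using w hw by auto
qed

end

section \<open>Normalization by continuity in the time variable\<close>

lemma q_complex_family_equivariant:
  assumes "q_complex_family f" "t > 0"
  shows "equivariant_map (f t) t"
  using assms unfolding q_complex_family_def equivariant_map_def Let_def by auto

lemma openin_family_preimage:
  assumes f: "q_complex_family f" and V: "open V"
  shows "openin (top_of_set ({0..} \<times> upper_half_plane))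
    {x \<in> {0..} \<times> upper_half_plane. (case x of (t, \<tau>) \<Rightarrow> f t \<tau>) \<in> Some ` V}"
proof -
  have "continuous_map (top_of_set ({0..} \<times> upper_half_plane)) cp1_topology (\<lambda>(t, \<tau>). f t \<tau>)"
    using f by (simp add: q_complex_family_def)
  moreover have "openin cp1_topology (Some ` V)" using V by (simp add: cp1_topology_def)
  ultimately show ?thesis using openin_continuous_map_preimage by fastforce
qed

definition family_coord :: "(real \<Rightarrow> complex \<Rightarrow> cp1) \<Rightarrow> real \<Rightarrow> complex \<Rightarrow> complex" where
  "family_coord f t = (\<lambda>\<tau>. cp1_coord (f t \<tau>))"

lemma family_0:
  assumes "q_complex_family f" "Im \<tau> > 0"
  shows "f 0 \<tau> = Some \<tau>"
  using assms by (simp add: q_complex_family_def)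

lemma family_at_i:
  assumes f: "q_complex_family f" and t: "t \<ge> 0"
  shows "f t \<i> \<noteq> None"
proof (cases "t = 0")
  case True
  then show ?thesis using family_0[OF f, of \<i>] by simp
next
  case False
  then interpret equivariant_map "f t" t using q_complex_family_equivariant[OF f, of t] t by simp
  show ?thesis using h_at_i(1) by simp
qed

lemma family_holomorphic:
  assumes f: "q_complex_family f" and t: "t \<ge> 0" and A: "A \<subseteq> {\<tau>. Im \<tau> > 0 \<and> f t \<tau> \<noteq> None}"
  shows "family_coord f t holomorphic_on A"
proof (cases "t = 0")
  case True
  have "(\<lambda>\<tau>. \<tau>) holomorphic_on A" by (rule holomorphic_on_ident)
  then show ?thesis
    by (rule holomorphic_transform) (use A True family_0[OF f] in \<open>auto simp: family_coord_def cp1_coord_def\<close>)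
next
  case False
  then interpret equivariant_map "f t" t using q_complex_family_equivariant[OF f, of t] t by simp
  have "family_coord f t = hc" by (simp add: fun_eq_iff family_coord_def hc_def)
  then show ?thesis using hc_holomorphic A by (auto intro: holomorphic_on_subset simp: fin_def)
qed

lemma family_deriv_nonzero:
  assumes f: "q_complex_family f" and t: "t \<ge> 0"
  shows "deriv (family_coord f t) \<i> \<noteq> 0"
proof (cases "t = 0")
  case True
  have "deriv (family_coord f t) \<i> = deriv (\<lambda>\<tau>. \<tau>) \<i>"
    by (rule deriv_eq_on_open[OF open_upper_half_plane])
       (use True family_0[OF f] in \<open>auto simp: family_coord_def cp1_coord_def\<close>)
  then show ?thesis by simp
next
  case False
  then interpret equivariant_map "f t" t using q_complex_family_equivariant[OF f, of t] t by simp
  have "family_coord f t = hc" by (simp add: fun_eq_iff family_coord_def hc_def)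
  then show ?thesis using deriv_hc_nonzero[of \<i>] family_at_i[OF f t] by (simp add: fin_def)
qed

text \<open>Near (t0, i) the family avoids infinity on a compact product of an interval and a disc.
  Uniform continuity there gives uniform convergence on a disc around i, and Weierstrass's theorem
  carries it to all derivatives. The case t0 = 0 is included, since it provides the starting
  value.\<close>

lemma family_higher_deriv_tendsto:
  assumes f: "q_complex_family f" and t0: "t0 \<ge> 0" and T: "\<And>n. T n \<ge> 0" "T \<longlonglongrightarrow> t0"
  shows "(\<lambda>n. (deriv ^^ k) (family_coord f (T n)) \<i>) \<longlonglongrightarrow> (deriv ^^ k) (family_coord f t0) \<i>"
proof -
  define X where "X = {0 :: real..} \<times> upper_half_plane"
  define \<Omega> where "\<Omega> = {x \<in> X. (case x of (t, \<tau>) \<Rightarrow> f t \<tau>) \<in> Some ` UNIV}"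
  have op: "openin (top_of_set X) \<Omega>"
    unfolding \<Omega>_def X_def by (rule openin_family_preimage[OF f open_UNIV])
  have mem: "(t, \<tau>) \<in> \<Omega> \<longleftrightarrow> t \<ge> 0 \<and> Im \<tau> > 0 \<and> f t \<tau> \<noteq> None" for t \<tau>
    unfolding \<Omega>_def X_def by (cases "f t \<tau>") auto
  have cont: "continuous_on \<Omega> (\<lambda>x. family_coord f (fst x) (snd x))"
    unfolding continuous_openin_preimage_eq
  proof (intro allI impI)
    fix V :: "complex set" assume V: "open V"
    have "\<Omega> \<inter> (\<lambda>x. family_coord f (fst x) (snd x)) -` V = {x \<in> X. (case x of (t, \<tau>) \<Rightarrow> f t \<tau>) \<in> Some ` V}"
    proof (rule set_eqI)
      fix x :: "real \<times> complex" show "x \<in> \<Omega> \<inter> (\<lambda>x. family_coord f (fst x) (snd x)) -` V \<longleftrightarrow> x \<in> {x \<in> X. (case x of (t, \<tau>) \<Rightarrow> f t \<tau>) \<in> Some ` V}"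
        by (cases x; cases "f (fst x) (snd x)") (auto simp: \<Omega>_def family_coord_def cp1_coord_def)
    qed
    moreover have "openin (top_of_set X) {x \<in> X. (case x of (t, \<tau>) \<Rightarrow> f t \<tau>) \<in> Some ` V}"
      unfolding X_def by (rule openin_family_preimage[OF f V])
    ultimately have "openin (top_of_set X) (\<Omega> \<inter> (\<lambda>x. family_coord f (fst x) (snd x)) -` V)" by simp
    then show "openin (top_of_set \<Omega>) (\<Omega> \<inter> (\<lambda>x. family_coord f (fst x) (snd x)) -` V)"
      by (rule openin_subset_trans) (auto simp: \<Omega>_def)
  qed
  have i\<Omega>: "(t0, \<i>) \<in> \<Omega>" using family_at_i[OF f t0] t0 by (simp add: mem)
  obtain W where W: "open W" "\<Omega> = X \<inter> W" using op by (auto simp: openin_open)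
  obtain A B where AB: "open A" "open B" "(t0, \<i>) \<in> A \<times> B" "A \<times> B \<subseteq> W"
    using W i\<Omega> open_prod_elim[of W "(t0, \<i>)"] by blast
  have iB: "\<i> \<in> B \<inter> upper_half_plane" and tA: "t0 \<in> A" using AB(3) by auto
  obtain e where e: "e > 0" "cball \<i> e \<subseteq> B \<inter> upper_half_plane"
    using iB open_Int[OF AB(2) open_upper_half_plane] open_contains_cball by metis
  obtain d where d: "d > 0" "cball t0 d \<subseteq> A" using tA AB(1) open_contains_cball by metis
  define K where "K = (cball t0 d \<inter> {0..}) \<times> cball \<i> e"
  have K\<Omega>: "K \<subseteq> \<Omega>" using d e AB(4) W(2) by (auto simp: K_def X_def)
  have "compact K" unfolding K_def by (intro compact_Times compact_Int_closed) auto
  then have "uniformly_continuous_on K (\<lambda>x. family_coord f (fst x) (snd x))"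
    by (intro compact_uniformly_continuous continuous_on_subset[OF cont K\<Omega>])
  then have uc: "\<exists>\<delta>>0. \<forall>x\<in>K. \<forall>x'\<in>K. dist x' x < \<delta> \<longrightarrow> dist (family_coord f (fst x') (snd x')) (family_coord f (fst x) (snd x)) < \<epsilon>"
    if "\<epsilon> > 0" for \<epsilon> using that unfolding uniformly_continuous_on_def by blast
  have evK: "eventually (\<lambda>n. dist (T n) t0 < d') sequentially" if "d' > 0" for d'
    using T(2) that by (rule tendstoD)
  have ul: "uniform_limit (ball \<i> e) (\<lambda>n. family_coord f (T n)) (family_coord f t0) sequentially"
  proof (rule uniform_limitI)
    fix \<epsilon> :: real assume "\<epsilon> > 0"
    then obtain \<delta> where \<delta>: "\<delta> > 0" "\<And>x x'. x \<in> K \<Longrightarrow> x' \<in> K \<Longrightarrow> dist x' x < \<delta> \<Longrightarrow> dist (family_coord f (fst x') (snd x')) (family_coord f (fst x) (snd x)) < \<epsilon>"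
      using uc by blast
    from evK[of "min \<delta> d"] show "\<forall>\<^sub>F n in sequentially. \<forall>\<tau>\<in>ball \<i> e. dist (family_coord f (T n) \<tau>) (family_coord f t0 \<tau>) < \<epsilon>"
    proof (rule eventually_mono)
      show "0 < min \<delta> d" using \<delta> d by simp
      fix n assume n: "dist (T n) t0 < min \<delta> d"
      show "\<forall>\<tau>\<in>ball \<i> e. dist (family_coord f (T n) \<tau>) (family_coord f t0 \<tau>) < \<epsilon>"
      proof
        fix \<tau> assume "\<tau> \<in> ball \<i> e"
        then have "(t0, \<tau>) \<in> K" "(T n, \<tau>) \<in> K" using n T(1)[of n] t0 d by (auto simp: K_def dist_commute)
        moreover have "dist (T n, \<tau>) (t0, \<tau>) < \<delta>" using n by (simp add: dist_Pair_Pair)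
        ultimately show "dist (family_coord f (T n) \<tau>) (family_coord f t0 \<tau>) < \<epsilon>" using \<delta>(2) by fastforce
      qed
    qed
  qed
  have "eventually (\<lambda>n. family_coord f (T n) holomorphic_on ball \<i> e) sequentially"
    using evK[OF d(1)]
  proof eventually_elim
    case (elim n)
    show ?case
    proof (rule family_holomorphic[OF f T(1)], rule subsetI)
      fix \<tau> assume "\<tau> \<in> ball \<i> e"
      then have "(T n, \<tau>) \<in> K" using elim T(1)[of n] by (auto simp: K_def dist_commute)
      then show "\<tau> \<in> {\<tau>. Im \<tau> > 0 \<and> f (T n) \<tau> \<noteq> None}" using K\<Omega> mem by blast
    qed
  qed
  then show ?thesis
    by (rule higher_deriv_complex_uniform_limit[OF ul]) (use e in auto)
qed

lemma family_coord_at_i: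
  assumes f: "q_complex_family f" and t: "t \<ge> 0"
  shows "family_coord f t \<i> = \<i> * of_real (exp (t / 2))"
proof -
  \<comment> \<open>The quotient by the expected value has square 1 for every t and equals 1 at t =
    0; continuity on the connected half-line fixes the sign.\<close>
  define g where "g = (\<lambda>t. family_coord f t \<i> / (\<i> * of_real (exp (t / 2))))"
  have cont: "continuous_on {0..} g"
    unfolding continuous_on_sequentially
  proof (intro allI ballI impI, elim conjE)
    fix T :: "nat \<Rightarrow> real" and t0 :: real assume h: "t0 \<in> {0..}" "\<forall>n. T n \<in> {0..}" "T \<longlonglongrightarrow> t0"
    have "(\<lambda>n. family_coord f (T n) \<i>) \<longlonglongrightarrow> family_coord f t0 \<i>"
      using family_higher_deriv_tendsto[OF f, of t0 T 0] h by simp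
    then show "(g \<circ> T) \<longlonglongrightarrow> g t0"
      unfolding g_def o_def by (intro tendsto_intros h(3)) auto
  qed
  have g2: "(g t)\<^sup>2 = 1" if "t \<ge> 0" for t
  proof (cases "t = 0")
    case True
    then show ?thesis using family_0[OF f, of \<i>] by (simp add: g_def family_coord_def cp1_coord_def)
  next
    case False
    then interpret equivariant_map "f t" t using q_complex_family_equivariant[OF f, of t] that by simp
    have e2: "(complex_of_real (exp (t / 2)))\<^sup>2 = of_real (exp t)"
      by (simp add: power2_eq_square flip: of_real_mult exp_add)
    have "(family_coord f t \<i>)\<^sup>2 = - of_real (exp t)" using h_at_i(2) by (simp add: family_coord_def hc_def)
    then show ?thesis unfolding g_def power_divide power_mult_distrib e2 by simp
  qed
  have "g constant_on {0..}"
  proof (rule continuous_finite_range_constant[OF _ cont])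
    have "g ` {0..} \<subseteq> {1, -1}" using g2 by (auto simp: power2_eq_1_iff)
    then show "finite (g ` {0..})" by (rule finite_subset) simp
  qed simp
  then have "g t = g 0" using t unfolding constant_on_def by force
  also have "g 0 = 1" using family_0[OF f, of \<i>] by (simp add: g_def family_coord_def cp1_coord_def)
  finally show ?thesis by (simp add: g_def)
qed

lemma weight4_axis_nonzero: "y > 0 \<Longrightarrow> weight4 (\<i> * of_real y) \<noteq> 0"
proof -
  assume y: "y > 0"
  then obtain ra rb where r: "ra > 0" "rb > 0" "th2 (\<i> * of_real y) = of_real ra" "th4 (\<i> * of_real y) = of_real rb"
    by (rule th_axis_positive)
  have "th3 (\<i> * of_real y) = of_real (ra + rb)" using jacobi_identity[of "\<i> * of_real y"] y r by simp
  then have "weight4 (\<i> * of_real y) = of_real ((ra\<^sup>2 + (ra + rb)\<^sup>2 + rb\<^sup>2) / 2)" using r by (simp add: weight4_def)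
  moreover have "(ra\<^sup>2 + (ra + rb)\<^sup>2 + rb\<^sup>2) / 2 > 0" using r by (simp add: add_pos_pos)
  ultimately show ?thesis by (metis of_real_eq_0_iff order_less_irrefl)
qed

text \<open>The integer m of the cusp expansion is recovered from the Schwarzian at i, which is
  continuous in t down to t = 0, where it vanishes.\<close>

lemma family_schwarzian_and_limit:
  assumes f: "q_complex_family f" and t: "t > 0"
  shows "\<exists>U0. U0 \<noteq> 0 \<and>
    ((\<lambda>\<tau>. (equivariant_map.hc (f t) \<tau> - equivariant_map.p t) * exp (of_real t * \<tau>)) \<longlongrightarrow> U0) at_i_infinity \<and>
    (\<forall>\<tau>. Im \<tau> > 0 \<longrightarrow> equivariant_map.Sh (f t) \<tau> = - ((of_real t)\<^sup>2 / 2) * weight4 \<tau>)"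
proof -
  define F where "F = (\<lambda>t. schwarzian (family_coord f t) \<i>)"
  \<comment> \<open>Normalized to be m^2: the real part of -(2 pi i m - t)^2 / 2 is 2 pi^2 m^2 - t^2
    / 2.\<close>
  define M where "M = (\<lambda>t. (Re (F t / weight4 \<i>) + t\<^sup>2 / 2) / (2 * pi\<^sup>2))"
  have w4: "weight4 \<i> \<noteq> 0" using weight4_axis_nonzero[of 1] by simp
  have F_eq: "F t = (deriv ^^ 3) (family_coord f t) \<i> / deriv (family_coord f t) \<i>
      - 3 / 2 * ((deriv ^^ 2) (family_coord f t) \<i> / deriv (family_coord f t) \<i>)\<^sup>2" if t: "t \<ge> 0" for t
  proof -
    have "\<exists>A. open A \<and> \<i> \<in> A \<and> A \<subseteq> {\<tau>. Im \<tau> > 0 \<and> f t \<tau> \<noteq> None}"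
    proof (cases "t = 0")
      case True
      then show ?thesis using open_upper_half_plane family_0[OF f] by (intro exI[of _ upper_half_plane]) auto
    next
      case False
      then interpret equivariant_map "f t" t using q_complex_family_equivariant[OF f, of t] t by simp
      show ?thesis using open_fin family_at_i[OF f t] by (intro exI[of _ fin]) (auto simp: fin_def)
    qed
    then obtain A where "open A" "\<i> \<in> A" "A \<subseteq> {\<tau>. Im \<tau> > 0 \<and> f t \<tau> \<noteq> None}" by blast
    then show ?thesis unfolding F_def
      by (intro schwarzian_higher_deriv[of A] family_holomorphic[OF f t] family_deriv_nonzero[OF f t])
  qed
  have cont: "continuous_on {0..} M"
    unfolding continuous_on_sequentially
  proof (intro allI ballI impI, elim conjE)
    fix T :: "nat \<Rightarrow> real" and t0 :: real assume h: "t0 \<in> {0..}" "\<forall>n. T n \<in> {0..}" "T \<longlonglongrightarrow> t0"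
    note d = family_higher_deriv_tendsto[OF f, of t0 T]
    have d1: "(\<lambda>n. deriv (family_coord f (T n)) \<i>) \<longlonglongrightarrow> deriv (family_coord f t0) \<i>"
      using d[of 1] h by simp
    have "(\<lambda>n. (deriv ^^ 3) (family_coord f (T n)) \<i> / deriv (family_coord f (T n)) \<i>
      - 3 / 2 * ((deriv ^^ 2) (family_coord f (T n)) \<i> / deriv (family_coord f (T n)) \<i>)\<^sup>2) \<longlonglongrightarrow> F t0"
      using F_eq[of t0] h family_deriv_nonzero[OF f, of t0] by (simp only: atLeast_iff) (intro tendsto_intros d d1; simp)
    then have "(\<lambda>n. F (T n)) \<longlonglongrightarrow> F t0" using F_eq h(2) by simp
    then show "(M \<circ> T) \<longlonglongrightarrow> M t0"
      unfolding M_def o_def using w4 by (intro tendsto_intros h(3)) auto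
  qed
  have M0: "M 0 = 0"
  proof -
    have "F 0 = schwarzian (\<lambda>\<tau>. 1 * \<tau> + 0) \<i>"
      unfolding F_def by (rule schwarzian_cong[OF open_upper_half_plane])
        (use family_0[OF f] in \<open>auto simp: family_coord_def cp1_coord_def\<close>)
    then have "F 0 = 0" by (simp only: schwarzian_affine_0)
    then show ?thesis by (simp add: M_def)
  qed
  have M_int: "\<exists>U0. U0 \<noteq> 0 \<and> M t = (real m)\<^sup>2 \<and>
      ((\<lambda>\<tau>. (equivariant_map.hc (f t) \<tau> - equivariant_map.p t) * exp (- (2 * of_real pi * \<i> * of_nat m - of_real t) * \<tau>)) \<longlongrightarrow> U0) at_i_infinity \<and>
      (\<forall>\<tau>. Im \<tau> > 0 \<longrightarrow> equivariant_map.Sh (f t) \<tau> = - ((2 * of_real pi * \<i> * of_nat m - of_real t)\<^sup>2 / 2) * weight4 \<tau>)"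
    if t: "t > 0" and m: "\<exists>U0. U0 \<noteq> 0 \<and>
      ((\<lambda>\<tau>. (equivariant_map.hc (f t) \<tau> - equivariant_map.p t) * exp (- (2 * of_real pi * \<i> * of_nat m - of_real t) * \<tau>)) \<longlongrightarrow> U0) at_i_infinity \<and>
      (\<forall>\<tau>. Im \<tau> > 0 \<longrightarrow> equivariant_map.Sh (f t) \<tau> = - ((2 * of_real pi * \<i> * of_nat m - of_real t)\<^sup>2 / 2) * weight4 \<tau>)" for t m
  proof -
    interpret equivariant_map "f t" t using q_complex_family_equivariant[OF f t] .
    have fc: "family_coord f t = hc" by (simp add: fun_eq_iff family_coord_def hc_def)
    have "\<i> \<in> fin" using family_at_i[OF f, of t] t by (simp add: fin_def)
    then have "F t = - ((2 * of_real pi * \<i> * of_nat m - of_real t)\<^sup>2 / 2) * weight4 \<i>"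
      using m Sh_fin[of \<i>] unfolding F_def fc by auto
    then have "F t / weight4 \<i> = - ((2 * of_real pi * \<i> * of_nat m - of_real t)\<^sup>2 / 2)" using w4 by simp
    also have "\<dots> = of_real (2 * pi\<^sup>2 * (real m)\<^sup>2 - t\<^sup>2 / 2) + \<i> * of_real (2 * pi * real m * t)"
      by (simp add: power2_eq_square algebra_simps add_divide_distrib diff_divide_distrib)
    finally have "Re (F t / weight4 \<i>) = 2 * pi\<^sup>2 * (real m)\<^sup>2 - t\<^sup>2 / 2" by simp
    then have "M t = (real m)\<^sup>2" by (simp add: M_def)
    then show ?thesis using m by blast
  qed
  have nat: "\<exists>m::nat. M t = (real m)\<^sup>2" if "t \<ge> 0" for t
  proof (cases "t = 0")
    case True
    then show ?thesis using M0 by (intro exI[of _ 0]) simp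
  next
    case False
    then interpret equivariant_map "f t" t using q_complex_family_equivariant[OF f, of t] that by simp
    have t: "t > 0" using False that by simp
    obtain m where "\<exists>U0. U0 \<noteq> 0 \<and>
      ((\<lambda>\<tau>. (hc \<tau> - p) * exp (- (2 * of_real pi * \<i> * of_nat m - of_real t) * \<tau>)) \<longlongrightarrow> U0) at_i_infinity \<and>
      (\<forall>\<tau>. Im \<tau> > 0 \<longrightarrow> Sh \<tau> = - ((2 * of_real pi * \<i> * of_nat m - of_real t)\<^sup>2 / 2) * weight4 \<tau>)"
      using schwarzian_eq_weight4 by blast
    from M_int[OF t this] show ?thesis by blast
  qed
  have "M constant_on {0..}"
  proof (rule continuous_discrete_range_constant[OF _ cont])
    fix x :: real assume x: "x \<in> {0..}"
    \<comment> \<open>Distinct squares of natural numbers differ by at least 1, so the range is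
      discrete and a continuous M is constant.\<close>
    show "\<exists>e>0. \<forall>y. y \<in> {0..} \<and> M y \<noteq> M x \<longrightarrow> e \<le> norm (M y - M x)"
    proof (intro exI[of _ 1] conjI allI impI)
      fix y :: real assume y: "y \<in> {0..} \<and> M y \<noteq> M x"
      obtain m n where mn: "M x = (real m)\<^sup>2" "M y = (real n)\<^sup>2" using nat[of x] nat[of y] x y by auto
      have "M y - M x = of_int (int n ^ 2 - int m ^ 2)" by (simp add: mn)
      moreover from this have "int n ^ 2 - int m ^ 2 \<noteq> 0" using y by auto
      then have "1 \<le> \<bar>int n ^ 2 - int m ^ 2\<bar>" by linarith
      then have "(of_int 1 :: real) \<le> of_int \<bar>int n ^ 2 - int m ^ 2\<bar>" by (simp only: of_int_le_iff)
      ultimately show "1 \<le> norm (M y - M x)" by (simp only: real_norm_def of_int_abs of_int_1)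
    qed simp
  qed simp
  then have Mt: "M t = 0" using t M0 unfolding constant_on_def by (metis atLeast_iff less_eq_real_def order_refl)
  interpret equivariant_map "f t" t using q_complex_family_equivariant[OF f t] .
  obtain m where m: "\<exists>U0. U0 \<noteq> 0 \<and>
    ((\<lambda>\<tau>. (hc \<tau> - p) * exp (- (2 * of_real pi * \<i> * of_nat m - of_real t) * \<tau>)) \<longlongrightarrow> U0) at_i_infinity \<and>
    (\<forall>\<tau>. Im \<tau> > 0 \<longrightarrow> Sh \<tau> = - ((2 * of_real pi * \<i> * of_nat m - of_real t)\<^sup>2 / 2) * weight4 \<tau>)"
    using schwarzian_eq_weight4 by blast
  have "m = 0" using M_int[OF t m] Mt by auto
  then show ?thesis using m by simp
qed

text \<open>The conclusion concerns punctured neighbourhoods, because values at poles are arbitrary;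
  the identity theorem is applied to the difference with its removable singularities filled
  in.\<close>

lemma meromorphic_identity:
  assumes f: "f meromorphic_on A" and g: "g meromorphic_on A" and A: "open A" "connected A"
    and z: "z \<in> A" "frequently (\<lambda>x. f x = g x) (at z)" and w: "w \<in> A"
  shows "eventually (\<lambda>x. f x = g x) (at w)"
proof -
  define d where "d = (\<lambda>x. f x - g x)"
  have d: "d meromorphic_on A" unfolding d_def by (intro meromorphic_intros f g)
  then have iso: "isolated_singularity_at d x" if "x \<in> A" for x
    using that by (intro meromorphic_on_isolated_singularity) (auto intro: meromorphic_on_subset)
  have eq: "eventually (\<lambda>y. remove_sings d y = d y) (at x)" if "x \<in> A" for x
    by (rule eventually_remove_sings_eq_at[OF iso[OF that]])
  have "frequently (\<lambda>x. f x = g x \<and> remove_sings d x = d x) (at z)"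
    by (rule frequently_eventually_frequently[OF z(2) eq[OF z(1)]])
  then have "frequently (\<lambda>x. remove_sings d x = 0) (at z)"
    by (rule frequently_elim1) (simp add: d_def)
  then have 0: "remove_sings d x = 0" if "x \<in> A" for x
    using frequently_eq_meromorphic_imp_constant[OF _ remove_sings_nicely_meromorphic[OF d] A z(1)] that by blast
  have "eventually (\<lambda>x. x \<in> A) (at w)" using A(1) w by (rule eventually_at_in_open')
  with eq[OF w] show ?thesis by eventually_elim (use 0 in \<open>simp add: d_def\<close>)
qed

text \<open>The equation has no first-order term, so Wronskians are constant; Cramer's rule with the
  nonzero Wronskian k then gives the coefficients.\<close>

lemma linear_second_order_combination:
  fixes G :: "complex \<Rightarrow> complex"
  assumes B: "open B" "connected B" and k: "k \<noteq> 0"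
    and a: "\<And>z. z \<in> B \<Longrightarrow> (a has_field_derivative a1 z) (at z)" "\<And>z. z \<in> B \<Longrightarrow> (a1 has_field_derivative G z * a z) (at z)"
    and b: "\<And>z. z \<in> B \<Longrightarrow> (b has_field_derivative b1 z) (at z)" "\<And>z. z \<in> B \<Longrightarrow> (b1 has_field_derivative G z * b z) (at z)"
    and w: "\<And>z. z \<in> B \<Longrightarrow> a z * b1 z - a1 z * b z = k"
    and u: "\<And>z. z \<in> B \<Longrightarrow> (u has_field_derivative u1 z) (at z)" "\<And>z. z \<in> B \<Longrightarrow> (u1 has_field_derivative G z * u z) (at z)"
  shows "\<exists>\<alpha> \<beta>. \<forall>z\<in>B. u z = \<alpha> * a z + \<beta> * b z"
proof -
  have const: "\<exists>c. \<forall>z\<in>B. u z * v1 z - u1 z * v z = c"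
    if v: "\<And>z. z \<in> B \<Longrightarrow> (v has_field_derivative v1 z) (at z)" "\<And>z. z \<in> B \<Longrightarrow> (v1 has_field_derivative G z * v z) (at z)"
    for v v1
  proof -
    have "((\<lambda>z. u z * v1 z - u1 z * v z) has_field_derivative 0) (at z within B)" if z: "z \<in> B" for z
      by (rule has_field_derivative_at_within,
          rule DERIV_cong[OF DERIV_diff[OF DERIV_mult[OF u(1)[OF z] v(2)[OF z]] DERIV_mult[OF u(2)[OF z] v(1)[OF z]]]])
         (simp add: algebra_simps)
    then show ?thesis using DERIV_zero_connected_constant[OF B(2,1) finite.emptyI, of "\<lambda>z. u z * v1 z - u1 z * v z"]
      by (metis (no_types, lifting) B Diff_empty has_field_derivative_imp_has_derivative has_derivative_continuous_on at_within_open continuous_on_eq_continuous_within has_field_derivative_def has_derivative_continuous)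
  qed
  obtain ca where ca: "\<And>z. z \<in> B \<Longrightarrow> u z * a1 z - u1 z * a z = ca" using const[OF a] by blast
  obtain cb where cb: "\<And>z. z \<in> B \<Longrightarrow> u z * b1 z - u1 z * b z = cb" using const[OF b] by blast
  have "u z = cb / k * a z + (- ca / k) * b z" if z: "z \<in> B" for z
  proof -
    have "k * u z = cb * a z - ca * b z"
      unfolding w[OF z, symmetric] ca[OF z, symmetric] cb[OF z, symmetric] by (simp add: algebra_simps)
    then show ?thesis using k by (simp add: field_simps)
  qed
  then show ?thesis by blast
qed

section \<open>The hypergeometric system in the variable of the upper half-plane\<close>

text \<open>The domain on which the hypergeometric solutions can be composed with
  \<open>modular_lambda\<close>. It contains the whole imaginary axis.\<close>

definition lens_region :: "complex set" where
  "lens_region = {\<tau>. Im \<tau> > 0 \<and> th3 \<tau> \<noteq> 0 \<and> modular_lambda \<tau> \<in> lens}"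

lemma th_derivs:
  assumes "Im \<tau> > 0"
  shows "(th2 has_field_derivative deriv th2 \<tau>) (at \<tau>)" "(th3 has_field_derivative deriv th3 \<tau>) (at \<tau>)"
    "(th4 has_field_derivative deriv th4 \<tau>) (at \<tau>)"
  using assms by (auto intro!: holomorphic_derivI[OF _ open_upper_half_plane] th_holomorphic)

lemma modular_lambda_deriv:
  assumes \<tau>: "Im \<tau> > 0" "th3 \<tau> \<noteq> 0"
  shows "(modular_lambda has_field_derivative
    of_real pi * \<i> * modular_lambda \<tau> * (1 - modular_lambda \<tau>) * th3 \<tau>) (at \<tau>)"
proof -
  have e: "(deriv th2 \<tau> * th3 \<tau> - th2 \<tau> * deriv th3 \<tau>) = of_real pi * \<i> * th2 \<tau> * th3 \<tau> * th4 \<tau>"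
    using th_wronskian[OF \<tau>(1)] jacobi_identity[OF \<tau>(1)] jacobi_identity_deriv(1)[OF \<tau>(1)] by algebra
  have th4: "th4 \<tau> = th3 \<tau> - th2 \<tau>" using jacobi_identity[OF \<tau>(1)] by simp
  have "of_real pi * \<i> * th2 \<tau> * th3 \<tau> * th4 \<tau> / (th3 \<tau> * th3 \<tau>) = of_real pi * \<i> * (th2 \<tau> / th3 \<tau>) * (1 - th2 \<tau> / th3 \<tau>) * th3 \<tau>"
    unfolding th4 using \<tau>(2) by (simp add: field_simps)
  moreover have ml: "modular_lambda = (\<lambda>\<tau>. th2 \<tau> / th3 \<tau>)" by (simp add: fun_eq_iff modular_lambda_eq)
  ultimately show ?thesis unfolding ml
    by (intro DERIV_cong[OF DERIV_divide[OF th_derivs(1)[OF \<tau>(1)] th_derivs(2)[OF \<tau>(1)] \<tau>(2)]]) (simp only: e)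
qed

lemma open_lens_region: "open lens_region"
proof -
  have c3: "continuous_on upper_half_plane th3" by (rule holomorphic_on_imp_continuous_on[OF th3_holomorphic])
  have o: "open (upper_half_plane \<inter> th3 -` (- {0}))"
    by (rule continuous_open_preimage[OF c3 open_upper_half_plane]) (simp add: open_Compl)
  have "continuous_on (upper_half_plane \<inter> th3 -` (- {0})) modular_lambda"
    unfolding modular_lambda_eq
    by (intro continuous_intros holomorphic_on_imp_continuous_on holomorphic_on_subset[OF th2_holomorphic]
        holomorphic_on_subset[OF th3_holomorphic]) auto
  then have "open ((upper_half_plane \<inter> th3 -` (- {0})) \<inter> modular_lambda -` lens)"
    by (rule continuous_open_preimage[OF _ o open_lens])
  moreover have "(upper_half_plane \<inter> th3 -` (- {0})) \<inter> modular_lambda -` lens = lens_region"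
    by (auto simp: lens_region_def)
  ultimately show ?thesis by simp
qed

text \<open>On \<open>lens\<close> both |z| and |1 - z| are below 1, so z (1 - z) is not 1, that is,
  1 - z + z^2 is not 0. The second-order equation of \<open>th3\<close> is thus available on all of
  \<open>lens_region\<close>.\<close>

lemma weight4_modular_lambda:
  assumes "\<tau> \<in> lens_region"
  shows "weight4 \<tau> = (th3 \<tau>)\<^sup>2 * (1 - modular_lambda \<tau> + (modular_lambda \<tau>)\<^sup>2)" "weight4 \<tau> \<noteq> 0"
proof -
  have \<tau>: "Im \<tau> > 0" "th3 \<tau> \<noteq> 0" "modular_lambda \<tau> \<in> lens" using assms by (auto simp: lens_region_def)
  have th4: "th4 \<tau> = th3 \<tau> - th2 \<tau>" using jacobi_identity[OF \<tau>(1)] by simp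
  show 1: "weight4 \<tau> = (th3 \<tau>)\<^sup>2 * (1 - modular_lambda \<tau> + (modular_lambda \<tau>)\<^sup>2)"
    unfolding weight4_def th4 modular_lambda_eq using \<tau>(2) by (simp add: field_simps power2_eq_square)
  have "cmod (modular_lambda \<tau> * (1 - modular_lambda \<tau>)) < 1"
    using \<tau>(3) mult_strict_mono'[of "cmod (modular_lambda \<tau>)" 1 "cmod (1 - modular_lambda \<tau>)" 1] by (simp add: mem_lens norm_mult)
  then have "modular_lambda \<tau> * (1 - modular_lambda \<tau>) \<noteq> 1" by auto
  then have "1 - modular_lambda \<tau> + (modular_lambda \<tau>)\<^sup>2 \<noteq> 0" by (auto simp: power2_eq_square algebra_simps)
  then show "weight4 \<tau> \<noteq> 0" unfolding 1 using \<tau>(2) by simp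
qed

text \<open>A global holomorphic square root of \<open>th3\<close>. The derivative of
  \<open>modular_lambda\<close> is pi i \<lambda> (1 - \<lambda>) times its square.\<close>

definition theta_sq :: "complex \<Rightarrow> complex" where "theta_sq \<tau> = (theta00 \<tau>)\<^sup>2"

lemma theta_sq_square: "theta_sq \<tau> * theta_sq \<tau> = th3 \<tau>"
  by (simp add: theta_sq_def th3_def flip: power_add)

lemma theta_sq_holomorphic: "theta_sq holomorphic_on upper_half_plane"
  unfolding theta_sq_def[abs_def] theta00_eq by (intro holomorphic_intros holomorphic_jacobi_theta open_upper_half_plane) auto

lemma theta_sq_derivs:
  assumes "Im \<tau> > 0"
  shows "(theta_sq has_field_derivative deriv theta_sq \<tau>) (at \<tau>)"
    "(deriv theta_sq has_field_derivative deriv (deriv theta_sq) \<tau>) (at \<tau>)"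
  using assms by (auto intro!: holomorphic_derivI[OF _ open_upper_half_plane] theta_sq_holomorphic holomorphic_deriv open_upper_half_plane)

lemma theta_sq_second_order:
  assumes \<tau>: "Im \<tau> > 0" "weight4 \<tau> \<noteq> 0" "th3 \<tau> \<noteq> 0"
  shows "2 * (deriv theta_sq \<tau>)\<^sup>2 - theta_sq \<tau> * deriv (deriv theta_sq) \<tau> = of_real pi ^ 2 * (theta_sq \<tau>)\<^sup>2 * th2 \<tau> * th4 \<tau> / 4"
proof -
  have th3: "th3 = (\<lambda>\<tau>. theta_sq \<tau> * theta_sq \<tau>)" by (simp add: fun_eq_iff theta_sq_square)
  have d: "deriv th3 \<tau> = 2 * theta_sq \<tau> * deriv theta_sq \<tau>" if "Im \<tau> > 0" for \<tau>
    unfolding th3 by (rule DERIV_imp_deriv, rule DERIV_cong[OF DERIV_mult[OF theta_sq_derivs(1)[OF that] theta_sq_derivs(1)[OF that]]]) simp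
  have "deriv (deriv th3) \<tau> = deriv (\<lambda>\<tau>. 2 * theta_sq \<tau> * deriv theta_sq \<tau>) \<tau>"
    by (rule deriv_eq_on_open[OF open_upper_half_plane]) (use d \<tau>(1) in auto)
  also have "\<dots> = 2 * (deriv theta_sq \<tau>)\<^sup>2 + 2 * theta_sq \<tau> * deriv (deriv theta_sq) \<tau>"
    by (rule DERIV_imp_deriv, rule DERIV_cong[OF DERIV_mult[OF DERIV_cmult[OF theta_sq_derivs(1)[OF \<tau>(1)], of 2] theta_sq_derivs(2)[OF \<tau>(1)]]])
       (simp add: power2_eq_square)
  finally have dd: "deriv (deriv th3) \<tau> = 2 * (deriv theta_sq \<tau>)\<^sup>2 + 2 * theta_sq \<tau> * deriv (deriv theta_sq) \<tau>" .
  have "3 * (2 * theta_sq \<tau> * deriv theta_sq \<tau>)\<^sup>2 - 2 * (theta_sq \<tau> * theta_sq \<tau>) * (2 * (deriv theta_sq \<tau>)\<^sup>2 + 2 * theta_sq \<tau> * deriv (deriv theta_sq) \<tau>)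
      = of_real pi ^ 2 * (theta_sq \<tau> * theta_sq \<tau>)\<^sup>2 * th2 \<tau> * th4 \<tau>"
    using th3_second_order[OF \<tau>(1,2)] unfolding dd d[OF \<tau>(1)] by (simp only: th3)
  then have "(4 * (theta_sq \<tau> * theta_sq \<tau>)) * (2 * (deriv theta_sq \<tau>)\<^sup>2 - theta_sq \<tau> * deriv (deriv theta_sq) \<tau>)
      = (4 * (theta_sq \<tau> * theta_sq \<tau>)) * (of_real pi ^ 2 * (theta_sq \<tau>)\<^sup>2 * th2 \<tau> * th4 \<tau> / 4)"
    by (simp add: power2_eq_square algebra_simps)
  moreover have "4 * (theta_sq \<tau> * theta_sq \<tau>) \<noteq> 0" unfolding theta_sq_square using \<tau>(3) by simp
  ultimately show ?thesis by (rule mult_left_cancel[THEN iffD1, rotated])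
qed

text \<open>Pulling the hypergeometric equation back along \<open>modular_lambda\<close> and dividing by \<open>theta_sq\<close>
  removes its first-order term.\<close>

lemma theta_system:
  assumes \<tau>: "\<tau> \<in> lens_region"
    and V: "\<And>z. z \<in> lens \<Longrightarrow> (V has_field_derivative W z / (z * (1 - z))) (at z)"
    and W: "\<And>z. z \<in> lens \<Longrightarrow> (W has_field_derivative (1/4 + \<sigma>\<^sup>2 * (1 - z + z\<^sup>2) / (z * (1 - z))) * V z) (at z)"
  shows "((\<lambda>\<tau>. V (modular_lambda \<tau>) / theta_sq \<tau>) has_field_derivative
      of_real pi * \<i> * theta_sq \<tau> * W (modular_lambda \<tau>) - V (modular_lambda \<tau>) * deriv theta_sq \<tau> / (theta_sq \<tau> * theta_sq \<tau>)) (at \<tau>)"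
    and "((\<lambda>\<tau>. of_real pi * \<i> * theta_sq \<tau> * W (modular_lambda \<tau>) - V (modular_lambda \<tau>) * deriv theta_sq \<tau> / (theta_sq \<tau> * theta_sq \<tau>))
      has_field_derivative - (of_real pi * \<sigma>)\<^sup>2 * weight4 \<tau> * (V (modular_lambda \<tau>) / theta_sq \<tau>)) (at \<tau>)"
proof -
  have t: "Im \<tau> > 0" "th3 \<tau> \<noteq> 0" "modular_lambda \<tau> \<in> lens" using \<tau> by (auto simp: lens_region_def)
  define l f f' f'' where defs: "l = modular_lambda \<tau>" "f = theta_sq \<tau>" "f' = deriv theta_sq \<tau>" "f'' = deriv (deriv theta_sq) \<tau>"
  have f0: "f \<noteq> 0" using theta_sq_square[of \<tau>] t(2) by (auto simp: defs)
  have l0: "l \<noteq> 0" "1 - l \<noteq> 0" using lens_nonzero[OF t(3)] by (auto simp: defs)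
  have dl: "(modular_lambda has_field_derivative of_real pi * \<i> * l * (1 - l) * (f * f)) (at \<tau>)"
    using modular_lambda_deriv[OF t(1,2)] by (simp add: defs theta_sq_square)
  have df: "(theta_sq has_field_derivative f') (at \<tau>)" "(deriv theta_sq has_field_derivative f'') (at \<tau>)"
    using theta_sq_derivs[OF t(1)] by (simp_all add: defs)
  have dV: "((\<lambda>\<tau>. V (modular_lambda \<tau>)) has_field_derivative of_real pi * \<i> * (f * f) * W l) (at \<tau>)"
    by (rule DERIV_cong[OF DERIV_chain2[OF V[OF t(3)] dl]]) (use l0 in \<open>simp add: defs(1)\<close>)
  have dW: "((\<lambda>\<tau>. W (modular_lambda \<tau>)) has_field_derivative of_real pi * \<i> * (f * f) * (l * (1 - l) / 4 + \<sigma>\<^sup>2 * (1 - l + l\<^sup>2)) * V l) (at \<tau>)"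
    by (rule DERIV_cong[OF DERIV_chain2[OF W[OF t(3)] dl]]) (use l0 in \<open>simp add: defs(1) field_simps\<close>)
  show "((\<lambda>\<tau>. V (modular_lambda \<tau>) / theta_sq \<tau>) has_field_derivative
      of_real pi * \<i> * theta_sq \<tau> * W (modular_lambda \<tau>) - V (modular_lambda \<tau>) * deriv theta_sq \<tau> / (theta_sq \<tau> * theta_sq \<tau>)) (at \<tau>)"
    unfolding defs[symmetric]
    by (rule DERIV_cong[OF DERIV_divide[OF dV df(1)]]) (use f0 in \<open>simp_all add: defs(1,2) field_simps\<close>)
  have th2: "th2 \<tau> = l * (f * f)" using t(2) by (simp add: defs theta_sq_square modular_lambda_eq)
  have th4: "th4 \<tau> = (1 - l) * (f * f)"
    using jacobi_identity[OF t(1)] th2 theta_sq_square[of \<tau>] by (simp add: defs(2) algebra_simps)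
  have so: "2 * f'\<^sup>2 - f * f'' = of_real pi ^ 2 * f\<^sup>2 * (l * (f * f)) * ((1 - l) * (f * f)) / 4"
    using theta_sq_second_order[OF t(1) weight4_modular_lambda(2)[OF \<tau>] t(2)] unfolding th2 th4 defs[symmetric] .
  have w4: "weight4 \<tau> = (f * f)\<^sup>2 * (1 - l + l\<^sup>2)"
    using weight4_modular_lambda(1)[OF \<tau>] by (simp add: defs theta_sq_square)
  have ff: "(\<lambda>\<tau>. theta_sq \<tau> * theta_sq \<tau>) \<tau> \<noteq> 0" using f0 by (simp add: defs)
  note D = DERIV_diff[OF DERIV_mult[OF DERIV_cmult[OF df(1), of "of_real pi * \<i>"] dW]
      DERIV_divide[OF DERIV_mult[OF dV df(2)] DERIV_mult[OF df(1) df(1)] ff]]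
  show "((\<lambda>\<tau>. of_real pi * \<i> * theta_sq \<tau> * W (modular_lambda \<tau>) - V (modular_lambda \<tau>) * deriv theta_sq \<tau> / (theta_sq \<tau> * theta_sq \<tau>))
      has_field_derivative - (of_real pi * \<sigma>)\<^sup>2 * weight4 \<tau> * (V (modular_lambda \<tau>) / theta_sq \<tau>)) (at \<tau>)"
  proof (rule DERIV_cong[OF D], unfold defs[symmetric] w4)
    define v w P where v_w_P_def: "v = V l" "w = W l" "P = complex_of_real pi"
    have i2: "P * \<i> * (P * \<i> * X) = - (P\<^sup>2 * X)" for X by (simp add: power2_eq_square algebra_simps)
    have "P * \<i> * f' * w + P * \<i> * (f * f) * (l * (1 - l) / 4 + \<sigma>\<^sup>2 * (1 - l + l\<^sup>2)) * v * (P * \<i> * f)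
        - ((P * \<i> * (f * f) * w * f' + f'' * v) * (f * f) - v * f' * (f' * f + f' * f)) / (f * f * (f * f))
      = - (P\<^sup>2) * f ^ 3 * (l * (1 - l) / 4 + \<sigma>\<^sup>2 * (1 - l + l\<^sup>2)) * v + v * (2 * f'\<^sup>2 - f * f'') / f ^ 3"
      using f0 by (simp add: field_simps power2_eq_square power3_eq_cube i2)
    \<comment> \<open>The second-order equation of \<open>theta_sq\<close> cancels exactly the term
      with 1/4 of the hypergeometric equation, leaving the multiple of
      \<open>weight4\<close>.\<close>
    also have "\<dots> = - (P * \<sigma>)\<^sup>2 * ((f * f)\<^sup>2 * (1 - l + l\<^sup>2)) * (v / f)"
      unfolding so v_w_P_def(3)[symmetric] using f0 by (simp add: field_simps power2_eq_square power3_eq_cube)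
    finally show "of_real pi * \<i> * f' * W l + of_real pi * \<i> * (f * f) * (l * (1 - l) / 4 + \<sigma>\<^sup>2 * (1 - l + l\<^sup>2)) * V l * (of_real pi * \<i> * f)
        - ((of_real pi * \<i> * (f * f) * W l * f' + f'' * V l) * (f * f) - V l * f' * (f' * f + f' * f)) / (f * f * (f * f))
      = - (of_real pi * \<sigma>)\<^sup>2 * ((f * f)\<^sup>2 * (1 - l + l\<^sup>2)) * (V l / f)"
      unfolding v_w_P_def .
  qed
qed

lemma modular_lambda_axis:
  assumes y: "y > 0"
  obtains x where "0 < x" "x < 1" "modular_lambda (\<i> * of_real y) = of_real x"
    "th4 (\<i> * of_real y) \<noteq> 0" "th3 (\<i> * of_real y) \<noteq> 0"
proof -
  obtain ra rb where r: "ra > 0" "rb > 0" "th2 (\<i> * of_real y) = of_real ra" "th4 (\<i> * of_real y) = of_real rb"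
    by (rule th_axis_positive[OF y])
  have th3: "th3 (\<i> * of_real y) = of_real (ra + rb)" using jacobi_identity[of "\<i> * of_real y"] y r by simp
  show thesis
  proof (rule that[of "ra / (ra + rb)"])
    show "modular_lambda (\<i> * of_real y) = of_real (ra / (ra + rb))" by (simp add: modular_lambda_eq th3 r)
    show "th3 (\<i> * of_real y) \<noteq> 0" unfolding th3 of_real_eq_0_iff using r by simp
  qed (use r in auto)
qed

lemma axis_lens_region: "y > 0 \<Longrightarrow> \<i> * of_real y \<in> lens_region"
  by (rule modular_lambda_axis[of y]) (auto simp: lens_region_def intro: lens_of_real)

lemma modular_lambda_holomorphic: "modular_lambda holomorphic_on lens_region"
  unfolding holomorphic_on_open[OF open_lens_region] using modular_lambda_deriv by (auto simp: lens_region_def)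

lemma hypv_modular_lambda_holomorphic:
  assumes "Re \<sigma> = 0"
  shows "(\<lambda>\<tau>. hypv \<sigma> (modular_lambda \<tau>)) holomorphic_on lens_region"
proof -
  have "hypv \<sigma> holomorphic_on lens"
    unfolding holomorphic_on_open[OF open_lens] using hypv_deriv[OF assms] by blast
  then show ?thesis
    using holomorphic_on_compose_gen[OF modular_lambda_holomorphic, of "hypv \<sigma>" lens]
    by (auto simp: o_def lens_region_def image_subset_iff)
qed

lemma holomorphic_imp_isCont: "f holomorphic_on A \<Longrightarrow> open A \<Longrightarrow> z \<in> A \<Longrightarrow> isCont f z"
  using holomorphic_on_imp_continuous_on continuous_on_eq_continuous_at by blast

definition axis_v :: "complex \<Rightarrow> real \<Rightarrow> complex" where
  "axis_v \<sigma> y = hypv \<sigma> (modular_lambda (\<i> * of_real y))"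

section \<open>From the Schwarzian equation to a relation on the imaginary axis\<close>

text \<open>Adds the outcome of continuity in t: m = 0 in the Schwarzian and in the cusp expansion,
  and the sign of the value at i.\<close>

locale normalized_equivariant_map = equivariant_map +
  assumes Sh_eq: "Im \<tau> > 0 \<Longrightarrow> Sh \<tau> = - ((of_real t)\<^sup>2 / 2) * weight4 \<tau>"
    and cusp: "\<exists>U0. U0 \<noteq> 0 \<and> ((\<lambda>\<tau>. (hc \<tau> - p) * exp (of_real t * \<tau>)) \<longlongrightarrow> U0) at_i_infinity"
    and hc_i: "hc \<i> = \<i> * of_real (exp (t / 2))"
begin

definition s :: complex where "s = of_real t / (2 * of_real pi * \<i>)"

text \<open>The relation -(pi s)^2 = t^2 / 4 matches the two linear equations: the hypergeometric
  one, pulled back, has the coefficient -(pi \<sigma>)^2 \<open>weight4\<close>, the Schwarzian one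
  has -\<open>Sh\<close> / 2.\<close>

lemma Re_s: "Re s = 0" "Re (- s) = 0" and s_nonzero: "s \<noteq> 0" "- s \<noteq> 0"
  and s_square: "- (of_real pi * s)\<^sup>2 = (of_real t)\<^sup>2 / 4" "- (of_real pi * - s)\<^sup>2 = (of_real t)\<^sup>2 / 4"
  and two_pi_i_s: "2 * of_real pi * \<i> * s = of_real t"
  using t_pos by (simp_all add: s_def Re_divide power_mult_distrib power_divide)

text \<open>The classical construction: \<psi> = (hc')^(-1/2) and hc \<psi> both solve u'' = -(Sh /
  2) u, and their quotient is \<open>hc\<close>. A square root of the derivative exists on a disc
  around i free of poles.\<close>

lemma schwarzian_solution:
  "\<exists>r \<psi> \<psi>1. r > 0 \<and> ball \<i> r \<subseteq> fin \<inter> lens_region \<and> (\<forall>\<tau>\<in>ball \<i> r. \<psi> \<tau> \<noteq> 0 \<and>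
     (\<psi> has_field_derivative \<psi>1 \<tau>) (at \<tau>) \<and> (\<psi>1 has_field_derivative ((of_real t)\<^sup>2 / 4 * weight4 \<tau>) * \<psi> \<tau>) (at \<tau>)) \<and>
     (\<exists>\<chi>1. \<forall>\<tau>\<in>ball \<i> r. ((\<lambda>\<tau>. hc \<tau> * \<psi> \<tau>) has_field_derivative \<chi>1 \<tau>) (at \<tau>) \<and>
       (\<chi>1 has_field_derivative ((of_real t)\<^sup>2 / 4 * weight4 \<tau>) * (hc \<tau> * \<psi> \<tau>)) (at \<tau>))"
proof -
  have "\<i> \<in> fin \<inter> lens_region" using h_at_i(1) axis_lens_region[of 1] by (simp add: fin_def)
  then obtain r where r: "r > 0" "ball \<i> r \<subseteq> fin \<inter> lens_region"
    using open_Int[OF open_fin open_lens_region] open_contains_ball by metis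
  define B where "B = ball \<i> r"
  have B: "open B" "B \<subseteq> fin" "contractible B" using r by (auto simp: B_def convex_imp_contractible)
  have dh: "deriv hc holomorphic_on B"
    by (intro holomorphic_deriv holomorphic_on_subset[OF hc_holomorphic] B)
  \<comment> \<open>\<open>k\<close> is a holomorphic square root of hc' on the disc, so that \<psi>
    = 1 / k and (hc \<psi>)' = k + hc \<psi>'.\<close>
  obtain k where k: "k holomorphic_on B" "\<And>z. z \<in> B \<Longrightarrow> deriv hc z = (k z)\<^sup>2"
    using contractible_imp_holomorphic_sqrt[OF dh B(3)] deriv_hc_nonzero B(2) by (metis subsetD)
  have k0: "k z \<noteq> 0" if "z \<in> B" for z using k(2)[OF that] deriv_hc_nonzero that B(2) by fastforce
  have dk: "(k has_field_derivative deriv k z) (at z)" "(deriv k has_field_derivative deriv (deriv k) z) (at z)" if "z \<in> B" for z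
    using that k(1) B(1) by (auto intro!: holomorphic_derivI[OF _ B(1)] holomorphic_deriv)
  have dhc: "(hc has_field_derivative (k z)\<^sup>2) (at z)" if "z \<in> B" for z
    using holomorphic_derivI[OF hc_holomorphic open_fin, of z UNIV] that B(2) k(2)[OF that] by auto
  have ddh: "deriv (deriv hc) z = 2 * k z * deriv k z" if "z \<in> B" for z
  proof -
    have "deriv (deriv hc) z = deriv (\<lambda>z. (k z)\<^sup>2) z" by (rule deriv_eq_on_open[OF B(1) k(2) that])
    also have "\<dots> = 2 * k z * deriv k z"
      by (rule DERIV_imp_deriv) (auto intro!: derivative_eq_intros dk that)
    finally show ?thesis .
  qed
  have Sk: "deriv (deriv k) z / (k z)\<^sup>2 - 2 * (deriv k z)\<^sup>2 / (k z) ^ 3 = Sh z / (2 * k z)" if z: "z \<in> B" for z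
  proof -
    have "deriv (\<lambda>w. deriv (deriv hc) w / deriv hc w) z = deriv (\<lambda>w. 2 * deriv k w / k w) z"
      by (rule deriv_eq_on_open[OF B(1) _ z]) (use k0 in \<open>simp add: ddh k(2) power2_eq_square\<close>)
    also have "\<dots> = 2 * deriv (deriv k) z / k z - 2 * (deriv k z)\<^sup>2 / (k z)\<^sup>2"
      by (rule DERIV_imp_deriv, rule DERIV_cong[OF DERIV_divide[OF DERIV_cmult[OF dk(2)[OF z], of 2] dk(1)[OF z] k0[OF z]]])
         (use k0[OF z] in \<open>simp add: field_simps power2_eq_square\<close>)
    finally have Sz: "Sh z = 2 * deriv (deriv k) z / k z - 2 * (deriv k z)\<^sup>2 / (k z)\<^sup>2 - (2 * k z * deriv k z / (k z)\<^sup>2)\<^sup>2 / 2"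
      using Sh_fin[of z] z B(2) unfolding schwarzian_def ddh[OF z] k(2)[OF z] by auto
    show ?thesis unfolding Sz using k0[OF z] by (simp add: field_simps power2_eq_square power3_eq_cube)
  qed
  have w: "Sh z = - ((of_real t)\<^sup>2 / 2) * weight4 z" if "z \<in> B" for z
    using Sh_eq[of z] that B(2) by (auto simp: fin_def)
  define \<psi> \<psi>1 where \<psi>_def: "\<psi> = (\<lambda>z. 1 / k z)" and \<psi>1_def: "\<psi>1 = (\<lambda>z. - deriv k z / (k z)\<^sup>2)"
  have \<psi>1: "(\<psi> has_field_derivative \<psi>1 z) (at z)" if z: "z \<in> B" for z
    unfolding \<psi>_def \<psi>1_def
    by (rule DERIV_cong[OF DERIV_divide[OF DERIV_const dk(1)[OF z] k0[OF z]]]) (simp add: power2_eq_square)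
  have \<psi>2: "(\<psi>1 has_field_derivative ((of_real t)\<^sup>2 / 4 * weight4 z) * \<psi> z) (at z)" if z: "z \<in> B" for z
  proof -
    have k2: "(k z)\<^sup>2 \<noteq> 0" using k0[OF z] by simp
    have dk2: "((\<lambda>z. (k z)\<^sup>2) has_field_derivative 2 * k z * deriv k z) (at z)"
      by (auto intro!: derivative_eq_intros dk z)
    have "(- deriv (deriv k) z * (k z)\<^sup>2 - - deriv k z * (2 * k z * deriv k z)) / ((k z)\<^sup>2 * (k z)\<^sup>2)
      = - (deriv (deriv k) z / (k z)\<^sup>2 - 2 * (deriv k z)\<^sup>2 / (k z) ^ 3)"
      using k0[OF z] by (simp add: field_simps power2_eq_square power3_eq_cube)
    also have "\<dots> = ((of_real t)\<^sup>2 / 4 * weight4 z) * \<psi> z" unfolding Sk[OF z] w[OF z] by (simp add: \<psi>_def)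
    finally show ?thesis unfolding \<psi>1_def
      by (intro DERIV_cong[OF DERIV_divide[OF DERIV_minus[OF dk(2)[OF z]] dk2 k2]])
  qed
  have \<chi>1: "((\<lambda>z. hc z * \<psi> z) has_field_derivative k z + hc z * \<psi>1 z) (at z)" if z: "z \<in> B" for z
    by (rule DERIV_cong[OF DERIV_mult[OF dhc[OF z] \<psi>1[OF z]]]) (use k0[OF z] in \<open>simp add: \<psi>_def power2_eq_square\<close>)
  have \<chi>2: "((\<lambda>z. k z + hc z * \<psi>1 z) has_field_derivative ((of_real t)\<^sup>2 / 4 * weight4 z) * (hc z * \<psi> z)) (at z)" if z: "z \<in> B" for z
    by (rule DERIV_cong[OF DERIV_add[OF dk(1)[OF z] DERIV_mult[OF dhc[OF z] \<psi>2[OF z]]]]) (use k0[OF z] in \<open>simp add: \<psi>1_def\<close>)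
  show ?thesis
    using r(1) r(2) k0 \<psi>1 \<psi>2 \<chi>1 \<chi>2 unfolding B_def
    by (intro exI[of _ r] exI[of _ \<psi>] exI[of _ \<psi>1] conjI exI[of _ "\<lambda>z. k z + hc z * \<psi>1 z"] ballI) (auto simp: \<psi>_def)
qed

text \<open>Both \<psi> and hc \<psi> are combinations of \<open>hypv s\<close> and
  \<open>hypv (- s)\<close> pulled back and divided by \<open>theta_sq\<close>. The relation is hc
  times \<psi> with this common divisor removed; \<psi> \<noteq> 0 keeps \<alpha>, \<beta> from
  vanishing together.\<close>

lemma local_relation:
  "\<exists>\<alpha> \<beta> \<gamma> \<delta> r. r > 0 \<and> ball \<i> r \<subseteq> fin \<inter> lens_region \<and> (\<alpha> \<noteq> 0 \<or> \<beta> \<noteq> 0) \<and>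
    (\<forall>\<tau>\<in>ball \<i> r. hc \<tau> * (\<alpha> * hypv s (modular_lambda \<tau>) + \<beta> * hypv (- s) (modular_lambda \<tau>))
      = \<gamma> * hypv s (modular_lambda \<tau>) + \<delta> * hypv (- s) (modular_lambda \<tau>))"
proof -
  obtain r \<psi> \<psi>1 \<chi>1 where r: "r > 0" "ball \<i> r \<subseteq> fin \<inter> lens_region"
    and \<psi>0: "\<And>\<tau>. \<tau> \<in> ball \<i> r \<Longrightarrow> \<psi> \<tau> \<noteq> 0"
    and \<psi>: "\<And>\<tau>. \<tau> \<in> ball \<i> r \<Longrightarrow> (\<psi> has_field_derivative \<psi>1 \<tau>) (at \<tau>)"
      "\<And>\<tau>. \<tau> \<in> ball \<i> r \<Longrightarrow> (\<psi>1 has_field_derivative ((of_real t)\<^sup>2 / 4 * weight4 \<tau>) * \<psi> \<tau>) (at \<tau>)"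
    and \<chi>: "\<And>\<tau>. \<tau> \<in> ball \<i> r \<Longrightarrow> ((\<lambda>\<tau>. hc \<tau> * \<psi> \<tau>) has_field_derivative \<chi>1 \<tau>) (at \<tau>)"
      "\<And>\<tau>. \<tau> \<in> ball \<i> r \<Longrightarrow> (\<chi>1 has_field_derivative ((of_real t)\<^sup>2 / 4 * weight4 \<tau>) * (hc \<tau> * \<psi> \<tau>)) (at \<tau>)"
    using schwarzian_solution by blast
  define \<phi> \<phi>1 where \<phi>_def: "\<phi> = (\<lambda>\<sigma> \<tau>. hypv \<sigma> (modular_lambda \<tau>) / theta_sq \<tau>)"
    and \<phi>1_def: "\<phi>1 = (\<lambda>\<sigma> \<tau>. of_real pi * \<i> * theta_sq \<tau> * hypw \<sigma> (modular_lambda \<tau>)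
      - hypv \<sigma> (modular_lambda \<tau>) * deriv theta_sq \<tau> / (theta_sq \<tau> * theta_sq \<tau>))"
  have L: "\<tau> \<in> lens_region" if "\<tau> \<in> ball \<i> r" for \<tau> using r(2) that by blast
  have f0: "theta_sq \<tau> \<noteq> 0" if "\<tau> \<in> ball \<i> r" for \<tau>
    using L[OF that] theta_sq_square[of \<tau>] by (auto simp: lens_region_def)
  have \<phi>: "(\<phi> \<sigma> has_field_derivative \<phi>1 \<sigma> \<tau>) (at \<tau>)" "(\<phi>1 \<sigma> has_field_derivative ((of_real t)\<^sup>2 / 4 * weight4 \<tau>) * \<phi> \<sigma> \<tau>) (at \<tau>)"
    if \<tau>: "\<tau> \<in> ball \<i> r" and \<sigma>: "Re \<sigma> = 0" "- (of_real pi * \<sigma>)\<^sup>2 = (of_real t)\<^sup>2 / 4" for \<tau> \<sigma>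
    unfolding \<phi>_def \<phi>1_def \<sigma>(2)[symmetric]
    by (rule theta_system[OF L[OF \<tau>] hypv_deriv[OF \<sigma>(1)] hypw_deriv[OF \<sigma>(1)]]; assumption)+
  have wr: "\<phi> s \<tau> * \<phi>1 (- s) \<tau> - \<phi>1 s \<tau> * \<phi> (- s) \<tau> = - (2 * of_real pi * \<i> * s)" if \<tau>: "\<tau> \<in> ball \<i> r" for \<tau>
  proof -
    have "modular_lambda \<tau> \<in> lens" using L[OF \<tau>] by (simp add: lens_region_def)
    note hw = hyp_wronskian[OF Re_s(1) this]
    have "\<phi> s \<tau> * \<phi>1 (- s) \<tau> - \<phi>1 s \<tau> * \<phi> (- s) \<tau> = of_real pi * \<i> *
      (hypv s (modular_lambda \<tau>) * hypw (- s) (modular_lambda \<tau>) - hypw s (modular_lambda \<tau>) * hypv (- s) (modular_lambda \<tau>))"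
      using f0[OF \<tau>] by (simp add: \<phi>_def \<phi>1_def field_simps)
    then show ?thesis unfolding hw by simp
  qed
  have k: "- (2 * of_real pi * \<i> * s) \<noteq> 0" using s_nonzero by simp
  note comb = linear_second_order_combination[OF open_ball connected_ball k
    \<phi>(1)[OF _ Re_s(1) s_square(1)] \<phi>(2)[OF _ Re_s(1) s_square(1)] \<phi>(1)[OF _ Re_s(2) s_square(2)] \<phi>(2)[OF _ Re_s(2) s_square(2)] wr]
  obtain \<alpha> \<beta> where ab: "\<And>\<tau>. \<tau> \<in> ball \<i> r \<Longrightarrow> \<psi> \<tau> = \<alpha> * \<phi> s \<tau> + \<beta> * \<phi> (- s) \<tau>"
    using comb[OF _ _ _ _ _ \<psi>] by blast
  obtain \<gamma> \<delta> where cd: "\<And>\<tau>. \<tau> \<in> ball \<i> r \<Longrightarrow> hc \<tau> * \<psi> \<tau> = \<gamma> * \<phi> s \<tau> + \<delta> * \<phi> (- s) \<tau>"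
    using comb[OF _ _ _ _ _ \<chi>] by blast
  have "\<alpha> \<noteq> 0 \<or> \<beta> \<noteq> 0" using \<psi>0[of \<i>] ab[of \<i>] r(1) by auto
  moreover have "hc \<tau> * (\<alpha> * hypv s (modular_lambda \<tau>) + \<beta> * hypv (- s) (modular_lambda \<tau>))
      = \<gamma> * hypv s (modular_lambda \<tau>) + \<delta> * hypv (- s) (modular_lambda \<tau>)" if \<tau>: "\<tau> \<in> ball \<i> r" for \<tau>
  proof -
    have e: "hypv \<sigma> (modular_lambda \<tau>) = theta_sq \<tau> * \<phi> \<sigma> \<tau>" for \<sigma> using f0[OF \<tau>] by (simp add: \<phi>_def)
    show ?thesis unfolding e using ab[OF \<tau>] cd[OF \<tau>] by algebra
  qed
  ultimately show ?thesis using r by blast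
qed

text \<open>The local relation at i is continued along the axis as an identity of meromorphic
  functions. The products are holomorphic away from the poles of h, and at a pole the relation is
  first divided by \<open>hc\<close>.\<close>

lemma axis_relation:
  "\<exists>\<alpha> \<beta> \<gamma> \<delta>. (\<alpha> \<noteq> 0 \<or> \<beta> \<noteq> 0) \<and> (\<forall>y>0.
    (h (\<i> * of_real y) = None \<longrightarrow> \<alpha> * axis_v s y + \<beta> * axis_v (- s) y = 0) \<and>
    (h (\<i> * of_real y) \<noteq> None \<longrightarrow>
      hc (\<i> * of_real y) * (\<alpha> * axis_v s y + \<beta> * axis_v (- s) y) = \<gamma> * axis_v s y + \<delta> * axis_v (- s) y))"
proof -
  obtain \<alpha> \<beta> \<gamma> \<delta> r where r: "r > 0" "ball \<i> r \<subseteq> fin \<inter> lens_region" and nz: "\<alpha> \<noteq> 0 \<or> \<beta> \<noteq> 0"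
    and rel: "\<And>\<tau>. \<tau> \<in> ball \<i> r \<Longrightarrow> hc \<tau> * (\<alpha> * hypv s (modular_lambda \<tau>) + \<beta> * hypv (- s) (modular_lambda \<tau>))
      = \<gamma> * hypv s (modular_lambda \<tau>) + \<delta> * hypv (- s) (modular_lambda \<tau>)"
    using local_relation by blast
  define X Y where X_def: "X = (\<lambda>\<tau>. \<alpha> * hypv s (modular_lambda \<tau>) + \<beta> * hypv (- s) (modular_lambda \<tau>))"
    and Y_def: "Y = (\<lambda>\<tau>. \<gamma> * hypv s (modular_lambda \<tau>) + \<delta> * hypv (- s) (modular_lambda \<tau>))"
  have XY: "X holomorphic_on lens_region" "Y holomorphic_on lens_region"
    unfolding X_def Y_def by (intro holomorphic_intros hypv_modular_lambda_holomorphic Re_s)+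
  \<comment> \<open>The identity theorem asks for a connected set; the component of i in
    \<open>lens_region\<close> contains the whole axis.\<close>
  define U where "U = connected_component_set lens_region \<i>"
  have U: "open U" "connected U" "U \<subseteq> lens_region"
    by (auto simp: U_def open_connected_component open_lens_region connected_component_subset)
  have axis: "\<i> * of_real y \<in> U" if "y > 0" for y
  proof -
    define Z where "Z = (\<lambda>y::real. \<i> * complex_of_real y) ` {0<..}"
    have "connected Z" unfolding Z_def by (intro connected_continuous_image continuous_intros) auto
    moreover have "\<i> \<in> Z" unfolding Z_def by (rule image_eqI[of _ _ 1]) auto
    moreover have "Z \<subseteq> lens_region" unfolding Z_def using axis_lens_region by auto
    ultimately have "Z \<subseteq> U" unfolding U_def by (intro connected_component_maximal)
    then show ?thesis using that by (auto simp: Z_def)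
  qed
  have iU: "\<i> \<in> U" using axis[of 1] by simp
  have UH: "U \<subseteq> upper_half_plane" using U(3) by (auto simp: lens_region_def)
  have mer: "hc meromorphic_on U" using hc_nicely UH by (auto simp: nicely_meromorphic_on_def intro: meromorphic_on_subset)
  have merXY: "X meromorphic_on U" "Y meromorphic_on U"
    using XY U by (auto intro!: analytic_on_imp_meromorphic_on simp: analytic_on_open intro: holomorphic_on_subset)
  have "eventually (\<lambda>\<tau>. \<tau> \<in> ball \<i> r) (at \<i>)" using r(1) by (intro eventually_at_in_open') auto
  then have "eventually (\<lambda>\<tau>. hc \<tau> * X \<tau> = Y \<tau>) (at \<i>)" by eventually_elim (simp add: rel X_def Y_def)
  then have "frequently (\<lambda>\<tau>. hc \<tau> * X \<tau> = Y \<tau>) (at \<i>)" by (rule eventually_frequently[rotated]) simp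
  then have ev: "eventually (\<lambda>\<tau>. hc \<tau> * X \<tau> = Y \<tau>) (at w)" if "w \<in> U" for w
    by (intro meromorphic_identity[OF meromorphic_on_mult[OF mer merXY(1)] merXY(2) U(1,2) iU _ that])
  have main: "if h w = None then X w = 0 else hc w * X w = Y w" if w: "w \<in> U" for w
  proof -
    have L: "w \<in> lens_region" "Im w > 0" using w U(3) by (auto simp: lens_region_def)
    have c: "isCont X w" "isCont Y w" by (auto intro!: holomorphic_imp_isCont[OF _ open_lens_region] XY L)
    show ?thesis
    proof (cases "h w = None")
      case True
      obtain B where B: "open B" "w \<in> B" "B - {w} \<subseteq> fin" "\<And>z. z \<in> B - {w} \<Longrightarrow> hc z \<noteq> 0"
        "(\<lambda>z. inverse (hc z)) holomorphic_on B" "\<And>z. z \<in> B \<Longrightarrow> deriv (\<lambda>z. inverse (hc z)) z \<noteq> 0"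
        by (rule pole_chart[OF L(2) True], rule that, assumption+)
      \<comment> \<open>\<open>inverse (hc z)\<close> is the chart at infinity and is continuous at
        the pole with value \<open>inverse 0 = 0\<close>, so dividing by \<open>hc\<close> gives X =
        0 there.\<close>
      have ci: "isCont (\<lambda>z. Y z * inverse (hc z)) w"
        by (intro continuous_intros c holomorphic_imp_isCont[OF B(5,1,2)])
      have "eventually (\<lambda>z. z \<in> B - {w}) (at w)" using B(1,2) by (rule eventually_at_in_open)
      with ev[OF w] have "eventually (\<lambda>z. X z = Y z * inverse (hc z)) (at w)"
        by eventually_elim (use B(4) in \<open>simp add: field_simps\<close>)
      then have "X w = Y w * inverse (hc w)" by (rule continuous_eqI_at[OF c(1) ci])
      then show ?thesis using True by (simp add: hc_def cp1_coord_def)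
    next
      case False
      then have "w \<in> fin" using L by (simp add: fin_def)
      then have "isCont (\<lambda>z. hc z * X z) w" by (intro continuous_intros c holomorphic_imp_isCont[OF hc_holomorphic open_fin])
      then have "hc w * X w = Y w" by (rule continuous_eqI_at[OF _ c(2) ev[OF w]])
      then show ?thesis using False by (simp only: if_False)
    qed
  qed
  have "(h (\<i> * of_real y) = None \<longrightarrow> \<alpha> * axis_v s y + \<beta> * axis_v (- s) y = 0) \<and>
    (h (\<i> * of_real y) \<noteq> None \<longrightarrow>
      hc (\<i> * of_real y) * (\<alpha> * axis_v s y + \<beta> * axis_v (- s) y) = \<gamma> * axis_v s y + \<delta> * axis_v (- s) y)"
    if "y > 0" for y
    using main[OF axis[OF that]] unfolding X_def Y_def axis_v_def if_bool_eq_conj .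
  with nz show ?thesis by blast
qed

end

section \<open>Behaviour on the imaginary axis\<close>

text \<open>Any point \<zeta> of the unit circle is attained by exp(-i t y) along a sequence of y
  tending to infinity, so the limiting quadratic polynomial vanishes at \<zeta>. The points 1, -1
  and -i suffice to kill its coefficients.\<close>

lemma quadratic_oscillation:
  fixes A B C :: "real \<Rightarrow> complex"
  assumes lim: "(A \<longlongrightarrow> A0) at_top" "(B \<longlongrightarrow> B0) at_top" "(C \<longlongrightarrow> C0) at_top" and t: "t > 0"
    and ev: "eventually (\<lambda>y. A y + B y * exp (- (\<i> * of_real (t * y))) + C y * (exp (- (\<i> * of_real (t * y))))\<^sup>2 = 0) at_top"
  shows "A0 = 0" "B0 = 0" "C0 = 0"
proof -
  have *: "A0 + B0 * \<zeta> + C0 * \<zeta>\<^sup>2 = 0" if \<zeta>: "\<zeta> = exp (- (\<i> * of_real \<theta>))" for \<zeta> \<theta>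
  proof -
    \<comment> \<open>Solutions y of t y = \<theta> modulo 2 pi.\<close>
    define Y where "Y = (\<lambda>n. (\<theta> + 2 * pi * real n) / t)"
    have "filterlim (\<lambda>n. real n * (2 * pi / t)) at_top sequentially"
      by (rule filterlim_at_top_mult_tendsto_pos[OF tendsto_const _ filterlim_real_sequentially]) (use t in simp)
    then have "filterlim (\<lambda>n. \<theta> / t + real n * (2 * pi / t)) at_top sequentially"
      by (rule filterlim_tendsto_add_at_top[OF tendsto_const])
    moreover have "Y = (\<lambda>n. \<theta> / t + real n * (2 * pi / t))" by (simp add: Y_def fun_eq_iff add_divide_distrib)
    ultimately have Y: "filterlim Y at_top sequentially" by simp
    have z: "exp (- (\<i> * of_real (t * Y n))) = \<zeta>" for n
    proof -
      have "t * Y n = \<theta> + 2 * pi * real n" using t by (simp add: Y_def)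
      then have "- (\<i> * of_real (t * Y n)) = - (\<i> * of_real \<theta>) + 2 * of_int (- int n) * of_real pi * \<i>"
        by (simp add: algebra_simps)
      moreover have "exp (2 * of_int (- int n) * complex_of_real pi * \<i>) = 1"
        unfolding exp_eq_1 by (auto simp: mult_ac intro!: exI[of _ "- int n"])
      ultimately show ?thesis unfolding \<zeta> by (simp only: exp_add mult_1_right)
    qed
    have lim_\<zeta>: "(\<lambda>n. A (Y n) + B (Y n) * \<zeta> + C (Y n) * \<zeta>\<^sup>2) \<longlonglongrightarrow> A0 + B0 * \<zeta> + C0 * \<zeta>\<^sup>2"
      by (intro tendsto_intros filterlim_compose[OF lim(1) Y] filterlim_compose[OF lim(2) Y] filterlim_compose[OF lim(3) Y])
    have ev_\<zeta>: "eventually (\<lambda>n. A (Y n) + B (Y n) * \<zeta> + C (Y n) * \<zeta>\<^sup>2 = 0) sequentially"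
      using eventually_compose_filterlim[OF ev Y] unfolding z .
    show ?thesis by (rule LIMSEQ_unique[OF lim_\<zeta> tendsto_eventually[OF ev_\<zeta>]])
  qed
  have 1: "A0 + B0 + C0 = 0" using *[of 1 0] by simp
  have 2: "A0 - B0 + C0 = 0" using *[of "- 1" pi] by (simp add: exp_minus exp_pi_i')
  have "exp (- (\<i> * of_real (pi / 2))) = cis (- (pi / 2))" unfolding cis_conv_exp by simp
  then have 3: "A0 - B0 * \<i> - C0 = 0" using *[of "- \<i>" "pi / 2"] by (simp only: cis_minus_pi_half) simp
  have b: "B0 = 0" using 1 2 by algebra
  then show "B0 = 0" .
  have "A0 = C0" using 3 b by simp
  then show "A0 = 0" "C0 = 0" using 1 b by simp_all
qed

lemma axis_filterlim: "filterlim (\<lambda>y. \<i> * of_real y) at_i_infinity at_top"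
  by (simp add: filterlim_filtercomap_iff o_def filterlim_ident)

text \<open>On the axis (1 - \<lambda>) / \<lambda> = th4 / th2, and th2 is exp(-pi y) times a
  factor J tending to 16. The logarithm thus splits into pi y and a convergent part, while \<lambda>
  tends to 0, where the series is 1.\<close>

lemma axis_v_asymptotics:
  assumes \<sigma>: "Re \<sigma> = 0"
  obtains A A0 where "A0 \<noteq> 0" "(A \<longlongrightarrow> A0) at_top" "\<And>y. y > 0 \<Longrightarrow> axis_v \<sigma> y = exp (- \<sigma> * of_real (pi * y)) * A y"
proof -
  define J where "J = (\<lambda>\<tau>. jacobi_theta (\<tau> / 2) \<tau> ^ 4)"
  define A where "A = (\<lambda>y::real. exp (- \<sigma> * Ln (th4 (\<i> * of_real y) / J (\<i> * of_real y))) * hypF \<sigma> (modular_lambda (\<i> * of_real y)))"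
  have L: "((\<lambda>y. th4 (\<i> * of_real y) / J (\<i> * of_real y)) \<longlongrightarrow> 1 / 16) at_top"
    by (intro tendsto_intros filterlim_compose[OF th4_limit axis_filterlim])
       (use filterlim_compose[OF jacobi_half_limit axis_filterlim] in \<open>simp_all add: J_def\<close>)
  have l: "((\<lambda>y. modular_lambda (\<i> * of_real y)) \<longlongrightarrow> 0 / 1) at_top"
    unfolding modular_lambda_eq
    by (intro tendsto_intros filterlim_compose[OF th2_limit axis_filterlim] filterlim_compose[OF th3_limit axis_filterlim]) simp
  have "hypF \<sigma> holomorphic_on ball 0 1"
    unfolding hypF_def by (rule hyp2F1_holomorphic[OF imaginary_parameter[OF \<sigma>]])
  then have "isCont (hypF \<sigma>) 0" by (rule holomorphic_imp_isCont) auto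
  then have F: "((\<lambda>y. hypF \<sigma> (modular_lambda (\<i> * of_real y))) \<longlongrightarrow> hypF \<sigma> 0) at_top"
    by (rule isCont_tendsto_compose) (use l in simp)
  have "(1 / 16 :: complex) \<notin> \<real>\<^sub>\<le>\<^sub>0" by (simp add: complex_nonpos_Reals_iff)
  then have "(A \<longlongrightarrow> exp (- \<sigma> * Ln (1 / 16)) * hypF \<sigma> 0) at_top"
    unfolding A_def by (intro tendsto_intros F L)
  moreover have "axis_v \<sigma> y = exp (- \<sigma> * of_real (pi * y)) * A y" if y: "y > 0" for y
  proof -
    obtain ra rb where r: "ra > 0" "rb > 0" "th2 (\<i> * of_real y) = of_real ra" "th4 (\<i> * of_real y) = of_real rb"
      by (rule th_axis_positive[OF y])
    have th3: "th3 (\<i> * of_real y) = of_real (ra + rb)" using jacobi_identity[of "\<i> * of_real y"] y r by simp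
    have "(1 - modular_lambda (\<i> * of_real y)) / modular_lambda (\<i> * of_real y) = of_real ((1 - ra / (ra + rb)) / (ra / (ra + rb)))"
      by (simp add: modular_lambda_eq th3 r)
    also have "1 - ra / (ra + rb) = rb / (ra + rb)" using r by (simp add: field_simps)
    also have "rb / (ra + rb) / (ra / (ra + rb)) = rb / ra" using r by simp
    finally have n1: "Ln ((1 - modular_lambda (\<i> * of_real y)) / modular_lambda (\<i> * of_real y)) = of_real (ln (rb / ra))"
      using r by (simp only: Ln_of_real divide_pos_pos)
    have "J (\<i> * of_real y) = of_real (exp (pi * y) * ra)"
    proof -
      have "of_real ra = exp (of_real pi * \<i> * (\<i> * of_real y)) * J (\<i> * of_real y)"
        using th2_eq[of "\<i> * of_real y"] unfolding r J_def .
      moreover have "of_real pi * \<i> * (\<i> * of_real y) = - complex_of_real (pi * y)" by (simp add: algebra_simps)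
      ultimately show ?thesis by (simp add: exp_minus field_simps flip: exp_of_real)
    qed
    then have n2: "Ln (th4 (\<i> * of_real y) / J (\<i> * of_real y)) = of_real (ln (rb / (exp (pi * y) * ra)))"
      using r by (simp only: r of_real_divide[symmetric] Ln_of_real divide_pos_pos mult_pos_pos exp_gt_zero)
    have n3: "ln (rb / (exp (pi * y) * ra)) = ln (rb / ra) - pi * y"
      using r by (simp add: ln_div ln_mult)
    show ?thesis
      unfolding axis_v_def hypv_def A_def n1 n2 n3 of_real_diff by (simp add: algebra_simps flip: exp_add)
  qed
  moreover have "exp (- \<sigma> * Ln (1 / 16)) * hypF \<sigma> 0 \<noteq> 0" by simp
  ultimately show thesis using that by blast
qed

lemma cp1_quot_neg_inverse:
  assumes "u \<noteq> 0 \<or> v \<noteq> 0" "c \<noteq> 0"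
  shows "cp1_inverse (cp1_affine c 0 (cp1_quot u v)) = cp1_quot v (c * u)"
  using assms by (auto simp: cp1_quot_def cp1_affine_def cp1_inverse_def)

lemma cp1_quot_eqD: "cp1_quot a b = cp1_quot c d \<Longrightarrow> a * d = b * c"
  by (auto simp: cp1_quot_def field_simps split: if_splits)

lemma modular_lambda_axis_inverse:
  assumes "y > 0"
  shows "modular_lambda (\<i> * of_real (1 / y)) = 1 - modular_lambda (\<i> * of_real y)"
proof -
  have y: "Im (\<i> * of_real y) > 0" using assms by simp
  have e: "\<i> * of_real (1 / y) = - 1 / (\<i> * of_real y)" using assms by (simp add: field_simps)
  obtain x where x: "th3 (\<i> * of_real y) \<noteq> 0" by (rule modular_lambda_axis[OF assms])
  have "modular_lambda (\<i> * of_real (1 / y)) = th4 (\<i> * of_real y) / th3 (\<i> * of_real y)"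
    unfolding e modular_lambda_eq th2_neg_inverse[OF y] th3_neg_inverse[OF y] using assms by simp
  then show ?thesis using jacobi_identity[OF y] x by (simp add: modular_lambda_eq field_simps)
qed

section \<open>Determination of the quotient on the axis\<close>

context normalized_equivariant_map
begin

lemma axis_v_nonzero: "y > 0 \<Longrightarrow> axis_v s y \<noteq> 0 \<or> axis_v (- s) y \<noteq> 0"
  using hyp_wronskian[OF Re_s(1), of "modular_lambda (\<i> * of_real y)"] axis_lens_region[of y] s_nonzero
  by (auto simp: axis_v_def lens_region_def)

text \<open>The quotient of the two exponentials is exp(2 pi s y) = exp(-i t y). The common nonzero
  factor e drops out of every homogeneous relation.\<close>

lemma axis_v_form:
  "\<exists>A B A0 B0. A0 \<noteq> 0 \<and> B0 \<noteq> 0 \<and> (A \<longlongrightarrow> A0) at_top \<and> (B \<longlongrightarrow> B0) at_top \<and> (\<forall>y>0. \<exists>e. e \<noteq> 0 \<and>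
     axis_v s y = e * A y \<and> axis_v (- s) y = e * (exp (- (\<i> * of_real (t * y))) * B y))"
proof -
  obtain A A0 where A: "A0 \<noteq> 0" "(A \<longlongrightarrow> A0) at_top" "\<And>y. y > 0 \<Longrightarrow> axis_v s y = exp (- s * of_real (pi * y)) * A y"
    by (rule axis_v_asymptotics[OF Re_s(1)], rule that, (assumption | simp)+)
  obtain B B0 where B: "B0 \<noteq> 0" "(B \<longlongrightarrow> B0) at_top" "\<And>y. y > 0 \<Longrightarrow> axis_v (- s) y = exp (- (- s) * of_real (pi * y)) * B y"
    by (rule axis_v_asymptotics[OF Re_s(2)], rule that, (assumption | simp)+)
  have e: "- (- s) * of_real (pi * y) = - s * of_real (pi * y) + - (\<i> * of_real (t * y))" for y
    by (simp add: s_def field_simps)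
  have bs: "axis_v (- s) y = exp (- s * of_real (pi * y)) * (exp (- (\<i> * of_real (t * y))) * B y)" if "y > 0" for y
    using B(3)[OF that] unfolding e exp_add by (simp only: mult.assoc)
  have "\<exists>e. e \<noteq> 0 \<and> axis_v s y = e * A y \<and> axis_v (- s) y = e * (exp (- (\<i> * of_real (t * y))) * B y)" if "y > 0" for y
    by (rule exI[of _ "exp (- s * of_real (pi * y))"]) (intro conjI exp_not_eq_zero A(3)[OF that] bs[OF that])
  then show ?thesis using A(1,2) B(1,2) by blast
qed

text \<open>The cusp expansion is inserted into the axis relation, which becomes a quadratic
  polynomial in z = exp(-i t y). Its constant and leading coefficients give \<gamma> = p \<alpha>
  and \<beta> = 0, the middle one gives \<delta> \<noteq> 0.\<close>

lemma axis_quotient: "\<exists>K. K \<noteq> 0 \<and> (\<forall>y>0. h (\<i> * of_real y) = cp1_quot (p * axis_v s y + K * axis_v (- s) y) (axis_v s y))"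
proof -
  obtain \<alpha> \<beta> \<gamma> \<delta> where nz: "\<alpha> \<noteq> 0 \<or> \<beta> \<noteq> 0"
    and pole: "\<And>y. y > 0 \<Longrightarrow> h (\<i> * of_real y) = None \<Longrightarrow> \<alpha> * axis_v s y + \<beta> * axis_v (- s) y = 0"
    and rel: "\<And>y. y > 0 \<Longrightarrow> h (\<i> * of_real y) \<noteq> None \<Longrightarrow>
      hc (\<i> * of_real y) * (\<alpha> * axis_v s y + \<beta> * axis_v (- s) y) = \<gamma> * axis_v s y + \<delta> * axis_v (- s) y"
    using axis_relation by blast
  obtain A B A0 B0 where AB: "A0 \<noteq> 0" "B0 \<noteq> 0" "(A \<longlongrightarrow> A0) at_top" "(B \<longlongrightarrow> B0) at_top"
    and form: "\<And>y. y > 0 \<Longrightarrow> \<exists>e. e \<noteq> 0 \<and> axis_v s y = e * A y \<and> axis_v (- s) y = e * (exp (- (\<i> * of_real (t * y))) * B y)"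
    using axis_v_form by blast
  obtain U0 where U0: "U0 \<noteq> 0" and cusp_lim: "((\<lambda>\<tau>. (hc \<tau> - p) * exp (of_real t * \<tau>)) \<longlongrightarrow> U0) at_i_infinity" using cusp by blast
  define u where "u = (\<lambda>y::real. (hc (\<i> * of_real y) - p) * exp (of_real t * (\<i> * of_real y)))"
  have u: "(u \<longlongrightarrow> U0) at_top" unfolding u_def by (rule filterlim_compose[OF cusp_lim axis_filterlim])
  obtain R where R: "\<And>\<tau>. Im \<tau> > R \<Longrightarrow> \<tau> \<in> fin" using near_cusp by metis
  have ev: "eventually (\<lambda>y. (p * \<alpha> - \<gamma>) * A y + ((p * \<beta> - \<delta>) * B y + u y * \<alpha> * A y) * exp (- (\<i> * of_real (t * y)))
      + u y * \<beta> * B y * (exp (- (\<i> * of_real (t * y))))\<^sup>2 = 0) at_top"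
    using eventually_gt_at_top[of "max R 0"]
  proof eventually_elim
    case (elim y)
    have y: "y > 0" "\<i> * of_real y \<in> fin" using elim R by auto
    define z where "z = exp (- (\<i> * of_real (t * y)))"
    have "exp (of_real t * (\<i> * of_real y)) * z = 1" by (simp add: z_def mult_ac flip: exp_add)
    \<comment> \<open>On the axis exp(t \<tau>) is 1 / z, so u = (hc - p) / z and u tends to
      \<open>U0\<close>.\<close>
    then have hc: "hc (\<i> * of_real y) = p + z * u y" unfolding u_def by algebra
    obtain e where e: "e \<noteq> 0" "axis_v s y = e * A y" "axis_v (- s) y = e * (z * B y)"
      using form[OF y(1)] unfolding z_def by blast
    have "e * ((p + z * u y) * (\<alpha> * A y + \<beta> * (z * B y))) = e * (\<gamma> * A y + \<delta> * (z * B y))"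
      using rel[OF y(1)] y(2) unfolding hc e by (simp add: fin_def algebra_simps)
    then have "(p + z * u y) * (\<alpha> * A y + \<beta> * (z * B y)) = \<gamma> * A y + \<delta> * (z * B y)" using e(1) by simp
    then show ?case unfolding z_def[symmetric] by algebra
  qed
  have "((\<lambda>y. (p * \<alpha> - \<gamma>) * A y) \<longlongrightarrow> (p * \<alpha> - \<gamma>) * A0) at_top"
    "((\<lambda>y. (p * \<beta> - \<delta>) * B y + u y * \<alpha> * A y) \<longlongrightarrow> (p * \<beta> - \<delta>) * B0 + U0 * \<alpha> * A0) at_top"
    "((\<lambda>y. u y * \<beta> * B y) \<longlongrightarrow> U0 * \<beta> * B0) at_top"
    by (intro tendsto_intros u AB)+
  note osc = quadratic_oscillation[OF this t_pos ev]
  have "(p * \<alpha> - \<gamma>) * A0 = 0" "(p * \<beta> - \<delta>) * B0 + U0 * \<alpha> * A0 = 0" "U0 * \<beta> * B0 = 0"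
    using osc by blast+
  then have \<gamma>: "\<gamma> = p * \<alpha>" and \<beta>: "\<beta> = 0" and \<delta>: "\<delta> * B0 = U0 * \<alpha> * A0" using AB U0 by auto
  have \<alpha>: "\<alpha> \<noteq> 0" using nz \<beta> by simp
  have \<delta>0: "\<delta> \<noteq> 0" using \<delta> \<alpha> AB U0 by auto
  show ?thesis
  proof (intro exI[of _ "\<delta> / \<alpha>"] conjI allI impI)
    show "\<delta> / \<alpha> \<noteq> 0" using \<alpha> \<delta>0 by simp
    fix y :: real assume y: "y > 0"
    show "h (\<i> * of_real y) = cp1_quot (p * axis_v s y + \<delta> / \<alpha> * axis_v (- s) y) (axis_v s y)"
    proof (cases "h (\<i> * of_real y)")
      case None
      then have "axis_v s y = 0" using pole[OF y] \<alpha> \<beta> by simp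
      then show ?thesis using None by (simp add: cp1_quot_def)
    next
      case (Some w)
      then have w: "hc (\<i> * of_real y) = w" by (simp add: hc_def cp1_coord_def)
      have r: "w * (\<alpha> * axis_v s y) = p * \<alpha> * axis_v s y + \<delta> * axis_v (- s) y" using rel[OF y] Some w \<beta> \<gamma> by simp
      then have "axis_v s y \<noteq> 0" using axis_v_nonzero[OF y] \<delta>0 by auto
      then show ?thesis using r \<alpha> Some by (simp add: cp1_quot_def field_simps)
    qed
  qed
qed

definition conn :: complex where
  "conn = Gamma (1 + 2 * s) * Gamma (2 * s) / (Gamma (1/2 + s) * Gamma (1/2 + 3 * s))"

text \<open>The constant K and two formulas at once. The law for -1 / \<tau>, rewritten by the
  connection formula, is again a quadratic polynomial in z = exp(-i t y). Its leading coefficient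
  reduces the numerator to A' times the solution at 1 / y; the middle one expresses K by A' and
  \<open>conn\<close>; and A' is the value at y = 1.\<close>

lemma axis_formulas:
  assumes y: "y > 0"
  shows "h (\<i> * of_real y) = cp1_quot (\<i> * of_real (exp (t / 2)) * axis_v s (1 / y)) (axis_v s y)"
    and "h (\<i> * of_real y) = cp1_affine 1 p (cp1_quot (\<i> * of_real (exp (t / 2)) * conn * axis_v (- s) y) (axis_v s y))"
proof -
  obtain K where K: "K \<noteq> 0"
    and hK: "\<And>y. y > 0 \<Longrightarrow> h (\<i> * of_real y) = cp1_quot (p * axis_v s y + K * axis_v (- s) y) (axis_v s y)"
    using axis_quotient by blast
  have lens: "modular_lambda (\<i> * of_real y) \<in> lens" if "y > 0" for y
    using axis_lens_region[OF that] by (simp add: lens_region_def)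
  obtain a1 where a1: "\<And>z. z \<in> lens \<Longrightarrow> hypv s (1 - z) = a1 * hypv s z + conn * hypv (- s) z"
  proof (rule hyp_connection[OF Re_s(1) s_nonzero(1)])
    fix \<alpha> assume "\<And>z. z \<in> lens \<Longrightarrow> hypv s (1 - z) = \<alpha> * hypv s z +
      Gamma (1 + 2 * s) * Gamma (2 * s) / (Gamma (1/2 + s) * Gamma (1/2 + 3 * s)) * hypv (- s) z"
    then show thesis by (intro that[of \<alpha>]) (simp only: conn_def)
  qed
  obtain a2 b2 where a2: "\<And>z. z \<in> lens \<Longrightarrow> hypv (- s) (1 - z) = b2 * hypv (- s) z + a2 * hypv (- (- s)) z"
  proof (rule hyp_connection[OF Re_s(2) s_nonzero(2)])
    fix \<alpha> assume "\<And>z. z \<in> lens \<Longrightarrow> hypv (- s) (1 - z) = \<alpha> * hypv (- s) z +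
      Gamma (1 + 2 * (- s)) * Gamma (2 * (- s)) / (Gamma (1/2 + (- s)) * Gamma (1/2 + 3 * (- s))) * hypv (- (- s)) z"
    then show thesis by (rule that)
  qed
  have c1: "axis_v s (1 / y) = a1 * axis_v s y + conn * axis_v (- s) y"
    and c2: "axis_v (- s) (1 / y) = b2 * axis_v (- s) y + a2 * axis_v s y" if "y > 0" for y
    using a1[OF lens[OF that]] a2[OF lens[OF that]] by (simp_all only: axis_v_def modular_lambda_axis_inverse[OF that] minus_minus)
  \<comment> \<open>The coefficients of the numerator at 1 / y in terms of the solutions at y. The
    entries \<open>a1\<close>, \<open>a2\<close>, \<open>b2\<close> of the connection matrix are
    left unevaluated; only \<open>conn\<close> is explicit.\<close>
  define A' B' where A'_B'_def: "A' = p * a1 + K * a2" "B' = p * conn + K * b2"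
  have N: "p * axis_v s (1 / y) + K * axis_v (- s) (1 / y) = A' * axis_v s y + B' * axis_v (- s) y" if "y > 0" for y
    unfolding c1[OF that] c2[OF that] A'_B'_def by (simp add: algebra_simps)
  have sym: "q * (p * axis_v s y + K * axis_v (- s) y) * (A' * axis_v s y + B' * axis_v (- s) y)
     + axis_v s y * (a1 * axis_v s y + conn * axis_v (- s) y) = 0" if y: "y > 0" for y
  proof -
    have e: "\<i> * of_real (1 / y) = - 1 / (\<i> * of_real y)" using y by (simp add: field_simps)
    have "cp1_quot (A' * axis_v s y + B' * axis_v (- s) y) (axis_v s (1 / y)) = h (\<i> * of_real (1 / y))"
      using hK[of "1 / y"] y N[OF y] by simp
    also have "\<dots> = cp1_inverse (cp1_affine (- q) 0 (h (\<i> * of_real y)))"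
      unfolding e by (rule h_neg_inverse) (use y in simp)
    also have "\<dots> = cp1_quot (axis_v s y) (- q * (p * axis_v s y + K * axis_v (- s) y))"
      unfolding hK[OF y] by (rule cp1_quot_neg_inverse) (use axis_v_nonzero[OF y] K in auto)
    finally have "(A' * axis_v s y + B' * axis_v (- s) y) * (- q * (p * axis_v s y + K * axis_v (- s) y)) = axis_v s (1 / y) * axis_v s y"
      by (rule cp1_quot_eqD)
    then show ?thesis unfolding c1[OF y] by algebra
  qed
  obtain A B A0 B0 where AB: "A0 \<noteq> 0" "B0 \<noteq> 0" "(A \<longlongrightarrow> A0) at_top" "(B \<longlongrightarrow> B0) at_top"
    and form: "\<And>y. y > 0 \<Longrightarrow> \<exists>e. e \<noteq> 0 \<and> axis_v s y = e * A y \<and> axis_v (- s) y = e * (exp (- (\<i> * of_real (t * y))) * B y)"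
    using axis_v_form by blast
  have ev: "eventually (\<lambda>y. (q * p * A' + a1) * (A y)\<^sup>2 + (q * (p * B' + K * A') + conn) * (A y * B y) * exp (- (\<i> * of_real (t * y)))
      + q * K * B' * (B y)\<^sup>2 * (exp (- (\<i> * of_real (t * y))))\<^sup>2 = 0) at_top"
    using eventually_gt_at_top[of 0]
  proof eventually_elim
    case (elim y)
    define z where "z = exp (- (\<i> * of_real (t * y)))"
    obtain e where e: "e \<noteq> 0" "axis_v s y = e * A y" "axis_v (- s) y = e * (z * B y)"
      using form[OF elim] unfolding z_def by blast
    have "e * e * ((q * p * A' + a1) * (A y)\<^sup>2 + (q * (p * B' + K * A') + conn) * (A y * B y) * z + q * K * B' * (B y)\<^sup>2 * z\<^sup>2) = 0"
      using sym[OF elim] unfolding e by (simp add: power2_eq_square algebra_simps)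
    then show ?case using e(1) unfolding z_def by simp
  qed
  have "((\<lambda>y. (q * p * A' + a1) * (A y)\<^sup>2) \<longlongrightarrow> (q * p * A' + a1) * A0\<^sup>2) at_top"
    "((\<lambda>y. (q * (p * B' + K * A') + conn) * (A y * B y)) \<longlongrightarrow> (q * (p * B' + K * A') + conn) * (A0 * B0)) at_top"
    "((\<lambda>y. q * K * B' * (B y)\<^sup>2) \<longlongrightarrow> q * K * B' * B0\<^sup>2) at_top"
    by (intro tendsto_intros AB)+
  note osc = quadratic_oscillation[OF this t_pos ev]
  have "(q * (p * B' + K * A') + conn) * (A0 * B0) = 0" "q * K * B' * B0\<^sup>2 = 0"
    using osc by blast+
  \<comment> \<open>K, q and \<open>B0\<close> are nonzero, so the coefficient q K B' forces B' = 0,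
    and the middle coefficient loses its term with p.\<close>
  then have B': "B' = 0" and conn: "q * (K * A') + conn = 0" using AB K by auto
  have hA: "h (\<i> * of_real y) = cp1_quot (A' * axis_v s (1 / y)) (axis_v s y)" if y: "y > 0" for y
    using hK[OF y] N[of "1 / y"] y B' by simp
  have "h \<i> = cp1_quot (A' * axis_v s 1) (axis_v s 1)" using hA[of 1] by simp
  \<comment> \<open>At y = 1 numerator and denominator contain the same value, and it is nonzero
    because h is finite at i.\<close>
  then have A': "A' = \<i> * of_real (exp (t / 2))"
    using h_at_i(1) hc_i by (simp add: cp1_quot_def split: if_splits)
  show "h (\<i> * of_real y) = cp1_quot (\<i> * of_real (exp (t / 2)) * axis_v s (1 / y)) (axis_v s y)"
    using hA[OF y] unfolding A' .
  \<comment> \<open>This turns q K A' = -conn into K = A' conn.\<close>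
  have "q * A' * A' = - 1"
  proof -
    have "exp (- t) * exp (t / 2) * exp (t / 2) = 1" by (simp flip: exp_add)
    then have "(of_real (exp (- t) * exp (t / 2) * exp (t / 2)) :: complex) = of_real 1" by (simp only:)
    then have "q * of_real (exp (t / 2)) * of_real (exp (t / 2)) = 1" by (simp only: of_real_mult of_real_1)
    then show ?thesis unfolding A' by (simp add: algebra_simps)
  qed
  then have K': "K = \<i> * of_real (exp (t / 2)) * conn" unfolding A'[symmetric] using conn by algebra
  show "h (\<i> * of_real y) = cp1_affine 1 p (cp1_quot (\<i> * of_real (exp (t / 2)) * conn * axis_v (- s) y) (axis_v s y))"
    unfolding hK[OF y] K'[symmetric] by (auto simp: cp1_quot_def cp1_affine_def field_simps)
qed

end

text \<open>Changing the sign of s exchanges the two upper parameters 1/2 - s and 1/2 + s.\<close>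

lemma hyp2F1_commute: "hyp2F1 a b c z = hyp2F1 b a c z"
  unfolding hyp2F1_def by (simp add: mult.commute)

lemma cp1_quot_scale: "c \<noteq> 0 \<Longrightarrow> cp1_quot (c * u) (c * v) = cp1_quot u v"
  by (simp add: cp1_quot_def)

context normalized_equivariant_map
begin

lemma h_q_formulas:
  assumes y: "y > 0"
  shows "h (\<i> * of_real y) = q_formula1 t (\<i> * of_real y)"
    and "h (\<i> * of_real y) = q_formula2 t (\<i> * of_real y)"
proof -
  define l where "l = modular_lambda (\<i> * of_real y)"
  \<comment> \<open>The power of (1 - \<lambda>) / \<lambda> with exponent s. The denominator
    carries its inverse, each numerator carries E itself; scaling the pair by E produces the
    exponent 2 s of the formulas.\<close>
  define E where "E = exp (s * Ln ((1 - l) / l))"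
  have l: "l \<in> lens" using axis_lens_region[OF y] by (simp add: l_def lens_region_def)
  have l0: "(1 - l) / l \<noteq> 0" using lens_nonzero[OF l] by simp
  have E: "E \<noteq> 0" "exp (- s * Ln ((1 - l) / l)) = inverse E" "inverse E \<noteq> 0" by (simp_all add: E_def exp_minus)
  have pw: "((1 - l) / l) powr (2 * s) = E * E"
    using l0 by (simp add: powr_def E_def algebra_simps flip: exp_add)
  have et: "exp (of_real pi * \<i> * s) = of_real (exp (t / 2))"
    using two_pi_i_s by (simp add: s_def flip: exp_of_real)
  have qp: "q powr (- 1 / 2) = of_real (exp (t / 2))"
  proof -
    have "Ln q = of_real (- t)" unfolding Ln_of_real[OF exp_gt_zero] by simp
    then show ?thesis by (simp add: powr_def flip: exp_of_real)
  qed
  have v1: "axis_v s y = inverse E * hypF s l" unfolding axis_v_def hypv_def l_def[symmetric] E(2) ..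
  have v2: "axis_v (- s) y = E * hypF (- s) l" unfolding axis_v_def hypv_def l_def[symmetric] E_def by simp
  have "Ln ((1 - (1 - l)) / (1 - l)) = - Ln ((1 - l) / l)" using Ln_inverse[OF lens_slit[OF l]] by simp
  then have v3: "axis_v s (1 / y) = E * hypF s (1 - l)"
    unfolding axis_v_def hypv_def modular_lambda_axis_inverse[OF y] l_def[symmetric] E_def by simp
  have "h (\<i> * of_real y) = cp1_quot (inverse E * (\<i> * of_real (exp (t / 2)) * (E * E) * hypF s (1 - l))) (inverse E * hypF s l)"
    unfolding axis_formulas(1)[OF y] v1 v3 using E(1) by (simp add: field_simps)
  also have "\<dots> = q_formula1 t (\<i> * of_real y)"
    unfolding cp1_quot_scale[OF E(3)] q_formula1_def Let_def l_def[symmetric] s_def[symmetric] pw et hypF_def ..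
  finally show "h (\<i> * of_real y) = q_formula1 t (\<i> * of_real y)" .
  have F: "hypF (- s) l = hyp2F1 (1/2 - s) (1/2 + s) (1 - 2 * s) l"
    unfolding hypF_def using hyp2F1_commute[of "1/2 + s" "1/2 - s"] by simp
  have "cp1_quot (\<i> * of_real (exp (t / 2)) * conn * axis_v (- s) y) (axis_v s y)
    = cp1_quot (inverse E * (\<i> * of_real (exp (t / 2)) * conn * (E * E) * hypF (- s) l)) (inverse E * hypF s l)"
    unfolding v1 v2 using E(1) by (simp add: field_simps)
  also have "\<dots> = cp1_quot (\<i> * of_real (exp (t / 2)) * conn * (E * E) * hypF (- s) l) (hypF s l)"
    by (rule cp1_quot_scale[OF E(3)])
  finally show "h (\<i> * of_real y) = q_formula2 t (\<i> * of_real y)"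
    unfolding axis_formulas(2)[OF y] q_formula2_def Let_def l_def[symmetric] s_def[symmetric] pw qp p_def F conn_def
    by (simp only: hypF_def)
qed

end

section \<open>Identity theorem for maps to the projective line and conclusion\<close>

lemma q_complex_family_normalized:
  assumes "q_complex_family f" "t > 0"
  shows "normalized_equivariant_map (f t) t"
proof -
  interpret equivariant_map "f t" t by (rule q_complex_family_equivariant[OF assms])
  have "family_coord f t = hc" by (simp add: fun_eq_iff family_coord_def hc_def)
  then have "hc \<i> = \<i> * of_real (exp (t / 2))" using family_coord_at_i[OF assms(1), of t] assms(2) by simp
  then show ?thesis using family_schwarzian_and_limit[OF assms] by unfold_locales blast+
qed

text \<open>The coordinates agree on punctured neighbourhoods by the identity theorem. This
  determines which points are poles, and at the others the values agree by continuity.\<close>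

lemma cp1_meromorphic_axis_identity:
  assumes g: "cp1_meromorphic_on g upper_half_plane" and k: "cp1_meromorphic_on k upper_half_plane"
    and axis: "\<And>\<tau>. Im \<tau> > 0 \<Longrightarrow> Re \<tau> = 0 \<Longrightarrow> g \<tau> = k \<tau>" and \<tau>: "\<tau> \<in> upper_half_plane"
  shows "g \<tau> = k \<tau>"
proof -
  define gc kc where gc_def: "gc = (\<lambda>z. cp1_coord (g z))" and kc_def: "kc = (\<lambda>z. cp1_coord (k z))"
  have n: "gc nicely_meromorphic_on upper_half_plane" "kc nicely_meromorphic_on upper_half_plane"
    and pole: "g \<tau> = None \<longleftrightarrow> is_pole gc \<tau>" "k \<tau> = None \<longleftrightarrow> is_pole kc \<tau>"
    using g k \<tau> by (auto simp: cp1_meromorphic_on_def gc_def kc_def)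
  have "frequently (\<lambda>x. gc x = kc x) (at \<i>)"
    unfolding frequently_def
  proof
    assume "eventually (\<lambda>x. \<not> gc x = kc x) (at \<i>)"
    then obtain d where d: "d > 0" "\<And>x. x \<noteq> \<i> \<Longrightarrow> dist x \<i> < d \<Longrightarrow> gc x \<noteq> kc x"
      unfolding eventually_at by auto
    define x where "x = \<i> * of_real (1 + d / 2)"
    have "x - \<i> = \<i> * of_real (d / 2)" by (simp add: x_def algebra_simps)
    then have "dist x \<i> = d / 2" using d(1) by (simp only: dist_norm norm_mult norm_of_real) simp
    then have "gc x \<noteq> kc x" using d by auto
    moreover have "g x = k x" by (rule axis) (use d(1) in \<open>simp_all add: x_def\<close>)
    ultimately show False by (simp add: gc_def kc_def)
  qed
  then have ev: "eventually (\<lambda>x. gc x = kc x) (at \<tau>)"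
    using n by (intro meromorphic_identity[OF _ _ open_upper_half_plane connected_upper_half_plane, of gc kc \<i>] \<tau>)
      (auto simp: nicely_meromorphic_on_def)
  then have same: "g \<tau> = None \<longleftrightarrow> k \<tau> = None" unfolding pole by (intro is_pole_cong refl)
  show ?thesis
  proof (cases "g \<tau> = None")
    case False
    then have np: "\<not> is_pole gc \<tau>" "\<not> is_pole kc \<tau>" using pole same by auto
    have "gc \<tau> = kc \<tau>"
      by (rule continuous_eqI_at[OF _ _ ev])
         (intro analytic_at_imp_isCont nicely_meromorphic_on_imp_analytic_at[OF n(1) \<tau> np(1)]
           nicely_meromorphic_on_imp_analytic_at[OF n(2) \<tau> np(2)])+
    then show ?thesis using False same by (auto simp: gc_def kc_def cp1_coord_def)
  qed (use same in simp)
qed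

lemma q_complex_family_formulas:
  assumes "q_complex_family f" "t > 0" "Im \<tau> > 0" "Re \<tau> = 0"
  shows "f t \<tau> = q_formula1 t \<tau>" "f t \<tau> = q_formula2 t \<tau>"
proof -
  have \<tau>: "\<tau> = \<i> * of_real (Im \<tau>)" using assms(4) by (simp add: complex_eq_iff)
  show "f t \<tau> = q_formula1 t \<tau>" "f t \<tau> = q_formula2 t \<tau>"
    using normalized_equivariant_map.h_q_formulas[OF q_complex_family_normalized[OF assms(1,2)] assms(3)] \<tau> by simp_all
qed

lemma q_complex_family_meromorphic:
  "q_complex_family f \<Longrightarrow> t > 0 \<Longrightarrow> cp1_meromorphic_on (f t) upper_half_plane"
  using equivariant_map.mero[OF q_complex_family_equivariant] .

theorem theorem9p1:
  fixes f :: "real \<Rightarrow> complex \<Rightarrow> cp1"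
  assumes "q_complex_family f"
  shows
    "(\<forall>g. q_complex_family g \<longrightarrow> (\<forall>t>0. \<forall>\<tau>\<in>upper_half_plane. g t \<tau> = f t \<tau>)) \<and>
     (\<forall>t>0. \<forall>\<tau>\<in>upper_half_plane. Re \<tau> = 0 \<longrightarrow>
        f t \<tau> = q_formula1 t \<tau> \<and> f t \<tau> = q_formula2 t \<tau>) \<and>
     (\<forall>t>0. \<forall>\<phi>\<in>{q_formula1 t, q_formula2 t}.
        continues_from_imaginary_axis (f t) \<phi> \<and>
        (\<forall>h. continues_from_imaginary_axis h \<phi> \<longrightarrow>
             (\<forall>\<tau>\<in>upper_half_plane. h \<tau> = f t \<tau>)))"
proof (intro conjI allI impI ballI)
  note mero = q_complex_family_meromorphic and formulas = q_complex_family_formulas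
  fix t :: real assume t: "t > 0"
  \<comment> \<open>Uniqueness needs no comparison of the two families themselves: both continue
    \<open>q_formula1 t\<close> from the imaginary axis.\<close>
  show "g t \<tau> = f t \<tau>" if g: "q_complex_family g" and \<tau>: "\<tau> \<in> upper_half_plane" for g \<tau>
    by (rule cp1_meromorphic_axis_identity[OF mero[OF g t] mero[OF assms t] _ \<tau>])
       (simp add: formulas(1)[OF g t] formulas(1)[OF assms t])
  show "f t \<tau> = q_formula1 t \<tau>" "f t \<tau> = q_formula2 t \<tau>" if "\<tau> \<in> upper_half_plane" "Re \<tau> = 0" for \<tau>
    using formulas[OF assms t] that by auto
  fix \<phi> assume "\<phi> \<in> {q_formula1 t, q_formula2 t}"
  then have \<phi>: "f t \<tau> = \<phi> \<tau>" if "Im \<tau> > 0" "Re \<tau> = 0" for \<tau>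
    using formulas[OF assms t that] by auto
  show "continues_from_imaginary_axis (f t) \<phi>"
    using mero[OF assms t] \<phi> by (simp add: continues_from_imaginary_axis_def)
  show "h \<tau> = f t \<tau>" if h: "continues_from_imaginary_axis h \<phi>" and \<tau>: "\<tau> \<in> upper_half_plane" for h \<tau>
  proof (rule cp1_meromorphic_axis_identity[OF _ mero[OF assms t] _ \<tau>])
    show "cp1_meromorphic_on h upper_half_plane" using h by (simp add: continues_from_imaginary_axis_def)
    show "h \<tau> = f t \<tau>" if "Im \<tau> > 0" "Re \<tau> = 0" for \<tau>
      using h \<phi>[OF that] that by (simp add: continues_from_imaginary_axis_def)
  qed
qed

end
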